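(* Let $d\ge3$ and suppose $V\in RH_q$ for some $q>d/2$ ($V\ge0$, not identically zero). Assume that $-\Delta u+Vu=f$ in $\mathbb{R}^d$, with $f$ satisfying $$\int_{\mathbb{R}^d}\frac{|f(x)|^p}{(1+|x|)^\sigma}\,dx<\infty$$ for some $\sigma>0$ and some $p\ge1$. Then: (1) if $1<p<q$, $\nabla^2u\in L^p_{\mathrm{loc}}$; (2) if $1\le p<q$, $Vu\in L^p_{\mathrm{loc}}$; (3) if $1\le p<p_1$, $V^{1/2}\nabla u\in L^p_{\mathrm{loc}}$, with $p_1$ such that $\dfrac1{p_1}=\left(\dfrac1q-\dfrac1d\right)^++\dfrac1{2q}$.
   Context: $V\in RH_q$ means there is $C$ with $\left(\frac1{|B|}\int_BV^q\right)^{1/q}\le C\frac1{|B|}\int_BV$ for every ball $B\subset\mathbb{R}^d$. $a^+=\max(a,0)$. *)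

theory Defs
  imports "HOL-Analysis.Analysis"
begin

definition average :: "'a::euclidean_space set \<Rightarrow> ('a \<Rightarrow> real) \<Rightarrow> real" where
  "average B g = (LINT x:B|lebesgue. g x) / measure lebesgue B"

text \<open>Integrability is demanded explicitly, because the integral of a non-integrable
  function is \<open>0\<close> by convention. The class is meant for nonnegative \<open>V\<close>; for such \<open>V\<close>
  the integrability of \<open>V\<close> on balls follows from that of \<open>V\<^sup>q\<close> when \<open>q \<ge> 1\<close>.\<close>

definition RH :: "real \<Rightarrow> ('a::euclidean_space \<Rightarrow> real) set" where
  "RH q = {V. V \<in> borel_measurable lebesgue \<and>
     (\<forall>x r. 0 < r \<longrightarrow> V absolutely_integrable_on ball x r \<and>
        (\<lambda>y. V y powr q) absolutely_integrable_on ball x r) \<and>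
     (\<exists>C. \<forall>x r. 0 < r \<longrightarrow>
        average (ball x r) (\<lambda>y. V y powr q) powr (1 / q) \<le> C * average (ball x r) V)}"

definition Lp_loc :: "real \<Rightarrow> ('a::euclidean_space \<Rightarrow> 'b::euclidean_space) set" where
  "Lp_loc p = {g. g \<in> borel_measurable lebesgue \<and>
     (\<forall>K. compact K \<longrightarrow> (\<lambda>x. norm (g x) powr p) absolutely_integrable_on K)}"

definition partial :: "'a::euclidean_space \<Rightarrow> ('a \<Rightarrow> real) \<Rightarrow> 'a \<Rightarrow> real" where
  "partial e \<phi> x = frechet_derivative \<phi> (at x) e"

primrec C_k :: "nat \<Rightarrow> ('a::euclidean_space \<Rightarrow> real) \<Rightarrow> bool" where
  "C_k 0 \<phi> \<longleftrightarrow> continuous_on UNIV \<phi>"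
| "C_k (Suc k) \<phi> \<longleftrightarrow> (\<forall>x. \<phi> differentiable (at x)) \<and> (\<forall>e\<in>Basis. C_k k (partial e \<phi>))"

definition test_function :: "('a::euclidean_space \<Rightarrow> real) \<Rightarrow> bool" where
  "test_function \<phi> \<longleftrightarrow> (\<forall>k. C_k k \<phi>) \<and> compact (closure {x. \<phi> x \<noteq> 0})"

definition laplacian :: "('a::euclidean_space \<Rightarrow> real) \<Rightarrow> 'a \<Rightarrow> real" where
  "laplacian \<phi> x = (\<Sum>e\<in>Basis. partial e (partial e \<phi>) x)"

definition weak_gradient :: "('a::euclidean_space \<Rightarrow> real) \<Rightarrow> ('a \<Rightarrow> 'a) \<Rightarrow> bool" where
  "weak_gradient u G \<longleftrightarrow> u \<in> Lp_loc 1 \<and> G \<in> Lp_loc 1 \<and>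
     (\<forall>\<phi>. test_function \<phi> \<longrightarrow> (\<forall>e\<in>Basis.
        (LINT x|lebesgue. u x * partial e \<phi> x) = - (LINT x|lebesgue. (G x \<bullet> e) * \<phi> x)))"

text \<open>\<open>H e e'\<close> is the second distributional derivative in the coordinate directions
  \<open>e, e'\<close>; only values at basis vectors matter.\<close>

definition weak_hessian :: "('a::euclidean_space \<Rightarrow> real) \<Rightarrow> ('a \<Rightarrow> 'a \<Rightarrow> 'a \<Rightarrow> real) \<Rightarrow> bool" where
  "weak_hessian u H \<longleftrightarrow> u \<in> Lp_loc 1 \<and>
     (\<forall>e\<in>Basis. \<forall>e'\<in>Basis. H e e' \<in> Lp_loc 1 \<and>
       (\<forall>\<phi>. test_function \<phi> \<longrightarrow>
         (LINT x|lebesgue. u x * partial e (partial e' \<phi>) x) = (LINT x|lebesgue. H e e' x * \<phi> x)))"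

text \<open>\<open>-\<Delta>u + Vu = f\<close> in the sense of distributions: \<open>u\<close>, \<open>Vu\<close> and \<open>f\<close> have to be locally
  integrable in order to define distributions.\<close>

definition schroedinger_solution ::
  "('a::euclidean_space \<Rightarrow> real) \<Rightarrow> ('a \<Rightarrow> real) \<Rightarrow> ('a \<Rightarrow> real) \<Rightarrow> bool" where
  "schroedinger_solution V u f \<longleftrightarrow>
     u \<in> Lp_loc 1 \<and> (\<lambda>x. V x * u x) \<in> Lp_loc 1 \<and> f \<in> Lp_loc 1 \<and>
     (\<forall>\<phi>. test_function \<phi> \<longrightarrow>
        - (LINT x|lebesgue. u x * laplacian \<phi> x) + (LINT x|lebesgue. V x * u x * \<phi> x)
          = (LINT x|lebesgue. f x * \<phi> x))"

end

theory Submission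
  imports Defs
begin

text \<open>All conclusions are local, so of the reverse Hoelder class only \<open>V \<in> L\<^sup>q\<close> on balls is used.
  Convolving the equation \<open>\<Delta>u = Vu - f\<close> with a compactly supported parametrix of the Laplacian
  writes \<open>u\<close>, up to a smooth term, as a convolution of \<open>Vu - f\<close> with a kernel bounded by
  \<open>|x|\<^sup>2\<^sup>-\<^sup>d\<close>, and its gradient with one bounded by \<open>|x|\<^sup>1\<^sup>-\<^sup>d\<close>. Young's inequality and
  \<open>V \<in> L\<^sup>q\<close>, \<open>q > d/2\<close>, improve the integrability of \<open>Vu\<close> by a fixed amount in each step,
  up to the exponent \<open>p\<close>, or to every exponent below \<open>q\<close>; the gradient bound follows in the same way.
  The Hessian needs the Calderon--Zygmund inequality. It comes from the heat flow: a convex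
  Bellman function of the heat extensions of \<open>\<Delta>w\<close> and \<open>g\<close> controls the pairing of a second
  derivative of \<open>w\<close> with \<open>g\<close>, without any singular integral theory.\<close>

section \<open>Smooth functions and test functions\<close>

text \<open>Let F, G, W, K be the heat extensions of f = \<Delta>w, g, w and k = \<partial>_j
  \<partial>_i g. The time derivative of \<integral> W K is 2 \<integral> F K = -2 \<integral>
  \<partial>_j F \<partial>_i G, a product of first derivatives. A quadratic form in the same first
  derivatives, with the Hessian of B as matrix, appears in the derivative of \<integral> B(F, G), so
  a sufficiently convex B forces monotonicity, and for large times nothing negative survives. Such a
  B must still be bounded by |u|^p + |v|^q; these two demands shape its formula. Smoothing by
  \<kappa> costs an error that tends to 0 with \<kappa>, because the data have compact support.
  Exponents: |x|^(2-d) is in L^t near 0 exactly for t < d/(d-2), so passing from Vu to u gains less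
  than 2/d in the reciprocal exponent, while multiplication by V costs 1/q < 2/d. The gradient gains
  less than 1/d over an exponent below q, and V^(1/2) costs 1/(2q); this is the origin of 1/p_1 =
  (1/q - 1/d)^+ + 1/(2q).\<close>

lemma partial_eqI: "(\<phi> has_derivative D) (at x) \<Longrightarrow> partial e \<phi> x = D e"
  unfolding partial_def using frechet_derivative_at by metis

lemma has_derivative_partial:
  fixes \<phi> :: "'a::euclidean_space \<Rightarrow> real"
  assumes "\<phi> differentiable (at x)"
  shows "(\<phi> has_derivative (\<lambda>h. \<Sum>e\<in>Basis. (h \<bullet> e) * partial e \<phi> x)) (at x)"
proof -
  have D: "(\<phi> has_derivative frechet_derivative \<phi> (at x)) (at x)"
    using assms frechet_derivative_works by blast
  then interpret bounded_linear "frechet_derivative \<phi> (at x)"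
    by (rule has_derivative_bounded_linear)
  have "frechet_derivative \<phi> (at x) h = (\<Sum>e\<in>Basis. (h \<bullet> e) * partial e \<phi> x)" for h
  proof -
    have "frechet_derivative \<phi> (at x) h = frechet_derivative \<phi> (at x) (\<Sum>e\<in>Basis. (h \<bullet> e) *\<^sub>R e)"
      by (simp add: euclidean_representation)
    also have "\<dots> = (\<Sum>e\<in>Basis. (h \<bullet> e) * partial e \<phi> x)"
      by (simp add: sum scaleR partial_def)
    finally show ?thesis .
  qed
  then have "frechet_derivative \<phi> (at x) = (\<lambda>h. \<Sum>e\<in>Basis. (h \<bullet> e) * partial e \<phi> x)" by blast
  then show ?thesis using D by simp
qed

lemma C_k_continuous: "C_k k \<phi> \<Longrightarrow> continuous_on UNIV \<phi>"
  by (cases k) (auto intro!: continuous_at_imp_continuous_on differentiable_imp_continuous_within)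

definition smooth :: "('a::euclidean_space \<Rightarrow> real) \<Rightarrow> bool" where
  "smooth \<phi> \<longleftrightarrow> (\<forall>k. C_k k \<phi>)"

text \<open>Replaces induction on the order of differentiation: for affine images, sums, scale
  integrals and convolutions it suffices to exhibit a family that differentiation maps into itself,
  even though its parameters change with each derivative.\<close>

lemma smooth_coinduct:
  assumes "X \<phi>"
    and "\<And>\<phi> x. X \<phi> \<Longrightarrow> \<phi> differentiable (at x)"
    and "\<And>\<phi> e. X \<phi> \<Longrightarrow> e \<in> Basis \<Longrightarrow> X (partial e \<phi>)"
  shows "smooth \<phi>"
proof -
  have "C_k k \<phi>" for k
    using assms(1)
  proof (induction k arbitrary: \<phi>)
    case 0
    then show ?case
      using assms(2) by (auto intro!: continuous_at_imp_continuous_on differentiable_imp_continuous_within)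
  next
    case (Suc k)
    then show ?case using assms(2,3) by auto
  qed
  then show ?thesis by (simp add: smooth_def)
qed

lemma smooth_differentiable: "smooth \<phi> \<Longrightarrow> \<phi> differentiable (at x)"
  unfolding smooth_def using C_k.simps(2) by blast

lemma smooth_partial: "smooth \<phi> \<Longrightarrow> e \<in> Basis \<Longrightarrow> smooth (partial e \<phi>)"
  unfolding smooth_def using C_k.simps(2) by blast

lemma smooth_continuous: "smooth \<phi> \<Longrightarrow> continuous_on UNIV \<phi>"
  unfolding smooth_def using C_k_continuous by blast

lemma smooth_has_derivative:
  "smooth \<phi> \<Longrightarrow> (\<phi> has_derivative (\<lambda>h. \<Sum>e\<in>Basis. (h \<bullet> e) * partial e \<phi> x)) (at x)"
  by (simp add: has_derivative_partial smooth_differentiable)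

lemma partial_affine:
  assumes "\<phi> differentiable (at (a *\<^sub>R x + b))"
  shows "(\<lambda>x. c * \<phi> (a *\<^sub>R x + b)) differentiable (at x)"
    and "partial e (\<lambda>x. c * \<phi> (a *\<^sub>R x + b)) x = (c * a) * partial e \<phi> (a *\<^sub>R x + b)"
proof -
  have D: "(\<phi> has_derivative frechet_derivative \<phi> (at (a *\<^sub>R x + b))) (at (a *\<^sub>R x + b))"
    using assms frechet_derivative_works by blast
  have "((\<lambda>x. a *\<^sub>R x + b) has_derivative (\<lambda>h. a *\<^sub>R h)) (at x)"
    by (auto intro!: derivative_eq_intros)
  from has_derivative_compose[OF this D]
  have *: "((\<lambda>x. c * \<phi> (a *\<^sub>R x + b)) has_derivative
      (\<lambda>h. c * frechet_derivative \<phi> (at (a *\<^sub>R x + b)) (a *\<^sub>R h))) (at x)"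
    by (rule has_derivative_mult_right)
  then show "(\<lambda>x. c * \<phi> (a *\<^sub>R x + b)) differentiable (at x)"
    by (auto simp: differentiable_def)
  interpret bounded_linear "frechet_derivative \<phi> (at (a *\<^sub>R x + b))"
    using D by (rule has_derivative_bounded_linear)
  show "partial e (\<lambda>x. c * \<phi> (a *\<^sub>R x + b)) x = (c * a) * partial e \<phi> (a *\<^sub>R x + b)"
    using partial_eqI[OF *] by (simp add: scaleR partial_def)
qed

lemma smooth_affine:
  assumes "smooth \<phi>"
  shows "smooth (\<lambda>x. c * \<phi> (a *\<^sub>R x + b))"
proof (rule smooth_coinduct[where X="\<lambda>\<psi>. \<exists>c \<phi>. smooth \<phi> \<and> \<psi> = (\<lambda>x. c * \<phi> (a *\<^sub>R x + b))"])
  show "\<exists>c' \<phi>'. smooth \<phi>' \<and> (\<lambda>x. c * \<phi> (a *\<^sub>R x + b)) = (\<lambda>x. c' * \<phi>' (a *\<^sub>R x + b))"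
    using assms by blast
next
  fix \<psi> x assume "\<exists>c \<phi>. smooth \<phi> \<and> \<psi> = (\<lambda>x. c * \<phi> (a *\<^sub>R x + b))"
  then show "\<psi> differentiable at x"
    using partial_affine(1) smooth_differentiable by blast
next
  fix \<psi> and e :: 'a assume "\<exists>c \<phi>. smooth \<phi> \<and> \<psi> = (\<lambda>x. c * \<phi> (a *\<^sub>R x + b))" and e: "e \<in> Basis"
  then obtain c \<phi> where *: "smooth \<phi>" "\<psi> = (\<lambda>x. c * \<phi> (a *\<^sub>R x + b))" by blast
  have "partial e \<psi> = (\<lambda>x. (c * a) * partial e \<phi> (a *\<^sub>R x + b))"
    unfolding *(2) by (intro ext partial_affine(2) smooth_differentiable *(1))
  then show "\<exists>c \<phi>. smooth \<phi> \<and> partial e \<psi> = (\<lambda>x. c * \<phi> (a *\<^sub>R x + b))"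
    using smooth_partial[OF *(1) e] by blast
qed

lemma partial_add:
  assumes "\<phi> differentiable (at x)" "\<psi> differentiable (at x)"
  shows "partial e (\<lambda>x. \<phi> x + \<psi> x) x = partial e \<phi> x + partial e \<psi> x"
proof -
  have "((\<lambda>x. \<phi> x + \<psi> x) has_derivative
      (\<lambda>h. frechet_derivative \<phi> (at x) h + frechet_derivative \<psi> (at x) h)) (at x)"
    using assms frechet_derivative_works has_derivative_add by blast
  from partial_eqI[OF this] show ?thesis by (simp add: partial_def)
qed

lemma smooth_add:
  fixes \<phi> \<psi> :: "'a::euclidean_space \<Rightarrow> real"
  assumes "smooth \<phi>" "smooth \<psi>"
  shows "smooth (\<lambda>x. \<phi> x + \<psi> x)"
proof (rule smooth_coinduct[where X="\<lambda>\<theta>. \<exists>\<phi> \<psi>. smooth \<phi> \<and> smooth \<psi> \<and> \<theta> = (\<lambda>x. \<phi> x + \<psi> x)"])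
  show "\<exists>\<phi>' \<psi>'. smooth \<phi>' \<and> smooth \<psi>' \<and> (\<lambda>x. \<phi> x + \<psi> x) = (\<lambda>x. \<phi>' x + \<psi>' x)"
    using assms by blast
next
  fix \<theta> :: "'a \<Rightarrow> real" and x :: 'a assume "\<exists>\<phi> \<psi>. smooth \<phi> \<and> smooth \<psi> \<and> \<theta> = (\<lambda>x. \<phi> x + \<psi> x)"
  then show "\<theta> differentiable at x"
    using smooth_differentiable differentiable_add by blast
next
  fix \<theta> :: "'a \<Rightarrow> real" and e :: 'a
  assume "\<exists>\<phi> \<psi>. smooth \<phi> \<and> smooth \<psi> \<and> \<theta> = (\<lambda>x. \<phi> x + \<psi> x)" and e: "e \<in> Basis"
  then obtain \<phi> \<psi> where *: "smooth \<phi>" "smooth \<psi>" "\<theta> = (\<lambda>x. \<phi> x + \<psi> x)" by blast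
  have "partial e \<theta> = (\<lambda>x. partial e \<phi> x + partial e \<psi> x)"
    unfolding *(3) by (intro ext partial_add smooth_differentiable *)
  then show "\<exists>\<phi> \<psi>. smooth \<phi> \<and> smooth \<psi> \<and> partial e \<theta> = (\<lambda>x. \<phi> x + \<psi> x)"
    using smooth_partial[OF _ e] * by blast
qed

lemma smooth_zero: "smooth (\<lambda>x. 0)"
proof (rule smooth_coinduct[where X="\<lambda>\<phi>. \<phi> = (\<lambda>x. 0)"])
  fix \<phi> :: "'a \<Rightarrow> real" and e :: 'a assume "\<phi> = (\<lambda>x. 0)"
  then show "partial e \<phi> = (\<lambda>x. 0)"
    by (intro ext) (auto intro!: partial_eqI derivative_eq_intros)
qed auto

lemma smooth_sum:
  assumes "finite A" "\<And>a. a \<in> A \<Longrightarrow> smooth (f a)"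
  shows "smooth (\<lambda>x. \<Sum>a\<in>A. f a x)"
  using assms by (induction A rule: finite_induct) (auto intro!: smooth_zero smooth_add)

lemma test_functionI:
  fixes \<phi> :: "'a::euclidean_space \<Rightarrow> real"
  assumes "smooth \<phi>" and "\<And>x. R \<le> norm x \<Longrightarrow> \<phi> x = 0"
  shows "test_function \<phi>"
proof -
  have "{x. \<phi> x \<noteq> 0} \<subseteq> cball 0 R" using assms(2) by (force simp: not_le)
  then have "bounded {x. \<phi> x \<noteq> 0}" using bounded_cball bounded_subset by blast
  then show ?thesis using assms(1) by (auto simp: test_function_def smooth_def)
qed

lemma test_functionE:
  fixes \<phi> :: "'a::euclidean_space \<Rightarrow> real"
  assumes "test_function \<phi>"
  obtains R where "R > 0" "\<And>x. R \<le> norm x \<Longrightarrow> \<phi> x = 0"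
proof -
  have "bounded {x. \<phi> x \<noteq> 0}"
    using assms bounded_subset[OF compact_imp_bounded closure_subset, of "{x. \<phi> x \<noteq> 0}"]
    by (simp add: test_function_def)
  then obtain R where R: "\<And>x. \<phi> x \<noteq> 0 \<Longrightarrow> norm x \<le> R"
    by (auto simp: bounded_iff)
  show ?thesis
    by (rule that[of "\<bar>R\<bar> + 1"]) (use R in fastforce)+
qed

lemma test_smooth: "test_function \<phi> \<Longrightarrow> smooth \<phi>"
  by (simp add: test_function_def smooth_def)

text \<open>The radius must not grow under differentiation, since the kernels built later have to
  stay in the unit ball. Outside the closed ball \<phi> is locally zero; on the sphere itself the
  value is a limit along the outward ray, by continuity of the derivative. If x = 0, then R <= 0 and
  \<phi> vanishes identically.\<close>

lemma partial_vanishes: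
  fixes \<phi> :: "'a::euclidean_space \<Rightarrow> real"
  assumes "smooth \<phi>" and *: "\<And>x. R \<le> norm x \<Longrightarrow> \<phi> x = 0" and "e \<in> Basis" and x: "R \<le> norm x"
  shows "partial e \<phi> x = 0"
proof -
  have out: "partial e \<phi> y = 0" if "R < norm y" for y
  proof -
    have op: "open {y::'a. R < norm y}" by (intro open_Collect_less continuous_intros)
    have "((\<lambda>z. 0::real) has_derivative (\<lambda>h. 0)) (at y)" by simp
    then have "(\<phi> has_derivative (\<lambda>h. 0)) (at y)"
      by (rule has_derivative_transform_within_open[OF _ op]) (use that * in auto)
    from partial_eqI[OF this] show ?thesis by simp
  qed
  show ?thesis
  proof (cases "x = 0")
    case True
    then have "\<phi> = (\<lambda>x. 0)" using x by (intro ext *) (simp add: order_trans)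
    then show ?thesis by (auto intro!: partial_eqI derivative_eq_intros)
  next
    case False
    have "(\<lambda>n. (1 + 1 / real (Suc n)) *\<^sub>R x) \<longlonglongrightarrow> (1 + 0) *\<^sub>R x"
      by (intro tendsto_intros lim_1_over_n[THEN LIMSEQ_Suc])
    moreover have "isCont (partial e \<phi>) x"
      using smooth_continuous[OF smooth_partial[OF assms(1,3)]]
      by (simp add: continuous_on_eq_continuous_at)
    ultimately have "(\<lambda>n. partial e \<phi> ((1 + 1 / real (Suc n)) *\<^sub>R x)) \<longlonglongrightarrow> partial e \<phi> x"
      using isCont_tendsto_compose by fastforce
    moreover have "partial e \<phi> ((1 + 1 / real (Suc n)) *\<^sub>R x) = 0" for n
    proof (rule out)
      have "norm x < (1 + 1 / real (Suc n)) * norm x"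
        using False by (simp add: algebra_simps)
      then show "R < norm ((1 + 1 / real (Suc n)) *\<^sub>R x)"
        using x by (simp add: abs_of_pos add_pos_pos)
    qed
    ultimately show ?thesis by (simp add: LIMSEQ_const_iff)
  qed
qed

lemma test_partial:
  assumes "test_function \<phi>" "e \<in> Basis"
  shows "test_function (partial e \<phi>)"
proof -
  obtain R where R: "\<And>x. R \<le> norm x \<Longrightarrow> \<phi> x = 0" using test_functionE[OF assms(1)] by blast
  have s: "smooth \<phi>" using assms(1) by (rule test_smooth)
  show ?thesis
  proof (rule test_functionI)
    show "smooth (partial e \<phi>)" using s assms(2) by (rule smooth_partial)
    show "partial e \<phi> x = 0" if "R \<le> norm x" for x
      using partial_vanishes[OF s R assms(2) that] .
  qed
qed

lemma test_affine:
  fixes \<phi> :: "'a::euclidean_space \<Rightarrow> real"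
  assumes "test_function \<phi>" "a \<noteq> 0"
  shows "test_function (\<lambda>x. c * \<phi> (a *\<^sub>R x + b))"
proof -
  obtain R where R: "\<And>x. R \<le> norm x \<Longrightarrow> \<phi> x = 0" using test_functionE[OF assms(1)] by blast
  show ?thesis
  proof (rule test_functionI)
    fix x :: 'a assume *: "(R + norm b) / \<bar>a\<bar> \<le> norm x"
    then have "R + norm b \<le> norm (a *\<^sub>R x)" using assms(2) by (simp add: field_simps)
    then have "R \<le> norm (a *\<^sub>R x + b)" using norm_diff_ineq[of "a *\<^sub>R x" b] by linarith
    then show "c * \<phi> (a *\<^sub>R x + b) = 0" by (simp add: R)
  qed (intro smooth_affine test_smooth assms)
qed

lemma test_add:
  assumes "test_function \<phi>" "test_function \<psi>"
  shows "test_function (\<lambda>x. \<phi> x + \<psi> x)"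
proof -
  obtain R S where "\<And>x. R \<le> norm x \<Longrightarrow> \<phi> x = 0" "\<And>x. S \<le> norm x \<Longrightarrow> \<psi> x = 0"
    using test_functionE assms by metis
  then show ?thesis
    using test_functionI[OF smooth_add[OF test_smooth[OF assms(1)] test_smooth[OF assms(2)]], of "max R S"]
    by simp
qed

lemma test_laplacian:
  assumes "test_function \<phi>" shows "test_function (laplacian \<phi>)"
proof -
  obtain R where R: "\<And>x. R \<le> norm x \<Longrightarrow> \<phi> x = 0" using test_functionE[OF assms(1)] by blast
  have s: "smooth \<phi>" using assms by (rule test_smooth)
  have "laplacian \<phi> = (\<lambda>x. \<Sum>e\<in>Basis. partial e (partial e \<phi>) x)"
    by (simp add: fun_eq_iff laplacian_def)
  moreover have "test_function \<dots>"
  proof (rule test_functionI)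
    show "smooth (\<lambda>x. \<Sum>e\<in>Basis. partial e (partial e \<phi>) x)"
      using s smooth_partial by (intro smooth_sum) auto
    show "(\<Sum>e\<in>Basis. partial e (partial e \<phi>) x) = 0" if x: "R \<le> norm x" for x
    proof (intro sum.neutral ballI)
      fix e :: 'a assume e: "e \<in> Basis"
      show "partial e (partial e \<phi>) x = 0"
        using partial_vanishes[OF smooth_partial[OF s e] partial_vanishes[OF s R e] e x] .
    qed
  qed
  ultimately show ?thesis by simp
qed

lemma test_continuous: "test_function \<phi> \<Longrightarrow> continuous_on UNIV \<phi>"
  by (simp add: smooth_continuous test_smooth)

lemma continuous_borel: "continuous_on UNIV \<phi> \<Longrightarrow> \<phi> \<in> borel_measurable borel"
  by (rule borel_measurable_continuous_onI)

lemma test_borel: "test_function \<phi> \<Longrightarrow> \<phi> \<in> borel_measurable borel"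
  by (simp add: test_continuous continuous_borel)

lemma continuous_compact_support_bounded:
  fixes \<phi> :: "'a::euclidean_space \<Rightarrow> real"
  assumes "continuous_on UNIV \<phi>" "\<And>x. R \<le> norm x \<Longrightarrow> \<phi> x = 0"
  obtains M where "M > 0" "\<And>x. \<bar>\<phi> x\<bar> \<le> M * indicat_real (cball 0 R) x"
proof -
  have "compact (\<phi> ` cball 0 R)"
    using assms(1) compact_cball compact_continuous_image continuous_on_subset by blast
  then obtain M where M: "M > 0" "\<And>x. x \<in> cball 0 R \<Longrightarrow> \<bar>\<phi> x\<bar> \<le> M"
    using compact_imp_bounded by (metis (no_types, lifting) bounded_pos image_eqI real_norm_def)
  show ?thesis
  proof (rule that[OF M(1)])
    fix x show "\<bar>\<phi> x\<bar> \<le> M * indicat_real (cball 0 R) x"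
      using M assms(2)[of x] by (auto simp: indicator_def)
  qed
qed

lemma test_bounded:
  fixes \<phi> :: "'a::euclidean_space \<Rightarrow> real"
  assumes "test_function \<phi>"
  obtains M where "M > 0" "\<And>x. \<bar>\<phi> x\<bar> \<le> M"
proof -
  obtain R where R: "\<And>x. R \<le> norm x \<Longrightarrow> \<phi> x = 0" using test_functionE[OF assms] by blast
  from continuous_compact_support_bounded[OF test_continuous[OF assms] this]
  obtain M where M: "M > 0" "\<And>x. \<bar>\<phi> x\<bar> \<le> M * indicat_real (cball 0 R) x" by metis
  show ?thesis
  proof (rule that[OF M(1)])
    fix x show "\<bar>\<phi> x\<bar> \<le> M"
      using M(2)[of x] M(1) by (cases "x \<in> cball 0 R") (auto simp: indicator_def)
  qed
qed

lemma continuous_compact_support_integrable: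
  fixes \<phi> :: "'a::euclidean_space \<Rightarrow> real"
  assumes "continuous_on UNIV \<phi>" "\<And>x. R \<le> norm x \<Longrightarrow> \<phi> x = 0"
  shows "integrable lborel \<phi>"
proof -
  obtain M where M: "M > 0" "\<And>x. \<bar>\<phi> x\<bar> \<le> M * indicat_real (cball 0 R) x"
    using continuous_compact_support_bounded[OF assms] by metis
  show ?thesis
  proof (rule Bochner_Integration.integrable_bound)
    show "integrable lborel (\<lambda>x::'a. M * indicat_real (cball 0 R) x)"
      by (intro integrable_mult_right integrable_real_indicator)
        (use emeasure_bounded_finite[of "cball 0 R :: 'a set"] in auto)
  qed (use M assms(1) in \<open>auto intro: continuous_borel simp: abs_mult\<close>)
qed

lemma test_integrable:
  assumes "test_function \<phi>" shows "integrable lborel \<phi>"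
  using test_functionE[OF assms] continuous_compact_support_integrable[OF test_continuous[OF assms]]
  by metis

lemma integral_abs_le_integral:
  fixes f g :: "'b \<Rightarrow> real"
  assumes "integrable M f" "integrable M g" "\<And>x. x \<in> space M \<Longrightarrow> \<bar>f x\<bar> \<le> g x"
  shows "\<bar>\<integral>x. f x \<partial>M\<bar> \<le> (\<integral>x. g x \<partial>M)"
proof -
  have "\<bar>\<integral>x. f x \<partial>M\<bar> \<le> (\<integral>x. \<bar>f x\<bar> \<partial>M)" by (rule integral_abs_bound)
  also have "\<dots> \<le> (\<integral>x. g x \<partial>M)" using assms by (intro integral_mono) auto
  finally show ?thesis .
qed

text \<open>The mean value inequality on the ball bounds the difference quotients by
  \<open>g\<close>, and the derivative is bounded by \<open>g\<close> as well, so the normalised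
  remainders are dominated by \<open>2 * g\<close> and dominated convergence along sequences gives
  the Frechet derivative. Scale integrals, convolutions and the heat flow are all differentiated
  with it.\<close>

lemma has_derivative_integral_dominated:
  fixes F :: "'a::euclidean_space \<Rightarrow> 'b \<Rightarrow> real"
  assumes r: "0 < r"
    and int: "\<And>x. x \<in> ball x0 r \<Longrightarrow> integrable M (F x)"
    and der: "\<And>x y. x \<in> ball x0 r \<Longrightarrow> y \<in> space M \<Longrightarrow> ((\<lambda>x. F x y) has_derivative F' x y) (at x)"
    and bnd: "\<And>x y h. x \<in> ball x0 r \<Longrightarrow> y \<in> space M \<Longrightarrow> \<bar>F' x y h\<bar> \<le> g y * norm h"
    and g: "integrable M g"
    and meas: "\<And>h. (\<lambda>y. F' x0 y h) \<in> borel_measurable M"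
  shows "((\<lambda>x. \<integral>y. F x y \<partial>M) has_derivative (\<lambda>h. \<integral>y. F' x0 y h \<partial>M)) (at x0)"
proof -
  have x0: "x0 \<in> ball x0 r" using r by simp
  have lin: "bounded_linear (F' x0 y)" if "y \<in> space M" for y
    using der[OF x0 that] by (rule has_derivative_bounded_linear)
  have I': "integrable M (\<lambda>y. F' x0 y h)" for h
  proof (rule Bochner_Integration.integrable_bound)
    show "integrable M (\<lambda>y. g y * norm h)" using g by simp
    show "AE y in M. norm (F' x0 y h) \<le> norm (g y * norm h)"
      using bnd[OF x0] by (intro AE_I2) (metis abs_ge_self order_trans real_norm_def)
  qed (rule meas)
  have bl: "bounded_linear (\<lambda>h. \<integral>y. F' x0 y h \<partial>M)"
  proof (rule bounded_linear_intro)
    fix h k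
    have "(\<integral>y. F' x0 y (h + k) \<partial>M) = (\<integral>y. F' x0 y h + F' x0 y k \<partial>M)"
      by (intro Bochner_Integration.integral_cong refl linear_add bounded_linear.linear lin)
    then show "(\<integral>y. F' x0 y (h + k) \<partial>M) = (\<integral>y. F' x0 y h \<partial>M) + (\<integral>y. F' x0 y k \<partial>M)"
      by (simp add: I')
  next
    fix c h
    have "(\<integral>y. F' x0 y (c *\<^sub>R h) \<partial>M) = (\<integral>y. c * F' x0 y h \<partial>M)"
      by (intro Bochner_Integration.integral_cong refl)
        (simp add: linear_scale[OF bounded_linear.linear[OF lin]])
    then show "(\<integral>y. F' x0 y (c *\<^sub>R h) \<partial>M) = c *\<^sub>R (\<integral>y. F' x0 y h \<partial>M)" by simp
  next
    fix h
    have "\<bar>\<integral>y. F' x0 y h \<partial>M\<bar> \<le> (\<integral>y. g y * norm h \<partial>M)"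
      by (rule integral_abs_le_integral[OF I' _ bnd[OF x0]]) (simp add: g)
    then show "norm (\<integral>y. F' x0 y h \<partial>M) \<le> norm h * (\<integral>y. g y \<partial>M)" by (simp add: mult.commute)
  qed
  show ?thesis
    unfolding has_derivative_at
  proof (intro conjI bl)
    show "(\<lambda>h. norm ((\<integral>y. F (x0 + h) y \<partial>M) - (\<integral>y. F x0 y \<partial>M) - (\<integral>y. F' x0 y h \<partial>M)) / norm h) \<midarrow>0\<rightarrow> 0"
      unfolding tendsto_at_iff_sequentially
    proof (intro allI impI)
      fix X :: "nat \<Rightarrow> 'a" assume X0: "\<forall>i. X i \<in> UNIV - {0}" and X: "X \<longlonglongrightarrow> 0"
      define Q where "Q n y = (F (x0 + X n) y - F x0 y - F' x0 y (X n)) / norm (X n)" for n y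
      \<comment> \<open>Only a tail of the sequence stays in the ball where the bounds hold, so
        dominated convergence is applied to the shifted sequence; \<open>LIMSEQ_offset\<close>
        undoes the shift at the end.\<close>
      obtain N where N: "\<And>n. n \<ge> N \<Longrightarrow> norm (X n) < r"
        using X r by (metis LIMSEQ_iff diff_zero)
      define Y where "Y n = X (n + N)" for n
      have inb: "x0 + Y n \<in> ball x0 r" for n using N[of "n + N"] by (simp add: Y_def dist_norm)
      have Ylim: "Y \<longlonglongrightarrow> 0" using X unfolding Y_def by (rule LIMSEQ_ignore_initial_segment)
      have Y0: "Y n \<noteq> 0" for n using X0 by (simp add: Y_def)
      have Qlim: "(\<lambda>n. Q (n + N) y) \<longlonglongrightarrow> 0" if y: "y \<in> space M" for y
      proof -
        have "(\<lambda>h. norm (F (x0 + h) y - F x0 y - F' x0 y h) / norm h) \<midarrow>0\<rightarrow> 0"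
          using der[OF x0 y] by (simp add: has_derivative_at)
        then have "(\<lambda>n. norm (F (x0 + Y n) y - F x0 y - F' x0 y (Y n)) / norm (Y n)) \<longlonglongrightarrow> 0"
          unfolding tendsto_at_iff_sequentially using Ylim Y0 by (auto simp: o_def)
        then have "(\<lambda>n. norm (Q (n + N) y)) \<longlonglongrightarrow> 0" by (simp add: Q_def Y_def)
        then show ?thesis by (rule tendsto_norm_zero_cancel)
      qed
      have Qb: "norm (Q (n + N) y) \<le> 2 * g y" if y: "y \<in> space M" for n y
      proof -
        have "norm (F (x0 + Y n) y - F x0 y) \<le> g y * norm (x0 + Y n - x0)"
        proof (rule differentiable_bound[where S="ball x0 r" and f'="\<lambda>x. F' x y"])
          show "((\<lambda>x. F x y) has_derivative F' x y) (at x within ball x0 r)" if "x \<in> ball x0 r" for x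
            using der[OF that y] by (rule has_derivative_at_withinI)
          show "onorm (F' x y) \<le> g y" if "x \<in> ball x0 r" for x
            using bnd[OF that y] by (intro onorm_le) auto
        qed (use inb x0 in auto)
        moreover have "\<bar>F' x0 y (Y n)\<bar> \<le> g y * norm (Y n)" by (rule bnd[OF x0 y])
        ultimately have "\<bar>F (x0 + Y n) y - F x0 y - F' x0 y (Y n)\<bar> \<le> 2 * g y * norm (Y n)" by auto
        then show ?thesis using Y0[of n] by (simp add: Q_def Y_def field_simps)
      qed
      have IN: "integrable M (\<lambda>y. F (x0 + Y n) y - F x0 y - F' x0 y (Y n))" for n
        by (intro Bochner_Integration.integrable_diff int inb x0 I')
      have IQ: "integrable M (Q (n + N))" for n
        using IN[of n] unfolding Q_def Y_def by (rule integrable_divide_zero)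
      have "(\<lambda>n. \<integral>y. Q (n + N) y \<partial>M) \<longlonglongrightarrow> (\<integral>y. 0 \<partial>M)"
      proof (rule integral_dominated_convergence[where w="\<lambda>y. 2 * g y"])
        show "(\<lambda>y. Q (n + N) y) \<in> borel_measurable M" for n
          using IQ by (rule borel_measurable_integrable)
        show "AE y in M. (\<lambda>n. Q (n + N) y) \<longlonglongrightarrow> 0" by (rule AE_I2) (rule Qlim)
        show "AE y in M. norm (Q (n + N) y) \<le> 2 * g y" for n by (rule AE_I2) (rule Qb)
      qed (simp_all add: g)
      then have "(\<lambda>n. \<bar>\<integral>y. Q (n + N) y \<partial>M\<bar>) \<longlonglongrightarrow> 0" by (simp add: tendsto_rabs_zero)
      moreover have "\<bar>\<integral>y. Q (n + N) y \<partial>M\<bar> = norm ((\<integral>y. F (x0 + Y n) y \<partial>M)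
          - (\<integral>y. F x0 y \<partial>M) - (\<integral>y. F' x0 y (Y n) \<partial>M)) / norm (Y n)" for n
      proof -
        have "(\<integral>y. Q (n + N) y \<partial>M) = (\<integral>y. F (x0 + Y n) y - F x0 y - F' x0 y (Y n) \<partial>M) / norm (Y n)"
          unfolding Q_def Y_def by (rule integral_divide_zero)
        also have "(\<integral>y. F (x0 + Y n) y - F x0 y - F' x0 y (Y n) \<partial>M)
            = (\<integral>y. F (x0 + Y n) y \<partial>M) - (\<integral>y. F x0 y \<partial>M) - (\<integral>y. F' x0 y (Y n) \<partial>M)"
          using int[OF inb[of n]] int[OF x0] I'[of "Y n"] by simp
        finally show ?thesis by simp
      qed
      ultimately have "(\<lambda>n. ((\<lambda>h. norm ((\<integral>y. F (x0 + h) y \<partial>M) - (\<integral>y. F x0 y \<partial>M)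
          - (\<integral>y. F' x0 y h \<partial>M)) / norm h) \<circ> X) (n + N)) \<longlonglongrightarrow> 0"
        by (simp add: Y_def o_def)
      then show "((\<lambda>h. norm ((\<integral>y. F (x0 + h) y \<partial>M) - (\<integral>y. F x0 y \<partial>M)
          - (\<integral>y. F' x0 y h \<partial>M)) / norm h) \<circ> X) \<longlonglongrightarrow> 0"
        by (rule LIMSEQ_offset)
    qed
  qed
qed

section \<open>Mollifiers and a parametrix of the Laplacian\<close>

lemma nn_integral_affine:
  fixes t :: "'a::euclidean_space"
  assumes [measurable]: "f \<in> borel_measurable borel" and "c \<noteq> 0"
  shows "(\<integral>\<^sup>+x. f x \<partial>lborel) = ennreal (\<bar>c\<bar> ^ DIM('a)) * (\<integral>\<^sup>+x. f (t + c *\<^sub>R x) \<partial>lborel)"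
  by (subst lborel_affine[OF assms(2), of t])
    (simp add: nn_integral_density nn_integral_distr nn_integral_cmult ennreal_power)

lemma integrable_affine:
  fixes t :: "'a::euclidean_space" and f :: "'a \<Rightarrow> real"
  assumes "integrable lborel f" and "c \<noteq> 0"
  shows "integrable lborel (\<lambda>x. f (t + c *\<^sub>R x))"
proof -
  have [measurable]: "f \<in> borel_measurable borel" using assms(1) by auto
  have "integrable (density (distr lborel borel (\<lambda>x. t + c *\<^sub>R x)) (\<lambda>_. ennreal (\<bar>c\<bar> ^ DIM('a)))) f"
    using assms lborel_affine[OF assms(2), of t] by simp
  then have "integrable (distr lborel borel (\<lambda>x. t + c *\<^sub>R x)) (\<lambda>x. \<bar>c\<bar> ^ DIM('a) * f x)"
    by (subst (asm) integrable_density) auto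
  then have "integrable lborel (\<lambda>x. \<bar>c\<bar> ^ DIM('a) * f (t + c *\<^sub>R x))"
    by (subst (asm) integrable_distr_eq) auto
  then show ?thesis using assms(2) by simp
qed

lemma integral_affine:
  fixes t :: "'a::euclidean_space" and f :: "'a \<Rightarrow> real"
  assumes [measurable]: "f \<in> borel_measurable borel" and "c \<noteq> 0"
  shows "(\<integral>x. f x \<partial>lborel) = \<bar>c\<bar> ^ DIM('a) * (\<integral>x. f (t + c *\<^sub>R x) \<partial>lborel)"
proof -
  have "(\<integral>x. f x \<partial>lborel) = (\<integral>x. f x \<partial>(density (distr lborel borel (\<lambda>x. t + c *\<^sub>R x)) (\<lambda>_. ennreal (\<bar>c\<bar> ^ DIM('a)))))"
    using lborel_affine[OF assms(2), of t] by simp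
  also have "\<dots> = (\<integral>x. \<bar>c\<bar> ^ DIM('a) * f x \<partial>(distr lborel borel (\<lambda>x. t + c *\<^sub>R x)))"
    by (subst integral_density) auto
  also have "\<dots> = (\<integral>x. \<bar>c\<bar> ^ DIM('a) * f (t + c *\<^sub>R x) \<partial>lborel)"
    by (subst integral_distr) auto
  finally show ?thesis by simp
qed

text \<open>Dividing by powers of \<open>t\<close> keeps the family closed under differentiation.\<close>

definition flat :: "nat \<Rightarrow> real \<Rightarrow> real" where
  "flat m t = (if 0 < t then exp (- (1 / t)) / t ^ m else 0)"

text \<open>Quadratic decay at 0 makes the difference quotient of \<open>flat m\<close> tend to 0
  there. It comes from exp y >= (1 + y/n)^n >= (y/n)^n with y = 1/t and n = m + 2.\<close>

lemma flat_le: "\<bar>flat m t\<bar> \<le> real (m + 2) ^ (m + 2) * t\<^sup>2"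
proof (cases "0 < t")
  case True
  have "((1 / t) / real (m + 2)) ^ (m + 2) \<le> (1 + (1 / t) / real (m + 2)) ^ (m + 2)"
    using True by (intro power_mono) auto
  also have "\<dots> \<le> exp (1 / t)"
    using True by (intro exp_ge_one_plus_x_over_n_power_n) (auto intro: order_trans[of _ 0])
  finally have "1 / (t ^ m * t\<^sup>2 * real (m + 2) ^ (m + 2)) \<le> exp (1 / t)"
    by (simp add: power_divide power_add power2_eq_square power_mult_distrib mult_ac)
  moreover have "0 < t ^ m * t\<^sup>2 * real (m + 2) ^ (m + 2)" using True by (intro mult_pos_pos) auto
  ultimately have "1 \<le> exp (1 / t) * (t ^ m * t\<^sup>2 * real (m + 2) ^ (m + 2))"
    by (simp only: pos_divide_le_eq)
  then have "exp (- (1 / t)) / t ^ m \<le> real (m + 2) ^ (m + 2) * t\<^sup>2"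
    using True by (simp add: exp_minus field_simps)
  then show ?thesis using True by (simp add: flat_def)
qed (simp add: flat_def)

lemma flat_has_derivative:
  "(flat m has_real_derivative flat (m + 2) t - m * flat (m + 1) t) (at t)"
proof -
  consider "t < 0" | "t = 0" | "0 < t" by linarith
  then show ?thesis
  proof cases
    case 1
    have "((\<lambda>t. 0) has_real_derivative 0) (at t)" by simp
    then have "(flat m has_real_derivative 0) (at t)"
      by (rule has_field_derivative_transform_within_open[of _ _ _ "{..<0}"])
        (use 1 in \<open>auto simp: flat_def\<close>)
    then show ?thesis using 1 by (simp add: flat_def)
  next
    case 2
    have "(\<lambda>h. (flat m (0 + h) - flat m 0) / h) \<midarrow>0\<rightarrow> 0"
    proof (rule Lim_null_comparison)
      show "eventually (\<lambda>h. norm ((flat m (0 + h) - flat m 0) / h) \<le> real (m + 2) ^ (m + 2) * \<bar>h\<bar>) (at 0)"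
      proof (rule eventually_mono[OF eventually_neq_at_within[of 0]])
        fix h :: real assume "h \<noteq> 0"
        then show "norm ((flat m (0 + h) - flat m 0) / h) \<le> real (m + 2) ^ (m + 2) * \<bar>h\<bar>"
          using flat_le[of m h] by (simp add: flat_def field_simps power2_eq_square abs_mult)
      qed
      show "(\<lambda>h. real (m + 2) ^ (m + 2) * \<bar>h\<bar>) \<midarrow>0\<rightarrow> 0"
        by (auto intro!: tendsto_eq_intros)
    qed
    then show ?thesis using 2 by (simp add: flat_def DERIV_def)
  next
    case 3
    have "((\<lambda>t. exp (- (1 / t)) / t ^ m) has_real_derivative flat (m + 2) t - m * flat (m + 1) t) (at t)"
    proof (cases m)
      case 0
      then show ?thesis using 3
        by (auto intro!: derivative_eq_intros simp: flat_def field_simps power2_eq_square)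
    next
      case (Suc n)
      have "((\<lambda>t. exp (- (1 / t)) / t ^ Suc n) has_real_derivative
          (exp (- (1 / t)) * (1 / t\<^sup>2) * t ^ Suc n - exp (- (1 / t)) * (real (Suc n) * t ^ n)) / (t ^ Suc n * t ^ Suc n)) (at t)"
        using 3 by (auto intro!: derivative_eq_intros simp: power2_eq_square) (cases n; simp add: algebra_simps)
      also have "(exp (- (1 / t)) * (1 / t\<^sup>2) * t ^ Suc n - exp (- (1 / t)) * (real (Suc n) * t ^ n)) / (t ^ Suc n * t ^ Suc n)
          = flat (m + 2) t - m * flat (m + 1) t"
        using 3 by (simp add: flat_def Suc field_simps power2_eq_square)
      finally show ?thesis unfolding Suc .
    qed
    then show ?thesis
      by (rule has_field_derivative_transform_within_open[of _ _ _ "{0<..}"])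
        (use 3 in \<open>auto simp: flat_def\<close>)
  qed
qed

section \<open>A smooth bump supported in the unit ball\<close>

definition bump :: "nat \<Rightarrow> 'a::euclidean_space \<Rightarrow> real" where
  "bump m x = flat m (1 - x \<bullet> x)"

lemma bump_has_derivative:
  "(bump m has_derivative (\<lambda>h. -2 * (x \<bullet> h) * (bump (m + 2) x - m * bump (m + 1) x))) (at x)"
proof -
  have 1: "((\<lambda>x::'a. 1 - x \<bullet> x) has_derivative (\<lambda>h. -2 * (x \<bullet> h))) (at x)"
    by (auto intro!: derivative_eq_intros simp: inner_commute)
  have 2: "(flat m has_derivative times (flat (m + 2) (1 - x \<bullet> x) - m * flat (m + 1) (1 - x \<bullet> x))) (at (1 - x \<bullet> x))"
    using flat_has_derivative by (simp add: has_field_derivative_def)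
  from has_derivative_compose[OF 1 2] show ?thesis
    by (simp add: bump_def[abs_def] mult_ac)
qed

text \<open>A directional derivative of a bump is a linear form times a combination of bumps with
  larger index. The class generated by bumps under multiplication by linear forms, sums and
  multiples is therefore closed under differentiation, which is the invariant that
  \<open>smooth_coinduct\<close> asks for.\<close>

inductive bumplike :: "('a::euclidean_space \<Rightarrow> real) \<Rightarrow> bool" where
  base: "bumplike (bump m)"
| mult: "bumplike f \<Longrightarrow> bumplike (\<lambda>x. (x \<bullet> b) * f x)"
| add: "bumplike f \<Longrightarrow> bumplike g \<Longrightarrow> bumplike (\<lambda>x. f x + g x)"
| scale: "bumplike f \<Longrightarrow> bumplike (\<lambda>x. c * f x)"

lemma bumplike_derivative:
  "bumplike f \<Longrightarrow> \<exists>D. (\<forall>x. (f has_derivative D x) (at x)) \<and> (\<forall>e. bumplike (\<lambda>x. D x e))"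
proof (induction rule: bumplike.induct)
  case (base m)
  show ?case
  proof (intro exI conjI allI)
    show "(bump m has_derivative (\<lambda>h. -2 * (x \<bullet> h) * (bump (m + 2) x - m * bump (m + 1) x))) (at x)" for x :: 'a
      by (rule bump_has_derivative)
    fix e :: 'a
    have "bumplike (\<lambda>x. (x \<bullet> e) * (-2 * bump (m + 2) x + 2 * m * bump (m + 1) x))"
      by (intro bumplike.intros)
    then show "bumplike (\<lambda>x. -2 * (x \<bullet> e) * (bump (m + 2) x - m * bump (m + 1) x))"
      by (simp add: algebra_simps)
  qed
next
  case (mult f b)
  then obtain D where D: "\<And>x. (f has_derivative D x) (at x)" "\<And>e. bumplike (\<lambda>x. D x e)" by blast
  show ?case
  proof (intro exI conjI allI)
    show "((\<lambda>x. (x \<bullet> b) * f x) has_derivative (\<lambda>h. (x \<bullet> b) * D x h + (h \<bullet> b) * f x)) (at x)" for x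
      by (rule has_derivative_mult) (auto intro!: D derivative_eq_intros)
    show "bumplike (\<lambda>x. (x \<bullet> b) * D x e + (e \<bullet> b) * f x)" for e
      by (intro bumplike.intros D mult.hyps)
  qed
next
  case (add f g)
  then obtain D E where D: "\<And>x. (f has_derivative D x) (at x)" "\<And>e. bumplike (\<lambda>x. D x e)"
    and E: "\<And>x. (g has_derivative E x) (at x)" "\<And>e. bumplike (\<lambda>x. E x e)" by blast
  show ?case
  proof (intro exI conjI allI)
    show "((\<lambda>x. f x + g x) has_derivative (\<lambda>h. D x h + E x h)) (at x)" for x
      by (intro has_derivative_add D E)
    show "bumplike (\<lambda>x. D x e + E x e)" for e by (intro bumplike.intros D E)
  qed
next
  case (scale f c)
  then obtain D where D: "\<And>x. (f has_derivative D x) (at x)" "\<And>e. bumplike (\<lambda>x. D x e)" by blast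
  show ?case
  proof (intro exI conjI allI)
    show "((\<lambda>x. c * f x) has_derivative (\<lambda>h. c * D x h)) (at x)" for x
      by (intro has_derivative_mult_right D)
    show "bumplike (\<lambda>x. c * D x e)" for e by (intro bumplike.intros D)
  qed
qed

lemma bumplike_smooth: "bumplike f \<Longrightarrow> smooth f"
proof (rule smooth_coinduct[where X=bumplike])
  fix f :: "'a \<Rightarrow> real" and x :: 'a assume "bumplike f"
  then show "f differentiable at x" using bumplike_derivative differentiable_def by blast
next
  fix f :: "'a \<Rightarrow> real" and e :: 'a assume "bumplike f"
  then obtain D where D: "\<And>x. (f has_derivative D x) (at x)" "\<And>e. bumplike (\<lambda>x. D x e)"
    using bumplike_derivative by blast
  have "partial e f = (\<lambda>x. D x e)" using partial_eqI[OF D(1)] by blast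
  then show "bumplike (partial e f)" using D(2) by simp
qed

lemma bump_nonneg: "0 \<le> bump m x"
  by (simp add: bump_def flat_def)

lemma bump_zero:
  assumes "1 \<le> norm x" shows "bump m x = 0"
proof -
  have "1 \<le> x \<bullet> x" using one_le_power[OF assms, of 2] by (simp add: power2_norm_eq_inner)
  then show ?thesis by (simp add: bump_def flat_def)
qed

lemma bump_pos:
  assumes "norm x < 1" shows "0 < bump m x"
proof -
  have "x \<bullet> x < 1" using power_strict_mono[OF assms, of 2] by (simp add: power2_norm_eq_inner)
  then show ?thesis by (simp add: bump_def flat_def)
qed

lemma test_bump: "test_function (bump m)"
  by (rule test_functionI[of _ 1]) (auto intro: bumplike_smooth bumplike.base bump_zero)

lemma integral_bump_pos: "0 < (\<integral>x. bump m (x::'a::euclidean_space) \<partial>lborel)"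
proof -
  have I: "integrable lborel (bump m :: 'a \<Rightarrow> real)" by (simp add: test_bump test_integrable)
  have "(\<integral>x. bump m (x::'a) \<partial>lborel) \<noteq> 0"
  proof
    assume "(\<integral>x. bump m (x::'a) \<partial>lborel) = 0"
    then have "AE x::'a in lborel. bump m x = 0"
      using I by (subst (asm) integral_nonneg_eq_0_iff_AE) (auto simp: bump_nonneg)
    then have "AE x::'a in lborel. x \<notin> ball 0 1"
    proof eventually_elim
      case (elim x)
      then show ?case using bump_pos[of x m] by auto
    qed
    then have "emeasure lborel (ball (0::'a) 1) = 0"
      by (subst (asm) AE_iff_measurable[OF _ refl]) (auto simp: ball_def)
    then show False using content_ball_pos[of 1 "0::'a"] by (simp add: measure_def)
  qed
  moreover have "0 \<le> (\<integral>x. bump m (x::'a) \<partial>lborel)" by (simp add: bump_nonneg)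
  ultimately show ?thesis by simp
qed

text \<open>The profile is \<open>bump 2\<close> because the gradient of \<open>bump 0\<close> is x
  times a multiple of it; hence the vector field x rho(x) has a primitive that is again a test
  function.\<close>

definition rho :: "'a::euclidean_space \<Rightarrow> real" where
  "rho x = (1 / (\<integral>y. bump 2 (y::'a) \<partial>lborel)) * bump 2 x"

text \<open>The constant is chosen so that the gradient of \<open>sig\<close> is \<open>x rho x\<close>.\<close>

definition sig :: "'a::euclidean_space \<Rightarrow> real" where
  "sig x = - (1 / (2 * (\<integral>y. bump 2 (y::'a) \<partial>lborel))) * bump 0 x"

lemma test_cmult: "test_function \<phi> \<Longrightarrow> test_function (\<lambda>x. c * \<phi> x)"
  using test_affine[of \<phi> 1 c 0] by simp

lemma test_rho: "test_function rho" and test_sig: "test_function sig"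
  unfolding rho_def[abs_def] sig_def[abs_def] by (intro test_cmult test_bump)+

lemma rho_nonneg: "0 \<le> rho x"
  by (simp add: rho_def bump_nonneg)

lemma rho_zero: "1 \<le> norm x \<Longrightarrow> rho x = 0" and sig_zero: "1 \<le> norm x \<Longrightarrow> sig x = 0"
  by (simp_all add: rho_def sig_def bump_zero)

lemma integral_rho: "(\<integral>x. rho (x::'a::euclidean_space) \<partial>lborel) = 1"
  using integral_bump_pos[of 2, where 'a='a] unfolding rho_def by (simp add: less_imp_neq[symmetric])

lemma partial_sig: "partial e sig x = (x \<bullet> e) * rho x"
proof -
  have "(sig has_derivative (\<lambda>h. - (1 / (2 * (\<integral>y. bump 2 (y::'a) \<partial>lborel))) *
      (-2 * (x \<bullet> h) * (bump (0 + 2) x - real 0 * bump (0 + 1) x)))) (at x)"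
    unfolding sig_def[abs_def] by (intro has_derivative_mult_right bump_has_derivative)
  from partial_eqI[OF this, of e] show ?thesis by (simp add: rho_def numeral_2_eq_2)
qed

text \<open>The Laplacian of \<open>sig\<close> is the divergence of x rho(x). Up to sign this is
  the derivative at t = 1 of the dilations t^(-d) rho(x/t), the identity that
  \<open>laplacian_parametrix\<close> integrates over the scales.\<close>

lemma laplacian_sig:
  fixes x :: "'a::euclidean_space"
  shows "laplacian sig x = DIM('a) * rho x + (\<Sum>e\<in>Basis. (x \<bullet> e) * partial e rho x)"
proof -
  have "partial e (partial e sig) x = rho x + (x \<bullet> e) * partial e rho x" if "e \<in> Basis" for e
  proof -
    have *: "partial e sig = (\<lambda>x. (x \<bullet> e) * rho x)" by (intro ext partial_sig)
    have "((\<lambda>x. (x \<bullet> e) * rho x) has_derivative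
        (\<lambda>h. (x \<bullet> e) * (\<Sum>b\<in>Basis. (h \<bullet> b) * partial b rho x) + (h \<bullet> e) * rho x)) (at x)"
      by (rule has_derivative_mult)
        (auto intro!: derivative_eq_intros smooth_has_derivative test_smooth test_rho)
    from partial_eqI[OF this, of e] show ?thesis
      using that by (simp add: * inner_Basis if_distrib[where f="\<lambda>c. c * _"] cong: if_cong)
  qed
  then show ?thesis by (simp add: laplacian_def sum.distrib)
qed

section \<open>Mollifiers and integrals over scales\<close>

definition moll :: "real \<Rightarrow> 'a::euclidean_space \<Rightarrow> real" where
  "moll t x = rho ((1 / t) *\<^sub>R x) / t ^ DIM('a)"

lemma test_moll: "t \<noteq> 0 \<Longrightarrow> test_function (moll t)"
  using test_affine[OF test_rho, of "1 / t" "1 / t ^ DIM('a)" 0] by (simp add: moll_def[abs_def])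

lemma moll_nonneg: "0 < t \<Longrightarrow> 0 \<le> moll t x"
  by (simp add: moll_def rho_nonneg)

lemma moll_zero: "0 < t \<Longrightarrow> t \<le> norm x \<Longrightarrow> moll t x = 0"
  by (simp add: moll_def rho_zero)

lemma integral_moll:
  assumes "0 < t" shows "(\<integral>x. moll t (x::'a::euclidean_space) \<partial>lborel) = 1"
  using integral_affine[of "moll t :: 'a \<Rightarrow> real" t 0] assms test_moll[of t, THEN test_borel]
  by (simp add: moll_def integral_rho)

lemma moll_1: "moll 1 = rho"
  by (simp add: moll_def[abs_def])

lemma test_derivative_bound:
  fixes \<phi> :: "'a::euclidean_space \<Rightarrow> real"
  assumes "test_function \<phi>"
  obtains C where "C > 0" "\<And>x h. \<bar>\<Sum>b\<in>Basis. (h \<bullet> b) * partial b \<phi> x\<bar> \<le> C * norm h"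
proof -
  have "\<forall>b\<in>Basis. \<exists>M>0. \<forall>x. \<bar>partial b \<phi> x\<bar> \<le> M"
    using test_bounded[OF test_partial[OF assms]] by metis
  then obtain M where M: "\<And>b. b \<in> Basis \<Longrightarrow> 0 < M b" "\<And>b x. b \<in> Basis \<Longrightarrow> \<bar>partial b \<phi> x\<bar> \<le> M b"
    by metis
  show ?thesis
  proof (rule that)
    show "0 < (\<Sum>b\<in>(Basis::'a set). M b)" using M(1) by (intro sum_pos) auto
    fix x h
    have "\<bar>\<Sum>b\<in>Basis. (h \<bullet> b) * partial b \<phi> x\<bar> \<le> (\<Sum>b\<in>Basis. \<bar>h \<bullet> b\<bar> * \<bar>partial b \<phi> x\<bar>)"
      by (rule order_trans[OF sum_abs]) (simp add: abs_mult)
    also have "\<dots> \<le> (\<Sum>b\<in>Basis. norm h * M b)"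
      by (intro sum_mono mult_mono Basis_le_norm M) auto
    finally show "\<bar>\<Sum>b\<in>Basis. (h \<bullet> b) * partial b \<phi> x\<bar> \<le> (\<Sum>b\<in>Basis. M b) * norm h"
      by (simp add: sum_distrib_left mult.commute)
  qed
qed

text \<open>Each derivative in x brings out a factor 1/t, so it only replaces \<phi> by a partial
  derivative and k by k + 1: the family is closed under differentiation. The lower end \<epsilon> >
  0 keeps the integrand bounded.\<close>

definition scale_int :: "nat \<Rightarrow> ('a::euclidean_space \<Rightarrow> real) \<Rightarrow> real \<Rightarrow> 'a \<Rightarrow> real" where
  "scale_int k \<phi> \<epsilon> x = (\<integral>t. indicat_real {\<epsilon>..1} t * (\<phi> ((1 / t) *\<^sub>R x) / t ^ k) \<partial>lborel)"

lemma integrable_indicator_bounded: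
  fixes f :: "'a::euclidean_space \<Rightarrow> real"
  assumes "f \<in> borel_measurable borel" "A \<in> sets borel" "bounded A" "\<And>x. x \<in> A \<Longrightarrow> \<bar>f x\<bar> \<le> M"
  shows "integrable lborel (\<lambda>x. indicat_real A x * f x)"
proof (rule Bochner_Integration.integrable_bound)
  show "integrable lborel (\<lambda>x. M * indicat_real A x)"
    using assms(2) emeasure_bounded_finite[OF assms(3)]
    by (intro integrable_mult_right integrable_real_indicator) auto
  show "(\<lambda>x. indicat_real A x * f x) \<in> borel_measurable lborel"
    using assms(1,2) by measurable
  show "AE x in lborel. norm (indicat_real A x * f x) \<le> norm (M * indicat_real A x)"
    using assms(4) by (intro AE_I2) (fastforce simp: indicator_def)
qed

lemma scale_int_integrable:
  assumes "test_function \<phi>" "0 < \<epsilon>"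
  shows "integrable lborel (\<lambda>t. indicat_real {\<epsilon>..1} t * (\<phi> ((1 / t) *\<^sub>R x) / t ^ k))"
proof -
  obtain M where M: "M > 0" "\<And>x. \<bar>\<phi> x\<bar> \<le> M" using test_bounded[OF assms(1)] by blast
  have [measurable]: "\<phi> \<in> borel_measurable borel" using assms(1) by (rule test_borel)
  show ?thesis
  proof (rule integrable_indicator_bounded)
    fix t assume "t \<in> {\<epsilon>..1}"
    then show "\<bar>\<phi> ((1 / t) *\<^sub>R x) / t ^ k\<bar> \<le> M / \<epsilon> ^ k"
      using assms(2) M by (auto simp: abs_divide intro!: frac_le power_mono)
  qed auto
qed

lemma scale_int_has_derivative:
  assumes \<phi>: "test_function \<phi>" and \<epsilon>: "0 < \<epsilon>"
  shows "(scale_int k \<phi> \<epsilon> has_derivative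
    (\<lambda>h. \<integral>t. indicat_real {\<epsilon>..1} t * ((\<Sum>b\<in>Basis. (h \<bullet> b) * partial b \<phi> ((1 / t) *\<^sub>R x)) / t ^ (k + 1)) \<partial>lborel)) (at x)"
proof -
  obtain C where C: "C > 0" "\<And>x h. \<bar>\<Sum>b\<in>Basis. (h \<bullet> b) * partial b \<phi> x\<bar> \<le> C * norm h"
    using test_derivative_bound[OF \<phi>] by blast
  show ?thesis
    unfolding scale_int_def[abs_def]
  proof (rule has_derivative_integral_dominated[where r=1])
  have [measurable]: "partial b \<phi> \<in> borel_measurable borel" if "b \<in> Basis" for b
    using test_borel[OF test_partial[OF \<phi> that]] .
  let ?g = "\<lambda>t. indicat_real {\<epsilon>..1} t * (C / \<epsilon> ^ (k + 1))"
  show "integrable lborel ?g"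
    by (rule integrable_indicator_bounded[where M="C / \<epsilon> ^ (k + 1)"]) (use C \<epsilon> in auto)
  show "integrable lborel (\<lambda>t. indicat_real {\<epsilon>..1} t * (\<phi> ((1 / t) *\<^sub>R x) / t ^ k))" for x
    by (rule scale_int_integrable[OF \<phi> \<epsilon>])
  show "((\<lambda>x. indicat_real {\<epsilon>..1} t * (\<phi> ((1 / t) *\<^sub>R x) / t ^ k)) has_derivative
     (\<lambda>h. indicat_real {\<epsilon>..1} t * ((\<Sum>b\<in>Basis. (h \<bullet> b) * partial b \<phi> ((1 / t) *\<^sub>R x)) / t ^ (k + 1)))) (at x)" for x t
  proof (cases "t \<in> {\<epsilon>..1}")
    case True
    then have t: "0 < t" using \<epsilon> by auto
    have "((\<lambda>x. (1 / t) *\<^sub>R x) has_derivative (\<lambda>h. (1 / t) *\<^sub>R h)) (at x)"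
      by (auto intro!: derivative_eq_intros)
    from has_derivative_compose[OF this smooth_has_derivative[OF test_smooth[OF \<phi>]]]
    have "((\<lambda>x. (1 / t ^ k) * \<phi> ((1 / t) *\<^sub>R x)) has_derivative
        (\<lambda>h. (1 / t ^ k) * (\<Sum>b\<in>Basis. ((1 / t) *\<^sub>R h \<bullet> b) * partial b \<phi> ((1 / t) *\<^sub>R x)))) (at x)"
      by (rule has_derivative_mult_right)
    also have "(\<lambda>h. (1 / t ^ k) * (\<Sum>b\<in>Basis. ((1 / t) *\<^sub>R h \<bullet> b) * partial b \<phi> ((1 / t) *\<^sub>R x)))
      = (\<lambda>h. (\<Sum>b\<in>Basis. (h \<bullet> b) * partial b \<phi> ((1 / t) *\<^sub>R x)) / t ^ (k + 1))"
      by (simp add: fun_eq_iff sum_divide_distrib sum_distrib_left field_simps)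
    finally show ?thesis using True by simp
  next
    case False
    then have "indicat_real {\<epsilon>..1} t = 0" by simp
    then show ?thesis by simp
  qed
  show "\<bar>indicat_real {\<epsilon>..1} t * ((\<Sum>b\<in>Basis. (h \<bullet> b) * partial b \<phi> ((1 / t) *\<^sub>R x)) / t ^ (k + 1))\<bar>
      \<le> ?g t * norm h" for x t h
  proof (cases "t \<in> {\<epsilon>..1}")
    case True
    then have "\<bar>(\<Sum>b\<in>Basis. (h \<bullet> b) * partial b \<phi> ((1 / t) *\<^sub>R x))\<bar> / t ^ (k + 1) \<le> (C * norm h) / \<epsilon> ^ (k + 1)"
      using \<epsilon> C by (intro frac_le power_mono) auto
    then show ?thesis using True \<epsilon> by (simp add: abs_divide)
  qed simp
  show "(\<lambda>t. indicat_real {\<epsilon>..1} t * ((\<Sum>b\<in>Basis. (h \<bullet> b) * partial b \<phi> ((1 / t) *\<^sub>R x)) / t ^ (k + 1)))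
    \<in> borel_measurable lborel" for h
    by measurable
  qed simp
qed

lemma partial_scale_int:
  assumes "test_function \<phi>" "0 < \<epsilon>" "e \<in> Basis"
  shows "partial e (scale_int k \<phi> \<epsilon>) = scale_int (k + 1) (partial e \<phi>) \<epsilon>"
proof
  fix x
  show "partial e (scale_int k \<phi> \<epsilon>) x = scale_int (k + 1) (partial e \<phi>) \<epsilon> x"
    using partial_eqI[OF scale_int_has_derivative[OF assms(1,2)], of e] assms(3)
    by (simp add: scale_int_def inner_Basis if_distrib[where f="\<lambda>c. c * _"] cong: if_cong)
qed

lemma scale_int_zero:
  assumes "\<And>x. 1 \<le> norm x \<Longrightarrow> \<phi> x = 0" "0 < \<epsilon>" "1 \<le> norm x"
  shows "scale_int k \<phi> \<epsilon> x = 0"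
proof -
  have "indicat_real {\<epsilon>..1} t * (\<phi> ((1 / t) *\<^sub>R x) / t ^ k) = 0" for t
  proof (cases "t \<in> {\<epsilon>..1}")
    case True
    then have "1 \<le> norm ((1 / t) *\<^sub>R x)" using assms(2,3) by (simp add: field_simps)
    then show ?thesis by (simp add: assms(1))
  qed simp
  then show ?thesis unfolding scale_int_def by (simp only: integral_zero)
qed

lemma test_scale_int:
  assumes "test_function \<phi>" "\<And>x. 1 \<le> norm x \<Longrightarrow> \<phi> x = 0" "0 < \<epsilon>"
  shows "test_function (scale_int k \<phi> \<epsilon>)"
proof (rule test_functionI)
  show "smooth (scale_int k \<phi> \<epsilon>)"
  proof (rule smooth_coinduct[where X="\<lambda>\<psi>. \<exists>k \<phi>. test_function \<phi> \<and> \<psi> = scale_int k \<phi> \<epsilon>"])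
    show "\<exists>k' \<phi>'. test_function \<phi>' \<and> scale_int k \<phi> \<epsilon> = scale_int k' \<phi>' \<epsilon>" using assms(1) by blast
  next
    fix \<psi> :: "'a \<Rightarrow> real" and x assume "\<exists>k \<phi>. test_function \<phi> \<and> \<psi> = scale_int k \<phi> \<epsilon>"
    then show "\<psi> differentiable at x"
      using scale_int_has_derivative[OF _ assms(3)] differentiable_def by blast
  next
    fix \<psi> :: "'a \<Rightarrow> real" and e :: 'a assume "\<exists>k \<phi>. test_function \<phi> \<and> \<psi> = scale_int k \<phi> \<epsilon>" "e \<in> Basis"
    then show "\<exists>k \<phi>. test_function \<phi> \<and> partial e \<psi> = scale_int k \<phi> \<epsilon>"
      using partial_scale_int[OF _ assms(3)] test_partial by metis
  qed
  show "1 \<le> norm x \<Longrightarrow> scale_int k \<phi> \<epsilon> x = 0" for x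
    by (rule scale_int_zero[OF assms(2,3)])
qed

text \<open>Since \<open>d/dt (moll t) = - t \<cdot> laplacian (t\<^sup>-\<^sup>d sig (\<cdot>/t))\<close>, integrating over the scales
  gives an exact compactly supported parametrix of the Laplacian.\<close>

definition parametrix :: "real \<Rightarrow> 'a::euclidean_space \<Rightarrow> real" where
  "parametrix = scale_int (DIM('a) - 1) sig"

lemma test_parametrix: "0 < \<epsilon> \<Longrightarrow> test_function (parametrix \<epsilon>)"
  unfolding parametrix_def by (rule test_scale_int[OF test_sig sig_zero])

lemma parametrix_zero: "0 < \<epsilon> \<Longrightarrow> 1 \<le> norm x \<Longrightarrow> parametrix \<epsilon> x = 0"
  unfolding parametrix_def by (rule scale_int_zero[OF sig_zero])

lemma partial_parametrix:
  "0 < \<epsilon> \<Longrightarrow> e \<in> Basis \<Longrightarrow> partial e (parametrix \<epsilon>) = scale_int DIM('a) (partial e sig) \<epsilon>"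
  for e :: "'a::euclidean_space"
  unfolding parametrix_def using partial_scale_int[OF test_sig, of \<epsilon> e "DIM('a) - 1"]
  by (simp add: Suc_leI)

lemma laplacian_parametrix:
  fixes x :: "'a::euclidean_space"
  assumes \<epsilon>: "0 < \<epsilon>" "\<epsilon> \<le> 1"
  shows "laplacian (parametrix \<epsilon>) x = moll \<epsilon> x - rho x"
proof -
  let ?d = "DIM('a)"
  let ?L = "\<lambda>t. laplacian sig ((1 / t) *\<^sub>R x) / t ^ (?d + 1)"
  have "laplacian (parametrix \<epsilon>) x = (\<Sum>e\<in>Basis. scale_int (?d + 1) (partial e (partial e sig)) \<epsilon> x)"
    unfolding laplacian_def
    by (intro sum.cong refl) (simp add: partial_parametrix \<epsilon> partial_scale_int test_partial test_sig)
  also have "\<dots> = (\<integral>t. (\<Sum>e\<in>Basis. indicat_real {\<epsilon>..1} t * (partial e (partial e sig) ((1 / t) *\<^sub>R x) / t ^ (?d + 1))) \<partial>lborel)"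
    unfolding scale_int_def
    by (rule Bochner_Integration.integral_sum[symmetric])
      (intro scale_int_integrable test_partial test_sig \<epsilon>)
  also have "\<dots> = (\<integral>t. ?L t * indicat_real {\<epsilon>..1} t \<partial>lborel)"
    by (intro Bochner_Integration.integral_cong refl)
      (simp add: laplacian_def sum_divide_distrib sum_distrib_left mult_ac)
  \<comment> \<open>By \<open>laplacian_sig\<close> the integrand is the t-derivative of - moll t x,
    so the integral over the scales reduces to its two ends.\<close>
  also have "\<dots> = - moll 1 x - - moll \<epsilon> x"
  proof (rule integral_FTC_Icc_real)
    fix t assume "\<epsilon> \<le> t" "t \<le> 1"
    then have t: "0 < t" using \<epsilon> by linarith
    have 1: "((\<lambda>t. (1 / t) *\<^sub>R x) has_derivative (\<lambda>h. (- h / t\<^sup>2) *\<^sub>R x)) (at t)"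
      using t by (auto intro!: derivative_eq_intros simp: power2_eq_square)
    let ?S = "\<Sum>b\<in>Basis. (x \<bullet> b) * partial b rho ((1 / t) *\<^sub>R x)"
    have "((\<lambda>t. rho ((1 / t) *\<^sub>R x)) has_derivative
        (\<lambda>h. \<Sum>b\<in>Basis. ((- h / t\<^sup>2) *\<^sub>R x \<bullet> b) * partial b rho ((1 / t) *\<^sub>R x))) (at t)"
      by (rule has_derivative_compose[OF 1 smooth_has_derivative[OF test_smooth[OF test_rho]]])
    also have "(\<lambda>h. \<Sum>b\<in>Basis. ((- h / t\<^sup>2) *\<^sub>R x \<bullet> b) * partial b rho ((1 / t) *\<^sub>R x)) = times (- ?S / t\<^sup>2)"
      by (simp add: fun_eq_iff sum_distrib_left sum_divide_distrib sum_negf mult_ac)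
    finally have 2: "((\<lambda>t. rho ((1 / t) *\<^sub>R x)) has_real_derivative - ?S / t\<^sup>2) (at t)"
      unfolding has_field_derivative_def .
    have "((\<lambda>t. - (rho ((1 / t) *\<^sub>R x) / t ^ ?d)) has_real_derivative
        - ((- ?S / t\<^sup>2 * t ^ ?d - rho ((1 / t) *\<^sub>R x) * (real ?d * t ^ (?d - 1))) / (t ^ ?d * t ^ ?d))) (at t)"
      using t by (intro DERIV_minus DERIV_divide 2 DERIV_pow) auto
    also have "- ((- ?S / t\<^sup>2 * t ^ ?d - rho ((1 / t) *\<^sub>R x) * (real ?d * t ^ (?d - 1))) / (t ^ ?d * t ^ ?d)) = ?L t"
    proof -
      obtain k where k: "?d = Suc k" using DIM_positive gr0_implies_Suc by blast
      have "(\<Sum>e\<in>Basis. ((1 / t) *\<^sub>R x \<bullet> e) * partial e rho ((1 / t) *\<^sub>R x)) = ?S / t"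
        by (simp add: sum_divide_distrib)
      then show ?thesis
        unfolding laplacian_sig using t by (simp add: k field_simps power2_eq_square)
    qed
    finally show "((\<lambda>t. - moll t x) has_real_derivative ?L t) (at t)"
      by (simp add: moll_def)
    have "isCont (laplacian sig) ((1 / t) *\<^sub>R x)"
      using test_continuous[OF test_laplacian[OF test_sig], where 'a='a]
      by (simp add: continuous_on_eq_continuous_at)
    then have "isCont (\<lambda>t. laplacian sig ((1 / t) *\<^sub>R x)) t"
      by (rule continuous_within_compose3) (use t in \<open>auto intro!: continuous_intros\<close>)
    then show "isCont ?L t" using t by (auto intro!: continuous_intros)
  qed (use \<epsilon> in simp)
  finally show ?thesis by (simp add: moll_1)
qed

section \<open>Locally integrable functions and convolution with test functions\<close>

definition locint :: "('a::euclidean_space \<Rightarrow> real) \<Rightarrow> bool" where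
  "locint g \<longleftrightarrow> g \<in> borel_measurable borel \<and> (\<forall>R. integrable lborel (\<lambda>x. indicat_real (cball 0 R) x * g x))"

definition conv :: "('a::euclidean_space \<Rightarrow> real) \<Rightarrow> ('a \<Rightarrow> real) \<Rightarrow> 'a \<Rightarrow> real" where
  "conv k g x = (\<integral>y. k (x - y) * g y \<partial>lborel)"

lemma locint_borel: "locint g \<Longrightarrow> g \<in> borel_measurable borel"
  by (simp add: locint_def)

lemma locint_integrable: "locint g \<Longrightarrow> integrable lborel (\<lambda>x. indicat_real (cball 0 R) x * g x)"
  by (simp add: locint_def)

lemma locint_abs:
  assumes "locint g" shows "locint (\<lambda>x. \<bar>g x\<bar>)"
  unfolding locint_def
proof (intro conjI allI)
  have [measurable]: "g \<in> borel_measurable borel" using assms by (rule locint_borel)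
  show "(\<lambda>x. \<bar>g x\<bar>) \<in> borel_measurable borel" by measurable
  fix R show "integrable lborel (\<lambda>x. indicat_real (cball 0 R) x * \<bar>g x\<bar>)"
    using integrable_abs[OF locint_integrable[OF assms, of R]] by (simp add: abs_mult)
qed

lemma integrable_conv:
  fixes k g :: "'a::euclidean_space \<Rightarrow> real"
  assumes [measurable]: "k \<in> borel_measurable borel" and M: "\<And>x. \<bar>k x\<bar> \<le> M"
    and R: "\<And>x. R \<le> norm x \<Longrightarrow> k x = 0" and g: "locint g"
  shows "integrable lborel (\<lambda>y. k (x - y) * g y)"
proof (rule Bochner_Integration.integrable_bound)
  show "integrable lborel (\<lambda>y. M * (indicat_real (cball 0 (norm x + R)) y * g y))"
    by (intro integrable_mult_right locint_integrable g)
  have [measurable]: "g \<in> borel_measurable borel" using g by (rule locint_borel)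
  show "(\<lambda>y. k (x - y) * g y) \<in> borel_measurable lborel" by measurable
  show "AE y in lborel. norm (k (x - y) * g y) \<le> norm (M * (indicat_real (cball 0 (norm x + R)) y * g y))"
  proof (rule AE_I2)
    fix y
    show "norm (k (x - y) * g y) \<le> norm (M * (indicat_real (cball 0 (norm x + R)) y * g y))"
    proof (cases "R \<le> norm (x - y)")
      case False
      then have "y \<in> cball 0 (norm x + R)" using norm_triangle_sub[of y x] by (simp add: norm_minus_commute)
      then show ?thesis using M[of "x - y"] by (simp add: abs_mult mult_right_mono)
    qed (simp add: R)
  qed
qed

lemma integrable_conv_test:
  fixes \<phi> g :: "'a::euclidean_space \<Rightarrow> real"
  assumes "test_function \<phi>" "locint g"
  shows "integrable lborel (\<lambda>y. \<phi> (x - y) * g y)"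
proof -
  obtain M where M: "M > 0" "\<And>x. \<bar>\<phi> x\<bar> \<le> M" using test_bounded[OF assms(1)] by blast
  obtain R where R: "R > 0" "\<And>x. R \<le> norm x \<Longrightarrow> \<phi> x = 0" using test_functionE[OF assms(1)] by blast
  from integrable_conv[OF test_borel[OF assms(1)] M(2) R(2) assms(2)] show ?thesis .
qed

lemma conv_has_derivative:
  fixes \<phi> g :: "'a::euclidean_space \<Rightarrow> real"
  assumes \<phi>: "test_function \<phi>" and g: "locint g"
  shows "(conv \<phi> g has_derivative
    (\<lambda>h. \<integral>y. (\<Sum>b\<in>Basis. (h \<bullet> b) * partial b \<phi> (x - y)) * g y \<partial>lborel)) (at x)"
proof -
  obtain C where C: "C > 0" "\<And>x h. \<bar>\<Sum>b\<in>Basis. (h \<bullet> b) * partial b \<phi> x\<bar> \<le> C * norm h"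
    using test_derivative_bound[OF \<phi>] by blast
  obtain R where R: "R > 0" "\<And>x. R \<le> norm x \<Longrightarrow> \<phi> x = 0" using test_functionE[OF \<phi>] by blast
  have [measurable]: "partial b \<phi> \<in> borel_measurable borel" if "b \<in> Basis" for b
    using test_borel[OF test_partial[OF \<phi> that]] .
  have [measurable]: "g \<in> borel_measurable borel" using g by (rule locint_borel)
  let ?g = "\<lambda>y. C * (indicat_real (cball 0 (norm x + 1 + R)) y * \<bar>g y\<bar>)"
  show ?thesis
    unfolding conv_def[abs_def]
  proof (rule has_derivative_integral_dominated[where r=1])
    show "integrable lborel ?g"
      by (intro integrable_mult_right locint_integrable locint_abs g)
    show "integrable lborel (\<lambda>y. \<phi> (z - y) * g y)" for z
      by (rule integrable_conv_test[OF \<phi> g])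
    show "((\<lambda>x. \<phi> (x - y) * g y) has_derivative
        (\<lambda>h. (\<Sum>b\<in>Basis. (h \<bullet> b) * partial b \<phi> (z - y)) * g y)) (at z)" for z y
    proof (rule has_derivative_mult_left)
      have "((\<lambda>x. x - y) has_derivative (\<lambda>h. h)) (at z)" by (auto intro!: derivative_eq_intros)
      from has_derivative_compose[OF this smooth_has_derivative[OF test_smooth[OF \<phi>]]]
      show "((\<lambda>x. \<phi> (x - y)) has_derivative (\<lambda>h. \<Sum>b\<in>Basis. (h \<bullet> b) * partial b \<phi> (z - y))) (at z)" .
    qed
    show "\<bar>(\<Sum>b\<in>Basis. (h \<bullet> b) * partial b \<phi> (z - y)) * g y\<bar> \<le> ?g y * norm h"
      if z: "z \<in> ball x 1" for z y h
    proof (cases "R \<le> norm (z - y)")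
      case True
      then have "(\<Sum>b\<in>Basis. (h \<bullet> b) * partial b \<phi> (z - y)) = 0"
        by (intro sum.neutral ballI) (simp add: partial_vanishes[OF test_smooth[OF \<phi>] R(2)])
      then show ?thesis using C(1) by simp
    next
      case False
      have "norm y \<le> norm x + norm (x - z) + norm (z - y)"
        using norm_triangle_ineq4[of x "x - z"] norm_triangle_ineq4[of z "z - y"] by simp
      then have "y \<in> cball 0 (norm x + 1 + R)" using z False by (simp add: dist_norm)
      then show ?thesis
        using mult_right_mono[OF C(2)[of h "z - y"], of "\<bar>g y\<bar>"] by (simp add: abs_mult mult_ac)
    qed
    show "(\<lambda>y. (\<Sum>b\<in>Basis. (h \<bullet> b) * partial b \<phi> (x - y)) * g y) \<in> borel_measurable lborel" for h
      by measurable
  qed simp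
qed

lemma partial_conv:
  assumes "test_function \<phi>" "locint g" "e \<in> Basis"
  shows "partial e (conv \<phi> g) = conv (partial e \<phi>) g"
proof
  fix x
  show "partial e (conv \<phi> g) x = conv (partial e \<phi>) g x"
    using partial_eqI[OF conv_has_derivative[OF assms(1,2)], of e] assms(3)
    by (simp add: conv_def inner_Basis if_distrib[where f="\<lambda>c. c * _"] cong: if_cong)
qed

lemma smooth_conv:
  fixes \<phi> g :: "'a::euclidean_space \<Rightarrow> real"
  assumes "test_function \<phi>" "locint g"
  shows "smooth (conv \<phi> g)"
proof (rule smooth_coinduct[where X="\<lambda>\<psi>. \<exists>\<phi>. test_function \<phi> \<and> \<psi> = conv \<phi> g"])
  show "\<exists>\<phi>'. test_function \<phi>' \<and> conv \<phi> g = conv \<phi>' g" using assms(1) by blast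
next
  fix \<psi> :: "'a \<Rightarrow> real" and x assume "\<exists>\<phi>. test_function \<phi> \<and> \<psi> = conv \<phi> g"
  then show "\<psi> differentiable at x"
    using conv_has_derivative[OF _ assms(2)] differentiable_def by blast
next
  fix \<psi> :: "'a \<Rightarrow> real" and e :: 'a assume "\<exists>\<phi>. test_function \<phi> \<and> \<psi> = conv \<phi> g" "e \<in> Basis"
  then show "\<exists>\<phi>. test_function \<phi> \<and> partial e \<psi> = conv \<phi> g"
    using partial_conv[OF _ assms(2)] test_partial by metis
qed

lemma conv_zero:
  fixes k g :: "'a::euclidean_space \<Rightarrow> real"
  assumes "\<And>x. R \<le> norm x \<Longrightarrow> k x = 0" "\<And>x. S \<le> norm x \<Longrightarrow> g x = 0" "R + S \<le> norm x"
  shows "conv k g x = 0"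
proof -
  have "k (x - y) * g y = 0" for y
  proof (cases "R \<le> norm (x - y)")
    case False
    then have "S \<le> norm y" using assms(3) norm_triangle_sub[of x y] by linarith
    then show ?thesis by (simp add: assms(2))
  qed (simp add: assms(1))
  then show ?thesis unfolding conv_def by (simp only: integral_zero)
qed

lemma test_conv:
  fixes \<phi> g :: "'a::euclidean_space \<Rightarrow> real"
  assumes "test_function \<phi>" "locint g" "\<And>x. S \<le> norm x \<Longrightarrow> g x = 0"
  shows "test_function (conv \<phi> g)"
proof -
  obtain R where R: "R > 0" "\<And>x. R \<le> norm x \<Longrightarrow> \<phi> x = 0" using test_functionE[OF assms(1)] by blast
  show ?thesis
    by (rule test_functionI[OF smooth_conv[OF assms(1,2)] conv_zero[OF R(2) assms(3)]])
qed

lemma laplacian_conv: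
  assumes "test_function \<phi>" "locint g"
  shows "laplacian (conv \<phi> g) x = conv (laplacian \<phi>) g x"
proof -
  have "laplacian (conv \<phi> g) x = (\<Sum>e\<in>Basis. conv (partial e (partial e \<phi>)) g x)"
    unfolding laplacian_def
    by (intro sum.cong refl) (simp add: partial_conv test_partial assms)
  also have "\<dots> = conv (laplacian \<phi>) g x"
    unfolding conv_def laplacian_def sum_distrib_right
    by (rule Bochner_Integration.integral_sum[symmetric])
      (intro integrable_conv_test test_partial assms)
  finally show ?thesis .
qed

lemma test_reflect: "test_function \<phi> \<Longrightarrow> test_function (\<lambda>y. \<phi> (x - y))"
  using test_affine[of \<phi> "-1" 1 x] by (simp add: algebra_simps)

lemma partial_reflect:
  assumes "smooth \<phi>"
  shows "partial e (\<lambda>y. \<phi> (x - y)) = (\<lambda>y. - partial e \<phi> (x - y))"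
proof
  fix y
  show "partial e (\<lambda>y. \<phi> (x - y)) y = - partial e \<phi> (x - y)"
    using partial_affine(2)[of \<phi> "-1" y x e 1] smooth_differentiable[OF assms]
    by (simp add: algebra_simps)
qed

lemma partial_minus:
  assumes "smooth \<phi>"
  shows "partial e (\<lambda>y. - \<phi> y) = (\<lambda>y. - partial e \<phi> y)"
proof
  fix y
  show "partial e (\<lambda>y. - \<phi> y) y = - partial e \<phi> y"
    using partial_affine(2)[of \<phi> 1 y 0 e "-1"] smooth_differentiable[OF assms] by simp
qed

lemma partial_partial_reflect:
  assumes "smooth \<phi>" "e \<in> Basis" "e' \<in> Basis"
  shows "partial e (partial e' (\<lambda>y. \<phi> (x - y))) = (\<lambda>y. partial e (partial e' \<phi>) (x - y))"
proof -
  have s: "smooth (\<lambda>y. partial e' \<phi> (x - y))"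
    using smooth_affine[OF smooth_partial[OF assms(1,3)], of 1 "-1" x] by (simp add: algebra_simps)
  have "partial e (partial e' (\<lambda>y. \<phi> (x - y))) = partial e (\<lambda>y. - partial e' \<phi> (x - y))"
    by (simp add: partial_reflect[OF assms(1)])
  also have "\<dots> = (\<lambda>y. - partial e (\<lambda>y. partial e' \<phi> (x - y)) y)"
    by (rule partial_minus[OF s])
  finally show ?thesis
    by (simp add: partial_reflect[OF smooth_partial[OF assms(1,3)]])
qed

lemma laplacian_reflect:
  "smooth \<phi> \<Longrightarrow> laplacian (\<lambda>y. \<phi> (x - y)) y = laplacian \<phi> (x - y)"
  unfolding laplacian_def by (intro sum.cong refl) (simp add: partial_partial_reflect)

section \<open>Integration by parts\<close>

text \<open>Joint integrability is tested on one iterated integral of the absolute value, with x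
  inside; in the applications translation invariance or a uniform L1 bound evaluates that inner
  integral.\<close>

lemma lborel_fubini:
  fixes F :: "'a::euclidean_space \<Rightarrow> 'b::euclidean_space \<Rightarrow> real"
  assumes meas[measurable]: "case_prod F \<in> borel_measurable (lborel \<Otimes>\<^sub>M lborel)"
    and fin: "(\<integral>\<^sup>+y. \<integral>\<^sup>+x. ennreal \<bar>F x y\<bar> \<partial>lborel \<partial>lborel) < \<infinity>"
  shows "integrable lborel (\<lambda>x. \<integral>y. F x y \<partial>lborel)"
    and "integrable lborel (\<lambda>y. \<integral>x. F x y \<partial>lborel)"
    and "(\<integral>x. \<integral>y. F x y \<partial>lborel \<partial>lborel) = (\<integral>y. \<integral>x. F x y \<partial>lborel \<partial>lborel)"
    and "AE x in lborel. integrable lborel (\<lambda>y. F x y)"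
    and "AE y in lborel. integrable lborel (\<lambda>x. F x y)"
proof -
  have "(\<integral>\<^sup>+p. ennreal (norm (case_prod F p)) \<partial>(lborel \<Otimes>\<^sub>M lborel)) = (\<integral>\<^sup>+y. \<integral>\<^sup>+x. ennreal \<bar>F x y\<bar> \<partial>lborel \<partial>lborel)"
    by (subst lborel_pair.nn_integral_snd[symmetric]) auto
  then have I: "integrable (lborel \<Otimes>\<^sub>M lborel) (case_prod F)"
    using fin by (intro integrableI_bounded) auto
  show "integrable lborel (\<lambda>x. \<integral>y. F x y \<partial>lborel)"
    using lborel_pair.integrable_fst'[OF I] by simp
  show "integrable lborel (\<lambda>y. \<integral>x. F x y \<partial>lborel)"
    using lborel_pair.integrable_snd[OF I] by simp
  show "(\<integral>x. \<integral>y. F x y \<partial>lborel \<partial>lborel) = (\<integral>y. \<integral>x. F x y \<partial>lborel \<partial>lborel)"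
    using lborel_pair.Fubini_integral[OF I] by simp
  show "AE x in lborel. integrable lborel (\<lambda>y. F x y)"
    using lborel_pair.AE_integrable_fst'[OF I] by simp
  show "AE y in lborel. integrable lborel (\<lambda>x. F x y)"
    using lborel_pair.AE_integrable_snd[OF I] by simp
qed

lemma borel_measurable_pair_continuous:
  fixes F :: "'a::euclidean_space \<times> 'b::euclidean_space \<Rightarrow> real"
  assumes "continuous_on UNIV F"
  shows "F \<in> borel_measurable (lborel \<Otimes>\<^sub>M lborel)"
proof -
  have "sets (lborel \<Otimes>\<^sub>M lborel) = sets (borel :: ('a \<times> 'b) measure)"
    unfolding borel_prod[symmetric] by (intro sets_pair_measure_cong) simp_all
  then show ?thesis
    using borel_measurable_continuous_onI[OF assms] measurable_cong_sets by blast
qed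

text \<open>Differentiability is asked for only inside the interval because the heat equation will
  be available only for t > 0, while the flow is continuous up to t = 0.\<close>

lemma FTC_interior:
  fixes F f :: "real \<Rightarrow> real"
  assumes "a \<le> b" "continuous_on {a..b} F" "\<And>x. a < x \<Longrightarrow> x < b \<Longrightarrow> (F has_real_derivative f x) (at x)"
    and "continuous_on {a..b} f"
  shows "(\<integral>t. indicat_real {a..b} t * f t \<partial>lborel) = F b - F a"
    and "integrable lborel (\<lambda>t. indicat_real {a..b} t * f t)"
proof -
  have int: "integrable lborel (\<lambda>t. indicat_real {a..b} t * f t)"
    using borel_integrable_compact[OF _ assms(4)] by auto
  have "(f has_integral F b - F a) {a..b}"
    using assms(1-3) by (intro fundamental_theorem_of_calculus_interior)
      (auto simp: has_real_derivative_iff_has_vector_derivative)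
  moreover have "((\<lambda>t. indicat_real {a..b} t * f t) has_integral (\<integral>t. indicat_real {a..b} t * f t \<partial>lborel)) UNIV"
    by (rule has_integral_integral_lborel[OF int])
  moreover have "(\<lambda>t. indicat_real {a..b} t * f t) = (\<lambda>t. if t \<in> {a..b} then f t else 0)"
    by (auto simp: indicator_def)
  ultimately have "(f has_integral F b - F a) {a..b}"
      "(f has_integral (\<integral>t. indicat_real {a..b} t * f t \<partial>lborel)) {a..b}"
    by (simp_all only: has_integral_restrict_UNIV)
  then show "(\<integral>t. indicat_real {a..b} t * f t \<partial>lborel) = F b - F a"
    using has_integral_unique by blast
  show "integrable lborel (\<lambda>t. indicat_real {a..b} t * f t)" by (rule int)
qed

lemma integrable_translate:
  fixes F :: "'a::euclidean_space \<Rightarrow> real"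
  assumes "integrable lborel F" shows "integrable lborel (\<lambda>x. F (x + v))"
  using integrable_affine[OF assms, of 1 v] by (simp add: add.commute)

lemma integral_translate:
  fixes F :: "'a::euclidean_space \<Rightarrow> real"
  assumes "F \<in> borel_measurable borel" shows "(\<integral>x. F (x + v) \<partial>lborel) = (\<integral>x. F x \<partial>lborel)"
  using integral_affine[OF assms, of 1 v] by (simp add: add.commute)

lemma nn_integral_translate:
  fixes F :: "'a::euclidean_space \<Rightarrow> ennreal"
  assumes "F \<in> borel_measurable borel" shows "(\<integral>\<^sup>+x. F (x + v) \<partial>lborel) = (\<integral>\<^sup>+x. F x \<partial>lborel)"
  using nn_integral_affine[OF assms, of 1 v] by (simp add: add.commute)

text \<open>Integrating the derivative along e over a unit interval gives F(x + e) - F(x), whose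
  integral over space is 0 by translation invariance. Exchanging the integrals, the same quantity is
  \<integral> F'. Integrability of F and F' thus takes the place of compact support.\<close>

lemma integral_derivative_zero:
  fixes F F' :: "'a::euclidean_space \<Rightarrow> real"
  assumes der: "\<And>x. ((\<lambda>s. F (x + s *\<^sub>R e)) has_real_derivative F' x) (at 0)"
    and cont: "continuous_on UNIV F'" and F: "integrable lborel F" and F': "integrable lborel F'"
  shows "(\<integral>x. F' x \<partial>lborel) = 0"
proof -
  have [measurable]: "F \<in> borel_measurable borel" "F' \<in> borel_measurable borel" using F F' by auto
  have der': "((\<lambda>s. F (x + s *\<^sub>R e)) has_real_derivative F' (x + t *\<^sub>R e)) (at t)" for x t
    using DERIV_shift[of "\<lambda>s. F (x + s *\<^sub>R e)" "F' (x + t *\<^sub>R e)" 0 t] der[of "x + t *\<^sub>R e"]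
    by (simp add: algebra_simps)
  have c: "continuous_on A (\<lambda>s. F' (x + s *\<^sub>R e))" for A x
    by (rule continuous_on_compose2[OF cont]) (auto intro!: continuous_intros)
  define G where "G x s = indicat_real {0..1} s * F' (x + s *\<^sub>R e)" for x s
  have Fx: "(\<integral>s. G x s \<partial>lborel) = F (x + e) - F x" for x
  proof -
    have "(\<integral>s. G x s \<partial>lborel) = F (x + 1 *\<^sub>R e) - F (x + 0 *\<^sub>R e)"
      unfolding G_def
      by (rule FTC_interior(1)) (use der' c in \<open>auto intro!: DERIV_isCont continuous_at_imp_continuous_on\<close>)
    then show ?thesis by simp
  qed
  have meas: "case_prod G \<in> borel_measurable (lborel \<Otimes>\<^sub>M lborel)"
    unfolding G_def by measurable
  have "(\<integral>\<^sup>+x. ennreal \<bar>G x s\<bar> \<partial>lborel) = indicator {0..1} s * (\<integral>\<^sup>+x. ennreal \<bar>F' x\<bar> \<partial>lborel)" for s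
  proof -
    have "(\<integral>\<^sup>+x. ennreal \<bar>G x s\<bar> \<partial>lborel) = (\<integral>\<^sup>+x. indicator {0..1} s * ennreal \<bar>F' (x + s *\<^sub>R e)\<bar> \<partial>lborel)"
      by (intro nn_integral_cong) (auto simp: G_def indicator_def)
    also have "\<dots> = indicator {0..1} s * (\<integral>\<^sup>+x. ennreal \<bar>F' (x + s *\<^sub>R e)\<bar> \<partial>lborel)"
      by (rule nn_integral_cmult) measurable
    also have "(\<integral>\<^sup>+x. ennreal \<bar>F' (x + s *\<^sub>R e)\<bar> \<partial>lborel) = (\<integral>\<^sup>+x. ennreal \<bar>F' x\<bar> \<partial>lborel)"
      by (rule nn_integral_translate) measurable
    finally show ?thesis .
  qed
  then have "(\<integral>\<^sup>+s. \<integral>\<^sup>+x. ennreal \<bar>G x s\<bar> \<partial>lborel \<partial>lborel) = (\<integral>\<^sup>+s. indicator {0..1} s * (\<integral>\<^sup>+x. ennreal \<bar>F' x\<bar> \<partial>lborel) \<partial>(lborel::real measure))"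
    by simp
  also have "\<dots> = (\<integral>\<^sup>+x. ennreal \<bar>F' x\<bar> \<partial>lborel)"
    by (subst nn_integral_multc) auto
  also have "\<dots> < \<infinity>" using F' by (simp add: integrable_iff_bounded)
  finally have fin: "(\<integral>\<^sup>+s. \<integral>\<^sup>+x. ennreal \<bar>G x s\<bar> \<partial>lborel \<partial>lborel) < \<infinity>" .
  have "(\<integral>s. \<integral>x. G x s \<partial>lborel \<partial>lborel) = (\<integral>s. indicat_real {0..1::real} s * (\<integral>x. F' x \<partial>lborel) \<partial>lborel)"
    unfolding G_def by (simp add: integral_translate)
  also have "\<dots> = (\<integral>x. F' x \<partial>lborel)" by simp
  finally have "(\<integral>x. F' x \<partial>lborel) = (\<integral>x. \<integral>s. G x s \<partial>lborel \<partial>lborel)"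
    using lborel_fubini(3)[OF meas fin] by simp
  also have "\<dots> = (\<integral>x. F (x + e) - F x \<partial>lborel)" by (simp add: Fx)
  also have "\<dots> = 0" using integrable_translate[OF F, of e] F by (simp add: integral_translate)
  finally show ?thesis .
qed

text \<open>One factor is bounded together with its derivative, the other integrable together with
  its derivative. This is the situation of a smooth function of two heat extensions multiplied by a
  heat extension, where nothing has compact support.\<close>

lemma integration_by_parts:
  fixes F G F' G' :: "'a::euclidean_space \<Rightarrow> real"
  assumes F: "\<And>x. ((\<lambda>s. F (x + s *\<^sub>R e)) has_real_derivative F' x) (at 0)"
    and G: "\<And>x. ((\<lambda>s. G (x + s *\<^sub>R e)) has_real_derivative G' x) (at 0)"
    and cont: "continuous_on UNIV F" "continuous_on UNIV F'" "continuous_on UNIV G" "continuous_on UNIV G'"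
    and bF: "\<And>x. \<bar>F x\<bar> \<le> M" and bF': "\<And>x. \<bar>F' x\<bar> \<le> M"
    and iG: "integrable lborel G" "integrable lborel G'"
  shows "(\<integral>x. F x * G' x \<partial>lborel) = - (\<integral>x. F' x * G x \<partial>lborel)"
    and "integrable lborel (\<lambda>x. F x * G' x)" "integrable lborel (\<lambda>x. F' x * G x)"
proof -
  have I: "integrable lborel (\<lambda>x. a x * b x)"
    if "continuous_on UNIV a" "\<And>x. \<bar>a x\<bar> \<le> M" "integrable lborel b" for a b :: "'a \<Rightarrow> real"
  proof (rule Bochner_Integration.integrable_bound[where f="\<lambda>x. M * b x"])
    show "(\<lambda>x. a x * b x) \<in> borel_measurable lborel"
      using that(1,3) continuous_borel by (intro borel_measurable_times) auto
    show "AE x in lborel. norm (a x * b x) \<le> norm (M * b x)"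
      by (intro AE_I2) (simp add: abs_mult mult_right_mono order_trans[OF that(2) abs_ge_self])
  qed (use that in simp)
  show 1: "integrable lborel (\<lambda>x. F x * G' x)" and 2: "integrable lborel (\<lambda>x. F' x * G x)"
    by (intro I cont bF bF' iG)+
  have "(\<integral>x. F' x * G x + F x * G' x \<partial>lborel) = 0"
  proof (rule integral_derivative_zero)
    show "((\<lambda>s. F (x + s *\<^sub>R e) * G (x + s *\<^sub>R e)) has_real_derivative F' x * G x + F x * G' x) (at 0)" for x
      using DERIV_mult[OF F[of x] G[of x]] by (simp add: mult_ac)
    show "integrable lborel (\<lambda>x. F x * G x)" by (intro I cont bF iG)
  qed (use 1 2 in \<open>auto intro!: continuous_intros cont\<close>)
  then show "(\<integral>x. F x * G' x \<partial>lborel) = - (\<integral>x. F' x * G x \<partial>lborel)"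
    using 1 2 by simp
qed

lemma smooth_directional:
  assumes "smooth \<phi>" "e \<in> Basis"
  shows "((\<lambda>s. \<phi> (x + s *\<^sub>R e)) has_real_derivative partial e \<phi> (x + t *\<^sub>R e)) (at t)"
proof -
  have "((\<lambda>s. x + s *\<^sub>R e) has_derivative (\<lambda>h. h *\<^sub>R e)) (at t)" by (auto intro!: derivative_eq_intros)
  from has_derivative_compose[OF this smooth_has_derivative[OF assms(1)]]
  have "((\<lambda>s. \<phi> (x + s *\<^sub>R e)) has_derivative
      (\<lambda>h. \<Sum>b\<in>Basis. (h *\<^sub>R e \<bullet> b) * partial b \<phi> (x + t *\<^sub>R e))) (at t)" .
  also have "(\<lambda>h. \<Sum>b\<in>Basis. (h *\<^sub>R e \<bullet> b) * partial b \<phi> (x + t *\<^sub>R e)) = times (partial e \<phi> (x + t *\<^sub>R e))"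
  proof
    fix h :: real
    have "(\<Sum>b\<in>Basis. (h *\<^sub>R e \<bullet> b) * partial b \<phi> (x + t *\<^sub>R e))
        = (\<Sum>b\<in>Basis. if b = e then partial e \<phi> (x + t *\<^sub>R e) * h else 0)"
      using assms(2) by (intro sum.cong) (auto simp: inner_Basis)
    then show "(\<Sum>b\<in>Basis. (h *\<^sub>R e \<bullet> b) * partial b \<phi> (x + t *\<^sub>R e)) = partial e \<phi> (x + t *\<^sub>R e) * h"
      using assms(2) by simp
  qed
  finally show ?thesis unfolding has_field_derivative_def .
qed

lemma test_integration_by_parts:
  fixes \<phi> \<psi> :: "'a::euclidean_space \<Rightarrow> real"
  assumes "test_function \<phi>" "test_function \<psi>" "e \<in> Basis"
  shows "(\<integral>x. \<phi> x * partial e \<psi> x \<partial>lborel) = - (\<integral>x. partial e \<phi> x * \<psi> x \<partial>lborel)"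
proof -
  obtain M where M: "M > 0" "\<And>x. \<bar>\<phi> x\<bar> \<le> M" using test_bounded[OF assms(1)] by blast
  obtain N where N: "N > 0" "\<And>x. \<bar>partial e \<phi> x\<bar> \<le> N" using test_bounded[OF test_partial[OF assms(1,3)]] by blast
  note t = assms(1,2) test_partial[OF assms(1,3)] test_partial[OF assms(2,3)]
  show ?thesis
  proof (rule integration_by_parts(1)[where e=e and M="max M N"])
    show "((\<lambda>s. \<phi> (x + s *\<^sub>R e)) has_real_derivative partial e \<phi> x) (at 0)" for x
      using smooth_directional[OF test_smooth[OF assms(1)] assms(3), of x 0] by simp
    show "((\<lambda>s. \<psi> (x + s *\<^sub>R e)) has_real_derivative partial e \<psi> x) (at 0)" for x
      using smooth_directional[OF test_smooth[OF assms(2)] assms(3), of x 0] by simp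
  qed (use t test_continuous test_integrable M N in \<open>auto simp: le_max_iff_disj\<close>)
qed

section \<open>The heat semigroup and Bellman functions\<close>

lemma integrable_exp_abs: "integrable lborel (\<lambda>x::real. exp (- \<bar>x\<bar>))"
proof -
  have half: "(\<integral>\<^sup>+x. ennreal (exp (- x)) * indicator {0..} x \<partial>lborel) = 1"
  proof -
    have "((\<lambda>x::real. - exp (- x)) \<longlongrightarrow> - 0) at_top"
      by (intro tendsto_minus filterlim_compose[OF exp_at_bot] filterlim_uminus_at_bot_at_top)
    then have "(\<integral>\<^sup>+x. ennreal (exp (- x)) * indicator {0..} x \<partial>lborel) = ennreal (- 0 - - exp (- 0))"
      by (rule nn_integral_FTC_atLeast[rotated -1]) (auto intro!: derivative_eq_intros)
    then show ?thesis by simp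
  qed
  have "(\<integral>\<^sup>+x. ennreal (exp (- \<bar>x\<bar>)) \<partial>lborel)
    \<le> (\<integral>\<^sup>+x. ennreal (exp (- x)) * indicator {0..} x + ennreal (exp (- (- x))) * indicator {0..} (- x) \<partial>(lborel::real measure))"
    by (intro nn_integral_mono) (auto simp: indicator_def)
  also have "\<dots> = 1 + (\<integral>\<^sup>+x. ennreal (exp (- (- x))) * indicator {0..} (- x) \<partial>(lborel::real measure))"
    by (subst nn_integral_add) (auto simp: half)
  also have "(\<integral>\<^sup>+x. ennreal (exp (- (- x))) * indicator {0..} (- x) \<partial>(lborel::real measure)) = 1"
    using nn_integral_affine[of "\<lambda>x::real. ennreal (exp (- x)) * indicator {0..} x" "-1" 0]
    by (simp add: half)
  finally show ?thesis
    by (intro integrableI_bounded) (auto simp: less_top[symmetric] top_unique elim!: order_le_less_trans)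
qed

text \<open>The Gaussian is compared with a product of one-dimensional functions exp(-|y_b|), whose
  integral factorises. The weight 1 + |y| is present because differentiating the heat flow in time
  produces a factor y.\<close>

lemma integrable_gauss_moment:
  "integrable lborel (\<lambda>y::'a::euclidean_space. (1 + norm y) * exp (- (y \<bullet> y) / 4))"
proof -
  let ?d = "real DIM('a)"
  let ?P = "\<lambda>y::'a. \<Prod>b\<in>Basis. exp (- \<bar>y \<bullet> b\<bar>)"
  have "(\<integral>\<^sup>+y. ennreal (?P y) \<partial>lborel) = (\<integral>\<^sup>+y. (\<Prod>b\<in>(Basis::'a set). ennreal (exp (- \<bar>y \<bullet> b\<bar>))) \<partial>lborel)"
    by (simp add: prod_ennreal)
  also have "\<dots> = (\<Prod>b\<in>(Basis::'a set). (\<integral>\<^sup>+x. ennreal (exp (- \<bar>x\<bar>)) \<partial>lborel))"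
    by (rule nn_integral_lborel_prod[of "\<lambda>b x. ennreal (exp (- \<bar>x\<bar>))"]) auto
  also have "\<dots> < \<infinity>"
    using integrable_exp_abs by (simp add: integrable_iff_bounded power_less_top_ennreal)
  finally have P: "integrable lborel ?P" by (intro integrableI_bounded) (auto simp: prod_nonneg abs_of_nonneg)
  show ?thesis
  proof (rule Bochner_Integration.integrable_bound)
    show "integrable lborel (\<lambda>y. exp ((1 + ?d)\<^sup>2) * ?P y)" using P by simp
    show "AE y in lborel. norm ((1 + norm y) * exp (- (y \<bullet> y) / 4)) \<le> norm (exp ((1 + ?d)\<^sup>2) * ?P y)"
    proof (rule AE_I2)
      fix y :: 'a
      have "(\<Sum>b\<in>Basis. \<bar>y \<bullet> b\<bar>) \<le> (\<Sum>b\<in>(Basis::'a set). norm y)" by (intro sum_mono Basis_le_norm)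
      then have *: "(\<Sum>b\<in>Basis. \<bar>y \<bullet> b\<bar>) \<le> ?d * norm y" by simp
      \<comment> \<open>Completing the square: |y|^2 / 4 dominates (1 + d) |y| up to a constant,
        where one |y| pays for the weight 1 + |y| <= exp |y| and d |y| pays for the sum of the
        |y_b|.\<close>
      have "0 \<le> (norm y / 2 - (1 + ?d))\<^sup>2" by simp
      then have "norm y - (y \<bullet> y) / 4 \<le> (1 + ?d)\<^sup>2 - ?d * norm y"
        by (simp add: power2_diff field_simps power2_norm_eq_inner[symmetric] power2_eq_square)
      with * have "norm y - (y \<bullet> y) / 4 \<le> (1 + ?d)\<^sup>2 - (\<Sum>b\<in>Basis. \<bar>y \<bullet> b\<bar>)" by linarith
      then have e: "exp (norm y - (y \<bullet> y) / 4) \<le> exp ((1 + ?d)\<^sup>2 - (\<Sum>b\<in>Basis. \<bar>y \<bullet> b\<bar>))" by simp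
      have "(1 + norm y) * exp (- (y \<bullet> y) / 4) \<le> exp (norm y) * exp (- (y \<bullet> y) / 4)"
        using exp_ge_add_one_self[of "norm y"] by (intro mult_right_mono) auto
      also have "\<dots> = exp (norm y - (y \<bullet> y) / 4)" by (simp add: mult_exp_exp)
      also note e
      also have "exp ((1 + ?d)\<^sup>2 - (\<Sum>b\<in>Basis. \<bar>y \<bullet> b\<bar>)) = exp ((1 + ?d)\<^sup>2) * ?P y"
        unfolding diff_conv_add_uminus exp_add sum_negf[symmetric] by (simp add: exp_sum)
      finally show "norm ((1 + norm y) * exp (- (y \<bullet> y) / 4)) \<le> norm (exp ((1 + ?d)\<^sup>2) * ?P y)"
        by (simp add: abs_mult abs_of_nonneg prod_nonneg)
    qed
  qed auto
qed

text \<open>The heat kernel at time 1. It is normalised by its own integral, so the value (4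
  \<pi>)^(-d/2) of the constant never enters.\<close>

definition gam :: "'a::euclidean_space \<Rightarrow> real" where
  "gam y = exp (- (y \<bullet> y) / 4) / (\<integral>z. exp (- (z \<bullet> z) / 4) \<partial>(lborel :: 'a measure))"

lemma borel_gam[measurable]: "gam \<in> borel_measurable borel"
  unfolding gam_def[abs_def] by measurable

lemma integrable_gauss: "integrable lborel (\<lambda>y::'a::euclidean_space. exp (- (y \<bullet> y) / 4))"
  by (rule Bochner_Integration.integrable_bound[OF integrable_gauss_moment])
    (auto simp: abs_mult intro!: AE_I2)

lemma integral_gauss_pos: "0 < (\<integral>z. exp (- (z \<bullet> z) / 4) \<partial>(lborel :: 'a::euclidean_space measure))"
proof -
  have "(\<integral>z. exp (- (z \<bullet> z) / 4) \<partial>(lborel :: 'a measure)) \<noteq> 0"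
  proof
    assume "(\<integral>z. exp (- (z \<bullet> z) / 4) \<partial>(lborel :: 'a measure)) = 0"
    then have "AE z::'a in lborel. exp (- (z \<bullet> z) / 4) = 0"
      using integrable_gauss by (subst (asm) integral_nonneg_eq_0_iff_AE) auto
    then have "AE z::'a in lborel. False" by simp
    then show False by (simp add: eventually_False ae_filter_eq_bot_iff)
  qed
  moreover have "0 \<le> (\<integral>z. exp (- (z \<bullet> z) / 4) \<partial>(lborel :: 'a measure))" by simp
  ultimately show ?thesis by (rule order_le_neq_trans[OF _ not_sym, rotated])
qed

lemma gam_pos: "0 < gam (y::'a::euclidean_space)"
  using integral_gauss_pos[where 'a='a] unfolding gam_def by (intro divide_pos_pos) auto

lemma integrable_gam: "integrable lborel (gam :: 'a::euclidean_space \<Rightarrow> real)"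
  unfolding gam_def[abs_def] using integrable_gauss[where 'a='a] by (intro integrable_divide_zero)

lemma integrable_gam_moment: "integrable lborel (\<lambda>y::'a::euclidean_space. (1 + norm y) * gam y)"
  unfolding gam_def times_divide_eq_right
  using integrable_gauss_moment[where 'a='a] by (intro integrable_divide_zero)

lemma integral_gam: "(\<integral>y. gam (y::'a::euclidean_space) \<partial>lborel) = 1"
  unfolding gam_def using integral_gauss_pos[where 'a='a] by (subst integral_divide_zero) simp

lemma gam_le: "gam (y::'a::euclidean_space) \<le> gam (0::'a)"
  unfolding gam_def
  by (rule divide_right_mono) (use integral_gauss_pos[where 'a='a] in \<open>auto intro: less_imp_le\<close>)

lemma gam_directional:
  fixes y :: "'a::euclidean_space"
  shows "((\<lambda>s. gam (y + s *\<^sub>R e)) has_real_derivative - (y \<bullet> e) / 2 * gam y) (at 0)"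
proof -
  have "((\<lambda>s. exp (- ((y + s *\<^sub>R e) \<bullet> (y + s *\<^sub>R e)) / 4)) has_real_derivative
      - (y \<bullet> e) / 2 * exp (- (y \<bullet> y) / 4)) (at 0)"
    by (auto intro!: derivative_eq_intros simp: inner_add_left inner_add_right inner_commute)
  from DERIV_cdivide[OF this, of "\<integral>z. exp (- (z \<bullet> z) / 4) \<partial>(lborel :: 'a measure)"]
  show ?thesis by (simp add: gam_def)
qed

text \<open>The heat semigroup in the variable rescaled by sqrt t. In this form time 0 is the
  identity without any limit, and continuity in (t, x) is dominated convergence; since the real root
  is extended oddly to negative arguments, it holds on the whole line.\<close>

definition heat :: "real \<Rightarrow> ('a::euclidean_space \<Rightarrow> real) \<Rightarrow> 'a \<Rightarrow> real" where
  "heat t f x = (\<integral>y. f (x + sqrt t *\<^sub>R y) * gam y \<partial>lborel)"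

lemma heat_0: "heat 0 f x = f x"
  by (simp add: heat_def integral_gam)

lemma bounded_gam_integrable:
  fixes g :: "'a::euclidean_space \<Rightarrow> real"
  assumes "g \<in> borel_measurable borel" "\<And>y. \<bar>g y\<bar> \<le> M"
  shows "integrable lborel (\<lambda>y. g y * gam y)"
proof (rule Bochner_Integration.integrable_bound)
  show "integrable lborel (\<lambda>y::'a. M * gam y)" by (intro integrable_mult_right integrable_gam)
  show "(\<lambda>y. g y * gam y) \<in> borel_measurable lborel" using assms(1) by measurable
  show "AE y in lborel. norm (g y * gam y) \<le> norm (M * gam y)"
    by (intro AE_I2) (simp add: abs_mult mult_right_mono order_trans[OF assms(2) abs_ge_self])
qed

lemma heat_integrable:
  assumes "test_function f"
  shows "integrable lborel (\<lambda>y. f (x + sqrt t *\<^sub>R y) * gam y)"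
proof -
  obtain M where M: "M > 0" "\<And>x. \<bar>f x\<bar> \<le> M" using test_bounded[OF assms(1)] by blast
  have [measurable]: "f \<in> borel_measurable borel" using assms by (rule test_borel)
  show ?thesis by (rule bounded_gam_integrable[OF _ M(2)]) measurable
qed

lemma heat_bound:
  assumes f: "test_function f" and M: "\<And>x. \<bar>f x\<bar> \<le> M"
  shows "\<bar>heat t f x\<bar> \<le> M"
proof -
  have "\<bar>heat t f x\<bar> \<le> (\<integral>y. M * gam (y::'a) \<partial>lborel)"
    unfolding heat_def
    by (rule integral_abs_le_integral[OF heat_integrable[OF f]])
      (auto simp: abs_mult less_imp_le[OF gam_pos] abs_of_pos[OF gam_pos] integrable_gam M intro!: mult_right_mono)
  then show ?thesis by (simp add: integral_gam)
qed

lemma heat_continuous: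
  assumes f: "test_function f"
  shows "continuous_on UNIV (\<lambda>(t, x). heat t f x)"
proof (rule continuous_on_sequentiallyI)
  fix p :: "nat \<Rightarrow> real \<times> 'a" and q assume p: "p \<longlonglongrightarrow> q"
  obtain M where M: "M > 0" "\<And>x. \<bar>f x\<bar> \<le> M" using test_bounded[OF assms(1)] by blast
  have [measurable]: "f \<in> borel_measurable borel" using assms by (rule test_borel)
  have cf: "isCont f z" for z
    using test_continuous[OF f] by (simp add: continuous_on_eq_continuous_at)
  have "(\<lambda>n. \<integral>y. f (snd (p n) + sqrt (fst (p n)) *\<^sub>R y) * gam y \<partial>lborel)
      \<longlonglongrightarrow> (\<integral>y. f (snd q + sqrt (fst q) *\<^sub>R y) * gam y \<partial>lborel)"
  proof (rule integral_dominated_convergence[where w="\<lambda>y. M * gam y"])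
    show "AE y in lborel. (\<lambda>n. f (snd (p n) + sqrt (fst (p n)) *\<^sub>R y) * gam y)
        \<longlonglongrightarrow> f (snd q + sqrt (fst q) *\<^sub>R y) * gam y"
      by (intro AE_I2 tendsto_mult isCont_tendsto_compose[OF cf] tendsto_intros tendsto_fst tendsto_snd p)
    show "AE y in lborel. norm (f (snd (p n) + sqrt (fst (p n)) *\<^sub>R y) * gam y) \<le> M * gam y" for n
      by (intro AE_I2) (simp add: abs_mult abs_of_pos[OF gam_pos] M mult_right_mono less_imp_le[OF gam_pos])
  qed (use integrable_gam in auto)
  then show "(\<lambda>n. case p n of (t, x) \<Rightarrow> heat t f x) \<longlonglongrightarrow> (case q of (t, x) \<Rightarrow> heat t f x)"
    by (simp add: heat_def case_prod_beta)
qed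

lemma heat_continuous_x: "test_function f \<Longrightarrow> continuous_on A (\<lambda>x. heat t f x)"
  using continuous_on_compose2[OF heat_continuous, of f A "\<lambda>x. (t, x)"] continuous_on_Pair[OF continuous_on_const continuous_on_id]
  by auto

lemma heat_continuous_t: "test_function f \<Longrightarrow> continuous_on A (\<lambda>t. heat t f x)"
  using continuous_on_compose2[OF heat_continuous, of f A "\<lambda>t. (t, x)"] continuous_on_Pair[OF continuous_on_id continuous_on_const]
  by auto

lemma heat_directional:
  assumes f: "test_function f" and e: "e \<in> Basis"
  shows "((\<lambda>s. heat t f (x + s *\<^sub>R e)) has_real_derivative heat t (partial e f) x) (at 0)"
proof -
  obtain M where M: "M > 0" "\<And>x. \<bar>partial e f x\<bar> \<le> M" using test_bounded[OF test_partial[OF f e]] by blast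
  have [measurable]: "partial e f \<in> borel_measurable borel" using test_borel[OF test_partial[OF f e]] .
  have "((\<lambda>s. \<integral>y. f (x + s *\<^sub>R e + sqrt t *\<^sub>R y) * gam y \<partial>lborel) has_derivative
      (\<lambda>h. \<integral>y. (partial e f (x + 0 *\<^sub>R e + sqrt t *\<^sub>R y) * gam y) * h \<partial>lborel)) (at 0)"
  proof (rule has_derivative_integral_dominated[where r=1])
    show "integrable lborel (\<lambda>y::'a. M * gam y)" by (intro integrable_mult_right integrable_gam)
    show "integrable lborel (\<lambda>y. f (x + s *\<^sub>R e + sqrt t *\<^sub>R y) * gam y)" for s
      by (rule heat_integrable[OF f])
    show "((\<lambda>s. f (x + s *\<^sub>R e + sqrt t *\<^sub>R y) * gam y) has_derivative
        (\<lambda>h. (partial e f (x + s *\<^sub>R e + sqrt t *\<^sub>R y) * gam y) * h)) (at s)" for s y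
    proof -
      have "((\<lambda>s. f ((x + sqrt t *\<^sub>R y) + s *\<^sub>R e)) has_real_derivative partial e f ((x + sqrt t *\<^sub>R y) + s *\<^sub>R e)) (at s)"
        by (rule smooth_directional[OF test_smooth[OF f] e])
      from DERIV_cmult_right[OF this, of "gam y"] show ?thesis
        unfolding has_field_derivative_def by (simp add: add_ac)
    qed
    show "\<bar>(partial e f (x + s *\<^sub>R e + sqrt t *\<^sub>R y) * gam y) * h\<bar> \<le> M * gam y * norm h" for h s y
      using mult_right_mono[OF M(2), of "gam y * \<bar>h\<bar>"]
      by (simp add: abs_mult abs_of_pos[OF gam_pos] mult_ac less_imp_le[OF gam_pos])
    show "(\<lambda>y. (partial e f (x + 0 *\<^sub>R e + sqrt t *\<^sub>R y) * gam y) * h) \<in> borel_measurable lborel" for h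
      by measurable
  qed simp
  then show ?thesis
    unfolding has_field_derivative_def by (simp add: heat_def)
qed


lemma heat_nn_integral:
  fixes f :: "'a::euclidean_space \<Rightarrow> real"
  assumes [measurable]: "f \<in> borel_measurable borel"
  shows "(\<integral>\<^sup>+y. \<integral>\<^sup>+x. ennreal \<bar>f (x + sqrt t *\<^sub>R y) * gam y\<bar> \<partial>lborel \<partial>lborel) = (\<integral>\<^sup>+x. ennreal \<bar>f x\<bar> \<partial>lborel)"
proof -
  have "(\<integral>\<^sup>+x. ennreal \<bar>f (x + sqrt t *\<^sub>R y) * gam y\<bar> \<partial>lborel) = ennreal (gam y) * (\<integral>\<^sup>+x. ennreal \<bar>f x\<bar> \<partial>lborel)" for y
  proof -
    have "(\<integral>\<^sup>+x. ennreal \<bar>f (x + sqrt t *\<^sub>R y) * gam y\<bar> \<partial>lborel) = (\<integral>\<^sup>+x. ennreal (gam y) * ennreal \<bar>f (x + sqrt t *\<^sub>R y)\<bar> \<partial>lborel)"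
      by (intro nn_integral_cong)
        (simp add: abs_mult abs_of_pos[OF gam_pos] ennreal_mult' less_imp_le[OF gam_pos] mult.commute)
    also have "\<dots> = ennreal (gam y) * (\<integral>\<^sup>+x. ennreal \<bar>f (x + sqrt t *\<^sub>R y)\<bar> \<partial>lborel)"
      by (rule nn_integral_cmult) measurable
    also have "(\<integral>\<^sup>+x. ennreal \<bar>f (x + sqrt t *\<^sub>R y)\<bar> \<partial>lborel) = (\<integral>\<^sup>+x. ennreal \<bar>f x\<bar> \<partial>lborel)"
      by (rule nn_integral_translate) measurable
    finally show ?thesis .
  qed
  then have "(\<integral>\<^sup>+y. \<integral>\<^sup>+x. ennreal \<bar>f (x + sqrt t *\<^sub>R y) * gam y\<bar> \<partial>lborel \<partial>lborel)
      = (\<integral>\<^sup>+y. ennreal (gam (y::'a)) * (\<integral>\<^sup>+x. ennreal \<bar>f x\<bar> \<partial>lborel) \<partial>lborel)"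
    by simp
  also have "\<dots> = (\<integral>\<^sup>+y. ennreal (gam (y::'a)) \<partial>lborel) * (\<integral>\<^sup>+x. ennreal \<bar>f x\<bar> \<partial>lborel)"
    by (rule nn_integral_multc) measurable
  also have "(\<integral>\<^sup>+y. ennreal (gam (y::'a)) \<partial>lborel) = ennreal (\<integral>y. gam (y::'a) \<partial>lborel)"
    by (rule nn_integral_eq_integral[OF integrable_gam]) (simp add: less_imp_le[OF gam_pos])
  finally show ?thesis by (simp add: integral_gam)
qed

lemma integrable_heat:
  fixes f :: "'a::euclidean_space \<Rightarrow> real"
  assumes f: "test_function f"
  shows "integrable lborel (heat t f)"
proof -
  have [measurable]: "f \<in> borel_measurable borel" using f by (rule test_borel)
  have fin: "(\<integral>\<^sup>+x. ennreal \<bar>f x\<bar> \<partial>lborel) < \<infinity>"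
    using test_integrable[OF f] by (simp add: integrable_iff_bounded)
  show ?thesis
    using lborel_fubini(1)[of "\<lambda>x y. f (x + sqrt t *\<^sub>R y) * gam y"] heat_nn_integral[of f t] fin
    by (simp add: heat_def[abs_def])
qed

lemma heat_L1:
  fixes f :: "'a::euclidean_space \<Rightarrow> real"
  assumes f: "test_function f"
  shows "(\<integral>x. \<bar>heat t f x\<bar> \<partial>lborel) \<le> (\<integral>x. \<bar>f x\<bar> \<partial>lborel)"
proof -
  have [measurable]: "f \<in> borel_measurable borel" using f by (rule test_borel)
  have "ennreal (\<integral>x. \<bar>heat t f x\<bar> \<partial>lborel) = (\<integral>\<^sup>+x. ennreal \<bar>heat t f x\<bar> \<partial>lborel)"
    by (rule nn_integral_eq_integral[symmetric]) (auto intro: integrable_heat f)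
  also have "\<dots> \<le> (\<integral>\<^sup>+x. \<integral>\<^sup>+y. ennreal \<bar>f (x + sqrt t *\<^sub>R y) * gam y\<bar> \<partial>lborel \<partial>lborel)"
    unfolding heat_def
    using integral_norm_bound_ennreal[OF heat_integrable[OF f]] by (intro nn_integral_mono) simp
  also have "\<dots> = (\<integral>\<^sup>+y. \<integral>\<^sup>+x. ennreal \<bar>f (x + sqrt t *\<^sub>R y) * gam y\<bar> \<partial>lborel \<partial>lborel)"
    by (rule lborel_pair.Fubini') measurable
  also have "\<dots> = (\<integral>\<^sup>+x. ennreal \<bar>f x\<bar> \<partial>lborel)" by (rule heat_nn_integral) measurable
  also have "\<dots> = ennreal (\<integral>x. \<bar>f x\<bar> \<partial>lborel)"
    by (rule nn_integral_eq_integral) (auto intro: test_integrable f)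
  finally show ?thesis by (simp add: ennreal_le_iff)
qed

text \<open>Sup decay of order t^(-d/2), from the bound of the kernel by its value at 0. It makes
  the bilinear term of the energy disappear for large times.\<close>

lemma heat_decay:
  fixes f :: "'a::euclidean_space \<Rightarrow> real"
  assumes f: "test_function f" and t: "0 < t"
  shows "\<bar>heat t f x\<bar> \<le> gam (0::'a) * (\<integral>x. \<bar>f x\<bar> \<partial>lborel) / sqrt t ^ DIM('a)"
proof -
  have [measurable]: "f \<in> borel_measurable borel" using f by (rule test_borel)
  have I: "integrable lborel (\<lambda>y. \<bar>f (x + sqrt t *\<^sub>R y)\<bar>)"
    using integrable_affine[of "\<lambda>x. \<bar>f x\<bar>" "sqrt t" x] test_integrable[OF f] t by simp
  have "\<bar>heat t f x\<bar> \<le> (\<integral>y. gam (0::'a) * \<bar>f (x + sqrt t *\<^sub>R y)\<bar> \<partial>lborel)"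
    unfolding heat_def
  proof (rule integral_abs_le_integral[OF heat_integrable[OF f]])
    show "\<bar>f (x + sqrt t *\<^sub>R y) * gam y\<bar> \<le> gam (0::'a) * \<bar>f (x + sqrt t *\<^sub>R y)\<bar>" for y
      using mult_right_mono[OF gam_le[of y], of "\<bar>f (x + sqrt t *\<^sub>R y)\<bar>"]
      by (simp add: abs_mult abs_of_pos[OF gam_pos] mult.commute)
  qed (use I in simp)
  also have "\<dots> = gam (0::'a) * (\<integral>y. \<bar>f (x + sqrt t *\<^sub>R y)\<bar> \<partial>lborel)" by simp
  also have "(\<integral>y. \<bar>f (x + sqrt t *\<^sub>R y)\<bar> \<partial>lborel) = (\<integral>x. \<bar>f x\<bar> \<partial>lborel) / sqrt t ^ DIM('a)"
    using integral_affine[of "\<lambda>x. \<bar>f x\<bar>" "sqrt t" x] t by (simp add: abs_of_pos field_simps)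
  finally show ?thesis by simp
qed

text \<open>The derivative of \<open>gam\<close> in direction e is -(y . e)/2 times
  \<open>gam\<close>, so a factor y . e against the Gaussian can be traded for a derivative of
  \<psi>. This is how the first-order expression coming from sqrt t turns into a Laplacian.\<close>

lemma gam_parts:
  fixes \<psi> :: "'a::euclidean_space \<Rightarrow> real"
  assumes \<psi>: "test_function \<psi>" and e: "e \<in> Basis"
  shows "(\<integral>y. \<psi> (x + sqrt t *\<^sub>R y) * ((y \<bullet> e) * gam y) \<partial>lborel) = 2 * sqrt t * heat t (partial e \<psi>) x"
    and "integrable lborel (\<lambda>y. \<psi> (x + sqrt t *\<^sub>R y) * ((y \<bullet> e) * gam y))"
proof -
  obtain M where M: "M > 0" "\<And>x. \<bar>\<psi> x\<bar> \<le> M" using test_bounded[OF \<psi>] by blast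
  have [measurable]: "\<psi> \<in> borel_measurable borel" using \<psi> by (rule test_borel)
  have c: "continuous_on UNIV (\<lambda>y. \<phi> (x + sqrt t *\<^sub>R y))" if "test_function \<phi>" for \<phi> :: "'a \<Rightarrow> real"
    by (rule continuous_on_compose2[OF test_continuous[OF that]]) (auto intro!: continuous_intros)
  have cg: "continuous_on UNIV (gam :: 'a \<Rightarrow> real)"
    unfolding gam_def[abs_def] by (intro continuous_intros) (use integral_gauss_pos[where 'a='a] in auto)
  show I: "integrable lborel (\<lambda>y. \<psi> (x + sqrt t *\<^sub>R y) * ((y \<bullet> e) * gam y))"
  proof (rule Bochner_Integration.integrable_bound)
    show "integrable lborel (\<lambda>y::'a. M * ((1 + norm y) * gam y))"
      by (intro integrable_mult_right integrable_gam_moment)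
    show "(\<lambda>y. \<psi> (x + sqrt t *\<^sub>R y) * ((y \<bullet> e) * gam y)) \<in> borel_measurable lborel" by measurable
    show "AE y in lborel. norm (\<psi> (x + sqrt t *\<^sub>R y) * ((y \<bullet> e) * gam y)) \<le> norm (M * ((1 + norm y) * gam y))"
    proof (rule AE_I2)
      fix y :: 'a
      have "\<bar>y \<bullet> e\<bar> \<le> 1 + norm y" using Basis_le_norm[OF e, of y] by linarith
      then have "\<bar>\<psi> (x + sqrt t *\<^sub>R y)\<bar> * (\<bar>y \<bullet> e\<bar> * gam y) \<le> M * ((1 + norm y) * gam y)"
        using M by (intro mult_mono) (auto simp: less_imp_le[OF gam_pos])
      then show "norm (\<psi> (x + sqrt t *\<^sub>R y) * ((y \<bullet> e) * gam y)) \<le> norm (M * ((1 + norm y) * gam y))"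
        using M(1) by (simp add: abs_mult abs_of_pos[OF gam_pos])
    qed
  qed
  note H = heat_integrable[OF test_partial[OF \<psi> e], of x t]
  have "(\<integral>y. sqrt t * (partial e \<psi> (x + sqrt t *\<^sub>R y) * gam y) - 1 / 2 * (\<psi> (x + sqrt t *\<^sub>R y) * ((y \<bullet> e) * gam y)) \<partial>lborel) = 0"
  proof (rule integral_derivative_zero)
    fix y :: 'a
    have "((\<lambda>s. \<psi> (x + sqrt t *\<^sub>R y + s *\<^sub>R e)) has_real_derivative partial e \<psi> (x + sqrt t *\<^sub>R y)) (at (sqrt t * 0))"
      using smooth_directional[OF test_smooth[OF \<psi>] e, of "x + sqrt t *\<^sub>R y" 0] by simp
    moreover have "((\<lambda>s. sqrt t * s) has_real_derivative sqrt t) (at 0)"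
      by (auto intro!: derivative_eq_intros)
    ultimately have "((\<lambda>s. \<psi> (x + sqrt t *\<^sub>R y + (sqrt t * s) *\<^sub>R e)) has_real_derivative
        partial e \<psi> (x + sqrt t *\<^sub>R y) * sqrt t) (at 0)"
      by (rule DERIV_chain2)
    from DERIV_mult[OF this gam_directional[of y e]]
    show "((\<lambda>s. \<psi> (x + sqrt t *\<^sub>R (y + s *\<^sub>R e)) * gam (y + s *\<^sub>R e)) has_real_derivative
        sqrt t * (partial e \<psi> (x + sqrt t *\<^sub>R y) * gam y) - 1 / 2 * (\<psi> (x + sqrt t *\<^sub>R y) * ((y \<bullet> e) * gam y))) (at 0)"
      by (simp add: algebra_simps)
  next
    show "continuous_on UNIV (\<lambda>y. sqrt t * (partial e \<psi> (x + sqrt t *\<^sub>R y) * gam y)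
        - 1 / 2 * (\<psi> (x + sqrt t *\<^sub>R y) * ((y \<bullet> e) * gam y)))"
      by (intro continuous_intros c cg \<psi> test_partial e)
    show "integrable lborel (\<lambda>y. \<psi> (x + sqrt t *\<^sub>R y) * gam y)" by (rule heat_integrable[OF \<psi>])
  qed (use H I in simp)
  then show "(\<integral>y. \<psi> (x + sqrt t *\<^sub>R y) * ((y \<bullet> e) * gam y) \<partial>lborel) = 2 * sqrt t * heat t (partial e \<psi>) x"
    using H I by (simp add: heat_def)
qed

text \<open>Differentiating f(x + sqrt t y) in t gives y . \<nabla>f / (2 sqrt t), and
  \<open>gam_parts\<close> converts each factor y_b into a second derivative times 2 sqrt t; the
  roots cancel.\<close>

lemma heat_equation:
  fixes f :: "'a::euclidean_space \<Rightarrow> real"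
  assumes f: "test_function f" and t: "0 < t"
  shows "((\<lambda>t. heat t f x) has_real_derivative heat t (laplacian f) x) (at t)"
proof -
  obtain C where C: "C > 0" "\<And>x h. \<bar>\<Sum>b\<in>Basis. (h \<bullet> b) * partial b f x\<bar> \<le> C * norm h"
    using test_derivative_bound[OF f] by blast
  have [measurable]: "partial b f \<in> borel_measurable borel" if "b \<in> Basis" for b
    using test_borel[OF test_partial[OF f that]] .
  let ?D = "\<lambda>t y. (\<Sum>b\<in>Basis. (y \<bullet> b) * partial b f (x + sqrt t *\<^sub>R y)) * gam y / (2 * sqrt t)"
  \<comment> \<open>On the ball of radius t/2 around t the singular factor 1 / sqrt s is at most 1 /
    sqrt (t/2), which yields a single dominating function.\<close>
  have sq: "sqrt (t / 2) \<le> sqrt s" if "s \<in> ball t (t / 2)" for s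
    using that by (auto simp: dist_real_def abs_if split: if_splits)
  have "((\<lambda>t. \<integral>y. f (x + sqrt t *\<^sub>R y) * gam y \<partial>lborel) has_derivative (\<lambda>h. \<integral>y. ?D t y * h \<partial>lborel)) (at t)"
  proof (rule has_derivative_integral_dominated[where r="t / 2"])
    show "integrable lborel (\<lambda>y::'a. C / (2 * sqrt (t / 2)) * ((1 + norm y) * gam y))"
      by (intro integrable_mult_right integrable_gam_moment)
    show "integrable lborel (\<lambda>y. f (x + sqrt t *\<^sub>R y) * gam y)" for t
      by (rule heat_integrable[OF f])
    fix s assume "s \<in> ball t (t / 2)"
    then have s: "sqrt (t / 2) \<le> sqrt s" by (rule sq)
    have "0 < sqrt (t / 2)" using t by simp
    with s have s0: "0 < s" by (metis less_le_trans real_sqrt_gt_0_iff)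
    fix y :: 'a
    show "((\<lambda>s. f (x + sqrt s *\<^sub>R y) * gam y) has_derivative (\<lambda>h. ?D s y * h)) (at s)"
    proof -
      have "((\<lambda>s. x + sqrt s *\<^sub>R y) has_derivative (\<lambda>h. (h / (2 * sqrt s)) *\<^sub>R y)) (at s)"
        using s0 by (auto intro!: derivative_eq_intros simp: field_simps)
      from has_derivative_compose[OF this smooth_has_derivative[OF test_smooth[OF f]]]
      have "((\<lambda>s. f (x + sqrt s *\<^sub>R y)) has_derivative
          (\<lambda>h. \<Sum>b\<in>Basis. ((h / (2 * sqrt s)) *\<^sub>R y \<bullet> b) * partial b f (x + sqrt s *\<^sub>R y))) (at s)" .
      from has_derivative_mult_left[OF this, of "gam y"]
      show ?thesis
        by (simp add: sum_distrib_left sum_distrib_right sum_divide_distrib mult_ac)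
    qed
    show "\<bar>?D s y * h\<bar> \<le> C / (2 * sqrt (t / 2)) * ((1 + norm y) * gam y) * norm h" for h
    proof -
      have "\<bar>?D s y\<bar> = \<bar>\<Sum>b\<in>Basis. (y \<bullet> b) * partial b f (x + sqrt s *\<^sub>R y)\<bar> * gam y / (2 * sqrt s)"
        using s0 by (simp add: abs_mult abs_of_pos[OF gam_pos])
      also have "\<dots> \<le> C * (1 + norm y) * gam y / (2 * sqrt (t / 2))"
      proof (intro frac_le mult_right_mono)
        have "C * norm y \<le> C * (1 + norm y)" using C(1) by simp
        then show "\<bar>\<Sum>b\<in>Basis. (y \<bullet> b) * partial b f (x + sqrt s *\<^sub>R y)\<bar> \<le> C * (1 + norm y)"
          using C(2)[of y "x + sqrt s *\<^sub>R y"] by linarith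
      qed (use s t C(1) less_imp_le[OF gam_pos] in \<open>auto intro!: mult_nonneg_nonneg\<close>)
      also have "\<dots> = C / (2 * sqrt (t / 2)) * ((1 + norm y) * gam y)" by simp
      finally have "\<bar>?D s y\<bar> * \<bar>h\<bar> \<le> C / (2 * sqrt (t / 2)) * ((1 + norm y) * gam y) * \<bar>h\<bar>"
        by (rule mult_right_mono) simp
      then show ?thesis by (simp only: abs_mult real_norm_def)
    qed
  next
    show "(\<lambda>y. ?D t y * h) \<in> borel_measurable lborel" for h by measurable
  qed (use t in simp)
  moreover have "(\<integral>y. ?D t y \<partial>lborel) = heat t (laplacian f) x"
  proof -
    have "(\<integral>y. ?D t y \<partial>lborel)
        = (\<integral>y. (\<Sum>b\<in>Basis. partial b f (x + sqrt t *\<^sub>R y) * ((y \<bullet> b) * gam y)) / (2 * sqrt t) \<partial>lborel)"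
      by (simp add: sum_distrib_left sum_distrib_right mult_ac)
    also have "\<dots> = (\<integral>y. (\<Sum>b\<in>Basis. partial b f (x + sqrt t *\<^sub>R y) * ((y \<bullet> b) * gam y)) \<partial>lborel) / (2 * sqrt t)"
      by (rule integral_divide_zero)
    also have "(\<integral>y. (\<Sum>b\<in>Basis. partial b f (x + sqrt t *\<^sub>R y) * ((y \<bullet> b) * gam y)) \<partial>lborel)
        = (\<Sum>b\<in>Basis. 2 * sqrt t * heat t (partial b (partial b f)) x)"
      by (subst Bochner_Integration.integral_sum) (auto simp: gam_parts test_partial f)
    also have "\<dots> / (2 * sqrt t) = (\<Sum>b\<in>Basis. heat t (partial b (partial b f)) x)"
      using t by (simp add: sum_distrib_left[symmetric])
    also have "\<dots> = heat t (laplacian f) x"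
      unfolding heat_def laplacian_def sum_distrib_right
      by (subst Bochner_Integration.integral_sum) (auto intro: heat_integrable test_partial f)
    finally show ?thesis .
  qed
  then have "(\<lambda>h. \<integral>y. ?D t y * h \<partial>lborel) = times (heat t (laplacian f) x)"
    by (simp only: integral_mult_left_zero)
  ultimately show ?thesis unfolding has_field_derivative_def heat_def[of _ f, abs_def] by simp
qed

lemma heat_laplacian:
  assumes "test_function f"
  shows "heat t (laplacian f) x = (\<Sum>e\<in>Basis. heat t (partial e (partial e f)) x)"
  unfolding heat_def laplacian_def sum_distrib_right
  by (subst Bochner_Integration.integral_sum) (auto intro: heat_integrable test_partial assms)

lemma integrable_bounded_mult:
  fixes a b :: "'a::euclidean_space \<Rightarrow> real"
  assumes "a \<in> borel_measurable borel" "\<And>x. \<bar>a x\<bar> \<le> M" "integrable lborel b"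
  shows "integrable lborel (\<lambda>x. a x * b x)"
proof (rule Bochner_Integration.integrable_bound[where f="\<lambda>x. M * b x"])
  show "(\<lambda>x. a x * b x) \<in> borel_measurable lborel"
    using assms(1,3) by (intro borel_measurable_times) auto
  show "AE x in lborel. norm (a x * b x) \<le> norm (M * b x)"
    by (intro AE_I2) (simp add: abs_mult mult_right_mono order_trans[OF assms(2) abs_ge_self])
qed (use assms in simp)

lemma integral_nonpos:
  fixes f :: "'b \<Rightarrow> real"
  assumes "\<And>x. f x \<le> 0" shows "(\<integral>x. f x \<partial>M) \<le> 0"
  using Bochner_Integration.integral_nonneg[of M "\<lambda>x. - f x"] assms by simp

lemma integral_bounded_mult_le:
  fixes a b :: "'a::euclidean_space \<Rightarrow> real"
  assumes "a \<in> borel_measurable borel" "\<And>x. \<bar>a x\<bar> \<le> M" "integrable lborel b"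
  shows "(\<integral>x. \<bar>a x * b x\<bar> \<partial>lborel) \<le> M * (\<integral>x. \<bar>b x\<bar> \<partial>lborel)"
proof -
  have "(\<integral>x. \<bar>a x * b x\<bar> \<partial>lborel) \<le> (\<integral>x. M * \<bar>b x\<bar> \<partial>lborel)"
  proof (rule integral_mono)
    show "integrable lborel (\<lambda>x. \<bar>a x * b x\<bar>)"
      by (rule integrable_abs[OF integrable_bounded_mult[OF assms]])
    show "integrable lborel (\<lambda>x. M * \<bar>b x\<bar>)"
      by (rule integrable_mult_right[OF integrable_abs[OF assms(3)]])
    show "\<bar>a x * b x\<bar> \<le> M * \<bar>b x\<bar>" for x
      by (simp add: abs_mult mult_right_mono assms(2))
  qed
  then show ?thesis by simp
qed

text \<open>Two integrations by parts in every direction. Later \<Delta>w is f, so this removes w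
  from the time derivative of the energy.\<close>

lemma heat_self_adjoint_laplacian:
  fixes w k :: "'a::euclidean_space \<Rightarrow> real"
  assumes w: "test_function w" and k: "test_function k"
  shows "(\<integral>x. heat t w x * heat t (laplacian k) x \<partial>lborel) = (\<integral>x. heat t (laplacian w) x * heat t k x \<partial>lborel)"
proof -
  have parts: "(\<integral>x. heat t a x * heat t (partial e b) x \<partial>lborel) = - (\<integral>x. heat t (partial e a) x * heat t b x \<partial>lborel)"
      "integrable lborel (\<lambda>x. heat t a x * heat t b x)"
    if a: "test_function a" and b: "test_function b" and e: "e \<in> Basis" for a b :: "'a \<Rightarrow> real" and e
  proof -
    obtain M where M: "M > 0" "\<And>x. \<bar>a x\<bar> \<le> M" using test_bounded[OF a] by blast
    obtain N where N: "N > 0" "\<And>x. \<bar>partial e a x\<bar> \<le> N" using test_bounded[OF test_partial[OF a e]] by blast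
    have bd: "\<bar>heat t a x\<bar> \<le> max M N" "\<bar>heat t (partial e a) x\<bar> \<le> max M N" for x
      using heat_bound[OF a M(2)] heat_bound[OF test_partial[OF a e] N(2)] by (auto simp: le_max_iff_disj)
    show "(\<integral>x. heat t a x * heat t (partial e b) x \<partial>lborel) = - (\<integral>x. heat t (partial e a) x * heat t b x \<partial>lborel)"
      by (rule integration_by_parts(1)[where e=e and M="max M N"])
        (intro heat_directional heat_continuous_x integrable_heat test_partial a b e bd)+
    show "integrable lborel (\<lambda>x. heat t a x * heat t b x)"
      by (rule integrable_bounded_mult[OF _ bd(1)])
        (intro integrable_heat b continuous_borel heat_continuous_x a)+
  qed
  have "(\<integral>x. heat t w x * heat t (laplacian k) x \<partial>lborel)
      = (\<Sum>e\<in>Basis. \<integral>x. heat t w x * heat t (partial e (partial e k)) x \<partial>lborel)"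
    unfolding heat_laplacian[OF k] sum_distrib_left
    by (rule Bochner_Integration.integral_sum) (rule parts(2)[OF w test_partial[OF test_partial[OF k]]])
  also have "\<dots> = (\<Sum>e\<in>Basis. \<integral>x. heat t (partial e (partial e w)) x * heat t k x \<partial>lborel)"
    by (intro sum.cong refl) (simp add: parts(1) w k test_partial)
  also have "\<dots> = (\<integral>x. heat t (laplacian w) x * heat t k x \<partial>lborel)"
    unfolding heat_laplacian[OF w] sum_distrib_right
    by (rule Bochner_Integration.integral_sum[symmetric]) (rule parts(2)[OF test_partial[OF test_partial[OF w]] k])
  finally show ?thesis .
qed

text \<open>The convexity condition \<open>hess\<close> says that \<open>\<langle>Hess B \<xi>, \<xi>\<rangle>\<close> dominates
  \<open>2c |\<xi>\<^sub>1| |\<xi>\<^sub>2|\<close>, in a form (with the weight \<open>\<tau>\<close>) that survives summation over the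
  coordinate directions.\<close>

locale bellman =
  fixes B Bu Bv Buu Buv Bvv :: "real \<Rightarrow> real \<Rightarrow> real" and c :: real
  assumes cont: "continuous_on UNIV (\<lambda>(u, v). B u v)"
      "continuous_on UNIV (\<lambda>(u, v). Bu u v)" "continuous_on UNIV (\<lambda>(u, v). Bv u v)"
      "continuous_on UNIV (\<lambda>(u, v). Buu u v)" "continuous_on UNIV (\<lambda>(u, v). Buv u v)"
      "continuous_on UNIV (\<lambda>(u, v). Bvv u v)"
    and der_B: "\<And>f g f' g' s. (f has_real_derivative f') (at s) \<Longrightarrow> (g has_real_derivative g') (at s) \<Longrightarrow>
      ((\<lambda>s. B (f s) (g s)) has_real_derivative Bu (f s) (g s) * f' + Bv (f s) (g s) * g') (at s)"
    and der_Bu: "\<And>f g f' g' s. (f has_real_derivative f') (at s) \<Longrightarrow> (g has_real_derivative g') (at s) \<Longrightarrow>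
      ((\<lambda>s. Bu (f s) (g s)) has_real_derivative Buu (f s) (g s) * f' + Buv (f s) (g s) * g') (at s)"
    and der_Bv: "\<And>f g f' g' s. (f has_real_derivative f') (at s) \<Longrightarrow> (g has_real_derivative g') (at s) \<Longrightarrow>
      ((\<lambda>s. Bv (f s) (g s)) has_real_derivative Buv (f s) (g s) * f' + Bvv (f s) (g s) * g') (at s)"
    and hess: "\<And>u v. \<exists>\<tau>>0. \<forall>x y. c * (\<tau> * x\<^sup>2 + y\<^sup>2 / \<tau>) \<le> Buu u v * x\<^sup>2 + 2 * Buv u v * x * y + Bvv u v * y\<^sup>2"
    and min: "\<And>u v. B 0 0 \<le> B u v"
    and c: "0 < c"
begin

text \<open>The weighted inequality 2 |x y| <= \<tau> x^2 + y^2 / \<tau> bounds the product a_j b_i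
  by one term of each sum. Since \<tau> depends on (u, v) alone and not on the direction, summing
  the Hessian bound over all directions covers every pair (i, j) with the same constant.\<close>

lemma hess_sum:
  fixes a b :: "'a::euclidean_space \<Rightarrow> real"
  assumes i: "i \<in> Basis" and j: "j \<in> Basis"
  shows "2 * c * \<bar>a j * b i\<bar> \<le> (\<Sum>e\<in>Basis. Buu u v * (a e)\<^sup>2 + 2 * Buv u v * a e * b e + Bvv u v * (b e)\<^sup>2)"
proof -
  obtain \<tau> where \<tau>: "\<tau> > 0" "\<And>x y. c * (\<tau> * x\<^sup>2 + y\<^sup>2 / \<tau>) \<le> Buu u v * x\<^sup>2 + 2 * Buv u v * x * y + Bvv u v * y\<^sup>2"
    using hess by blast
  have "2 * (\<tau> * \<bar>a j\<bar>) * \<bar>b i\<bar> \<le> (\<tau> * \<bar>a j\<bar>)\<^sup>2 + \<bar>b i\<bar>\<^sup>2" by (rule sum_squares_bound)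
  then have "\<tau> * (2 * \<bar>a j * b i\<bar>) \<le> \<tau> * (\<tau> * (a j)\<^sup>2 + (b i)\<^sup>2 / \<tau>)"
    using \<tau>(1) by (simp add: abs_mult power_mult_distrib power2_eq_square algebra_simps)
  then have "2 * \<bar>a j * b i\<bar> \<le> \<tau> * (a j)\<^sup>2 + (b i)\<^sup>2 / \<tau>" using \<tau>(1) by simp
  also have "\<dots> \<le> (\<Sum>e\<in>Basis. \<tau> * (a e)\<^sup>2) + (\<Sum>e\<in>Basis. (b e)\<^sup>2 / \<tau>)"
    using \<tau>(1) i j by (intro add_mono member_le_sum[where f="\<lambda>e. \<tau> * (a e)\<^sup>2"] member_le_sum[where f="\<lambda>e. (b e)\<^sup>2 / \<tau>"]) auto
  finally have "c * (2 * \<bar>a j * b i\<bar>) \<le> c * ((\<Sum>e\<in>Basis. \<tau> * (a e)\<^sup>2) + (\<Sum>e\<in>Basis. (b e)\<^sup>2 / \<tau>))"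
    using c by (intro mult_left_mono) auto
  also have "\<dots> = (\<Sum>e\<in>Basis. c * (\<tau> * (a e)\<^sup>2 + (b e)\<^sup>2 / \<tau>))"
    by (simp add: sum.distrib sum_distrib_left distrib_left)
  also have "\<dots> \<le> (\<Sum>e\<in>Basis. Buu u v * (a e)\<^sup>2 + 2 * Buv u v * a e * b e + Bvv u v * (b e)\<^sup>2)"
    by (intro sum_mono \<tau>(2))
  finally show ?thesis by simp
qed

lemma bounded_comp:
  fixes X :: "real \<Rightarrow> real \<Rightarrow> real"
  assumes "continuous_on UNIV (\<lambda>(u, v). X u v)"
  obtains K where "K > 0" "\<And>u v. \<bar>u\<bar> \<le> M \<Longrightarrow> \<bar>v\<bar> \<le> N \<Longrightarrow> \<bar>X u v\<bar> \<le> K"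
proof -
  have "compact ((\<lambda>(u, v). X u v) ` ({-M..M} \<times> {-N..N}))"
    by (intro compact_continuous_image continuous_on_subset[OF assms] compact_Times) auto
  then obtain K where K: "K > 0" "\<And>z. z \<in> (\<lambda>(u, v). X u v) ` ({-M..M} \<times> {-N..N}) \<Longrightarrow> norm z \<le> K"
    using compact_imp_bounded bounded_pos by metis
  show ?thesis
  proof (rule that[OF K(1)])
    fix u v :: real assume "\<bar>u\<bar> \<le> M" "\<bar>v\<bar> \<le> N"
    then have "X u v \<in> (\<lambda>(u, v). X u v) ` ({-M..M} \<times> {-N..N})"
      by (intro image_eqI[of _ _ "(u, v)"]) auto
    from K(2)[OF this] show "\<bar>X u v\<bar> \<le> K" by simp
  qed
qed

text \<open>Makes B(F, G) - B(0, 0) integrable over the whole space when F and G are bounded and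
  integrable. The mean value theorem is applied on the segment from the origin to (u, v).\<close>

lemma B_lipschitz:
  obtains K where "K > 0" "\<And>u v. \<bar>u\<bar> \<le> M \<Longrightarrow> \<bar>v\<bar> \<le> N \<Longrightarrow> \<bar>B u v - B 0 0\<bar> \<le> K * (\<bar>u\<bar> + \<bar>v\<bar>)"
proof -
  obtain K1 where K1: "K1 > 0" "\<And>u v. \<bar>u\<bar> \<le> M \<Longrightarrow> \<bar>v\<bar> \<le> N \<Longrightarrow> \<bar>Bu u v\<bar> \<le> K1"
    using bounded_comp[OF cont(2)] by metis
  obtain K2 where K2: "K2 > 0" "\<And>u v. \<bar>u\<bar> \<le> M \<Longrightarrow> \<bar>v\<bar> \<le> N \<Longrightarrow> \<bar>Bv u v\<bar> \<le> K2"
    using bounded_comp[OF cont(3)] by metis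
  show ?thesis
  proof (rule that)
    show "0 < K1 + K2" using K1 K2 by simp
    fix u v assume uv: "\<bar>u\<bar> \<le> M" "\<bar>v\<bar> \<le> N"
    have "((\<lambda>s. B (s * u) (s * v)) has_real_derivative Bu (s * u) (s * v) * u + Bv (s * u) (s * v) * v) (at s)" for s
      by (rule der_B) (auto intro!: derivative_eq_intros)
    then obtain z where z: "0 < z" "z < 1"
      "B (1 * u) (1 * v) - B (0 * u) (0 * v) = (1 - 0) * (Bu (z * u) (z * v) * u + Bv (z * u) (z * v) * v)"
      using MVT2[of 0 1 "\<lambda>s. B (s * u) (s * v)" "\<lambda>s. Bu (s * u) (s * v) * u + Bv (s * u) (s * v) * v"] by auto
    have "\<bar>z * u\<bar> \<le> 1 * \<bar>u\<bar>" "\<bar>z * v\<bar> \<le> 1 * \<bar>v\<bar>"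
      unfolding abs_mult using z by (intro mult_right_mono; simp)+
    then have "\<bar>Bu (z * u) (z * v)\<bar> \<le> K1" "\<bar>Bv (z * u) (z * v)\<bar> \<le> K2"
      using K1(2)[of "z * u" "z * v"] K2(2)[of "z * u" "z * v"] uv by auto
    then have "\<bar>Bu (z * u) (z * v) * u\<bar> \<le> K1 * \<bar>u\<bar>" "\<bar>Bv (z * u) (z * v) * v\<bar> \<le> K2 * \<bar>v\<bar>"
      unfolding abs_mult by (intro mult_right_mono; simp)+
    moreover have "K1 * \<bar>u\<bar> + K2 * \<bar>v\<bar> \<le> (K1 + K2) * (\<bar>u\<bar> + \<bar>v\<bar>)"
      using K1 K2 by (simp add: algebra_simps)
    moreover have "B u v - B 0 0 = Bu (z * u) (z * v) * u + Bv (z * u) (z * v) * v"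
      using z(3) by simp
    ultimately show "\<bar>B u v - B 0 0\<bar> \<le> (K1 + K2) * (\<bar>u\<bar> + \<bar>v\<bar>)"
      by linarith
  qed
qed

lemma comp_continuous_x:
  fixes X :: "real \<Rightarrow> real \<Rightarrow> real" and f g :: "'a::euclidean_space \<Rightarrow> real"
  assumes "continuous_on UNIV (\<lambda>(u, v). X u v)" "test_function f" "test_function g"
  shows "continuous_on A (\<lambda>x. X (heat t f x) (heat t g x))"
  using continuous_on_compose2[OF assms(1), of A "\<lambda>x. (heat t f x, heat t g x)"]
    continuous_on_Pair[OF heat_continuous_x[OF assms(2)] heat_continuous_x[OF assms(3)]]
  by auto

lemma comp_continuous:
  fixes X :: "real \<Rightarrow> real \<Rightarrow> real" and f g :: "'a::euclidean_space \<Rightarrow> real"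
  assumes "continuous_on UNIV (\<lambda>(u, v). X u v)" "test_function f" "test_function g"
  shows "continuous_on UNIV (\<lambda>(t, x). X (heat t f x) (heat t g x))"
  using continuous_on_compose2[OF assms(1), of UNIV "\<lambda>p. (heat (fst p) f (snd p), heat (fst p) g (snd p))"]
    continuous_on_Pair[OF heat_continuous[OF assms(2)] heat_continuous[OF assms(3)]]
  by (auto simp: case_prod_beta)

text \<open>To be used with X = \<open>Bu\<close>, h = f and with X = \<open>Bv\<close>, h = g: the
  two resulting sums add up to the quadratic form of the Hessian of B on the gradients of the two
  heat extensions.\<close>

lemma gradient_parts:
  fixes f g h :: "'a::euclidean_space \<Rightarrow> real" and t :: real
  assumes X: "continuous_on UNIV (\<lambda>(u, v). X u v)" "continuous_on UNIV (\<lambda>(u, v). Xu u v)"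
      "continuous_on UNIV (\<lambda>(u, v). Xv u v)"
    and der: "\<And>f g f' g' s. (f has_real_derivative f') (at s) \<Longrightarrow> (g has_real_derivative g') (at s) \<Longrightarrow>
      ((\<lambda>s. X (f s) (g s)) has_real_derivative Xu (f s) (g s) * f' + Xv (f s) (g s) * g') (at s)"
    and t: "test_function f" "test_function g" "test_function h"
  defines "Q \<equiv> \<lambda>x. \<Sum>e\<in>Basis. (Xu (heat t f x) (heat t g x) * heat t (partial e f) x
      + Xv (heat t f x) (heat t g x) * heat t (partial e g) x) * heat t (partial e h) x"
  shows "(\<integral>x. X (heat t f x) (heat t g x) * heat t (laplacian h) x \<partial>lborel) = - (\<integral>x. Q x \<partial>lborel)"
    and "integrable lborel Q"
    and "integrable lborel (\<lambda>x. X (heat t f x) (heat t g x) * heat t (laplacian h) x)"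
proof -
  obtain M where M: "M > 0" "\<And>x. \<bar>f x\<bar> \<le> M" using test_bounded[OF t(1)] by blast
  obtain N where N: "N > 0" "\<And>x. \<bar>g x\<bar> \<le> N" using test_bounded[OF t(2)] by blast
  note hf = heat_bound[OF t(1) M(2)] and hg = heat_bound[OF t(2) N(2)]
  obtain K0 where K0: "K0 > 0" "\<And>u v. \<bar>u\<bar> \<le> M \<Longrightarrow> \<bar>v\<bar> \<le> N \<Longrightarrow> \<bar>X u v\<bar> \<le> K0"
    using bounded_comp[OF X(1)] by metis
  obtain K1 where K1: "K1 > 0" "\<And>u v. \<bar>u\<bar> \<le> M \<Longrightarrow> \<bar>v\<bar> \<le> N \<Longrightarrow> \<bar>Xu u v\<bar> \<le> K1"
    using bounded_comp[OF X(2)] by metis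
  obtain K2 where K2: "K2 > 0" "\<And>u v. \<bar>u\<bar> \<le> M \<Longrightarrow> \<bar>v\<bar> \<le> N \<Longrightarrow> \<bar>Xv u v\<bar> \<le> K2"
    using bounded_comp[OF X(3)] by metis
  define Y where "Y e x = Xu (heat t f x) (heat t g x) * heat t (partial e f) x
      + Xv (heat t f x) (heat t g x) * heat t (partial e g) x" for e x
  have parts: "(\<integral>x. X (heat t f x) (heat t g x) * heat t (partial e (partial e h)) x \<partial>lborel)
        = - (\<integral>x. Y e x * heat t (partial e h) x \<partial>lborel)"
      "integrable lborel (\<lambda>x. X (heat t f x) (heat t g x) * heat t (partial e (partial e h)) x)"
      "integrable lborel (\<lambda>x. Y e x * heat t (partial e h) x)"
    if e: "e \<in> Basis" for e
  proof -
    obtain M' where M': "M' > 0" "\<And>x. \<bar>partial e f x\<bar> \<le> M'" using test_bounded[OF test_partial[OF t(1) e]] by blast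
    obtain N' where N': "N' > 0" "\<And>x. \<bar>partial e g x\<bar> \<le> N'" using test_bounded[OF test_partial[OF t(2) e]] by blast
    note hf' = heat_bound[OF test_partial[OF t(1) e] M'(2)] and hg' = heat_bound[OF test_partial[OF t(2) e] N'(2)]
    have bX: "\<bar>X (heat t f x) (heat t g x)\<bar> \<le> max K0 (K1 * M' + K2 * N')" for x
      using K0(2)[OF hf hg] by (auto simp: le_max_iff_disj)
    have bY: "\<bar>Y e x\<bar> \<le> max K0 (K1 * M' + K2 * N')" for x
    proof -
      have "\<bar>Xu (heat t f x) (heat t g x) * heat t (partial e f) x\<bar> \<le> K1 * M'"
        unfolding abs_mult using K1 K1(2)[OF hf hg] hf' by (intro mult_mono) auto
      moreover have "\<bar>Xv (heat t f x) (heat t g x) * heat t (partial e g) x\<bar> \<le> K2 * N'"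
        unfolding abs_mult using K2 K2(2)[OF hf hg] hg' by (intro mult_mono) auto
      ultimately have "\<bar>Y e x\<bar> \<le> K1 * M' + K2 * N'" unfolding Y_def by linarith
      then show ?thesis by simp
    qed
    have dX: "((\<lambda>s. X (heat t f (x + s *\<^sub>R e)) (heat t g (x + s *\<^sub>R e))) has_real_derivative Y e x) (at 0)" for x
      using der[OF heat_directional[OF t(1) e, of t x] heat_directional[OF t(2) e, of t x]] by (simp add: Y_def)
    have cY: "continuous_on UNIV (Y e)"
      unfolding Y_def by (intro continuous_intros comp_continuous_x X t heat_continuous_x test_partial e)
    note ibp = integration_by_parts[OF dX heat_directional[OF test_partial[OF t(3) e] e]
        comp_continuous_x[OF X(1) t(1,2)] cY heat_continuous_x[OF test_partial[OF t(3) e]]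
        heat_continuous_x[OF test_partial[OF test_partial[OF t(3) e] e]]
        bX bY integrable_heat[OF test_partial[OF t(3) e]] integrable_heat[OF test_partial[OF test_partial[OF t(3) e] e]]]
    show "(\<integral>x. X (heat t f x) (heat t g x) * heat t (partial e (partial e h)) x \<partial>lborel)
        = - (\<integral>x. Y e x * heat t (partial e h) x \<partial>lborel)"
      "integrable lborel (\<lambda>x. X (heat t f x) (heat t g x) * heat t (partial e (partial e h)) x)"
      "integrable lborel (\<lambda>x. Y e x * heat t (partial e h) x)"
      by (rule ibp)+
  qed
  have Q: "Q = (\<lambda>x. \<Sum>e\<in>Basis. Y e x * heat t (partial e h) x)" by (simp add: Q_def Y_def)
  show "integrable lborel Q" unfolding Q by (intro Bochner_Integration.integrable_sum parts(3))
  show "integrable lborel (\<lambda>x. X (heat t f x) (heat t g x) * heat t (laplacian h) x)"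
    unfolding heat_laplacian[OF t(3)] sum_distrib_left by (intro Bochner_Integration.integrable_sum parts(2))
  have "(\<integral>x. X (heat t f x) (heat t g x) * heat t (laplacian h) x \<partial>lborel)
      = (\<Sum>e\<in>Basis. (\<integral>x. X (heat t f x) (heat t g x) * heat t (partial e (partial e h)) x \<partial>lborel))"
    unfolding heat_laplacian[OF t(3)] sum_distrib_left
    by (intro Bochner_Integration.integral_sum parts(2))
  also have "\<dots> = - (\<Sum>e\<in>Basis. \<integral>x. Y e x * heat t (partial e h) x \<partial>lborel)"
    by (simp add: parts(1) sum_negf)
  also have "(\<Sum>e\<in>Basis. \<integral>x. Y e x * heat t (partial e h) x \<partial>lborel) = (\<integral>x. Q x \<partial>lborel)"
    unfolding Q by (intro Bochner_Integration.integral_sum[symmetric] parts(3))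
  finally show "(\<integral>x. X (heat t f x) (heat t g x) * heat t (laplacian h) x \<partial>lborel) = - (\<integral>x. Q x \<partial>lborel)" .
qed

lemma heat_product_parts:
  fixes a b :: "'a::euclidean_space \<Rightarrow> real"
  assumes a: "test_function a" and b: "test_function b" and e: "e \<in> Basis"
  shows "(\<integral>x. heat t a x * heat t (partial e b) x \<partial>lborel) = - (\<integral>x. heat t (partial e a) x * heat t b x \<partial>lborel)"
    and "integrable lborel (\<lambda>x. heat t a x * heat t b x)"
proof -
  obtain M where M: "M > 0" "\<And>x. \<bar>a x\<bar> \<le> M" using test_bounded[OF a] by blast
  obtain N where N: "N > 0" "\<And>x. \<bar>partial e a x\<bar> \<le> N" using test_bounded[OF test_partial[OF a e]] by blast
  have bd: "\<bar>heat t a x\<bar> \<le> max M N" "\<bar>heat t (partial e a) x\<bar> \<le> max M N" for x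
    using heat_bound[OF a M(2)] heat_bound[OF test_partial[OF a e] N(2)] by (auto simp: le_max_iff_disj)
  show "(\<integral>x. heat t a x * heat t (partial e b) x \<partial>lborel) = - (\<integral>x. heat t (partial e a) x * heat t b x \<partial>lborel)"
    by (rule integration_by_parts(1)[where e=e and M="max M N"])
      (intro heat_directional heat_continuous_x integrable_heat test_partial a b e bd)+
  show "integrable lborel (\<lambda>x. heat t a x * heat t b x)"
    by (rule integrable_bounded_mult[OF _ bd(1)])
      (intro integrable_heat b continuous_borel heat_continuous_x a)+
qed

text \<open>Integrated over space, this is nonincreasing in \<open>t\<close> when \<open>f\<close> is the Laplacian of \<open>w\<close>, \<open>k\<close> is a second
  derivative of \<open>g\<close> and \<open>s\<close> is a sign: the time derivative of the last term is a
  bilinear expression in the gradients of the heat extensions of \<open>f\<close> and \<open>g\<close>, which the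
  Hessian of \<open>B\<close> absorbs.\<close>

definition energy where
  "energy s f g w k t x = B (heat t f x) (heat t g x) - B 0 0 + s * c * (heat t w x * heat t k x)"

definition energy_dt where
  "energy_dt s f g w k t x = Bu (heat t f x) (heat t g x) * heat t (laplacian f) x
    + Bv (heat t f x) (heat t g x) * heat t (laplacian g) x
    + s * c * (heat t (laplacian w) x * heat t k x + heat t w x * heat t (laplacian k) x)"

lemma energy_has_derivative:
  assumes "test_function f" "test_function g" "test_function w" "test_function k" "0 < t"
  shows "((\<lambda>t. energy s f g w k t x) has_real_derivative energy_dt s f g w k t x) (at t)"
proof -
  have "((\<lambda>t. B (heat t f x) (heat t g x)) has_real_derivative
      Bu (heat t f x) (heat t g x) * heat t (laplacian f) x + Bv (heat t f x) (heat t g x) * heat t (laplacian g) x) (at t)"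
    by (intro der_B heat_equation assms)
  moreover have "((\<lambda>t. heat t w x * heat t k x) has_real_derivative
      heat t (laplacian w) x * heat t k x + heat t w x * heat t (laplacian k) x) (at t)"
    using DERIV_mult[OF heat_equation[OF assms(3,5)] heat_equation[OF assms(4,5)]] by (simp add: mult_ac)
  ultimately have "((\<lambda>t. (B (heat t f x) (heat t g x) - B 0 0) + s * c * (heat t w x * heat t k x)) has_real_derivative
      (Bu (heat t f x) (heat t g x) * heat t (laplacian f) x + Bv (heat t f x) (heat t g x) * heat t (laplacian g) x - 0)
      + s * c * (heat t (laplacian w) x * heat t k x + heat t w x * heat t (laplacian k) x)) (at t)"
    by (intro DERIV_add DERIV_diff DERIV_const DERIV_cmult)
  then show ?thesis
    unfolding energy_def energy_dt_def by simp
qed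

text \<open>Here it matters that f is \<Delta>w: moving the Laplacian from k to w shows that both
  halves of the derivative of the product term equal \<integral> F K, and one integration by parts
  turns this into - \<integral> \<partial>_j F \<partial>_i G. What remains is minus the Hessian
  form plus a product that \<open>hess_sum\<close> absorbs for either sign.\<close>

lemma energy_dt_integral:
  fixes g w :: "'a::euclidean_space \<Rightarrow> real"
  assumes g: "test_function g" and w: "test_function w" and i: "i \<in> Basis" and j: "j \<in> Basis"
    and s: "\<bar>s\<bar> = 1"
  defines "f \<equiv> laplacian w" and "k \<equiv> partial j (partial i g)"
  shows "(\<integral>x. energy_dt s f g w k t x \<partial>lborel) \<le> 0" and "integrable lborel (energy_dt s f g w k t)"
proof -
  have f: "test_function f" unfolding f_def by (rule test_laplacian[OF w])
  have k: "test_function k" unfolding k_def by (intro test_partial g i j)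
  note gp1 = gradient_parts[OF cont(2,4,5) der_Bu f g f, of t]
  note gp2 = gradient_parts[OF cont(3,5,6) der_Bv f g g, of t]
  have fk: "(\<integral>x. heat t f x * heat t k x \<partial>lborel) = - (\<integral>x. heat t (partial j f) x * heat t (partial i g) x \<partial>lborel)"
    unfolding k_def by (rule heat_product_parts(1)[OF f test_partial[OF g i] j])
  have wk: "(\<integral>x. heat t w x * heat t (laplacian k) x \<partial>lborel) = (\<integral>x. heat t f x * heat t k x \<partial>lborel)"
    unfolding f_def by (rule heat_self_adjoint_laplacian[OF w k])
  have Ifk: "integrable lborel (\<lambda>x. heat t f x * heat t k x)"
    and Iwk: "integrable lborel (\<lambda>x. heat t w x * heat t (laplacian k) x)"
    and Ifg: "integrable lborel (\<lambda>x. heat t (partial j f) x * heat t (partial i g) x)"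
    by (intro heat_product_parts(2)[where e=i] f k w g i j test_laplacian test_partial)+
  have f': "heat t (laplacian w) x = heat t f x" for x by (simp add: f_def)
  define Q1 where "Q1 = (\<lambda>x. \<Sum>e\<in>Basis. (Buu (heat t f x) (heat t g x) * heat t (partial e f) x
      + Buv (heat t f x) (heat t g x) * heat t (partial e g) x) * heat t (partial e f) x)"
  define Q2 where "Q2 = (\<lambda>x. \<Sum>e\<in>Basis. (Buv (heat t f x) (heat t g x) * heat t (partial e f) x
      + Bvv (heat t f x) (heat t g x) * heat t (partial e g) x) * heat t (partial e g) x)"
  have e1: "(\<integral>x. Bu (heat t f x) (heat t g x) * heat t (laplacian f) x \<partial>lborel) = - (\<integral>x. Q1 x \<partial>lborel)"
    unfolding Q1_def by (rule gp1(1))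
  have e2: "(\<integral>x. Bv (heat t f x) (heat t g x) * heat t (laplacian g) x \<partial>lborel) = - (\<integral>x. Q2 x \<partial>lborel)"
    unfolding Q2_def by (rule gp2(1))
  have I1: "integrable lborel Q1" unfolding Q1_def by (rule gp1(2))
  have I2: "integrable lborel Q2" unfolding Q2_def by (rule gp2(2))
  show "integrable lborel (energy_dt s f g w k t)"
    unfolding energy_dt_def[abs_def] f'
    by (intro Bochner_Integration.integrable_add integrable_mult_right gp1(3) gp2(3) Ifk Iwk)
  have "(\<integral>x. energy_dt s f g w k t x \<partial>lborel)
    = (\<integral>x. Bu (heat t f x) (heat t g x) * heat t (laplacian f) x \<partial>lborel)
      + (\<integral>x. Bv (heat t f x) (heat t g x) * heat t (laplacian g) x \<partial>lborel)
      + s * c * ((\<integral>x. heat t f x * heat t k x \<partial>lborel) + (\<integral>x. heat t w x * heat t (laplacian k) x \<partial>lborel))"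
    unfolding energy_dt_def f' by (simp add: gp1(3) gp2(3) Ifk Iwk)
  also have "\<dots> = - (\<integral>x. Q1 x \<partial>lborel) + - (\<integral>x. Q2 x \<partial>lborel)
      + s * c * ((\<integral>x. heat t f x * heat t k x \<partial>lborel) + (\<integral>x. heat t f x * heat t k x \<partial>lborel))"
    by (simp only: e1 e2 wk)
  also have "\<dots> = (\<integral>x. - (Q1 x + Q2 x + 2 * s * c * (heat t (partial j f) x * heat t (partial i g) x)) \<partial>lborel)"
    unfolding fk by (simp add: I1 I2 Ifg)
  also have "\<dots> \<le> 0"
  proof (rule integral_nonpos)
    fix x
    have "2 * c * \<bar>heat t (partial j f) x * heat t (partial i g) x\<bar> \<le> Q1 x + Q2 x"
      using hess_sum[OF i j, of "\<lambda>e. heat t (partial e f) x" "\<lambda>e. heat t (partial e g) x" "heat t f x" "heat t g x"]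
      unfolding Q1_def Q2_def sum.distrib[symmetric] by (simp add: power2_eq_square algebra_simps)
    moreover have "\<bar>2 * s * c * (heat t (partial j f) x * heat t (partial i g) x)\<bar> = 2 * c * \<bar>heat t (partial j f) x * heat t (partial i g) x\<bar>"
      using s c by (simp add: abs_mult)
    ultimately show "- (Q1 x + Q2 x + 2 * s * c * (heat t (partial j f) x * heat t (partial i g) x)) \<le> 0"
      by linarith
  qed
  finally show "(\<integral>x. energy_dt s f g w k t x \<partial>lborel) \<le> 0" .
qed

lemma energy_integrable:
  fixes f g w k :: "'a::euclidean_space \<Rightarrow> real"
  assumes f: "test_function f" and g: "test_function g" and w: "test_function w" and k: "test_function k"
  shows "integrable lborel (\<lambda>x. B (heat t f x) (heat t g x) - B 0 0)"
    and "integrable lborel (energy s f g w k t)"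
proof -
  obtain M where M: "M > 0" "\<And>x. \<bar>f x\<bar> \<le> M" using test_bounded[OF f] by blast
  obtain N where N: "N > 0" "\<And>x. \<bar>g x\<bar> \<le> N" using test_bounded[OF g] by blast
  obtain K where K: "K > 0" "\<And>u v. \<bar>u\<bar> \<le> M \<Longrightarrow> \<bar>v\<bar> \<le> N \<Longrightarrow> \<bar>B u v - B 0 0\<bar> \<le> K * (\<bar>u\<bar> + \<bar>v\<bar>)"
    using B_lipschitz by metis
  show 1: "integrable lborel (\<lambda>x. B (heat t f x) (heat t g x) - B 0 0)"
  proof (rule Bochner_Integration.integrable_bound)
    show "integrable lborel (\<lambda>x. K * (\<bar>heat t f x\<bar> + \<bar>heat t g x\<bar>))"
      by (intro integrable_mult_right Bochner_Integration.integrable_add integrable_abs integrable_heat f g)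
    show "(\<lambda>x. B (heat t f x) (heat t g x) - B 0 0) \<in> borel_measurable lborel"
      using continuous_borel[OF comp_continuous_x[OF cont(1) f g]] by simp
    show "AE x in lborel. norm (B (heat t f x) (heat t g x) - B 0 0) \<le> norm (K * (\<bar>heat t f x\<bar> + \<bar>heat t g x\<bar>))"
      by (intro AE_I2) (simp add: order_trans[OF K(2)[OF heat_bound[OF f M(2)] heat_bound[OF g N(2)]] abs_ge_self])
  qed
  show "integrable lborel (energy s f g w k t)"
    unfolding energy_def[abs_def]
    using heat_product_parts(2)[OF w k] nonempty_Basis
    by (intro Bochner_Integration.integrable_add 1 integrable_mult_right) blast
qed

text \<open>Uniformity in t, which comes from the L1 contraction of the heat flow, is what allows
  the integrals over time and space to be exchanged.\<close>

lemma energy_dt_L1: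
  fixes f g w k :: "'a::euclidean_space \<Rightarrow> real"
  assumes f: "test_function f" and g: "test_function g" and w: "test_function w" and k: "test_function k"
  obtains K where "\<And>t. (\<integral>\<^sup>+x. ennreal \<bar>energy_dt s f g w k t x\<bar> \<partial>lborel) \<le> ennreal K"
proof -
  obtain M where M: "M > 0" "\<And>x. \<bar>f x\<bar> \<le> M" using test_bounded[OF f] by blast
  obtain N where N: "N > 0" "\<And>x. \<bar>g x\<bar> \<le> N" using test_bounded[OF g] by blast
  obtain Mw where Mw: "Mw > 0" "\<And>x. \<bar>w x\<bar> \<le> Mw" using test_bounded[OF w] by blast
  obtain Mk where Mk: "Mk > 0" "\<And>x. \<bar>k x\<bar> \<le> Mk" using test_bounded[OF k] by blast
  obtain K1 where K1: "K1 > 0" "\<And>u v. \<bar>u\<bar> \<le> M \<Longrightarrow> \<bar>v\<bar> \<le> N \<Longrightarrow> \<bar>Bu u v\<bar> \<le> K1"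
    using bounded_comp[OF cont(2)] by metis
  obtain K2 where K2: "K2 > 0" "\<And>u v. \<bar>u\<bar> \<le> M \<Longrightarrow> \<bar>v\<bar> \<le> N \<Longrightarrow> \<bar>Bv u v\<bar> \<le> K2"
    using bounded_comp[OF cont(3)] by metis
  let ?n = "\<lambda>f::'a \<Rightarrow> real. \<integral>x. \<bar>f x\<bar> \<partial>lborel"
  let ?S = "\<bar>s * c\<bar>"
  let ?G = "\<lambda>t x. K1 * \<bar>heat t (laplacian f) x\<bar> + K2 * \<bar>heat t (laplacian g) x\<bar>
    + (?S * Mk * \<bar>heat t (laplacian w) x\<bar> + ?S * Mw * \<bar>heat t (laplacian k) x\<bar>)"
  note l = test_laplacian[OF f] test_laplacian[OF g] test_laplacian[OF w] test_laplacian[OF k]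
  show ?thesis
  proof (rule that)
    fix t
    have le: "\<bar>energy_dt s f g w k t x\<bar> \<le> ?G t x" for x
    proof -
      have "\<bar>Bu (heat t f x) (heat t g x) * heat t (laplacian f) x\<bar> \<le> K1 * \<bar>heat t (laplacian f) x\<bar>"
        unfolding abs_mult by (intro mult_right_mono K1 heat_bound f g M N) simp
      moreover have "\<bar>Bv (heat t f x) (heat t g x) * heat t (laplacian g) x\<bar> \<le> K2 * \<bar>heat t (laplacian g) x\<bar>"
        unfolding abs_mult by (intro mult_right_mono K2 heat_bound f g M N) simp
      moreover have "\<bar>s * c * (heat t (laplacian w) x * heat t k x)\<bar> \<le> ?S * Mk * \<bar>heat t (laplacian w) x\<bar>"
        using mult_left_mono[OF heat_bound[OF k Mk(2), of t x], of "?S * \<bar>heat t (laplacian w) x\<bar>"]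
        by (simp add: abs_mult mult_ac)
      moreover have "\<bar>s * c * (heat t w x * heat t (laplacian k) x)\<bar> \<le> ?S * Mw * \<bar>heat t (laplacian k) x\<bar>"
        using mult_left_mono[OF heat_bound[OF w Mw(2), of t x], of "?S * \<bar>heat t (laplacian k) x\<bar>"]
        by (simp add: abs_mult mult_ac)
      ultimately show ?thesis unfolding energy_dt_def distrib_left by linarith
    qed
    have I: "integrable lborel (?G t)"
      by (intro Bochner_Integration.integrable_add integrable_mult_right integrable_abs integrable_heat l)
    have "(\<integral>\<^sup>+x. ennreal \<bar>energy_dt s f g w k t x\<bar> \<partial>lborel) \<le> (\<integral>\<^sup>+x. ennreal (?G t x) \<partial>lborel)"
      by (intro nn_integral_mono ennreal_leI le)
    also have "\<dots> = ennreal (\<integral>x. ?G t x \<partial>lborel)"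
      using I K1 K2 Mk Mw by (intro nn_integral_eq_integral AE_I2) auto
    also have "(\<integral>x. ?G t x \<partial>lborel) = K1 * ?n (heat t (laplacian f)) + K2 * ?n (heat t (laplacian g))
        + (?S * Mk * ?n (heat t (laplacian w)) + ?S * Mw * ?n (heat t (laplacian k)))"
      using integrable_heat[OF l(1)] integrable_heat[OF l(2)] integrable_heat[OF l(3)] integrable_heat[OF l(4)]
      by simp
    also have "\<dots> \<le> K1 * ?n (laplacian f) + K2 * ?n (laplacian g) + (?S * Mk * ?n (laplacian w) + ?S * Mw * ?n (laplacian k))"
      using K1 K2 Mk Mw by (intro add_mono mult_left_mono heat_L1 l) auto
    finally show "(\<integral>\<^sup>+x. ennreal \<bar>energy_dt s f g w k t x\<bar> \<partial>lborel) \<le> ennreal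
        (K1 * ?n (laplacian f) + K2 * ?n (laplacian g) + (?S * Mk * ?n (laplacian w) + ?S * Mw * ?n (laplacian k)))"
      by (simp add: ennreal_leI)
  qed
qed

lemma energy_dt_continuous:
  fixes f g w k :: "'a::euclidean_space \<Rightarrow> real"
  assumes t: "test_function f" "test_function g" "test_function w" "test_function k"
  shows "continuous_on UNIV (\<lambda>(t, x). energy_dt s f g w k t x)"
proof -
  note l = t(1)[THEN test_laplacian] t(2)[THEN test_laplacian] t(3)[THEN test_laplacian] t(4)[THEN test_laplacian]
  note h = heat_continuous[OF t(1)] heat_continuous[OF t(2)] heat_continuous[OF t(3)] heat_continuous[OF t(4)]
    heat_continuous[OF l(1)] heat_continuous[OF l(2)] heat_continuous[OF l(3)] heat_continuous[OF l(4)]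
    comp_continuous[OF cont(2) t(1,2)] comp_continuous[OF cont(3) t(1,2)]
  show ?thesis
    using h unfolding energy_dt_def case_prod_beta by (intro continuous_intros)
qed

text \<open>At each x the fundamental theorem applies on [0, T], as the energy is differentiable for
  t > 0 and continuous up to 0. Exchanging the integrals puts the space integral inside, where
  \<open>energy_dt_integral\<close> gives the sign.\<close>

lemma energy_decreasing:
  fixes g w :: "'a::euclidean_space \<Rightarrow> real"
  assumes g: "test_function g" and w: "test_function w" and i: "i \<in> Basis" and j: "j \<in> Basis"
    and s: "\<bar>s\<bar> = 1" and T: "0 \<le> T"
  defines "f \<equiv> laplacian w" and "k \<equiv> partial j (partial i g)"
  shows "(\<integral>x. energy s f g w k T x \<partial>lborel) \<le> (\<integral>x. energy s f g w k 0 x \<partial>lborel)"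
proof -
  have f: "test_function f" unfolding f_def by (rule test_laplacian[OF w])
  have k: "test_function k" unfolding k_def by (intro test_partial g i j)
  define G where "G x t = indicat_real {0..T} t * energy_dt s f g w k t x" for x t
  note c2 = energy_dt_continuous[OF f g w k, of s]
  have ct: "continuous_on A (\<lambda>t. energy_dt s f g w k t x)" for A x
    using continuous_on_compose2[OF c2, of A "\<lambda>t. (t, x)"] continuous_on_Pair[OF continuous_on_id continuous_on_const]
    by auto
  have ce: "continuous_on A (\<lambda>t. energy s f g w k t x)" for A x
  proof -
    have "continuous_on A (\<lambda>t. B (heat t f x) (heat t g x))"
      using continuous_on_compose2[OF comp_continuous[OF cont(1) f g], of A "\<lambda>t. (t, x)"]
        continuous_on_Pair[OF continuous_on_id continuous_on_const] by auto
    then show ?thesis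
      unfolding energy_def by (intro continuous_intros heat_continuous_t w k)
  qed
  have Gx: "(\<integral>t. G x t \<partial>lborel) = energy s f g w k T x - energy s f g w k 0 x" for x
    unfolding G_def
    by (rule FTC_interior(1)[OF T ce energy_has_derivative[OF f g w k] ct])
  have [measurable]: "(\<lambda>(t, x). energy_dt s f g w k t x) \<in> borel_measurable (lborel \<Otimes>\<^sub>M lborel)"
    by (rule borel_measurable_pair_continuous[OF c2])
  have meas: "case_prod G \<in> borel_measurable (lborel \<Otimes>\<^sub>M lborel)"
    unfolding G_def by measurable
  obtain K where K: "\<And>t. (\<integral>\<^sup>+x. ennreal \<bar>energy_dt s f g w k t x\<bar> \<partial>lborel) \<le> ennreal K"
    using energy_dt_L1[OF f g w k] by metis
  have "(\<integral>\<^sup>+t. \<integral>\<^sup>+x. ennreal \<bar>G x t\<bar> \<partial>lborel \<partial>lborel) \<le> (\<integral>\<^sup>+t. ennreal K * indicator {0..T} t \<partial>lborel)"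
  proof (rule nn_integral_mono)
    fix t
    show "(\<integral>\<^sup>+x. ennreal \<bar>G x t\<bar> \<partial>lborel) \<le> ennreal K * indicator {0..T} t"
      using K[of t] by (cases "t \<in> {0..T}") (simp_all add: G_def)
  qed
  also have "\<dots> < \<infinity>"
    using T by (subst nn_integral_cmult_indicator) (auto simp: ennreal_mult_less_top)
  finally have fin: "(\<integral>\<^sup>+t. \<integral>\<^sup>+x. ennreal \<bar>G x t\<bar> \<partial>lborel \<partial>lborel) < \<infinity>" .
  have "(\<integral>x. energy s f g w k T x \<partial>lborel) - (\<integral>x. energy s f g w k 0 x \<partial>lborel) = (\<integral>x. \<integral>t. G x t \<partial>lborel \<partial>lborel)"
    by (simp add: Gx energy_integrable[OF f g w k])
  also have "\<dots> = (\<integral>t. \<integral>x. G x t \<partial>lborel \<partial>lborel)" by (rule lborel_fubini(3)[OF meas fin])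
  also have "\<dots> \<le> 0"
  proof (rule integral_nonpos)
    fix t show "(\<integral>x. G x t \<partial>lborel) \<le> 0"
      unfolding G_def using energy_dt_integral(1)[OF g w i j s, of t, folded f_def k_def]
      by (cases "t \<in> {0..T}") simp_all
  qed
  finally show ?thesis by simp
qed

text \<open>At time T the B part is nonnegative because B is minimal at the origin, and the product
  term is at most the sup of \<open>heat T k\<close>, which decays, times the L1 norm of w.
  Monotonicity carries this lower bound back to time 0, and T -> infinity shows that the initial
  energy is nonnegative. The two signs s give the absolute value.\<close>

theorem heat_flow_estimate:
  fixes g w :: "'a::euclidean_space \<Rightarrow> real"
  assumes g: "test_function g" and w: "test_function w" and i: "i \<in> Basis" and j: "j \<in> Basis"
  shows "c * \<bar>\<integral>x. w x * partial j (partial i g) x \<partial>lborel\<bar> \<le> (\<integral>x. B (laplacian w x) (g x) - B 0 0 \<partial>lborel)"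
proof -
  define f where "f = laplacian w"
  define k where "k = partial j (partial i g)"
  have f: "test_function f" unfolding f_def by (rule test_laplacian[OF w])
  have k: "test_function k" unfolding k_def by (intro test_partial g i j)
  obtain Mw where Mw: "Mw > 0" "\<And>x. \<bar>w x\<bar> \<le> Mw" using test_bounded[OF w] by blast
  define A where "A = c * Mw * (gam (0::'a) * (\<integral>x. \<bar>k x\<bar> \<partial>lborel))"
  define L where "L = c * (gam (0::'a) * (\<integral>x. \<bar>k x\<bar> \<partial>lborel)) * (\<integral>x. \<bar>w x\<bar> \<partial>lborel)"
  have L0: "0 \<le> L" unfolding L_def using c less_imp_le[OF gam_pos] by (intro mult_nonneg_nonneg) auto
  have lower: "- L / sqrt T ^ DIM('a) \<le> (\<integral>x. energy s f g w k 0 x \<partial>lborel)" if s: "\<bar>s\<bar> = 1" and T: "0 < T" for s T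
  proof -
    let ?D = "gam (0::'a) * (\<integral>x. \<bar>k x\<bar> \<partial>lborel) / sqrt T ^ DIM('a)"
    have D: "\<bar>heat T k x\<bar> \<le> ?D" for x by (rule heat_decay[OF k T])
    have hk: "heat T k \<in> borel_measurable borel"
      by (rule continuous_borel[OF heat_continuous_x[OF k]])
    have "(\<integral>x. \<bar>heat T k x * heat T w x\<bar> \<partial>lborel) \<le> ?D * (\<integral>x. \<bar>heat T w x\<bar> \<partial>lborel)"
      by (rule integral_bounded_mult_le[OF hk D integrable_heat[OF w]])
    then have "- (c * (?D * (\<integral>x. \<bar>heat T w x\<bar> \<partial>lborel))) \<le> - (c * (\<integral>x. \<bar>heat T k x * heat T w x\<bar> \<partial>lborel))"
      using c by (simp only: neg_le_iff_le mult_le_cancel_left_pos)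
    also have "\<dots> = (\<integral>x. - (c * \<bar>heat T k x * heat T w x\<bar>) \<partial>lborel)" by simp
    also have "\<dots> \<le> (\<integral>x. energy s f g w k T x \<partial>lborel)"
    proof (rule integral_mono)
      have "integrable lborel (\<lambda>x. heat T k x * heat T w x)"
        by (rule integrable_bounded_mult[OF hk D integrable_heat[OF w]])
      then show "integrable lborel (\<lambda>x. - (c * \<bar>heat T k x * heat T w x\<bar>))" by simp
      fix x
      have "\<bar>s * c * (heat T w x * heat T k x)\<bar> = c * \<bar>heat T k x * heat T w x\<bar>"
        using s c by (simp add: abs_mult mult_ac)
      then show "- (c * \<bar>heat T k x * heat T w x\<bar>) \<le> energy s f g w k T x"
        using min[of "heat T f x" "heat T g x"] unfolding energy_def by linarith
    qed (rule energy_integrable[OF f g w k])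
    also have "\<dots> \<le> (\<integral>x. energy s f g w k 0 x \<partial>lborel)"
      unfolding f_def k_def using energy_decreasing[OF g w i j s] T by simp
    finally have *: "- (c * (?D * (\<integral>x. \<bar>heat T w x\<bar> \<partial>lborel))) \<le> (\<integral>x. energy s f g w k 0 x \<partial>lborel)" .
    have "c * (?D * (\<integral>x. \<bar>heat T w x\<bar> \<partial>lborel)) \<le> c * (?D * (\<integral>x. \<bar>w x\<bar> \<partial>lborel))"
      using c T less_imp_le[OF gam_pos]
      by (intro mult_left_mono heat_L1 w divide_nonneg_nonneg mult_nonneg_nonneg) auto
    also have "\<dots> = L / sqrt T ^ DIM('a)" by (simp add: L_def)
    finally show ?thesis using * by simp
  qed
  have pos: "0 \<le> (\<integral>x. energy s f g w k 0 x \<partial>lborel)" if s: "\<bar>s\<bar> = 1" for s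
  proof (rule ccontr)
    assume "\<not> 0 \<le> (\<integral>x. energy s f g w k 0 x \<partial>lborel)"
    then obtain a where a: "a > 0" "(\<integral>x. energy s f g w k 0 x \<partial>lborel) = - a"
      by (metis minus_minus neg_0_less_iff_less not_le)
    \<comment> \<open>A time at which the lower bound exceeds -a: sqrt T = 1 + L / a is at least 1,
      so its d-th power is still larger than L / a.\<close>
    define T where "T = (1 + L / a)\<^sup>2"
    have r: "sqrt T = 1 + L / a" unfolding T_def using L0 a by (simp add: real_sqrt_abs)
    then have T0: "0 < T" using L0 a by (metis add_pos_nonneg divide_nonneg_pos real_sqrt_gt_0_iff zero_less_one)
    have "1 + L / a \<le> sqrt T ^ DIM('a)"
      unfolding r using L0 a by (intro self_le_power) auto
    then have "L < a * sqrt T ^ DIM('a)"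
      using mult_left_mono[of "1 + L / a" "sqrt T ^ DIM('a)" a] a by (simp add: distrib_left)
    moreover have "0 < sqrt T ^ DIM('a)" using T0 by simp
    ultimately have "L / sqrt T ^ DIM('a) < a" by (simp add: field_simps)
    then show False using lower[OF s T0] a by simp
  qed
  have e0: "(\<integral>x. energy s f g w k 0 x \<partial>lborel) = (\<integral>x. B (f x) (g x) - B 0 0 \<partial>lborel) + s * c * (\<integral>x. w x * k x \<partial>lborel)" for s
  proof -
    have "integrable lborel (\<lambda>x. heat 0 w x * heat 0 k x)" by (rule heat_product_parts(2)[OF w k i])
    then show ?thesis
      using energy_integrable(1)[OF f g w k, of 0] unfolding energy_def heat_0 by simp
  qed
  have "\<bar>c * (\<integral>x. w x * k x \<partial>lborel)\<bar> \<le> (\<integral>x. B (f x) (g x) - B 0 0 \<partial>lborel)"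
    using pos[of 1] pos[of "-1"] unfolding e0 by simp
  then show ?thesis using c by (simp add: abs_mult f_def k_def)
qed

end

text \<open>A smooth Bellman function of Nazarov--Treil type. The letters \<open>u\<close>, \<open>v\<close> appended to \<open>B\<close> denote
  partial derivatives, \<open>\<kappa>\<close> removes the singularities at \<open>0\<close>, and \<open>C\<close> is so large that
  the second summand of \<open>B\<close> compensates the lack of convexity of the third one in \<open>v\<close>.\<close>

locale bellman_function =
  fixes p q \<kappa> :: real
  assumes p: "2 \<le> p" and pq: "(p - 1) * (q - 1) = 1" and \<kappa>: "0 < \<kappa>"
begin

definition "P r u = (u\<^sup>2 + \<kappa>) powr r"
text \<open>With a = u^2 + \<kappa> and b = v^2 + \<kappa> this is b (b^(q-1) + a). For small
  \<kappa> its root is comparable to |v|^q where |u| <= |v|^(q-1) and to |u v| elsewhere; the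
  interface is |u|^p = |v|^q because p (q - 1) = q. The root is thus a smooth substitute for a
  function defined by cases on the two sides.\<close>

definition "S u v = P q v + (u\<^sup>2 + \<kappa>) * (v\<^sup>2 + \<kappa>)"
definition "T r u v = S u v powr r"
text \<open>Half of the v-derivative of \<open>S u v\<close>, divided by v.\<close>

definition "E u v = q * P (q - 1) v + (u\<^sup>2 + \<kappa>)"
definition "C = 9 / (q * (q - 1))"
definition "B u v = P (p / 2) u + C * P (q / 2) v + T (1 / 2) u v"
definition "Bu u v = p * u * P (p / 2 - 1) u + u * (v\<^sup>2 + \<kappa>) * T (- 1 / 2) u v"
definition "Bv u v = C * q * v * P (q / 2 - 1) v + v * E u v * T (- 1 / 2) u v"
definition "Buu u v = p * P (p / 2 - 1) u + p * (p - 2) * u\<^sup>2 * P (p / 2 - 2) u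
  + ((v\<^sup>2 + \<kappa>) * T (- 1 / 2) u v - u\<^sup>2 * (v\<^sup>2 + \<kappa>)\<^sup>2 * T (- 3 / 2) u v)"
definition "Buv u v = 2 * u * v * T (- 1 / 2) u v - u * v * (v\<^sup>2 + \<kappa>) * E u v * T (- 3 / 2) u v"
definition "Bvv u v = C * (q * P (q / 2 - 1) v + q * (q - 2) * v\<^sup>2 * P (q / 2 - 2) v)
  + ((E u v + 2 * q * (q - 1) * v\<^sup>2 * P (q - 2) v) * T (- 1 / 2) u v - v\<^sup>2 * (E u v)\<^sup>2 * T (- 3 / 2) u v)"

lemma q: "1 < q" "q \<le> 2"
proof -
  have "0 < p - 1" using p by simp
  then have "q - 1 = 1 / (p - 1)" "0 < 1 / (p - 1)" "1 / (p - 1) \<le> 1" using pq p by (simp_all add: field_simps)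
  then show "1 < q" "q \<le> 2" by linarith+
qed

lemma pos: "0 < u\<^sup>2 + \<kappa>"
  using \<kappa> by (simp add: add_nonneg_pos)

lemma S_pos: "0 < S u v"
  unfolding S_def P_def by (intro add_pos_pos mult_pos_pos pos) (simp add: pos less_imp_neq[OF pos, symmetric])

lemma deriv_P:
  assumes "(f has_real_derivative f') (at s)"
  shows "((\<lambda>s. P r (f s)) has_real_derivative 2 * r * f s * P (r - 1) (f s) * f') (at s)"
proof -
  have "((\<lambda>s. (f s)\<^sup>2 + \<kappa>) has_real_derivative 2 * f s * f') (at s)"
    using assms by (auto intro!: derivative_eq_intros)
  from DERIV_fun_powr[OF this pos, of r] show ?thesis unfolding P_def by (simp add: mult_ac)
qed

lemma deriv_S:
  assumes f: "(f has_real_derivative f') (at s)" and g: "(g has_real_derivative g') (at s)"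
  shows "((\<lambda>s. S (f s) (g s)) has_real_derivative 2 * f s * ((g s)\<^sup>2 + \<kappa>) * f' + 2 * g s * E (f s) (g s) * g') (at s)"
  unfolding S_def
  by (rule derivative_eq_intros deriv_P f g refl)+ (simp add: E_def algebra_simps)

lemma deriv_T:
  assumes f: "(f has_real_derivative f') (at s)" and g: "(g has_real_derivative g') (at s)"
  shows "((\<lambda>s. T r (f s) (g s)) has_real_derivative
    r * T (r - 1) (f s) (g s) * (2 * f s * ((g s)\<^sup>2 + \<kappa>) * f' + 2 * g s * E (f s) (g s) * g')) (at s)"
  using DERIV_fun_powr[OF deriv_S[OF f g] S_pos, of r] unfolding T_def by simp

lemma deriv_E:
  assumes f: "(f has_real_derivative f') (at s)" and g: "(g has_real_derivative g') (at s)"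
  shows "((\<lambda>s. E (f s) (g s)) has_real_derivative 2 * q * (q - 1) * g s * P (q - 2) (g s) * g' + 2 * f s * f') (at s)"
  unfolding E_def
  by (rule derivative_eq_intros deriv_P f g refl)+ (simp add: algebra_simps)

lemma deriv_B:
  assumes f: "(f has_real_derivative f') (at s)" and g: "(g has_real_derivative g') (at s)"
  shows "((\<lambda>s. B (f s) (g s)) has_real_derivative Bu (f s) (g s) * f' + Bv (f s) (g s) * g') (at s)"
proof -
  have "((\<lambda>s. B (f s) (g s)) has_real_derivative
      2 * (p / 2) * f s * P (p / 2 - 1) (f s) * f' + C * (2 * (q / 2) * g s * P (q / 2 - 1) (g s) * g')
      + (1 / 2) * T (1 / 2 - 1) (f s) (g s) * (2 * f s * ((g s)\<^sup>2 + \<kappa>) * f' + 2 * g s * E (f s) (g s) * g')) (at s)"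
    unfolding B_def by (intro DERIV_add DERIV_cmult deriv_P deriv_T f g)
  then show ?thesis by (simp add: Bu_def Bv_def algebra_simps)
qed

lemma deriv_Bu:
  assumes f: "(f has_real_derivative f') (at s)" and g: "(g has_real_derivative g') (at s)"
  shows "((\<lambda>s. Bu (f s) (g s)) has_real_derivative Buu (f s) (g s) * f' + Buv (f s) (g s) * g') (at s)"
proof -
  have c: "p / 2 - 1 - 1 = p / 2 - 2" "- 1 / 2 - 1 = (- 3 / 2 :: real)" by simp_all
  show ?thesis
    unfolding Bu_def
    by (rule derivative_eq_intros deriv_P deriv_T f g refl)+
      (simp add: Buu_def Buv_def c, simp add: algebra_simps power2_eq_square)
qed

lemma deriv_Bv:
  assumes f: "(f has_real_derivative f') (at s)" and g: "(g has_real_derivative g') (at s)"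
  shows "((\<lambda>s. Bv (f s) (g s)) has_real_derivative Buv (f s) (g s) * f' + Bvv (f s) (g s) * g') (at s)"
proof -
  have c: "q / 2 - 1 - 1 = q / 2 - 2" "- 1 / 2 - 1 = (- 3 / 2 :: real)" by simp_all
  show ?thesis
    unfolding Bv_def
    by (rule derivative_eq_intros deriv_P deriv_T deriv_E f g refl)+
      (simp add: Bvv_def Buv_def c, simp add: algebra_simps power2_eq_square)
qed

lemma continuous_P: "continuous_on UNIV f \<Longrightarrow> continuous_on UNIV (\<lambda>x. P r (f x))"
  unfolding P_def by (intro continuous_intros) (use pos less_imp_neq[OF pos, symmetric] in auto)

lemma continuous_S: "continuous_on UNIV f \<Longrightarrow> continuous_on UNIV g \<Longrightarrow> continuous_on UNIV (\<lambda>x. S (f x) (g x))"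
  unfolding S_def by (intro continuous_intros continuous_P)

lemma continuous_T: "continuous_on UNIV f \<Longrightarrow> continuous_on UNIV g \<Longrightarrow> continuous_on UNIV (\<lambda>x. T r (f x) (g x))"
  unfolding T_def by (intro continuous_intros continuous_S) (use S_pos less_imp_neq[OF S_pos, symmetric] in auto)

lemma continuous_E: "continuous_on UNIV f \<Longrightarrow> continuous_on UNIV g \<Longrightarrow> continuous_on UNIV (\<lambda>x. E (f x) (g x))"
  unfolding E_def by (intro continuous_intros continuous_P)

text \<open>With a = u^2 + \<kappa>, b = v^2 + \<kappa> and \<beta> = b^(q-1), the weight is \<tau>
  = b^(1-q/2). Its reciprocal is the size of the second v-derivative of \<open>P (q / 2)\<close>. In
  the u-direction a lower bound of order \<tau> comes from the root of \<open>S\<close> when a <=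
  \<beta> and from the power |u|^p otherwise. The mixed derivative is at most 1, which is the
  geometric mean of \<tau> and 1 / \<tau>.\<close>

lemma hessian:
  obtains \<tau> where "\<tau> > 0" "\<And>x y. 1 / 6 * (\<tau> * x\<^sup>2 + y\<^sup>2 / \<tau>) \<le> Buu u v * x\<^sup>2 + 2 * Buv u v * x * y + Bvv u v * y\<^sup>2"
proof -
  define a where "a = u\<^sup>2 + \<kappa>"
  define b where "b = v\<^sup>2 + \<kappa>"
  define \<beta> where "\<beta> = b powr (q - 1)"
  define r where "r = \<beta> + a"
  define m where "m = (q - 1) * \<beta>"
  define \<tau> where "\<tau> = sqrt b / sqrt \<beta>"
  have a0: "0 < a" and b0: "0 < b" unfolding a_def b_def by (rule pos)+
  have \<beta>0: "0 < \<beta>" using b0 by (simp add: \<beta>_def)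
  have r0: "0 < r" and \<beta>r: "\<beta> \<le> r" and ar: "a \<le> r" using a0 \<beta>0 by (auto simp: r_def)
  have m0: "0 \<le> m" and m\<beta>: "m \<le> \<beta>" using q \<beta>0 mult_right_mono[of "q - 1" 1 \<beta>] by (auto simp: m_def)
  have \<tau>0: "0 < \<tau>" using b0 \<beta>0 by (simp add: \<tau>_def)
  have bq: "b powr q = b * \<beta>" using b0 powr_add[of b 1 "q - 1"] by (simp add: \<beta>_def)
  have S: "S u v = b * r"
    unfolding S_def P_def a_def[symmetric] b_def[symmetric] bq r_def by (simp add: algebra_simps)
  have S0: "0 < b * r" using b0 r0 by simp
  have T1: "T (- 1 / 2) u v = 1 / sqrt (b * r)"
    using S0 by (simp add: T_def S powr_half_sqrt[symmetric] powr_minus_divide)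
  have T3: "T (- 3 / 2) u v = 1 / (b * r * sqrt (b * r))"
  proof -
    have "(b * r) powr (- 1 / 2 + - 1) = (b * r) powr (- 1 / 2) * (b * r) powr (- 1)"
      by (rule powr_add)
    also have "(- 1 / 2 + - 1 :: real) = - 3 / 2" by simp
    also have "(b * r) powr (- 1) = 1 / (b * r)" using S0 powr_minus_divide[of "b * r" 1] by simp
    finally show ?thesis using T1 by (simp add: T_def S)
  qed
  have E: "E u v = r + m"
    unfolding E_def P_def a_def[symmetric] b_def[symmetric] \<beta>_def[symmetric] r_def m_def
    by (simp add: algebra_simps)
  have sq: "sqrt (b * r) = sqrt b * sqrt r" by (simp add: real_sqrt_mult)
  have ub: "u\<^sup>2 \<le> a" and vb: "v\<^sup>2 \<le> b" using \<kappa> by (auto simp: a_def b_def)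
  have sb: "sqrt b * sqrt b = b" and sr: "sqrt r * sqrt r = r" and s\<beta>: "sqrt \<beta> * sqrt \<beta> = \<beta>"
    using b0 r0 \<beta>0 by simp_all
  have sb0: "0 < sqrt b" and sr0: "0 < sqrt r" and s\<beta>0: "0 < sqrt \<beta>" using b0 r0 \<beta>0 by simp_all
  have Pq: "P (q / 2 - 1) v = 1 / \<tau>"
  proof -
    have "sqrt \<beta> = b powr ((q - 1) / 2)" using b0 by (simp add: \<beta>_def powr_half_sqrt[symmetric] powr_powr)
    then have "1 / \<tau> = b powr ((q - 1) / 2) / b powr (1 / 2)" using b0 by (simp add: \<tau>_def powr_half_sqrt)
    also have "\<dots> = b powr ((q - 1) / 2 - 1 / 2)" by (simp add: powr_diff)
    also have "(q - 1) / 2 - 1 / 2 = q / 2 - 1" by (simp add: field_simps)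
    finally show ?thesis by (simp add: P_def b_def)
  qed
  have uu: "(v\<^sup>2 + \<kappa>) * T (- 1 / 2) u v - u\<^sup>2 * (v\<^sup>2 + \<kappa>)\<^sup>2 * T (- 3 / 2) u v = sqrt b * (r - u\<^sup>2) / (r * sqrt r)"
  proof -
    have "b * (1 / sqrt (b * r)) - u\<^sup>2 * b\<^sup>2 * (1 / (b * r * sqrt (b * r))) = (b / sqrt (b * r)) * ((r - u\<^sup>2) / r)"
      using b0 r0 by (simp add: field_simps power2_eq_square)
    also have "b / sqrt (b * r) = sqrt b / sqrt r"
      unfolding sq using sb0 sr0 sb by (simp add: field_simps)
    finally show ?thesis unfolding T1 T3 b_def[symmetric] by (simp add: mult_ac)
  qed
  have uu0: "sqrt b * \<beta> / (r * sqrt r) \<le> sqrt b * (r - u\<^sup>2) / (r * sqrt r)"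
    using ub b0 r0 by (intro divide_right_mono mult_left_mono) (auto simp: r_def)
  have uv: "\<bar>Buv u v\<bar> \<le> 1"
  proof -
    have "Buv u v = u * v / sqrt (b * r) * (1 - m / r)"
      unfolding Buv_def T1 T3 E b_def[symmetric] using b0 r0 by (simp add: field_simps)
    moreover have "\<bar>u * v\<bar> \<le> sqrt (b * r)"
    proof (rule real_le_rsqrt)
      have "u\<^sup>2 * v\<^sup>2 \<le> r * b" using ub vb ar a0 b0 by (intro mult_mono) auto
      then show "\<bar>u * v\<bar>\<^sup>2 \<le> b * r" by (simp add: power_mult_distrib mult.commute)
    qed
    then have "\<bar>u * v / sqrt (b * r)\<bar> \<le> 1" using S0 by (simp add: divide_le_eq)
    moreover have "\<bar>1 - m / r\<bar> \<le> 1" using m0 m\<beta> \<beta>r r0 by (simp add: field_simps abs_le_iff)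
    ultimately show ?thesis
      using mult_mono[of "\<bar>u * v / sqrt (b * r)\<bar>" 1 "\<bar>1 - m / r\<bar>" 1] by (simp add: abs_mult)
  qed
  \<comment> \<open>The negative term is largest for v^2 = b, where (r + m) - (r + m)^2 / r = -(r +
    m) m / r >= -2 m >= -2 \<beta>. Dividing by sqrt (b r) and using r >= \<beta> turns 2 \<beta>
    into at most 2 / \<tau>.\<close>
  have vv: "- (2 / \<tau>) \<le> (E u v + 2 * q * (q - 1) * v\<^sup>2 * P (q - 2) v) * T (- 1 / 2) u v - v\<^sup>2 * (E u v)\<^sup>2 * T (- 3 / 2) u v"
  proof -
    have "(r + m)\<^sup>2 * v\<^sup>2 / (b * r) \<le> (r + m)\<^sup>2 * b / (b * r)"
      using vb b0 r0 by (intro divide_right_mono mult_left_mono) auto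
    also have "\<dots> = (r + m) * (1 + m / r)" using b0 r0 by (simp add: field_simps power2_eq_square)
    finally have 1: "(r + m) * v\<^sup>2 * (r + m) / (b * r) \<le> (r + m) + (r + m) * (m / r)"
      by (simp add: power2_eq_square algebra_simps)
    have "(r + m) * (m / r) \<le> (2 * r) * (m / r)" using m0 m\<beta> \<beta>r r0 by (intro mult_right_mono) auto
    also have "\<dots> = 2 * m" using r0 by simp
    finally have 2: "- (2 * \<beta>) \<le> (r + m) - (r + m) * v\<^sup>2 * (r + m) / (b * r)" using 1 m\<beta> by linarith
    have "0 \<le> 2 * q * (q - 1) * v\<^sup>2 * P (q - 2) v" using q by (simp add: P_def)
    then have "- (2 * \<beta>) \<le> (r + m) + 2 * q * (q - 1) * v\<^sup>2 * P (q - 2) v - (r + m) * v\<^sup>2 * (r + m) / (b * r)"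
      using 2 by linarith
    then have "- (2 * \<beta>) / sqrt (b * r) \<le> ((r + m) + 2 * q * (q - 1) * v\<^sup>2 * P (q - 2) v - (r + m) * v\<^sup>2 * (r + m) / (b * r)) / sqrt (b * r)"
      using S0 by (intro divide_right_mono) auto
    also have "\<dots> = (E u v + 2 * q * (q - 1) * v\<^sup>2 * P (q - 2) v) * T (- 1 / 2) u v - v\<^sup>2 * (E u v)\<^sup>2 * T (- 3 / 2) u v"
      unfolding T1 T3 E by (simp add: diff_divide_distrib power2_eq_square mult_ac)
    finally have 3: "- (2 * \<beta>) / sqrt (b * r) \<le> (E u v + 2 * q * (q - 1) * v\<^sup>2 * P (q - 2) v) * T (- 1 / 2) u v - v\<^sup>2 * (E u v)\<^sup>2 * T (- 3 / 2) u v" .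
    have "\<beta> / sqrt (b * r) \<le> \<beta> / (sqrt b * sqrt \<beta>)"
      unfolding sq using sb0 s\<beta>0 \<beta>0 \<beta>r by (intro divide_left_mono mult_left_mono mult_pos_pos) auto
    also have "\<dots> = 1 / \<tau>" unfolding \<tau>_def using sb0 s\<beta>0 s\<beta> by (simp add: field_simps)
    finally have "- (2 / \<tau>) \<le> - (2 * \<beta>) / sqrt (b * r)" by simp
    with 3 show ?thesis by linarith
  qed
  \<comment> \<open>Since z = v^2 / b is at most 1 and q <= 2, the factor 1 + (q - 2) z is at least
    q - 1; the denominator q (q - 1) of \<open>C\<close> cancels exactly this loss.\<close>
  have Cq: "9 / \<tau> \<le> C * (q * P (q / 2 - 1) v + q * (q - 2) * v\<^sup>2 * P (q / 2 - 2) v)"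
  proof -
    have P2: "P (q / 2 - 2) v = 1 / (\<tau> * b)"
      using Pq b0 powr_diff[of b "q / 2 - 1" 1] by (simp add: P_def b_def[symmetric])
    define z where "z = v\<^sup>2 / b"
    have "(2 - q) * z \<le> (2 - q) * 1" using vb b0 q unfolding z_def by (intro mult_left_mono) auto
    then have "q - 1 \<le> 1 + (q - 2) * z" by (simp add: algebra_simps)
    then have "(q * (1 / \<tau>)) * (q - 1) \<le> (q * (1 / \<tau>)) * (1 + (q - 2) * z)"
      using q \<tau>0 by (intro mult_left_mono) auto
    also have "\<dots> = q * P (q / 2 - 1) v + q * (q - 2) * v\<^sup>2 * P (q / 2 - 2) v"
      unfolding Pq P2 z_def using \<tau>0 b0 by (simp add: field_simps)
    finally have "C * ((q * (1 / \<tau>)) * (q - 1)) \<le> C * (q * P (q / 2 - 1) v + q * (q - 2) * v\<^sup>2 * P (q / 2 - 2) v)"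
      using q by (intro mult_left_mono) (auto simp: C_def)
    then show ?thesis using q by (simp add: C_def)
  qed
  have pu: "p * P (p / 2 - 1) u \<le> p * P (p / 2 - 1) u + p * (p - 2) * u\<^sup>2 * P (p / 2 - 2) u"
    using p by (simp add: P_def)
  have uu1: "\<tau> / 3 \<le> Buu u v"
  proof (cases "a \<le> \<beta>")
    case True
    then have r2: "r \<le> 2 * \<beta>" by (simp add: r_def)
    \<comment> \<open>The factor 9/4 replaces 2 to have a rational root: r sqrt r <= 2 \<beta> *
      (3/2) sqrt \<beta> = 3 \<beta> sqrt \<beta> is the source of the constant 1/3.\<close>
    have "sqrt r \<le> sqrt (9 / 4 * \<beta>)" using r2 \<beta>0 by (intro real_sqrt_le_mono) simp
    also have "\<dots> = 3 / 2 * sqrt \<beta>" using real_sqrt_mult[of "9 / 4" \<beta>] by (simp add: real_sqrt_divide)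
    finally have "r * sqrt r \<le> (2 * \<beta>) * (3 / 2 * sqrt \<beta>)" using r2 r0 \<beta>0 by (intro mult_mono) auto
    then have "sqrt b * \<beta> / ((2 * \<beta>) * (3 / 2 * sqrt \<beta>)) \<le> sqrt b * \<beta> / (r * sqrt r)"
      using b0 r0 \<beta>0 by (intro divide_left_mono) auto
    moreover have "sqrt b * \<beta> / ((2 * \<beta>) * (3 / 2 * sqrt \<beta>)) = \<tau> / 3"
      using \<beta>0 by (simp add: \<tau>_def)
    moreover have "0 \<le> p * P (p / 2 - 1) u" using p by (simp add: P_def)
    ultimately show ?thesis unfolding Buu_def uu using uu0 pu by linarith
  next
    case False
    have "\<tau> = b powr (1 - q / 2)"
    proof -
      have "b powr (1 - q / 2) = 1 / b powr (q / 2 - 1)" using powr_minus_divide[of b "q / 2 - 1"] by simp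
      then show ?thesis using Pq \<tau>0 by (simp add: P_def b_def[symmetric])
    qed
    \<comment> \<open>Conjugacy enters here: \<tau> is the power p/2 - 1 of \<beta>, hence
      comparable with the second derivative of the |u|^p term as soon as a >= \<beta>.\<close>
    also have "1 - q / 2 = (q - 1) * (p / 2 - 1)" using pq by (simp add: field_simps)
    also have "b powr ((q - 1) * (p / 2 - 1)) = \<beta> powr (p / 2 - 1)" by (simp add: \<beta>_def powr_powr)
    also have "\<dots> \<le> a powr (p / 2 - 1)" using False \<beta>0 p by (intro powr_mono2) auto
    finally have "\<tau> \<le> P (p / 2 - 1) u" by (simp add: P_def a_def)
    also have "\<dots> \<le> p * P (p / 2 - 1) u" using p by (simp add: P_def mult_le_cancel_right1)
    finally have "\<tau> \<le> p * P (p / 2 - 1) u" .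
    moreover have "0 \<le> sqrt b * \<beta> / (r * sqrt r)" using b0 r0 \<beta>0 by simp
    ultimately show ?thesis unfolding Buu_def uu using uu0 pu \<tau>0 by linarith
  qed
  have vv1: "7 / \<tau> \<le> Bvv u v" unfolding Bvv_def using vv Cq by simp
  show ?thesis
  proof (rule that[OF \<tau>0])
    fix x y :: real
    have "\<tau> / 3 * x\<^sup>2 \<le> Buu u v * x\<^sup>2" "7 / \<tau> * y\<^sup>2 \<le> Bvv u v * y\<^sup>2"
      using uu1 vv1 by (intro mult_right_mono; simp)+
    moreover have "\<bar>2 * Buv u v * x * y\<bar> \<le> 2 * \<bar>x\<bar> * \<bar>y\<bar>"
      using mult_right_mono[OF uv, of "2 * \<bar>x\<bar> * \<bar>y\<bar>"] by (simp add: abs_mult mult_ac)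
    \<comment> \<open>The budget: \<tau>/3 is spent as \<tau>/6 on the mixed term and \<tau>/6 on
      the claim, and 7/\<tau>, the 9/\<tau> from \<open>C\<close> less the 2/\<tau> lost by the
      root, pays 6/\<tau> and 1/(6 \<tau>).\<close>
    moreover have "2 * \<bar>x\<bar> * \<bar>y\<bar> \<le> \<tau> / 6 * x\<^sup>2 + 6 / \<tau> * y\<^sup>2"
    proof -
      have "2 * (\<tau> * \<bar>x\<bar>) * (6 * \<bar>y\<bar>) \<le> (\<tau> * \<bar>x\<bar>)\<^sup>2 + (6 * \<bar>y\<bar>)\<^sup>2" by (rule sum_squares_bound)
      then have "(6 * \<tau>) * (2 * \<bar>x\<bar> * \<bar>y\<bar>) \<le> (6 * \<tau>) * (\<tau> / 6 * x\<^sup>2 + 6 / \<tau> * y\<^sup>2)"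
        using \<tau>0 by (simp add: power_mult_distrib algebra_simps power2_eq_square)
      then show ?thesis using \<tau>0 by (subst (asm) mult_le_cancel_left_pos) auto
    qed
    moreover have "0 \<le> y\<^sup>2 / \<tau>" using \<tau>0 by simp
    ultimately show "1 / 6 * (\<tau> * x\<^sup>2 + y\<^sup>2 / \<tau>) \<le> Buu u v * x\<^sup>2 + 2 * Buv u v * x * y + Bvv u v * y\<^sup>2"
      by (simp add: algebra_simps)
  qed
qed

lemma C_pos: "0 < C" using q by (simp add: C_def)

lemma P_mono: "0 \<le> r \<Longrightarrow> \<bar>u\<bar> \<le> \<bar>u'\<bar> \<Longrightarrow> P r u \<le> P r u'"
  unfolding P_def using \<kappa> by (intro powr_mono2) (auto simp: abs_le_square_iff)

lemma minimum: "B 0 0 \<le> B u v"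
proof -
  have "S 0 0 \<le> S u v"
    unfolding S_def using P_mono[of q 0 v] q \<kappa> by (intro add_mono mult_mono) auto
  then have "T (1 / 2) 0 0 \<le> T (1 / 2) u v"
    unfolding T_def using S_pos[of 0 0] by (intro powr_mono2) auto
  then show ?thesis
    unfolding B_def using P_mono[of "p / 2" 0 u] P_mono[of "q / 2" 0 v] p q C_pos
    by (intro add_mono mult_left_mono) auto
qed

sublocale bellman B Bu Bv Buu Buv Bvv "1 / 6"
proof
  show "continuous_on UNIV (\<lambda>(u, v). B u v)" "continuous_on UNIV (\<lambda>(u, v). Bu u v)"
    "continuous_on UNIV (\<lambda>(u, v). Bv u v)" "continuous_on UNIV (\<lambda>(u, v). Buu u v)"
    "continuous_on UNIV (\<lambda>(u, v). Buv u v)" "continuous_on UNIV (\<lambda>(u, v). Bvv u v)"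
    unfolding B_def Bu_def Bv_def Buu_def Buv_def Bvv_def case_prod_beta
    by (intro continuous_intros continuous_P continuous_T continuous_E)+
  show "\<exists>\<tau>>0. \<forall>x y. 1 / 6 * (\<tau> * x\<^sup>2 + y\<^sup>2 / \<tau>) \<le> Buu u v * x\<^sup>2 + 2 * Buv u v * x * y + Bvv u v * y\<^sup>2" for u v
    by (rule hessian[of u v]) blast
qed (rule deriv_B deriv_Bu deriv_Bv minimum, assumption+ | simp add: minimum)+

end

text \<open>Exchanging the arguments replaces \<tau> by its reciprocal. It serves exponents below 2,
  where \<Delta>w has to take the place of v, the argument with the smaller exponent.\<close>

lemma (in bellman) swap:
  "bellman (\<lambda>u v. B v u) (\<lambda>u v. Bv v u) (\<lambda>u v. Bu v u) (\<lambda>u v. Bvv v u) (\<lambda>u v. Buv v u) (\<lambda>u v. Buu v u) c"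
proof
  have sw: "continuous_on UNIV (\<lambda>(u, v). X v u)" if "continuous_on UNIV (\<lambda>(u, v). X u v)" for X :: "real \<Rightarrow> real \<Rightarrow> real"
  proof -
    have "continuous_on UNIV (\<lambda>p::real \<times> real. (snd p, fst p))" by (intro continuous_intros)
    from continuous_on_compose2[OF that this] show ?thesis by (simp add: case_prod_beta)
  qed
  show "continuous_on UNIV (\<lambda>(u, v). B v u)" "continuous_on UNIV (\<lambda>(u, v). Bv v u)"
    "continuous_on UNIV (\<lambda>(u, v). Bu v u)" "continuous_on UNIV (\<lambda>(u, v). Bvv v u)"
    "continuous_on UNIV (\<lambda>(u, v). Buv v u)" "continuous_on UNIV (\<lambda>(u, v). Buu v u)"
    by (rule sw, rule cont)+
  show "\<exists>\<tau>>0. \<forall>x y. c * (\<tau> * x\<^sup>2 + y\<^sup>2 / \<tau>) \<le> Bvv v u * x\<^sup>2 + 2 * Buv v u * x * y + Buu v u * y\<^sup>2" for u v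
  proof -
    obtain \<tau> where \<tau>: "\<tau> > 0" "\<And>x y. c * (\<tau> * x\<^sup>2 + y\<^sup>2 / \<tau>) \<le> Buu v u * x\<^sup>2 + 2 * Buv v u * x * y + Bvv v u * y\<^sup>2"
      using hess by blast
    show ?thesis
    proof (intro exI[of _ "1 / \<tau>"] conjI allI)
      fix x y
      show "c * (1 / \<tau> * x\<^sup>2 + y\<^sup>2 / (1 / \<tau>)) \<le> Bvv v u * x\<^sup>2 + 2 * Buv v u * x * y + Buu v u * y\<^sup>2"
        using \<tau>(2)[of y x] by (simp add: algebra_simps)
    qed (use \<tau>(1) in simp)
  qed
next
  fix f g :: "real \<Rightarrow> real" and f' g' s
  assume f: "(f has_real_derivative f') (at s)" and g: "(g has_real_derivative g') (at s)"
  show "((\<lambda>s. B (g s) (f s)) has_real_derivative Bv (g s) (f s) * f' + Bu (g s) (f s) * g') (at s)"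
    using der_B[OF g f] by (simp add: add.commute)
  show "((\<lambda>s. Bv (g s) (f s)) has_real_derivative Bvv (g s) (f s) * f' + Buv (g s) (f s) * g') (at s)"
    using der_Bv[OF g f] by (simp add: add.commute)
  show "((\<lambda>s. Bu (g s) (f s)) has_real_derivative Buv (g s) (f s) * f' + Buu (g s) (f s) * g') (at s)"
    using der_Bu[OF g f] by (simp add: add.commute)
qed (rule min, rule c)

lemma powr_half_square: "(x\<^sup>2) powr (r / 2) = \<bar>x\<bar> powr r" for x :: real
proof (cases "x = 0")
  case False
  then have "x\<^sup>2 = \<bar>x\<bar> powr 2" by simp
  moreover have "(\<bar>x\<bar> powr 2) powr (r / 2) = \<bar>x\<bar> powr r" by (simp only: powr_powr) simp
  ultimately show ?thesis by (simp only:)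
qed simp

context bellman_function
begin

lemma P_le:
  assumes "0 \<le> r" shows "P (r / 2) u \<le> 2 powr (r / 2) * (\<bar>u\<bar> powr r + \<kappa> powr (r / 2))"
proof -
  have "P (r / 2) u \<le> (2 * max (u\<^sup>2) \<kappa>) powr (r / 2)"
    unfolding P_def using \<kappa> assms by (intro powr_mono2) auto
  also have "\<dots> = 2 powr (r / 2) * (max (u\<^sup>2) \<kappa>) powr (r / 2)"
    using \<kappa> by (simp add: powr_mult)
  also have "(max (u\<^sup>2) \<kappa>) powr (r / 2) \<le> (u\<^sup>2) powr (r / 2) + \<kappa> powr (r / 2)"
    by (simp add: max_def)
  finally show ?thesis by (simp add: powr_half_square)
qed

text \<open>The root of a sum is at most the sum of the roots, so the root of \<open>S\<close> is
  bounded by |v|^q plus |u v| up to \<kappa>, and Young's inequality splits the product. The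
  constant does not depend on \<kappa>, which permits \<kappa> -> 0.\<close>

lemma B_le:
  "B u v \<le> (C + 2) * 2 powr (p / 2) * ((\<bar>u\<bar> powr p + \<bar>v\<bar> powr q) + (\<kappa> powr (p / 2) + \<kappa> powr (q / 2)))"
proof -
  have pq': "1 / p + 1 / q = 1" using pq p q by (simp add: field_simps)
  have "S u v = P q v + P 1 u * P 1 v" using pos[of u] pos[of v] by (simp add: S_def P_def)
  then have "T (1 / 2) u v = sqrt (P q v + P 1 u * P 1 v)"
    using S_pos[of u v] by (simp add: T_def powr_half_sqrt)
  also have "\<dots> \<le> sqrt (P q v) + sqrt (P 1 u * P 1 v)"
    by (intro sqrt_add_le_add_sqrt) (auto simp: P_def)
  also have "sqrt (P q v) = P (q / 2) v" by (simp add: P_def powr_half_sqrt[symmetric] powr_powr)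
  also have "sqrt (P 1 u * P 1 v) = P (1 / 2) u * P (1 / 2) v"
    using pos[of u] pos[of v] by (simp add: P_def real_sqrt_mult powr_half_sqrt)
  also have "P (1 / 2) u * P (1 / 2) v \<le> P (1 / 2) u powr p / p + P (1 / 2) v powr q / q"
    using p q pq' by (intro Youngs_inequality) (auto simp: P_def)
  also have "P (1 / 2) u powr p = P (p / 2) u" by (simp add: P_def powr_powr)
  also have "P (1 / 2) v powr q = P (q / 2) v" by (simp add: P_def powr_powr)
  finally have T: "T (1 / 2) u v \<le> P (q / 2) v + (P (p / 2) u / p + P (q / 2) v / q)" by simp
  have "P (p / 2) u / p \<le> P (p / 2) u" "P (q / 2) v / q \<le> P (q / 2) v"
    using p q by (auto simp: P_def divide_le_eq mult_le_cancel_left1)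
  with T have "B u v \<le> 2 * P (p / 2) u + (C + 2) * P (q / 2) v"
    unfolding B_def by (simp add: algebra_simps)
  also have "\<dots> \<le> (C + 2) * P (p / 2) u + (C + 2) * P (q / 2) v"
    using C_pos by (intro add_mono mult_right_mono) (auto simp: P_def)
  also have "\<dots> = (C + 2) * (P (p / 2) u + P (q / 2) v)" by (simp add: distrib_left)
  also have "\<dots> \<le> (C + 2) * (2 powr (p / 2) * (\<bar>u\<bar> powr p + \<kappa> powr (p / 2)) + 2 powr (p / 2) * (\<bar>v\<bar> powr q + \<kappa> powr (q / 2)))"
  proof (intro mult_left_mono add_mono)
    show "P (p / 2) u \<le> 2 powr (p / 2) * (\<bar>u\<bar> powr p + \<kappa> powr (p / 2))" using P_le p by simp
    have "P (q / 2) v \<le> 2 powr (q / 2) * (\<bar>v\<bar> powr q + \<kappa> powr (q / 2))" using P_le q by simp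
    also have "\<dots> \<le> 2 powr (p / 2) * (\<bar>v\<bar> powr q + \<kappa> powr (q / 2))"
      using p q by (intro mult_right_mono powr_mono) auto
    finally show "P (q / 2) v \<le> 2 powr (p / 2) * (\<bar>v\<bar> powr q + \<kappa> powr (q / 2))" .
  qed (use C_pos in simp)
  finally show ?thesis by (simp add: algebra_simps)
qed

end

section \<open>From the Bellman function to the Calderon--Zygmund inequality\<close>

lemma compact_support_powr_integrable:
  fixes h :: "'a::euclidean_space \<Rightarrow> real"
  assumes "continuous_on UNIV h" "\<And>x. R \<le> norm x \<Longrightarrow> h x = 0" "0 < p"
  shows "integrable lborel (\<lambda>x. \<bar>h x\<bar> powr p)"
  using assms by (intro continuous_compact_support_integrable[of _ R])
    (auto intro!: continuous_intros continuous_on_powr')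

lemma test_powr_integrable:
  assumes "test_function h" "0 < p"
  shows "integrable lborel (\<lambda>x. \<bar>h x\<bar> powr p)"
  using test_functionE[OF assms(1)] compact_support_powr_integrable[OF test_continuous[OF assms(1)] _ assms(2)] by metis

lemma limit_\<kappa>:
  fixes A B :: real
  assumes "0 < p" "0 < q" "\<And>\<kappa>. 0 < \<kappa> \<Longrightarrow> A \<le> B + D * (\<kappa> powr p + \<kappa> powr q)"
  shows "A \<le> B"
proof (rule tendsto_lowerbound)
  show "((\<lambda>\<kappa>. B + D * (\<kappa> powr p + \<kappa> powr q)) \<longlongrightarrow> B) (at_right 0)"
  proof -
    have "((\<lambda>\<kappa>. \<kappa> powr r) \<longlongrightarrow> 0) (at_right (0::real))" if "0 < r" for r :: real
      using that by (intro tendsto_zero_powrI[of _ _ _ r]) (auto intro: tendsto_eq_intros eventually_at_rightI[of 0 1])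
    then have "((\<lambda>\<kappa>. B + D * (\<kappa> powr p + \<kappa> powr q)) \<longlongrightarrow> B + D * (0 + 0)) (at_right 0)"
      using assms(1,2) by (intro tendsto_intros)
    then show ?thesis by simp
  qed
  show "eventually (\<lambda>\<kappa>. A \<le> B + D * (\<kappa> powr p + \<kappa> powr q)) (at_right 0)"
    using assms(3) by (intro eventually_at_rightI[of 0 1]) auto
qed simp

text \<open>Outside a ball containing both supports, B(f, g) - B(0, 0) is 0, so the \<kappa> terms
  of \<open>B_le\<close> are integrated over a set of fixed finite measure and vanish in the limit.
  The two conclusions differ in which of the two functions carries the exponent p >= 2; the second
  is the swapped Bellman function.\<close>

lemma bilinear_estimate_ge2:
  assumes p: "2 \<le> p" and pq: "(p - 1) * (q - 1) = 1"
  obtains K where "K > 0" "\<And>w g :: 'a::euclidean_space \<Rightarrow> real. \<And>i j. test_function w \<Longrightarrow> test_function g \<Longrightarrow> i \<in> Basis \<Longrightarrow> j \<in> Basis \<Longrightarrow>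
      \<bar>\<integral>x. w x * partial j (partial i g) x \<partial>lborel\<bar> \<le> K * ((\<integral>x. \<bar>laplacian w x\<bar> powr p \<partial>lborel) + (\<integral>x. \<bar>g x\<bar> powr q \<partial>lborel))"
    "\<And>w g :: 'a::euclidean_space \<Rightarrow> real. \<And>i j. test_function w \<Longrightarrow> test_function g \<Longrightarrow> i \<in> Basis \<Longrightarrow> j \<in> Basis \<Longrightarrow>
      \<bar>\<integral>x. w x * partial j (partial i g) x \<partial>lborel\<bar> \<le> K * ((\<integral>x. \<bar>laplacian w x\<bar> powr q \<partial>lborel) + (\<integral>x. \<bar>g x\<bar> powr p \<partial>lborel))"
proof -
  define C where "C = 9 / (q * (q - 1))"
  define K where "K = (C + 2) * 2 powr (p / 2)"
  interpret L: bellman_function p q 1 by unfold_locales (use p pq in auto)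
  note q = L.q
  have CC: "C = L.C" by (simp add: C_def L.C_def)
  have K0: "0 < K" using L.C_pos CC by (simp add: K_def)
  have est: "(1 / 6) * I \<le> K * ((\<integral>x. \<bar>f x\<bar> powr p \<partial>lborel) + (\<integral>x. \<bar>g x\<bar> powr q \<partial>lborel))"
    if f: "test_function f" and g: "test_function g"
      and I: "\<And>\<kappa>. 0 < \<kappa> \<Longrightarrow> (1 / 6) * I \<le> (\<integral>x. bellman_function.B p q \<kappa> (f x) (g x) - bellman_function.B p q \<kappa> 0 0 \<partial>lborel)"
    for f g :: "'a \<Rightarrow> real" and I
  proof -
    obtain R where R: "\<And>x. R \<le> norm x \<Longrightarrow> f x = 0" using test_functionE[OF f] by blast
    obtain R' where R': "\<And>x. R' \<le> norm x \<Longrightarrow> g x = 0" using test_functionE[OF g] by blast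
    let ?A = "cball (0::'a) (max R R')"
    let ?X = "(\<integral>x. \<bar>f x\<bar> powr p \<partial>lborel) + (\<integral>x. \<bar>g x\<bar> powr q \<partial>lborel)"
    have If: "integrable lborel (\<lambda>x. \<bar>f x\<bar> powr p)" and Ig: "integrable lborel (\<lambda>x. \<bar>g x\<bar> powr q)"
      using test_powr_integrable[OF f, of p] test_powr_integrable[OF g, of q] p q by simp_all
    have IA: "integrable lborel (indicat_real ?A)"
      using emeasure_bounded_finite[of ?A] by (intro integrable_real_indicator) auto
    show ?thesis
    proof (rule limit_\<kappa>)
      fix \<kappa> :: real assume \<kappa>: "0 < \<kappa>"
      interpret M: bellman_function p q \<kappa> by unfold_locales (use p pq \<kappa> in auto)
      have CM: "M.C = C" by (simp add: C_def M.C_def)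
      let ?k = "\<kappa> powr (p / 2) + \<kappa> powr (q / 2)"
      have pw: "M.B (f x) (g x) - M.B 0 0 \<le> K * (\<bar>f x\<bar> powr p + \<bar>g x\<bar> powr q) + K * ?k * indicat_real ?A x" for x
      proof (cases "x \<in> ?A")
        case True
        have "M.B (f x) (g x) \<le> K * ((\<bar>f x\<bar> powr p + \<bar>g x\<bar> powr q) + ?k)"
          using M.B_le[of "f x" "g x"] unfolding CM K_def .
        moreover have "0 \<le> M.B 0 0" unfolding M.B_def using M.C_pos by (simp add: M.P_def M.T_def)
        ultimately show ?thesis using True by (simp add: distrib_left)
      next
        case False
        then have "f x = 0" "g x = 0" using R[of x] R'[of x] by (auto simp: not_le)
        then show ?thesis using False by simp
      qed
      have "(1 / 6) * I \<le> (\<integral>x. M.B (f x) (g x) - M.B 0 0 \<partial>lborel)" by (rule I[OF \<kappa>])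
      also have "\<dots> \<le> (\<integral>x. K * (\<bar>f x\<bar> powr p + \<bar>g x\<bar> powr q) + K * ?k * indicat_real ?A x \<partial>lborel)"
      proof (rule integral_mono)
        \<comment> \<open>At time 0 the heat extensions are f and g themselves, so integrability
          along the flow specialises to the static integrand.\<close>
        show "integrable lborel (\<lambda>x. M.B (f x) (g x) - M.B 0 0)"
          using M.energy_integrable(1)[OF f g f g, of 0] by (simp add: heat_0)
      qed (use If Ig IA pw in auto)
      also have "\<dots> = K * ?X + K * measure lborel ?A * ?k"
        using If Ig IA by simp
      finally show "(1 / 6) * I \<le> K * ?X + K * measure lborel ?A * ?k" .
    qed (use p q in auto)
  qed
  show ?thesis
  proof (rule that[of "6 * K"])
    show "0 < 6 * K" using K0 by simp
    fix w g :: "'a \<Rightarrow> real" and i j :: 'a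
    assume w: "test_function w" and g: "test_function g" and i: "i \<in> Basis" and j: "j \<in> Basis"
    have "(1 / 6) * \<bar>\<integral>x. w x * partial j (partial i g) x \<partial>lborel\<bar> \<le> K * ((\<integral>x. \<bar>laplacian w x\<bar> powr p \<partial>lborel) + (\<integral>x. \<bar>g x\<bar> powr q \<partial>lborel))"
    proof (rule est[OF test_laplacian[OF w] g])
      fix \<kappa> :: real assume \<kappa>: "0 < \<kappa>"
      interpret M: bellman_function p q \<kappa> by unfold_locales (use p pq \<kappa> in auto)
      show "1 / 6 * \<bar>\<integral>x. w x * partial j (partial i g) x \<partial>lborel\<bar> \<le> (\<integral>x. M.B (laplacian w x) (g x) - M.B 0 0 \<partial>lborel)"
        by (rule M.heat_flow_estimate[OF g w i j])
    qed
    then show "\<bar>\<integral>x. w x * partial j (partial i g) x \<partial>lborel\<bar> \<le> 6 * K * ((\<integral>x. \<bar>laplacian w x\<bar> powr p \<partial>lborel) + (\<integral>x. \<bar>g x\<bar> powr q \<partial>lborel))"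
      by simp
    have "(1 / 6) * \<bar>\<integral>x. w x * partial j (partial i g) x \<partial>lborel\<bar> \<le> K * ((\<integral>x. \<bar>g x\<bar> powr p \<partial>lborel) + (\<integral>x. \<bar>laplacian w x\<bar> powr q \<partial>lborel))"
    proof (rule est[OF g test_laplacian[OF w]])
      fix \<kappa> :: real assume \<kappa>: "0 < \<kappa>"
      interpret M: bellman_function p q \<kappa> by unfold_locales (use p pq \<kappa> in auto)
      show "1 / 6 * \<bar>\<integral>x. w x * partial j (partial i g) x \<partial>lborel\<bar> \<le> (\<integral>x. M.B (g x) (laplacian w x) - M.B 0 0 \<partial>lborel)"
        by (rule bellman.heat_flow_estimate[OF M.swap g w i j])
    qed
    then show "\<bar>\<integral>x. w x * partial j (partial i g) x \<partial>lborel\<bar> \<le> 6 * K * ((\<integral>x. \<bar>laplacian w x\<bar> powr q \<partial>lborel) + (\<integral>x. \<bar>g x\<bar> powr p \<partial>lborel))"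
      by (simp add: add.commute)
  qed
qed

text \<open>If p < 2, the conjugate exponent is at least 2 and the previous estimate is used with
  the roles of the two functions exchanged. Two integrations by parts put both derivatives on
  w.\<close>

lemma bilinear_estimate:
  assumes p: "1 < p" and pq: "(p - 1) * (q - 1) = 1"
  obtains K where "K > 0" "\<And>w g :: 'a::euclidean_space \<Rightarrow> real. \<And>i j. test_function w \<Longrightarrow> test_function g \<Longrightarrow> i \<in> Basis \<Longrightarrow> j \<in> Basis \<Longrightarrow>
      \<bar>\<integral>x. partial i (partial j w) x * g x \<partial>lborel\<bar> \<le> K * ((\<integral>x. \<bar>laplacian w x\<bar> powr p \<partial>lborel) + (\<integral>x. \<bar>g x\<bar> powr q \<partial>lborel))"
proof -
  have eq: "(\<integral>x. partial i (partial j w) x * g x \<partial>lborel) = (\<integral>x. w x * partial j (partial i g) x \<partial>lborel)"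
    if t: "test_function w" "test_function g" "i \<in> Basis" "j \<in> Basis" for w g :: "'a \<Rightarrow> real" and i j
    using test_integration_by_parts[OF t(1) test_partial[OF t(2,3)] t(4)]
      test_integration_by_parts[OF test_partial[OF t(1,4)] t(2,3)] by simp
  show ?thesis
  proof (cases "2 \<le> p")
    case True
    show ?thesis
    proof (rule bilinear_estimate_ge2[OF True pq, where 'a='a])
      fix K assume "K > 0" and K: "\<And>w g :: 'a \<Rightarrow> real. \<And>i j. test_function w \<Longrightarrow> test_function g \<Longrightarrow> i \<in> Basis \<Longrightarrow> j \<in> Basis \<Longrightarrow>
        \<bar>\<integral>x. w x * partial j (partial i g) x \<partial>lborel\<bar> \<le> K * ((\<integral>x. \<bar>laplacian w x\<bar> powr p \<partial>lborel) + (\<integral>x. \<bar>g x\<bar> powr q \<partial>lborel))"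
      then show ?thesis by (intro that[of K]) (simp_all only: eq)
    qed
  next
    case False
    have "q - 1 = 1 / (p - 1)" using pq p by (simp add: field_simps)
    moreover have "1 \<le> 1 / (p - 1)" using False p by simp
    ultimately have "2 \<le> q" by linarith
    moreover have "(q - 1) * (p - 1) = 1" using pq by (simp add: mult.commute)
    ultimately show ?thesis
    proof (rule bilinear_estimate_ge2[where 'a='a])
      fix K assume "K > 0" and K: "\<And>w g :: 'a \<Rightarrow> real. \<And>i j. test_function w \<Longrightarrow> test_function g \<Longrightarrow> i \<in> Basis \<Longrightarrow> j \<in> Basis \<Longrightarrow>
        \<bar>\<integral>x. w x * partial j (partial i g) x \<partial>lborel\<bar> \<le> K * ((\<integral>x. \<bar>laplacian w x\<bar> powr p \<partial>lborel) + (\<integral>x. \<bar>g x\<bar> powr q \<partial>lborel))"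
      then show ?thesis by (intro that[of K]) (simp_all only: eq)
    qed
  qed
qed

section \<open>Pointwise convergence of mollifications\<close>

lemma continuous_locint:
  fixes g :: "'a::euclidean_space \<Rightarrow> real"
  assumes "continuous_on UNIV g" shows "locint g"
  unfolding locint_def
proof (intro conjI allI)
  show "g \<in> borel_measurable borel" using assms by (rule continuous_borel)
  fix R
  have "compact (g ` cball 0 R)"
    using assms by (intro compact_continuous_image) (auto intro: continuous_on_subset)
  then obtain M where "\<And>x. x \<in> cball 0 R \<Longrightarrow> \<bar>g x\<bar> \<le> M"
    using compact_imp_bounded by (metis (no_types, lifting) bounded_iff image_eqI real_norm_def)
  then show "integrable lborel (\<lambda>x. indicat_real (cball 0 R) x * g x)"
    using assms by (intro integrable_indicator_bounded) (auto intro: continuous_borel)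
qed

lemma integral_moll_shift:
  assumes "0 < \<epsilon>"
  shows "(\<integral>y. moll \<epsilon> (x - y) \<partial>lborel) = 1" "integrable lborel (\<lambda>y::'a::euclidean_space. moll \<epsilon> (x - y))"
proof -
  have t: "test_function (moll \<epsilon> :: 'a \<Rightarrow> real)" using assms by (simp add: test_moll)
  show "(\<integral>y. moll \<epsilon> (x - y) \<partial>lborel) = 1"
    using integral_affine[of "moll \<epsilon> :: 'a \<Rightarrow> real" "-1" x] integral_moll[OF assms, where 'a='a] test_borel[OF t] by simp
  show "integrable lborel (\<lambda>y. moll \<epsilon> (x - y))"
    using integrable_affine[OF test_integrable[OF t], of "-1" x] by simp
qed

text \<open>\<open>moll \<epsilon>\<close> is a probability density on the ball of radius
  \<epsilon>, so the convolution averages nearby values. With c = 0 the lemma also serves as a sup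
  bound.\<close>

lemma conv_moll_diff_le:
  fixes g :: "'a::euclidean_space \<Rightarrow> real"
  assumes \<epsilon>: "0 < \<epsilon>" and g: "locint g" and \<eta>: "\<And>y. dist y x < \<epsilon> \<Longrightarrow> \<bar>g y - c\<bar> \<le> \<eta>"
  shows "\<bar>conv (moll \<epsilon>) g x - c\<bar> \<le> \<eta>"
proof -
  have t: "test_function (moll \<epsilon> :: 'a \<Rightarrow> real)" using \<epsilon> by (simp add: test_moll)
  note I = integrable_conv_test[OF t g, of x] integral_moll_shift[OF \<epsilon>, of x]
  have "conv (moll \<epsilon>) g x - c = (\<integral>y. moll \<epsilon> (x - y) * (g y - c) \<partial>lborel)"
    using I by (simp add: conv_def right_diff_distrib)
  also have "\<bar>\<dots>\<bar> \<le> (\<integral>y. moll \<epsilon> (x - y) * \<eta> \<partial>lborel)"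
  proof (rule integral_abs_le_integral)
    show "integrable lborel (\<lambda>y. moll \<epsilon> (x - y) * (g y - c))"
      using I by (simp add: right_diff_distrib)
    show "\<bar>moll \<epsilon> (x - y) * (g y - c)\<bar> \<le> moll \<epsilon> (x - y) * \<eta>" for y
    proof (cases "dist y x < \<epsilon>")
      case True
      then show ?thesis using \<eta>[of y] moll_nonneg[OF \<epsilon>, of "x - y"] by (simp add: abs_mult mult_left_mono)
    next
      case False
      then show ?thesis using moll_zero[OF \<epsilon>, of "x - y"] by (simp add: dist_norm norm_minus_commute)
    qed
  qed (use I in simp)
  also have "\<dots> = \<eta>" using I by simp
  finally show ?thesis .
qed

definition scale_seq :: "nat \<Rightarrow> real" where "scale_seq n = 1 / real (Suc n)"

lemma scale_seq: "0 < scale_seq n" "scale_seq n \<le> 1"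
  by (simp_all add: scale_seq_def)

lemma scale_seq_limit: "scale_seq \<longlonglongrightarrow> 0"
  unfolding scale_seq_def[abs_def] by (rule LIMSEQ_Suc[OF lim_1_over_n])

lemma conv_moll_tendsto:
  fixes g :: "'a::euclidean_space \<Rightarrow> real"
  assumes g: "continuous_on UNIV g"
  shows "(\<lambda>n. conv (moll (scale_seq n)) g x) \<longlonglongrightarrow> g x"
proof (rule LIMSEQ_I)
  fix r :: real assume r: "0 < r"
  have "isCont g x" using g by (simp add: continuous_on_eq_continuous_at)
  then obtain d where d: "d > 0" "\<And>y. dist y x < d \<Longrightarrow> dist (g y) (g x) < r / 2"
    using r unfolding continuous_at_eps_delta by (meson half_gt_zero)
  obtain N where N: "\<And>n. n \<ge> N \<Longrightarrow> scale_seq n < d"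
    using scale_seq_limit d(1) by (metis LIMSEQ_D scale_seq(1) abs_of_pos diff_zero real_norm_def)
  show "\<exists>N. \<forall>n\<ge>N. norm (conv (moll (scale_seq n)) g x - g x) < r"
  proof (intro exI allI impI)
    fix n assume n: "N \<le> n"
    have "\<bar>conv (moll (scale_seq n)) g x - g x\<bar> \<le> r / 2"
    proof (rule conv_moll_diff_le[OF scale_seq(1) continuous_locint[OF g]])
      fix y assume "dist y x < scale_seq n"
      then show "\<bar>g y - g x\<bar> \<le> r / 2" using d(2)[of y] N[OF n] by (simp add: dist_real_def)
    qed
    then show "norm (conv (moll (scale_seq n)) g x - g x) < r" using r by simp
  qed
qed

text \<open>Duality: the bilinear estimate is tested with mollifications of
  \<open>\<lambda> sgn h |h|\<^sup>p\<^sup>-\<^sup>1\<close>, where \<open>h\<close> is the second derivative to be estimated.\<close>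

theorem calderon_zygmund:
  assumes p: "1 < p"
  obtains K where "K > 0" "\<And>w :: 'a::euclidean_space \<Rightarrow> real. \<And>i j. test_function w \<Longrightarrow> i \<in> Basis \<Longrightarrow> j \<in> Basis \<Longrightarrow>
      (\<integral>x. \<bar>partial i (partial j w) x\<bar> powr p \<partial>lborel) \<le> K * (\<integral>x. \<bar>laplacian w x\<bar> powr p \<partial>lborel)"
proof -
  define q where "q = 1 + 1 / (p - 1)"
  have pq: "(p - 1) * (q - 1) = 1" and q: "1 < q" using p by (simp_all add: q_def)
  have pq': "(p - 1) * q = p" using pq by (simp add: algebra_simps)
  obtain K where K: "K > 0" "\<And>w g :: 'a \<Rightarrow> real. \<And>i j. test_function w \<Longrightarrow> test_function g \<Longrightarrow> i \<in> Basis \<Longrightarrow> j \<in> Basis \<Longrightarrow>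
      \<bar>\<integral>x. partial i (partial j w) x * g x \<partial>lborel\<bar> \<le> K * ((\<integral>x. \<bar>laplacian w x\<bar> powr p \<partial>lborel) + (\<integral>x. \<bar>g x\<bar> powr q \<partial>lborel))"
    by (rule bilinear_estimate[OF p pq, where 'a='a]) (rule that)
  \<comment> \<open>Chosen so that K l^q = l / 2. Testing with a function of size l |h|^(p-1) puts l
    Z on the left and K l^q Z on the right, where Z is the integral of |h|^p, so half of the left
    side absorbs the latter.\<close>
  define l where "l = (1 / (2 * K)) powr (1 / (q - 1))"
  have l0: "0 < l" using K(1) by (simp add: l_def)
  have lq: "K * l powr q = l / 2"
  proof -
    have "l powr (q - 1) = 1 / (2 * K)" using q K(1) by (simp add: l_def powr_powr)
    moreover have "l powr q = l * l powr (q - 1)" using powr_add[of l 1 "q - 1"] l0 by simp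
    ultimately show ?thesis using K(1) by simp
  qed
  show ?thesis
  proof (rule that)
    show "0 < 2 * K / l" using K(1) l0 by simp
    fix w :: "'a \<Rightarrow> real" and i j :: 'a
    assume w: "test_function w" and i: "i \<in> Basis" and j: "j \<in> Basis"
    define h where "h = partial i (partial j w)"
    define X where "X = (\<integral>x. \<bar>laplacian w x\<bar> powr p \<partial>lborel)"
    define Z where "Z = (\<integral>x. \<bar>h x\<bar> powr p \<partial>lborel)"
    have h: "test_function h" unfolding h_def by (intro test_partial w i j)
    obtain R where R: "R > 0" "\<And>x. R \<le> norm x \<Longrightarrow> h x = 0" using test_functionE[OF h] by blast
    define g where "g x = l * ((max (h x) 0) powr (p - 1) - (max (- h x) 0) powr (p - 1))" for x
    have gc: "continuous_on UNIV g"
      unfolding g_def using p test_continuous[OF h]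
      by (intro continuous_intros continuous_on_powr') auto
    have g0: "g x = 0" if "R \<le> norm x" for x using R(2)[OF that] by (simp add: g_def)
    have ga: "\<bar>g x\<bar> = l * \<bar>h x\<bar> powr (p - 1)" for x
      using l0 by (auto simp: g_def abs_mult max_def)
    have hg: "h x * g x = l * \<bar>h x\<bar> powr p" for x
      using powr_mult_base[of "\<bar>h x\<bar>" "p - 1"] by (auto simp: g_def max_def mult_ac)
    have gq: "\<bar>g x\<bar> powr q = l powr q * \<bar>h x\<bar> powr p" for x
      unfolding ga using l0 by (simp add: powr_mult powr_powr pq')
    obtain M where M: "M > 0" "\<And>x. \<bar>g x\<bar> \<le> M * indicat_real (cball 0 R) x"
      using continuous_compact_support_bounded[OF gc g0] by metis
    have gM: "\<bar>g x\<bar> \<le> M" for x using M(1) M(2)[of x] by (cases "x \<in> cball 0 R") (auto simp: indicator_def)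
    define G where "G n = conv (moll (scale_seq n)) g" for n
    have tm: "test_function (moll (scale_seq n) :: 'a \<Rightarrow> real)" for n
      using scale_seq(1)[of n] by (simp add: test_moll)
    have tG: "test_function (G n)" for n
      unfolding G_def by (rule test_conv[OF tm continuous_locint[OF gc] g0])
    have GM: "\<bar>G n x\<bar> \<le> M" for n x
      unfolding G_def using conv_moll_diff_le[OF scale_seq(1) continuous_locint[OF gc], where c=0 and \<eta>=M] gM by simp
    have G0: "G n x = 0" if x: "1 + R \<le> norm x" for n x
      unfolding G_def
    proof (rule conv_zero[OF moll_zero[OF scale_seq(1)] g0])
      show "scale_seq n + R \<le> norm x" using x scale_seq(2)[of n] by linarith
    qed
    have Glim: "(\<lambda>n. G n x) \<longlonglongrightarrow> g x" for x
      unfolding G_def by (rule conv_moll_tendsto[OF gc])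
    have IA: "integrable lborel (\<lambda>x. D * indicat_real (cball (0::'a) (1 + R)) x)" for D
      using emeasure_bounded_finite[of "cball (0::'a) (1 + R)"] by (intro integrable_mult_right integrable_real_indicator) auto
    have bG: "\<bar>G n x\<bar> \<le> M * indicat_real (cball 0 (1 + R)) x" for n x
      using GM[of n x] G0[of x n] by (cases "x \<in> cball 0 (1 + R)") auto
    have lim1: "(\<lambda>n. \<integral>x. h x * G n x \<partial>lborel) \<longlonglongrightarrow> (\<integral>x. h x * g x \<partial>lborel)"
    proof (rule integral_dominated_convergence[where w="\<lambda>x. M * \<bar>h x\<bar>"])
      show "AE x in lborel. (\<lambda>n. h x * G n x) \<longlonglongrightarrow> h x * g x" by (intro AE_I2 tendsto_intros Glim)
      show "AE x in lborel. norm (h x * G n x) \<le> M * \<bar>h x\<bar>" for n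
      proof (rule AE_I2)
        fix x show "norm (h x * G n x) \<le> M * \<bar>h x\<bar>"
          using mult_right_mono[OF GM[of n x], of "\<bar>h x\<bar>"] by (simp add: abs_mult mult.commute)
      qed
    qed (use test_integrable[OF h] test_borel[OF h] test_borel[OF tG] continuous_borel[OF gc] in auto)
    have lim2: "(\<lambda>n. \<integral>x. \<bar>G n x\<bar> powr q \<partial>lborel) \<longlonglongrightarrow> (\<integral>x. \<bar>g x\<bar> powr q \<partial>lborel)"
    proof (rule integral_dominated_convergence[where w="\<lambda>x. M powr q * indicat_real (cball (0::'a) (1 + R)) x"])
      show "AE x in lborel. (\<lambda>n. \<bar>G n x\<bar> powr q) \<longlonglongrightarrow> \<bar>g x\<bar> powr q"
        using q by (intro AE_I2 tendsto_powr2 tendsto_rabs Glim tendsto_const) auto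
      show "AE x in lborel. norm (\<bar>G n x\<bar> powr q) \<le> M powr q * indicat_real (cball (0::'a) (1 + R)) x" for n
      proof (rule AE_I2)
        fix x
        show "norm (\<bar>G n x\<bar> powr q) \<le> M powr q * indicat_real (cball (0::'a) (1 + R)) x"
          using powr_mono2[of q "\<bar>G n x\<bar>" M] GM[of n x] G0[of x n] q by (cases "x \<in> cball 0 (1 + R)") auto
      qed
    qed (use IA test_borel[OF tG] continuous_borel[OF gc] in auto)
    have "(\<integral>x. h x * G n x \<partial>lborel) \<le> K * (X + (\<integral>x. \<bar>G n x\<bar> powr q \<partial>lborel))" for n
      using K(2)[OF w tG i j, of n] unfolding h_def X_def by linarith
    moreover have "(\<lambda>n. K * (X + (\<integral>x. \<bar>G n x\<bar> powr q \<partial>lborel))) \<longlonglongrightarrow> K * (X + (\<integral>x. \<bar>g x\<bar> powr q \<partial>lborel))"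
      by (intro tendsto_intros lim2)
    ultimately have "(\<integral>x. h x * g x \<partial>lborel) \<le> K * (X + (\<integral>x. \<bar>g x\<bar> powr q \<partial>lborel))"
      using lim1 LIMSEQ_le by blast
    then have "l * Z \<le> K * X + (K * l powr q) * Z"
      unfolding hg gq Z_def by (simp add: algebra_simps)
    then have "l * Z \<le> 2 * K * X" unfolding lq by simp
    then have "Z \<le> 2 * K / l * X" using l0 by (simp add: field_simps)
    then show "(\<integral>x. \<bar>partial i (partial j w) x\<bar> powr p \<partial>lborel) \<le> 2 * K / l * (\<integral>x. \<bar>laplacian w x\<bar> powr p \<partial>lborel)"
      by (simp add: Z_def X_def h_def)
  qed
qed

section \<open>Local integrability and convolutions\<close>

lemma AE_lborel_negligible:
  assumes "negligible N" shows "AE x in lborel. x \<notin> N"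
proof -
  have "N \<in> null_sets lebesgue" using assms by (simp add: negligible_iff_null_sets)
  then have "AE x in lebesgue. x \<notin> N" by (rule AE_not_in)
  then show ?thesis by (simp add: AE_completion_iff)
qed

text \<open>A measurable function is almost everywhere a limit of continuous ones, but without
  control in L1. Truncation at height m and the factor \<eta>, which is 1 where |x| <= R and 0 from
  radius R + 1 on, supply a dominating function.\<close>

lemma L1_approx_continuous:
  fixes h :: "'a::euclidean_space \<Rightarrow> real"
  assumes h: "integrable lborel h" and R: "\<And>x. R \<le> norm x \<Longrightarrow> h x = 0" and \<epsilon>: "0 < \<epsilon>"
  obtains g where "continuous_on UNIV g" "\<And>x. R + 1 \<le> norm x \<Longrightarrow> g x = 0" "(\<integral>x. \<bar>h x - g x\<bar> \<partial>lborel) < \<epsilon>"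
proof -
  have [measurable]: "h \<in> borel_measurable borel" using h by auto
  define tr where "tr M z = max (- M) (min M z)" for M z :: real
  have tr_cont: "continuous_on UNIV (\<lambda>x. tr M (f x))" if "continuous_on UNIV f" for M and f :: "'a \<Rightarrow> real"
    unfolding tr_def by (intro continuous_intros that)
  have tr_le: "\<bar>tr M z\<bar> \<le> M" if "0 \<le> M" for M z using that by (auto simp: tr_def)
  have "(\<lambda>m::nat. \<integral>x. \<bar>h x - tr (real m) (h x)\<bar> \<partial>lborel) \<longlonglongrightarrow> (\<integral>x. 0 \<partial>(lborel::'a measure))"
  proof (rule integral_dominated_convergence[where w="\<lambda>x. \<bar>h x\<bar>"])
    show "AE x in lborel. (\<lambda>m::nat. \<bar>h x - tr (real m) (h x)\<bar>) \<longlonglongrightarrow> 0"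
    proof (rule AE_I2)
      fix x
      obtain N :: nat where N: "\<bar>h x\<bar> \<le> real N" using real_arch_simple by blast
      have "\<bar>h x - tr (real m) (h x)\<bar> = 0" if "m \<ge> N" for m
      proof -
        have "\<bar>h x\<bar> \<le> real m" using N that by linarith
        then show ?thesis by (auto simp: tr_def)
      qed
      then show "(\<lambda>m::nat. \<bar>h x - tr (real m) (h x)\<bar>) \<longlonglongrightarrow> 0"
        by (intro tendsto_eventually eventually_sequentiallyI) auto
    qed
    show "AE x in lborel. norm \<bar>h x - tr (real m) (h x)\<bar> \<le> \<bar>h x\<bar>" for m :: nat
      by (intro AE_I2) (auto simp: tr_def)
    show "(\<lambda>x. \<bar>h x - tr (real m) (h x)\<bar>) \<in> borel_measurable lborel" for m :: nat
      unfolding tr_def by measurable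
  qed (use h in auto)
  then have "(\<lambda>m::nat. \<integral>x. \<bar>h x - tr (real m) (h x)\<bar> \<partial>lborel) \<longlonglongrightarrow> 0" by simp
  then have "eventually (\<lambda>m::nat. (\<integral>x. \<bar>h x - tr (real m) (h x)\<bar> \<partial>lborel) < \<epsilon> / 2) sequentially"
    using order_tendstoD(2)[of _ 0 sequentially "\<epsilon> / 2"] \<epsilon> by simp
  then obtain m :: nat where m: "(\<integral>x. \<bar>h x - tr (real m) (h x)\<bar> \<partial>lborel) < \<epsilon> / 2"
    by (auto simp: eventually_sequentially)
  have "h measurable_on UNIV"
    by (rule lebesgue_measurable_imp_measurable_on) (auto intro: measurable_completion)
  then obtain N g where N: "negligible N" and gc: "\<And>n. continuous_on UNIV (g n)"
    and glim: "\<And>x. x \<notin> N \<Longrightarrow> (\<lambda>n. g n x) \<longlonglongrightarrow> h x"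
    unfolding measurable_on_def by auto
  define \<eta> where "\<eta> x = max 0 (min 1 (R + 1 - norm x))" for x :: 'a
  define G where "G n x = \<eta> x * tr (real m) (g n x)" for n x
  have Gc: "continuous_on UNIV (G n)" for n
    unfolding G_def \<eta>_def by (intro continuous_intros tr_cont gc)
  have G0: "G n x = 0" if "R + 1 \<le> norm x" for n x using that by (simp add: G_def \<eta>_def)
  have Ga: "\<bar>G n x\<bar> \<le> real m * indicat_real (cball 0 (R + 1)) x" for n x
  proof (cases "norm x \<le> R + 1")
    case True
    have "\<bar>\<eta> x\<bar> \<le> 1" by (auto simp: \<eta>_def)
    then have "\<bar>G n x\<bar> \<le> 1 * real m"
      unfolding G_def abs_mult by (intro mult_mono tr_le) auto
    then show ?thesis using True by simp
  next
    case False
    then show ?thesis using G0[of x n] by simp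
  qed
  have tr0: "tr (real m) 0 = 0" by (simp add: tr_def)
  have IA: "integrable lborel (\<lambda>x. real m * indicat_real (cball (0::'a) (R + 1)) x)"
    using emeasure_bounded_finite[of "cball (0::'a) (R + 1)"] by (intro integrable_mult_right integrable_real_indicator) auto
  have IG: "integrable lborel (G n)" for n
    by (rule continuous_compact_support_integrable[OF Gc G0])
  have It: "integrable lborel (\<lambda>x. tr (real m) (h x))"
    by (rule Bochner_Integration.integrable_bound[OF h]) (auto simp: tr_def intro!: AE_I2)
  have "(\<lambda>n. \<integral>x. \<bar>tr (real m) (h x) - G n x\<bar> \<partial>lborel) \<longlonglongrightarrow> (\<integral>x. 0 \<partial>(lborel::'a measure))"
  proof (rule integral_dominated_convergence[where w="\<lambda>x. \<bar>h x\<bar> + real m * indicat_real (cball (0::'a) (R + 1)) x"])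
    show "AE x in lborel. (\<lambda>n. \<bar>tr (real m) (h x) - G n x\<bar>) \<longlonglongrightarrow> 0"
      using AE_lborel_negligible[OF N]
    proof eventually_elim
      case (elim x)
      have "(\<lambda>n. G n x) \<longlonglongrightarrow> \<eta> x * tr (real m) (h x)"
        unfolding G_def tr_def by (intro tendsto_intros glim elim)
      moreover have "\<eta> x * tr (real m) (h x) = tr (real m) (h x)"
        using R[of x] tr0 by (cases "R \<le> norm x") (auto simp: \<eta>_def)
      ultimately have "(\<lambda>n. tr (real m) (h x) - G n x) \<longlonglongrightarrow> tr (real m) (h x) - tr (real m) (h x)"
        by (intro tendsto_intros) simp
      then show ?case by (intro tendsto_rabs_zero) simp
    qed
    show "AE x in lborel. norm \<bar>tr (real m) (h x) - G n x\<bar> \<le> \<bar>h x\<bar> + real m * indicat_real (cball (0::'a) (R + 1)) x" for n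
    proof (rule AE_I2)
      fix x
      have "\<bar>tr (real m) (h x)\<bar> \<le> \<bar>h x\<bar>" by (auto simp: tr_def)
      then show "norm \<bar>tr (real m) (h x) - G n x\<bar> \<le> \<bar>h x\<bar> + real m * indicat_real (cball (0::'a) (R + 1)) x"
        using Ga[of n x] by simp
    qed
    show "(\<lambda>x. \<bar>tr (real m) (h x) - G n x\<bar>) \<in> borel_measurable lborel" for n
      using borel_measurable_integrable[OF It] borel_measurable_integrable[OF IG[of n]] by simp
  qed (use h IA in auto)
  then have "eventually (\<lambda>n. (\<integral>x. \<bar>tr (real m) (h x) - G n x\<bar> \<partial>lborel) < \<epsilon> / 2) sequentially"
    using order_tendstoD(2)[of _ 0 sequentially "\<epsilon> / 2"] \<epsilon> by simp
  then obtain n where n: "(\<integral>x. \<bar>tr (real m) (h x) - G n x\<bar> \<partial>lborel) < \<epsilon> / 2"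
    by (auto simp: eventually_sequentially)
  have "(\<integral>x. \<bar>h x - G n x\<bar> \<partial>lborel) \<le> (\<integral>x. \<bar>h x - tr (real m) (h x)\<bar> + \<bar>tr (real m) (h x) - G n x\<bar> \<partial>lborel)"
    using h It IG[of n] by (intro integral_mono) auto
  also have "\<dots> < \<epsilon>" using h It IG[of n] m n by simp
  finally show ?thesis using that[OF Gc G0] by blast
qed

section \<open>Young's inequality for convolutions\<close>

lemma weighted_amgm3:
  fixes X Y Z :: real
  assumes "0 < X" "0 < Y" "0 < Z" "w1 + w2 + w3 = 1" "0 \<le> w1" "0 \<le> w2" "0 \<le> w3"
  shows "X powr w1 * Y powr w2 * Z powr w3 \<le> w1 * X + w2 * Y + w3 * Z"
proof -
  define G where "G = X powr w1 * Y powr w2 * Z powr w3"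
  have G: "0 < G" using assms by (simp add: G_def)
  have lG: "ln G = w1 * ln X + w2 * ln Y + w3 * ln Z" using assms by (simp add: G_def ln_mult ln_powr)
  have le: "ln A - ln G \<le> A / G - 1" if "0 < A" for A
    using ln_le_minus_one[of "A / G"] that G by (simp add: ln_div)
  have "w1 * (ln X - ln G) + w2 * (ln Y - ln G) + w3 * (ln Z - ln G)
      \<le> w1 * (X / G - 1) + w2 * (Y / G - 1) + w3 * (Z / G - 1)"
    using assms by (intro add_mono mult_left_mono le)
  moreover have "w1 * (ln X - ln G) + w2 * (ln Y - ln G) + w3 * (ln Z - ln G) = ln G - (w1 + w2 + w3) * ln G"
    unfolding lG by (simp add: algebra_simps)
  moreover have "w1 * (X / G - 1) + w2 * (Y / G - 1) + w3 * (Z / G - 1) = (w1 * X + w2 * Y + w3 * Z) / G - (w1 + w2 + w3)"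
    using G by (simp add: field_simps)
  ultimately have "1 \<le> (w1 * X + w2 * Y + w3 * Z) / G" using assms(4) by simp
  then have "G \<le> w1 * X + w2 * Y + w3 * Z" using G by (simp add: field_simps)
  then show ?thesis by (simp add: G_def)
qed

text \<open>Additive form of the three-factor Hoelder step in Young's inequality: the weights 1/r,
  1/s - 1/r and 1/a - 1/r sum to 1 by the exponent relation. Division by I, which will be the
  integral of A^s H^a, makes the integrated right side a constant times I^(1/r). Zero values of A or
  H are separated because the mean inequality works with logarithms.\<close>

lemma young_pointwise:
  fixes A H I s a r :: real
  assumes pos: "0 \<le> A" "0 \<le> H" "0 < I" "1 \<le> s" "1 \<le> a" "0 < r" and r: "1 / r = 1 / a + 1 / s - 1"
  shows "A * H \<le> I powr (1 / r) * (1 / r * (A powr s * H powr a / I) + (1 / s - 1 / r) * A powr s + (1 / a - 1 / r) * H powr a)"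
proof (cases "A = 0 \<or> H = 0")
  case True
  have "1 / a \<le> 1" "1 / s \<le> 1" using pos by simp_all
  then have "0 \<le> 1 / s - 1 / r" "0 \<le> 1 / a - 1 / r" using r by linarith+
  then have "0 \<le> I powr (1 / r) * (1 / r * (A powr s * H powr a / I) + (1 / s - 1 / r) * A powr s + (1 / a - 1 / r) * H powr a)"
    using pos by (intro mult_nonneg_nonneg add_nonneg_nonneg) auto
  then show ?thesis using True by auto
next
  case False
  then have A: "0 < A" and H: "0 < H" using pos by auto
  have "1 / a \<le> 1" "1 / s \<le> 1" using pos by simp_all
  then have w: "0 \<le> 1 / s - 1 / r" "0 \<le> 1 / a - 1 / r" using r by linarith+
  have "(A powr s * H powr a / I) powr (1 / r) * (A powr s) powr (1 / s - 1 / r) * (H powr a) powr (1 / a - 1 / r)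
      \<le> 1 / r * (A powr s * H powr a / I) + (1 / s - 1 / r) * A powr s + (1 / a - 1 / r) * H powr a"
  proof (rule weighted_amgm3)
    show "1 / r + (1 / s - 1 / r) + (1 / a - 1 / r) = 1" using r by linarith
  qed (use A H pos w in auto)
  moreover have "(A powr s * H powr a / I) powr (1 / r) * (A powr s) powr (1 / s - 1 / r) * (H powr a) powr (1 / a - 1 / r)
      = A * H / I powr (1 / r)"
  proof -
    have sA: "(A powr s) powr (1 / r) * (A powr s) powr (1 / s - 1 / r) = A"
      using A pos by (simp add: powr_add[symmetric] powr_powr right_diff_distrib)
    have sH: "(H powr a) powr (1 / r) * (H powr a) powr (1 / a - 1 / r) = H"
      using H pos by (simp add: powr_add[symmetric] powr_powr right_diff_distrib)
    have "(A powr s * H powr a / I) powr (1 / r) = (A powr s) powr (1 / r) * (H powr a) powr (1 / r) / I powr (1 / r)"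
      using A H pos by (simp add: powr_divide powr_mult)
    then have "(A powr s * H powr a / I) powr (1 / r) * (A powr s) powr (1 / s - 1 / r) * (H powr a) powr (1 / a - 1 / r)
      = ((A powr s) powr (1 / r) * (A powr s) powr (1 / s - 1 / r)) * ((H powr a) powr (1 / r) * (H powr a) powr (1 / a - 1 / r)) / I powr (1 / r)"
      by (simp add: mult_ac)
    then show ?thesis unfolding sA sH .
  qed
  ultimately have "A * H / I powr (1 / r) \<le> 1 / r * (A powr s * H powr a / I) + (1 / s - 1 / r) * A powr s + (1 / a - 1 / r) * H powr a"
    by simp
  then show ?thesis using pos(3) by (simp add: pos_divide_le_eq mult.commute)
qed

lemma integrable_shift_reflect:
  fixes k :: "'a::euclidean_space \<Rightarrow> real"
  assumes "integrable lborel k"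
  shows "integrable lborel (\<lambda>y. k (x - y))" "(\<integral>y. k (x - y) \<partial>lborel) = (\<integral>y. k y \<partial>lborel)"
  using integrable_affine[OF assms, of "-1" x] integral_affine[of k "-1" x] assms
  by (auto simp: borel_measurable_integrable)

text \<open>The constant is not the sharp one, except for \<open>s = 1\<close>
  and \<open>\<integral>|k| = 1\<close>, where it equals \<open>1\<close>.\<close>

lemma young_convolution:
  fixes k h :: "'a::euclidean_space \<Rightarrow> real"
  assumes [measurable]: "k \<in> borel_measurable borel" "h \<in> borel_measurable borel"
    and k: "integrable lborel (\<lambda>x. \<bar>k x\<bar> powr s)" and h: "integrable lborel (\<lambda>x. \<bar>h x\<bar> powr a)"
    and sar: "1 \<le> s" "1 \<le> a" "0 < r" "1 / r = 1 / a + 1 / s - 1"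
  defines "K \<equiv> \<integral>x. \<bar>k x\<bar> powr s \<partial>lborel" and "H \<equiv> \<integral>x. \<bar>h x\<bar> powr a \<partial>lborel"
  shows "AE x in lborel. integrable lborel (\<lambda>y. k (x - y) * h y)"
    and "integrable lborel (\<lambda>x. \<bar>conv k h x\<bar> powr r)"
    and "(\<integral>x. \<bar>conv k h x\<bar> powr r \<partial>lborel) \<le> (1 / r + (1 / s - 1 / r) * K + (1 / a - 1 / r) * H) powr r * (K * H)"
proof -
  define C where "C = 1 / r + (1 / s - 1 / r) * K + (1 / a - 1 / r) * H"
  define F where "F x y = \<bar>k (x - y)\<bar> powr s * \<bar>h y\<bar> powr a" for x y
  \<comment> \<open>The convolution of |k|^s with |h|^a. By Fubini it is integrable with integral K
    H, and the r-th power of |k * h| will be at most a constant times it.\<close>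
  define I where "I x = (\<integral>y. F x y \<partial>lborel)" for x
  have Fmeas: "case_prod F \<in> borel_measurable (lborel \<Otimes>\<^sub>M lborel)" unfolding F_def by measurable
  have KH: "0 \<le> K" "0 \<le> H" by (simp_all add: K_def H_def)
  have "1 / a \<le> 1" "1 / s \<le> 1" using sar by simp_all
  then have w: "0 \<le> 1 / s - 1 / r" "0 \<le> 1 / a - 1 / r" using sar(4) by linarith+
  have C0: "0 < C" unfolding C_def using sar(3) KH w by (intro add_pos_nonneg mult_nonneg_nonneg) auto
  have inner: "(\<integral>\<^sup>+x. ennreal \<bar>F x y\<bar> \<partial>lborel) = ennreal K * ennreal (\<bar>h y\<bar> powr a)" for y
  proof -
    have "(\<integral>\<^sup>+x. ennreal \<bar>F x y\<bar> \<partial>lborel) = (\<integral>\<^sup>+x. ennreal (\<bar>k (x + - y)\<bar> powr s) * ennreal (\<bar>h y\<bar> powr a) \<partial>lborel)"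
      by (intro nn_integral_cong) (simp add: F_def ennreal_mult')
    also have "\<dots> = (\<integral>\<^sup>+x. ennreal (\<bar>k (x + - y)\<bar> powr s) \<partial>lborel) * ennreal (\<bar>h y\<bar> powr a)"
      by (rule nn_integral_multc) measurable
    also have "(\<integral>\<^sup>+x. ennreal (\<bar>k (x + - y)\<bar> powr s) \<partial>lborel) = (\<integral>\<^sup>+x. ennreal (\<bar>k x\<bar> powr s) \<partial>lborel)"
      by (rule nn_integral_translate) measurable
    also have "\<dots> = ennreal K" unfolding K_def by (rule nn_integral_eq_integral[OF k]) simp
    finally show ?thesis .
  qed
  have "(\<integral>\<^sup>+y. \<integral>\<^sup>+x. ennreal \<bar>F x y\<bar> \<partial>lborel \<partial>lborel) = ennreal K * (\<integral>\<^sup>+y. ennreal (\<bar>h y\<bar> powr a) \<partial>lborel)"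
    unfolding inner by (rule nn_integral_cmult) measurable
  also have "(\<integral>\<^sup>+y. ennreal (\<bar>h y\<bar> powr a) \<partial>lborel) = ennreal H"
    unfolding H_def by (rule nn_integral_eq_integral[OF h]) simp
  finally have fin: "(\<integral>\<^sup>+y. \<integral>\<^sup>+x. ennreal \<bar>F x y\<bar> \<partial>lborel \<partial>lborel) = ennreal (K * H)"
    using KH by (simp add: ennreal_mult)
  then have fin': "(\<integral>\<^sup>+y. \<integral>\<^sup>+x. ennreal \<bar>F x y\<bar> \<partial>lborel \<partial>lborel) < \<infinity>" by simp
  note fub = lborel_fubini[OF Fmeas fin']
  have II: "integrable lborel I" unfolding I_def by (rule fub(1))
  have Iint: "(\<integral>x. I x \<partial>lborel) = K * H"
  proof -
    have "(\<integral>x. I x \<partial>lborel) = (\<integral>y. \<integral>x. F x y \<partial>lborel \<partial>lborel)" unfolding I_def by (rule fub(3))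
    moreover have "(\<integral>x. F x y \<partial>lborel) = K * \<bar>h y\<bar> powr a" for y
      using integral_translate[of "\<lambda>x. \<bar>k x\<bar> powr s" "- y"] by (simp add: F_def K_def)
    ultimately show ?thesis by (simp add: H_def)
  qed
  have main: "integrable lborel (\<lambda>y. k (x - y) * h y) \<and> \<bar>conv k h x\<bar> powr r \<le> C powr r * I x"
    if Fx: "integrable lborel (F x)" for x
  proof (cases "I x = 0")
    \<comment> \<open>The normalisation by I x fails here, but then the product k (x - y) h y
      vanishes for almost every y.\<close>
    case True
    then have "AE y in lborel. F x y = 0"
      using Fx unfolding I_def by (subst (asm) integral_nonneg_eq_0_iff_AE) (auto simp: F_def)
    then have 0: "AE y in lborel. k (x - y) * h y = 0"
      by eventually_elim (auto simp: F_def)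
    then have "integrable lborel (\<lambda>y. k (x - y) * h y) \<longleftrightarrow> integrable lborel (\<lambda>y::'a. 0::real)"
      by (intro integrable_cong_AE) auto
    moreover have "conv k h x = (\<integral>y. 0 \<partial>(lborel :: 'a measure))"
      unfolding conv_def using 0 by (intro integral_cong_AE) auto
    ultimately show ?thesis using True by simp
  next
    case False
    have "0 \<le> I x" unfolding I_def F_def by (intro Bochner_Integration.integral_nonneg) simp
    with False have I0: "0 < I x" by simp
    let ?G = "\<lambda>y. I x powr (1 / r) * (1 / r * (F x y / I x) + (1 / s - 1 / r) * \<bar>k (x - y)\<bar> powr s + (1 / a - 1 / r) * \<bar>h y\<bar> powr a)"
    note kx = integrable_shift_reflect[OF k, of x]
    have GI: "integrable lborel ?G"
      by (intro integrable_mult_right Bochner_Integration.integrable_add integrable_divide_zero Fx kx h)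
    have le: "\<bar>k (x - y) * h y\<bar> \<le> ?G y" for y
      using young_pointwise[OF _ _ I0 sar, of "\<bar>k (x - y)\<bar>" "\<bar>h y\<bar>"] by (simp add: abs_mult F_def)
    have kh: "integrable lborel (\<lambda>y. k (x - y) * h y)"
    proof (rule Bochner_Integration.integrable_bound[OF GI])
      show "AE y in lborel. norm (k (x - y) * h y) \<le> norm (?G y)"
        unfolding real_norm_def by (intro AE_I2 order_trans[OF le abs_ge_self])
    qed measurable
    have "\<bar>conv k h x\<bar> \<le> (\<integral>y. ?G y \<partial>lborel)"
      unfolding conv_def by (rule integral_abs_le_integral[OF kh GI le])
    also have "\<dots> = I x powr (1 / r) * (1 / r * (I x / I x) + (1 / s - 1 / r) * K + (1 / a - 1 / r) * H)"
      using Fx kx h by (simp add: K_def H_def I_def)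
    also have "\<dots> = I x powr (1 / r) * C" using I0 by (simp add: C_def)
    finally have "\<bar>conv k h x\<bar> powr r \<le> (I x powr (1 / r) * C) powr r"
      using sar by (intro powr_mono2) auto
    also have "\<dots> = C powr r * I x" using I0 C0 sar(3) by (simp add: powr_mult powr_powr)
    finally show ?thesis using kh by simp
  qed
  show "AE x in lborel. integrable lborel (\<lambda>y. k (x - y) * h y)"
    using fub(4) by eventually_elim (use main in blast)
  have AEle: "AE x in lborel. \<bar>conv k h x\<bar> powr r \<le> C powr r * I x"
    using fub(4) by eventually_elim (use main in blast)
  have cm[measurable]: "conv k h \<in> borel_measurable borel"
    unfolding conv_def by measurable
  show 1: "integrable lborel (\<lambda>x. \<bar>conv k h x\<bar> powr r)"
  proof (rule Bochner_Integration.integrable_bound)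
    show "integrable lborel (\<lambda>x. C powr r * I x)" using II by simp
    show "AE x in lborel. norm (\<bar>conv k h x\<bar> powr r) \<le> norm (C powr r * I x)"
      using AEle by eventually_elim auto
  qed measurable
  have "(\<integral>x. \<bar>conv k h x\<bar> powr r \<partial>lborel) \<le> (\<integral>x. C powr r * I x \<partial>lborel)"
    using 1 II AEle by (intro integral_mono_AE) auto
  also have "\<dots> = C powr r * (K * H)" by (simp add: Iint)
  finally show "(\<integral>x. \<bar>conv k h x\<bar> powr r \<partial>lborel) \<le> (1 / r + (1 / s - 1 / r) * K + (1 / a - 1 / r) * H) powr r * (K * H)"
    by (simp add: C_def)
qed

section \<open>Local L^p classes and convolution with kernels supported in the unit ball\<close>

definition Lploc :: "real \<Rightarrow> ('a::euclidean_space \<Rightarrow> real) \<Rightarrow> bool" where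
  "Lploc p h \<longleftrightarrow> h \<in> borel_measurable borel \<and>
    (\<forall>R. integrable lborel (\<lambda>x. indicat_real (cball 0 R) x * \<bar>h x\<bar> powr p))"

lemma Lploc_borel: "Lploc p h \<Longrightarrow> h \<in> borel_measurable borel"
  by (simp add: Lploc_def)

lemma Lploc_integrable: "Lploc p h \<Longrightarrow> integrable lborel (\<lambda>x. indicat_real (cball 0 R) x * \<bar>h x\<bar> powr p)"
  by (simp add: Lploc_def)

lemma indicator_mult_borel:
  fixes h :: "'a::euclidean_space \<Rightarrow> real"
  shows "h \<in> borel_measurable borel \<Longrightarrow> (\<lambda>x. indicat_real (cball 0 R) x * h x) \<in> borel_measurable borel"
  by (intro borel_measurable_times borel_measurable_indicator) auto

lemma abs_powr_borel:
  fixes h :: "'b \<Rightarrow> real"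
  assumes [measurable]: "h \<in> borel_measurable M" shows "(\<lambda>x. \<bar>h x\<bar> powr p) \<in> borel_measurable M"
  by measurable

lemma LplocI:
  fixes h :: "'a::euclidean_space \<Rightarrow> real"
  assumes h: "h \<in> borel_measurable borel"
    and g: "\<And>R. integrable lborel (\<lambda>x. indicat_real (cball 0 R) x * g x)"
    and le: "AE x in lborel. \<bar>h x\<bar> powr p \<le> g x"
  shows "Lploc p h"
  unfolding Lploc_def
proof (intro conjI allI h)
  fix R
  show "integrable lborel (\<lambda>x. indicat_real (cball 0 R) x * \<bar>h x\<bar> powr p)"
  proof (rule Bochner_Integration.integrable_bound[OF g])
    show "(\<lambda>x. indicat_real (cball 0 R) x * \<bar>h x\<bar> powr p) \<in> borel_measurable lborel"
      using indicator_mult_borel[OF abs_powr_borel[OF h]] by simp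
    show "AE x in lborel. norm (indicat_real (cball 0 R) x * \<bar>h x\<bar> powr p) \<le> norm (indicat_real (cball 0 R) x * g x)"
      using le by eventually_elim (auto simp: indicator_def)
  qed
qed

lemma indicator_cball_integrable: "integrable lborel (\<lambda>x::'a::euclidean_space. indicat_real (cball 0 R) x * c)"
  using emeasure_bounded_finite[of "cball (0::'a) R"] by (intro integrable_mult_left integrable_real_indicator) auto

lemma Lploc_mono:
  assumes "Lploc a h" "0 < b" "b \<le> a"
  shows "Lploc b h"
proof (rule LplocI[OF Lploc_borel[OF assms(1)]])
  show "integrable lborel (\<lambda>x. indicat_real (cball 0 R) x * (1 + \<bar>h x\<bar> powr a))" for R
    unfolding distrib_left by (intro Bochner_Integration.integrable_add indicator_cball_integrable Lploc_integrable assms)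
  show "AE x in lborel. \<bar>h x\<bar> powr b \<le> 1 + \<bar>h x\<bar> powr a"
  proof (rule AE_I2)
    fix x
    show "\<bar>h x\<bar> powr b \<le> 1 + \<bar>h x\<bar> powr a"
    proof (cases "\<bar>h x\<bar> \<le> 1")
      case True
      then have "\<bar>h x\<bar> powr b \<le> 1 powr b" using assms by (intro powr_mono2) auto
      then show ?thesis by (simp add: add_increasing2)
    next
      case False
      then have "\<bar>h x\<bar> powr b \<le> \<bar>h x\<bar> powr a" using assms by (intro powr_mono) auto
      then show ?thesis by simp
    qed
  qed
qed

lemma powr_add_le:
  fixes x y p :: real
  assumes "0 \<le> x" "0 \<le> y" "0 \<le> p"
  shows "(x + y) powr p \<le> 2 powr p * (x powr p + y powr p)"
proof -
  have "(x + y) powr p \<le> (2 * max x y) powr p" using assms by (intro powr_mono2) auto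
  also have "\<dots> = 2 powr p * max x y powr p" using assms by (simp add: powr_mult)
  also have "max x y powr p \<le> x powr p + y powr p" by (simp add: max_def)
  finally show ?thesis by simp
qed

lemma Lploc_add:
  assumes f: "Lploc p f" and g: "Lploc p g" and p: "0 < p"
  shows "Lploc p (\<lambda>x. f x + g x)"
proof (rule LplocI)
  show "(\<lambda>x. f x + g x) \<in> borel_measurable borel" using Lploc_borel[OF f] Lploc_borel[OF g] by measurable
  show "integrable lborel (\<lambda>x. indicat_real (cball 0 R) x * (2 powr p * (\<bar>f x\<bar> powr p + \<bar>g x\<bar> powr p)))" for R
  proof -
    have "integrable lborel (\<lambda>x. 2 powr p * (indicat_real (cball 0 R) x * \<bar>f x\<bar> powr p + indicat_real (cball 0 R) x * \<bar>g x\<bar> powr p))"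
      by (intro integrable_mult_right Bochner_Integration.integrable_add Lploc_integrable f g)
    then show ?thesis by (simp add: algebra_simps)
  qed
  show "AE x in lborel. \<bar>f x + g x\<bar> powr p \<le> 2 powr p * (\<bar>f x\<bar> powr p + \<bar>g x\<bar> powr p)"
  proof (rule AE_I2)
    fix x
    have "\<bar>f x + g x\<bar> powr p \<le> (\<bar>f x\<bar> + \<bar>g x\<bar>) powr p" using p by (intro powr_mono2) auto
    also have "\<dots> \<le> 2 powr p * (\<bar>f x\<bar> powr p + \<bar>g x\<bar> powr p)" using p by (intro powr_add_le) auto
    finally show "\<bar>f x + g x\<bar> powr p \<le> 2 powr p * (\<bar>f x\<bar> powr p + \<bar>g x\<bar> powr p)" .
  qed
qed

lemma Lploc_dominated:
  assumes "Lploc p g" "h \<in> borel_measurable borel" "AE x in lborel. \<bar>h x\<bar> \<le> \<bar>g x\<bar>" "0 < p"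
  shows "Lploc p h"
proof (rule LplocI[OF assms(2) Lploc_integrable[OF assms(1)]])
  show "AE x in lborel. \<bar>h x\<bar> powr p \<le> \<bar>g x\<bar> powr p"
    using assms(3) by eventually_elim (use assms(4) in \<open>auto intro: powr_mono2\<close>)
qed

lemma Lploc_cmult:
  assumes "Lploc p f" shows "Lploc p (\<lambda>x. c * f x)"
proof (rule LplocI)
  show "(\<lambda>x. c * f x) \<in> borel_measurable borel" using Lploc_borel[OF assms] by measurable
  show "integrable lborel (\<lambda>x. indicat_real (cball 0 R) x * (\<bar>c\<bar> powr p * \<bar>f x\<bar> powr p))" for R
    using integrable_mult_right[OF Lploc_integrable[OF assms, of R], of "\<bar>c\<bar> powr p"] by (simp add: mult_ac)
qed (simp add: abs_mult powr_mult)

text \<open>Membership is local and qualitative, so the pointwise bound |f g|^c <= |f|^a + |g|^b,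
  which is Young's inequality with weights c/a and c/b, replaces Hoelder's inequality for
  norms.\<close>

lemma Lploc_mult:
  assumes f: "Lploc a f" and g: "Lploc b g" and abc: "0 < a" "0 < b" "0 < c" "1 / c = 1 / a + 1 / b"
  shows "Lploc c (\<lambda>x. f x * g x)"
proof (rule LplocI)
  have ca: "c / a + c / b = 1" "0 < c / a" "0 < c / b"
    using abc(1-3) arg_cong[OF abc(4), of "\<lambda>z. c * z"] by (simp_all add: distrib_left)
  then have le1: "c / a \<le> 1" "c / b \<le> 1" by linarith+
  show "(\<lambda>x. f x * g x) \<in> borel_measurable borel" using Lploc_borel[OF f] Lploc_borel[OF g] by measurable
  show "integrable lborel (\<lambda>x. indicat_real (cball 0 R) x * (\<bar>f x\<bar> powr a + \<bar>g x\<bar> powr b))" for R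
    unfolding distrib_left by (intro Bochner_Integration.integrable_add Lploc_integrable f g)
  show "AE x in lborel. \<bar>f x * g x\<bar> powr c \<le> \<bar>f x\<bar> powr a + \<bar>g x\<bar> powr b"
  proof (rule AE_I2)
    fix x
    show "\<bar>f x * g x\<bar> powr c \<le> \<bar>f x\<bar> powr a + \<bar>g x\<bar> powr b"
    proof (cases "f x = 0 \<or> g x = 0")
      case True
      then show ?thesis by auto
    next
      case False
      then have pos: "0 < \<bar>f x\<bar> powr a" "0 < \<bar>g x\<bar> powr b" by auto
      have "\<bar>f x * g x\<bar> powr c = (\<bar>f x\<bar> powr a) powr (c / a) * (\<bar>g x\<bar> powr b) powr (c / b)"
        using abc(1,2) by (simp add: abs_mult powr_mult powr_powr)
      also have "\<dots> \<le> c / a * \<bar>f x\<bar> powr a + c / b * \<bar>g x\<bar> powr b"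
        using ca pos by (intro Youngs_inequality_0) auto
      also have "\<dots> \<le> 1 * \<bar>f x\<bar> powr a + 1 * \<bar>g x\<bar> powr b"
        using le1 by (intro add_mono mult_right_mono) auto
      finally show ?thesis by simp
    qed
  qed
qed

lemma Lploc_1: "Lploc 1 h \<longleftrightarrow> locint h"
proof
  assume L: "Lploc 1 h"
  have [measurable]: "h \<in> borel_measurable borel" using L by (rule Lploc_borel)
  show "locint h"
    unfolding locint_def
  proof (intro conjI allI)
    fix R
    show "integrable lborel (\<lambda>x. indicat_real (cball 0 R) x * h x)"
      by (rule Bochner_Integration.integrable_bound[OF Lploc_integrable[OF L, of R]])
        (use indicator_mult_borel[OF Lploc_borel[OF L]] in \<open>auto intro!: AE_I2 simp: abs_mult\<close>)
  qed measurable
next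
  assume "locint h"
  then show "Lploc 1 h"
    using locint_integrable[OF locint_abs[OF \<open>locint h\<close>]] locint_borel[OF \<open>locint h\<close>] by (simp add: Lploc_def)
qed

lemma Lploc_locint: "Lploc p h \<Longrightarrow> 1 \<le> p \<Longrightarrow> locint h"
  using Lploc_mono[of p h 1] by (simp add: Lploc_1)

lemma continuous_Lploc:
  fixes h :: "'a::euclidean_space \<Rightarrow> real"
  assumes "continuous_on UNIV h" "0 < p" shows "Lploc p h"
proof -
  have "continuous_on UNIV (\<lambda>x. \<bar>h x\<bar> powr p)"
    using assms by (intro continuous_on_powr' continuous_intros) auto
  from locint_integrable[OF continuous_locint[OF this]] show ?thesis
    using assms(1) by (simp add: Lploc_def continuous_borel)
qed

definition cutoff :: "real \<Rightarrow> ('a::euclidean_space \<Rightarrow> real) \<Rightarrow> 'a \<Rightarrow> real" where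
  "cutoff R h x = indicat_real (cball 0 R) x * h x"

lemma cutoff_zero: "R < norm x \<Longrightarrow> cutoff R h x = 0" by (simp add: cutoff_def)

lemma cutoff_borel: "h \<in> borel_measurable borel \<Longrightarrow> cutoff R h \<in> borel_measurable borel"
  unfolding cutoff_def[abs_def] by (rule indicator_mult_borel)

lemma cutoff_integrable: "locint h \<Longrightarrow> integrable lborel (cutoff R h)"
  unfolding cutoff_def[abs_def] by (rule locint_integrable)

lemma cutoff_powr: "0 < p \<Longrightarrow> \<bar>cutoff R h x\<bar> powr p = indicat_real (cball 0 R) x * \<bar>h x\<bar> powr p"
  by (simp add: cutoff_def indicator_def)

lemma cutoff_Lp: "Lploc p h \<Longrightarrow> 0 < p \<Longrightarrow> integrable lborel (\<lambda>x. \<bar>cutoff R h x\<bar> powr p)"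
  unfolding cutoff_powr by (rule Lploc_integrable)

lemma integrable_locint: "integrable lborel h \<Longrightarrow> locint h"
  unfolding locint_def
  by (auto intro!: Bochner_Integration.integrable_bound[where f=h] AE_I2 simp: indicator_def)

text \<open>Seen from |x| <= R, a kernel supported in the unit ball reaches only the ball of radius
  R + 1. This turns each global convolution estimate into a local one.\<close>

lemma conv_cutoff:
  fixes k h :: "'a::euclidean_space \<Rightarrow> real"
  assumes "\<And>x. 1 \<le> norm x \<Longrightarrow> k x = 0" "norm x \<le> R"
  shows "k (x - y) * h y = k (x - y) * cutoff (R + 1) h y" and "conv k h x = conv k (cutoff (R + 1) h) x"
proof -
  have *: "k (x - y) * h y = k (x - y) * cutoff (R + 1) h y" for y
  proof (cases "1 \<le> norm (x - y)")
    case False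
    then have "norm y \<le> R + 1" using norm_triangle_sub[of y x] assms(2) by (simp add: norm_minus_commute)
    then show ?thesis by (simp add: cutoff_def)
  qed (simp add: assms(1))
  then show "k (x - y) * h y = k (x - y) * cutoff (R + 1) h y" .
  show "conv k h x = conv k (cutoff (R + 1) h) x" unfolding conv_def by (subst *) (rule refl)
qed

lemma conv_borel:
  fixes k h :: "'a::euclidean_space \<Rightarrow> real"
  assumes [measurable]: "k \<in> borel_measurable borel" "h \<in> borel_measurable borel"
  shows "conv k h \<in> borel_measurable borel"
  unfolding conv_def[abs_def] by measurable

lemma Lploc_conv:
  fixes k h :: "'a::euclidean_space \<Rightarrow> real"
  assumes k: "k \<in> borel_measurable borel" "integrable lborel (\<lambda>x. \<bar>k x\<bar> powr s)" "\<And>x. 1 \<le> norm x \<Longrightarrow> k x = 0"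
    and h: "Lploc a h"
    and sar: "1 \<le> s" "1 \<le> a" "0 < r" "1 / r = 1 / a + 1 / s - 1"
  shows "Lploc r (conv k h)" and "AE x in lborel. integrable lborel (\<lambda>y. k (x - y) * h y)"
proof -
  have hb: "h \<in> borel_measurable borel" using h by (rule Lploc_borel)
  have a0: "0 < a" using sar by simp
  note Y = young_convolution[OF k(1) cutoff_borel[OF hb] k(2) cutoff_Lp[OF h a0] sar]
  show "Lploc r (conv k h)"
    unfolding Lploc_def
  proof (intro conjI allI conv_borel k hb)
    fix R
    have "integrable lborel (\<lambda>x. indicat_real (cball 0 R) x * \<bar>conv k (cutoff (R + 1) h) x\<bar> powr r)"
      using locint_integrable[OF integrable_locint[OF Y(2)]] .
    also have "(\<lambda>x. indicat_real (cball 0 R) x * \<bar>conv k (cutoff (R + 1) h) x\<bar> powr r)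
        = (\<lambda>x. indicat_real (cball 0 R) x * \<bar>conv k h x\<bar> powr r)"
    proof
      fix x
      show "indicat_real (cball 0 R) x * \<bar>conv k (cutoff (R + 1) h) x\<bar> powr r = indicat_real (cball 0 R) x * \<bar>conv k h x\<bar> powr r"
        using conv_cutoff(2)[OF k(3), where x=x and R=R and h=h] by (cases "x \<in> cball 0 R") auto
    qed
    finally show "integrable lborel (\<lambda>x. indicat_real (cball 0 R) x * \<bar>conv k h x\<bar> powr r)" .
  qed
  \<comment> \<open>The exceptional null set depends on the cutoff radius; integer radii keep the
    union of these sets countable.\<close>
  have "AE x in lborel. \<forall>n::nat. integrable lborel (\<lambda>y. k (x - y) * cutoff (real n) h y)"
    by (subst AE_all_countable) (rule allI, rule Y(1))
  then show "AE x in lborel. integrable lborel (\<lambda>y. k (x - y) * h y)"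
  proof eventually_elim
    case (elim x)
    obtain n :: nat where n: "norm x \<le> real n" using real_arch_simple by blast
    have "(\<lambda>y. k (x - y) * h y) = (\<lambda>y. k (x - y) * cutoff (real n + 1) h y)"
      by (intro ext conv_cutoff(1)[OF k(3) n])
    then show ?case using elim[rule_format, of "Suc n"] by (simp add: add.commute)
  qed
qed

lemma conv_L1:
  fixes k h :: "'a::euclidean_space \<Rightarrow> real"
  assumes k: "integrable lborel k" and h: "integrable lborel h"
  shows "integrable lborel (conv k h)" "(\<integral>x. \<bar>conv k h x\<bar> \<partial>lborel) \<le> (\<integral>x. \<bar>k x\<bar> \<partial>lborel) * (\<integral>x. \<bar>h x\<bar> \<partial>lborel)"
proof -
  have [measurable]: "k \<in> borel_measurable borel" "h \<in> borel_measurable borel" using k h by auto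
  note Y = young_convolution[of k h 1 1 1]
  have I: "integrable lborel (\<lambda>x. \<bar>conv k h x\<bar>)" using Y(2) k h by simp
  show "integrable lborel (conv k h)"
    by (rule integrable_abs_cancel[OF I]) (simp add: conv_borel)
  show "(\<integral>x. \<bar>conv k h x\<bar> \<partial>lborel) \<le> (\<integral>x. \<bar>k x\<bar> \<partial>lborel) * (\<integral>x. \<bar>h x\<bar> \<partial>lborel)"
    using Y(3) k h by simp
qed

section \<open>Mollification in L^p and in L1\<close>

lemma conv_moll_Lp:
  fixes h :: "'a::euclidean_space \<Rightarrow> real"
  assumes \<epsilon>: "0 < \<epsilon>" and h: "h \<in> borel_measurable borel" "integrable lborel (\<lambda>x. \<bar>h x\<bar> powr p)" and p: "1 \<le> p"
  shows "integrable lborel (\<lambda>x. \<bar>conv (moll \<epsilon>) h x\<bar> powr p)"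
    and "(\<integral>x. \<bar>conv (moll \<epsilon>) h x\<bar> powr p \<partial>lborel) \<le> (\<integral>x. \<bar>h x\<bar> powr p \<partial>lborel)"
proof -
  have t: "test_function (moll \<epsilon> :: 'a \<Rightarrow> real)" using \<epsilon> by (simp add: test_moll)
  have am: "\<bar>moll \<epsilon> x\<bar> = moll \<epsilon> x" for x :: 'a using moll_nonneg[OF \<epsilon>, of x] by simp
  have Im: "integrable lborel (\<lambda>x::'a. \<bar>moll \<epsilon> x\<bar> powr 1)" using test_integrable[OF t] by (simp add: am)
  note Y = young_convolution[OF test_borel[OF t] h(1) Im h(2), of p]
  show "integrable lborel (\<lambda>x. \<bar>conv (moll \<epsilon>) h x\<bar> powr p)" using Y(2) p by simp
  have "(\<integral>x. \<bar>conv (moll \<epsilon>) h x\<bar> powr p \<partial>lborel) \<le> (1 / p + (1 / 1 - 1 / p) * 1 + (1 / p - 1 / p) * (\<integral>x. \<bar>h x\<bar> powr p \<partial>lborel)) powr p * (1 * (\<integral>x. \<bar>h x\<bar> powr p \<partial>lborel))"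
    using Y(3) p integral_moll[OF \<epsilon>, where 'a='a] by (simp add: am)
  then show "(\<integral>x. \<bar>conv (moll \<epsilon>) h x\<bar> powr p \<partial>lborel) \<le> (\<integral>x. \<bar>h x\<bar> powr p \<partial>lborel)" using p by simp
qed

lemma conv_diff:
  assumes "integrable lborel (\<lambda>y. k (x - y) * f y)" "integrable lborel (\<lambda>y. k (x - y) * g y)"
  shows "conv k (\<lambda>y. f y - g y) x = conv k f x - conv k g x"
  using assms by (simp add: conv_def right_diff_distrib)

text \<open>Replacing h by a continuous g with compact support costs r/3 twice, because
  mollification does not increase the L1 norm. For g the convergence is pointwise and dominated on a
  fixed ball, which costs the last third.\<close>

lemma conv_moll_L1_limit:
  fixes h :: "'a::euclidean_space \<Rightarrow> real"
  assumes h: "integrable lborel h" and R: "\<And>x. R \<le> norm x \<Longrightarrow> h x = 0"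
  shows "(\<lambda>n. \<integral>x. \<bar>conv (moll (scale_seq n)) h x - h x\<bar> \<partial>lborel) \<longlonglongrightarrow> 0"
proof (rule LIMSEQ_I)
  fix r :: real assume r: "0 < r"
  then have r3: "0 < r / 3" by simp
  obtain g where g: "continuous_on UNIV g" "\<And>x. R + 1 \<le> norm x \<Longrightarrow> g x = 0" "(\<integral>x. \<bar>h x - g x\<bar> \<partial>lborel) < r / 3"
    using L1_approx_continuous[OF h R r3] by metis
  have Ig: "integrable lborel g" by (rule continuous_compact_support_integrable[OF g(1,2)])
  obtain M where M: "M > 0" "\<And>x. \<bar>g x\<bar> \<le> M * indicat_real (cball 0 (R + 1)) x"
    using continuous_compact_support_bounded[OF g(1,2)] by metis
  have gM: "\<bar>g x\<bar> \<le> M" for x using M(1) M(2)[of x] by (cases "x \<in> cball 0 (R + 1)") (auto simp: indicator_def)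
  have t: "test_function (moll (scale_seq n) :: 'a \<Rightarrow> real)" for n
    using scale_seq(1)[of n] by (simp add: test_moll)
  define G where "G n = conv (moll (scale_seq n)) g" for n
  have cG: "continuous_on UNIV (G n)" for n
    unfolding G_def by (rule smooth_continuous[OF smooth_conv[OF t continuous_locint[OF g(1)]]])
  have G0: "G n x = 0" if x: "R + 2 \<le> norm x" for n x
    unfolding G_def
  proof (rule conv_zero[OF moll_zero[OF scale_seq(1)] g(2)])
    show "scale_seq n + (R + 1) \<le> norm x" using x scale_seq(2)[of n] by linarith
  qed
  have IG: "integrable lborel (G n)" for n by (rule continuous_compact_support_integrable[OF cG G0])
  have GM: "\<bar>G n x\<bar> \<le> M" for n x
    unfolding G_def using conv_moll_diff_le[OF scale_seq(1) continuous_locint[OF g(1)], where c=0 and \<eta>=M] gM by simp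
  have "(\<lambda>n. \<integral>x. \<bar>G n x - g x\<bar> \<partial>lborel) \<longlonglongrightarrow> (\<integral>x. 0 \<partial>(lborel :: 'a measure))"
  proof (rule integral_dominated_convergence[where w="\<lambda>x. indicat_real (cball (0::'a) (R + 2)) x * (2 * M)"])
    show "AE x in lborel. (\<lambda>n. \<bar>G n x - g x\<bar>) \<longlonglongrightarrow> 0"
      unfolding G_def using conv_moll_tendsto[OF g(1)] by (intro AE_I2 tendsto_rabs_zero) (simp add: LIM_zero)
    show "AE x in lborel. norm \<bar>G n x - g x\<bar> \<le> indicat_real (cball (0::'a) (R + 2)) x * (2 * M)" for n
    proof (rule AE_I2)
      fix x
      show "norm \<bar>G n x - g x\<bar> \<le> indicat_real (cball (0::'a) (R + 2)) x * (2 * M)"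
        using GM[of n x] gM[of x] G0[of x n] g(2)[of x] by (cases "x \<in> cball 0 (R + 2)") auto
    qed
  qed (use IG Ig indicator_cball_integrable in auto)
  then have "eventually (\<lambda>n. (\<integral>x. \<bar>G n x - g x\<bar> \<partial>lborel) < r / 3) sequentially"
    using order_tendstoD(2)[of _ 0 sequentially "r / 3"] r3 by simp
  then obtain N where N: "\<And>n. n \<ge> N \<Longrightarrow> (\<integral>x. \<bar>G n x - g x\<bar> \<partial>lborel) < r / 3"
    by (auto simp: eventually_sequentially)
  show "\<exists>N. \<forall>n\<ge>N. norm ((\<integral>x. \<bar>conv (moll (scale_seq n)) h x - h x\<bar> \<partial>lborel) - 0) < r"
  proof (intro exI allI impI)
    fix n assume n: "N \<le> n"
    let ?m = "moll (scale_seq n) :: 'a \<Rightarrow> real"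
    have m1: "(\<integral>x. \<bar>?m x\<bar> \<partial>lborel) = 1"
      by (simp add: abs_of_nonneg moll_nonneg[OF scale_seq(1)] integral_moll[OF scale_seq(1)])
    have Ihg: "integrable lborel (\<lambda>y. h y - g y)" using h Ig by simp
    note c1 = conv_L1[OF test_integrable[OF t[of n]] Ihg] and ch = conv_L1[OF test_integrable[OF t[of n]] h]
    have e: "conv ?m (\<lambda>y. h y - g y) x = conv ?m h x - G n x" for x
      unfolding G_def
      by (intro conv_diff integrable_conv_test t integrable_locint h Ig)
    have "(\<integral>x. \<bar>conv ?m h x - h x\<bar> \<partial>lborel) \<le> (\<integral>x. \<bar>conv ?m (\<lambda>y. h y - g y) x\<bar> + \<bar>G n x - g x\<bar> + \<bar>h x - g x\<bar> \<partial>lborel)"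
      using c1(1) ch(1) IG[of n] Ig h Ihg unfolding e by (intro integral_mono) auto
    also have "\<dots> = (\<integral>x. \<bar>conv ?m (\<lambda>y. h y - g y) x\<bar> \<partial>lborel) + (\<integral>x. \<bar>G n x - g x\<bar> \<partial>lborel) + (\<integral>x. \<bar>h x - g x\<bar> \<partial>lborel)"
      using c1(1) IG[of n] Ig h Ihg by simp
    also have "\<dots> < r / 3 + r / 3 + r / 3"
      using c1(2) g(3) N[OF n] by (intro add_strict_mono) (auto simp: m1)
    finally show "norm ((\<integral>x. \<bar>conv ?m h x - h x\<bar> \<partial>lborel) - 0) < r" by simp
  qed
qed

section \<open>Convergence in L1 on balls\<close>

definition L1loc_lim :: "(nat \<Rightarrow> 'a::euclidean_space \<Rightarrow> real) \<Rightarrow> ('a \<Rightarrow> real) \<Rightarrow> bool" where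
  "L1loc_lim f h \<longleftrightarrow> (\<forall>R. (\<lambda>n. \<integral>x. \<bar>cutoff R (f n) x - cutoff R h x\<bar> \<partial>lborel) \<longlonglongrightarrow> 0)"

lemma L1loc_lim_conv_moll:
  fixes h :: "'a::euclidean_space \<Rightarrow> real"
  assumes h: "locint h"
  shows "L1loc_lim (\<lambda>n. conv (moll (scale_seq n)) h) h"
  unfolding L1loc_lim_def
proof
  fix R
  have t: "test_function (moll (scale_seq n) :: 'a \<Rightarrow> real)" for n
    using scale_seq(1)[of n] by (simp add: test_moll)
  have z: "moll (scale_seq n) x = 0" if "1 \<le> norm x" for n and x :: 'a
    using moll_zero[OF scale_seq(1), of n x] scale_seq(2)[of n] that by simp
  let ?h = "cutoff (R + 1) h"
  have Ih: "integrable lborel ?h" by (rule cutoff_integrable[OF h])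
  have lim: "(\<lambda>n. \<integral>x. \<bar>conv (moll (scale_seq n)) ?h x - ?h x\<bar> \<partial>lborel) \<longlonglongrightarrow> 0"
    by (rule conv_moll_L1_limit[OF Ih, of "R + 2"]) (simp add: cutoff_def)
  show "(\<lambda>n. \<integral>x. \<bar>cutoff R (conv (moll (scale_seq n)) h) x - cutoff R h x\<bar> \<partial>lborel) \<longlonglongrightarrow> 0"
  proof (rule tendsto_sandwich[OF always_eventually always_eventually tendsto_const lim]; intro allI)
    fix n
    show "0 \<le> (\<integral>x. \<bar>cutoff R (conv (moll (scale_seq n)) h) x - cutoff R h x\<bar> \<partial>lborel)" by simp
    show "(\<integral>x. \<bar>cutoff R (conv (moll (scale_seq n)) h) x - cutoff R h x\<bar> \<partial>lborel)
        \<le> (\<integral>x. \<bar>conv (moll (scale_seq n)) ?h x - ?h x\<bar> \<partial>lborel)"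
    proof (rule integral_mono')
      show "integrable lborel (\<lambda>x. \<bar>conv (moll (scale_seq n)) ?h x - ?h x\<bar>)"
        using conv_L1(1)[OF test_integrable[OF t] Ih] Ih by simp
      fix x
      show "\<bar>cutoff R (conv (moll (scale_seq n)) h) x - cutoff R h x\<bar> \<le> \<bar>conv (moll (scale_seq n)) ?h x - ?h x\<bar>"
      proof (cases "norm x \<le> R")
        case True
        then show ?thesis using conv_cutoff(2)[OF z True, where h=h] by (simp add: cutoff_def)
      qed (simp add: cutoff_def)
    qed simp
  qed
qed

text \<open>The means by which identities for smooth mollifications pass to weak identities for
  their limits: on its support the test function is bounded, and there the convergence is in
  L1.\<close>

lemma L1loc_lim_integral:
  fixes h :: "'a::euclidean_space \<Rightarrow> real"
  assumes f: "\<And>n. locint (f n)" and h: "locint h" and lim: "L1loc_lim f h"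
    and \<phi>: "continuous_on UNIV \<phi>" "\<And>x. R \<le> norm x \<Longrightarrow> \<phi> x = 0"
  shows "(\<lambda>n. \<integral>x. \<phi> x * f n x \<partial>lborel) \<longlonglongrightarrow> (\<integral>x. \<phi> x * h x \<partial>lborel)"
    and "integrable lborel (\<lambda>x. \<phi> x * h x)"
proof -
  obtain M where M: "M > 0" "\<And>x. \<bar>\<phi> x\<bar> \<le> M * indicat_real (cball 0 R) x"
    using continuous_compact_support_bounded[OF \<phi>] by metis
  have pM: "\<bar>\<phi> x\<bar> \<le> M" for x using M(1) M(2)[of x] by (cases "x \<in> cball 0 R") (auto simp: indicator_def)
  have eq: "\<phi> x * g x = \<phi> x * cutoff R g x" for g :: "'a \<Rightarrow> real" and x
    using \<phi>(2)[of x] by (cases "norm x \<le> R") (auto simp: cutoff_def)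
  have J: "integrable lborel (\<lambda>x. \<phi> x * cutoff R g x)" if "locint g" for g
    by (rule integrable_bounded_mult[OF continuous_borel[OF \<phi>(1)] pM cutoff_integrable[OF that]])
  have I: "integrable lborel (\<lambda>x. \<phi> x * g x)" if "locint g" for g
    unfolding eq[of _ g] by (rule J[OF that])
  show "integrable lborel (\<lambda>x. \<phi> x * h x)" by (rule I[OF h])
  have "(\<lambda>n. (\<integral>x. \<phi> x * f n x \<partial>lborel) - (\<integral>x. \<phi> x * h x \<partial>lborel)) \<longlonglongrightarrow> 0"
  proof (rule Lim_null_comparison)
    show "(\<lambda>n. M * (\<integral>x. \<bar>cutoff R (f n) x - cutoff R h x\<bar> \<partial>lborel)) \<longlonglongrightarrow> 0"
      using tendsto_mult_left[OF lim[unfolded L1loc_lim_def, rule_format, of R], of M] by simp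
    show "\<forall>\<^sub>F n in sequentially. norm ((\<integral>x. \<phi> x * f n x \<partial>lborel) - (\<integral>x. \<phi> x * h x \<partial>lborel))
        \<le> M * (\<integral>x. \<bar>cutoff R (f n) x - cutoff R h x\<bar> \<partial>lborel)"
    proof (intro always_eventually allI)
      fix n
      have "(\<integral>x. \<phi> x * f n x \<partial>lborel) - (\<integral>x. \<phi> x * h x \<partial>lborel) = (\<integral>x. \<phi> x * (cutoff R (f n) x - cutoff R h x) \<partial>lborel)"
        unfolding eq[of _ h] eq[of _ "f n"] using J[OF f[of n]] J[OF h] by (simp add: right_diff_distrib)
      also have "\<bar>\<dots>\<bar> \<le> (\<integral>x. \<bar>\<phi> x * (cutoff R (f n) x - cutoff R h x)\<bar> \<partial>lborel)" by (rule integral_abs_bound)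
      also have "\<dots> \<le> M * (\<integral>x. \<bar>cutoff R (f n) x - cutoff R h x\<bar> \<partial>lborel)"
        by (rule integral_bounded_mult_le[OF continuous_borel[OF \<phi>(1)] pM])
          (intro Bochner_Integration.integrable_diff cutoff_integrable f h)
      finally show "norm ((\<integral>x. \<phi> x * f n x \<partial>lborel) - (\<integral>x. \<phi> x * h x \<partial>lborel))
        \<le> M * (\<integral>x. \<bar>cutoff R (f n) x - cutoff R h x\<bar> \<partial>lborel)" by simp
    qed
  qed
  then show "(\<lambda>n. \<integral>x. \<phi> x * f n x \<partial>lborel) \<longlonglongrightarrow> (\<integral>x. \<phi> x * h x \<partial>lborel)"
    by (simp add: LIM_zero_cancel)
qed

section \<open>Kernel bounds for the parametrix and its gradient\<close>

definition rker :: "real \<Rightarrow> 'a::euclidean_space \<Rightarrow> real" where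
  "rker \<alpha> x = indicat_real (ball 0 1) x * norm x powr (- \<alpha>)"

lemma rker_borel[measurable]: "rker \<alpha> \<in> borel_measurable borel"
  unfolding rker_def[abs_def] by (intro borel_measurable_times borel_measurable_indicator) auto

lemma rker_nonneg: "0 \<le> rker \<alpha> x" by (simp add: rker_def)

lemma rker_zero: "1 \<le> norm x \<Longrightarrow> rker \<alpha> x = 0" by (simp add: rker_def)

lemma rker_powr: "0 < s \<Longrightarrow> \<bar>rker \<alpha> x\<bar> powr s = rker (\<alpha> * s) x"
  by (simp add: rker_def indicator_def powr_powr)

text \<open>Dyadic decomposition: between the radii 2^-(n+1) and 2^-n the kernel is at most 2^((n+1)
  \<alpha>), and the ball has measure of order 2^(-n d). The integral is dominated by a geometric
  series of ratio 2^(\<alpha> - d) < 1.\<close>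

lemma integrable_rker:
  assumes \<alpha>: "0 \<le> \<alpha>" "\<alpha> < real DIM('a)"
  shows "integrable lborel (rker \<alpha> :: 'a::euclidean_space \<Rightarrow> real)"
proof -
  let ?d = "real DIM('a)"
  let ?B = "\<lambda>n. ball (0::'a) ((1 / 2) ^ n)"
  define c where "c n = ((1 / 2) ^ Suc n) powr (- \<alpha>)" for n :: nat
  have pw: "ennreal (rker \<alpha> x) \<le> (\<Sum>n. ennreal (c n) * indicator (?B n) x)" for x :: 'a
  proof (cases "x \<noteq> 0 \<and> norm x < 1")
    case True
    define P where "P n \<longleftrightarrow> (1 / 2) ^ n \<le> norm x" for n :: nat
    have "\<exists>n. (1 / 2) ^ n < norm x" using True by (intro real_arch_pow_inv) auto
    then have "\<exists>n. P n" unfolding P_def by (meson less_imp_le)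
    define m where "m = (LEAST n. P n)"
    have L: "P m" unfolding m_def using \<open>\<exists>n. P n\<close> by (rule LeastI_ex)
    have "m \<noteq> 0"
    proof
      assume "m = 0"
      then show False using L True by (simp add: P_def)
    qed
    then obtain n where n: "m = Suc n" by (cases m) auto
    then have "n < m" by simp
    then have "\<not> P n" unfolding m_def by (rule not_less_Least)
    then have up: "norm x < (1 / 2) ^ n" by (simp add: P_def)
    have lo: "(1 / 2) ^ Suc n \<le> norm x" using L unfolding n P_def .
    have "rker \<alpha> x \<le> c n"
      unfolding c_def rker_def using True lo \<alpha> by (auto simp: powr_minus intro!: le_imp_inverse_le powr_mono2)
    define F where "F k = ennreal (c k) * indicator (?B k) x" for k
    from \<open>rker \<alpha> x \<le> c n\<close> have "ennreal (rker \<alpha> x) \<le> F n"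
      using up by (simp add: F_def ennreal_leI)
    also have "\<dots> = sum F {n}" by simp
    also have "\<dots> \<le> suminf F" by (rule sum_le_suminf) auto
    also have "\<dots> = (\<Sum>n. ennreal (c n) * indicator (?B n) x)" by (simp only: F_def[abs_def])
    finally show ?thesis .
  next
    case False
    then have "rker \<alpha> x = 0" by (auto simp: rker_def)
    then show ?thesis by simp
  qed
  have meas: "emeasure lborel (?B n) = ennreal (unit_ball_vol ?d * ((1 / 2) ^ n) ^ DIM('a))" for n
    by (simp add: emeasure_ball)
  have q: "ennreal (c n) * emeasure lborel (?B n) = ennreal (2 powr \<alpha> * unit_ball_vol ?d * (2 powr (\<alpha> - ?d)) ^ n)" for n
  proof -
    have half: "(1 / 2 :: real) ^ k = 2 powr (- real k)" for k
      by (simp add: power_one_over powr_minus powr_realpow inverse_eq_divide)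
    have c: "c n = 2 powr (real (Suc n) * \<alpha>)" unfolding c_def half powr_powr by (simp add: algebra_simps)
    have "((1 / 2) ^ n) ^ DIM('a) = 2 powr (- (real n * ?d))"
      using half[of "n * DIM('a)"] by (simp only: power_mult of_nat_mult)
    moreover have "(2 powr (\<alpha> - ?d)) ^ n = 2 powr ((\<alpha> - ?d) * real n)"
      by (simp add: powr_realpow[symmetric] powr_powr)
    ultimately have "c n * ((1 / 2) ^ n) ^ DIM('a) = 2 powr \<alpha> * (2 powr (\<alpha> - ?d)) ^ n"
      unfolding c by (simp add: powr_add[symmetric] algebra_simps)
    then have "c n * (unit_ball_vol ?d * ((1 / 2) ^ n) ^ DIM('a)) = 2 powr \<alpha> * unit_ball_vol ?d * (2 powr (\<alpha> - ?d)) ^ n"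
      by (simp add: mult_ac)
    then show ?thesis unfolding meas by (simp add: ennreal_mult'[symmetric] c_def)
  qed
  have "(\<integral>\<^sup>+x. ennreal (norm (rker \<alpha> (x::'a))) \<partial>lborel) \<le> (\<integral>\<^sup>+x. (\<Sum>n. ennreal (c n) * indicator (?B n) x) \<partial>lborel)"
    using pw by (intro nn_integral_mono) (simp add: rker_nonneg)
  also have "\<dots> = (\<Sum>n. \<integral>\<^sup>+x. ennreal (c n) * indicator (?B n) x \<partial>lborel)"
    by (rule nn_integral_suminf) (auto intro!: borel_measurable_times_ennreal borel_measurable_indicator)
  also have "\<dots> = (\<Sum>n. ennreal (c n) * emeasure lborel (?B n))"
    by (intro suminf_cong nn_integral_cmult_indicator) auto
  also have "\<dots> = (\<Sum>n. ennreal (2 powr \<alpha> * unit_ball_vol ?d * (2 powr (\<alpha> - ?d)) ^ n))"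
    by (simp only: q)
  also have "\<dots> < \<infinity>"
  proof -
    have "2 powr (\<alpha> - ?d) < 2 powr 0" using \<alpha> by (intro powr_less_mono) auto
    then have "summable (\<lambda>n. 2 powr \<alpha> * unit_ball_vol ?d * (2 powr (\<alpha> - ?d)) ^ n)"
      by (intro summable_mult summable_geometric) simp
    then have "(\<Sum>n. ennreal (2 powr \<alpha> * unit_ball_vol ?d * (2 powr (\<alpha> - ?d)) ^ n)) \<noteq> top"
      by (rule ennreal_suminf_neq_top) simp
    then show ?thesis by (simp only: less_top infinity_ennreal_def)
  qed
  finally show ?thesis by (intro integrableI_bounded) auto
qed

text \<open>\<phi>(x/t) vanishes for t <= |x|, so only the scales from |x| to 1 contribute, and the
  integral of t^(-m-1) over them is at most |x|^(-m) / m whatever \<epsilon> is. The origin is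
  excluded because \<open>0 powr a\<close> is 0, so that \<open>rker\<close> vanishes there instead
  of blowing up.\<close>

lemma scale_int_le:
  fixes \<phi> :: "'a::euclidean_space \<Rightarrow> real"
  assumes \<phi>: "test_function \<phi>" "\<And>x. 1 \<le> norm x \<Longrightarrow> \<phi> x = 0" "\<And>x. \<bar>\<phi> x\<bar> \<le> M"
    and m: "1 \<le> m" and \<epsilon>: "0 < \<epsilon>" and x: "x \<noteq> 0"
  shows "\<bar>scale_int (Suc m) \<phi> \<epsilon> x\<bar> \<le> M / m * rker m x"
proof (cases "1 \<le> norm x")
  case True
  then show ?thesis using scale_int_zero[OF \<phi>(2) \<epsilon> True] by (simp add: rker_zero)
next
  case False
  let ?n = "norm x"
  have n0: "0 < ?n" using x by simp
  have M0: "0 \<le> M" using \<phi>(3)[of 0] by linarith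
  have FTC: "(\<integral>t. indicat_real {?n..1} t * (1 / t ^ Suc m) \<partial>lborel) = - (1 / (real m * 1 ^ m)) - - (1 / (real m * ?n ^ m))"
    "integrable lborel (\<lambda>t. indicat_real {?n..1} t * (1 / t ^ Suc m))"
  proof -
    have d: "((\<lambda>t. - (1 / (m * t ^ m))) has_real_derivative 1 / t ^ Suc m) (at t)" if nt: "?n < t" for t :: real
    proof -
      have that: "0 < t" using nt n0 by linarith
      obtain k where k: "m = Suc k" using m by (cases m) auto
      have "((\<lambda>t. - (1 / real m) * (1 / t) ^ m) has_real_derivative
          - (1 / real m) * (real m * (1 / t) ^ (m - 1) * (- 1 / t\<^sup>2))) (at t)"
        using that by (auto intro!: derivative_eq_intros simp: power2_eq_square)
      also have "- (1 / real m) * (real m * (1 / t) ^ (m - 1) * (- 1 / t\<^sup>2)) = 1 / t ^ Suc m"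
        using that unfolding k by (simp add: power_one_over power2_eq_square)
      also have "(\<lambda>t. - (1 / real m) * (1 / t) ^ m) = (\<lambda>t. - (1 / (real m * t ^ m)))"
        by (simp add: power_one_over)
      finally show ?thesis .
    qed
    have c: "continuous_on {?n..1} (\<lambda>t. 1 / t ^ Suc m)"
      using n0 by (intro continuous_intros) auto
    have c': "continuous_on {?n..1} (\<lambda>t. - (1 / (m * t ^ m)))"
      using n0 m by (intro continuous_intros) auto
    show "(\<integral>t. indicat_real {?n..1} t * (1 / t ^ Suc m) \<partial>lborel) = - (1 / (real m * 1 ^ m)) - - (1 / (real m * ?n ^ m))"
      by (rule FTC_interior(1)[OF _ c' d c]) (use n0 False in auto)
    show "integrable lborel (\<lambda>t. indicat_real {?n..1} t * (1 / t ^ Suc m))"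
      by (rule FTC_interior(2)[OF _ c' d c]) (use n0 False in auto)
  qed
  have "\<bar>scale_int (Suc m) \<phi> \<epsilon> x\<bar> \<le> (\<integral>t. M * (indicat_real {?n..1} t * (1 / t ^ Suc m)) \<partial>lborel)"
    unfolding scale_int_def
  proof (rule integral_abs_le_integral[OF scale_int_integrable[OF \<phi>(1) \<epsilon>]])
    show "integrable lborel (\<lambda>t. M * (indicat_real {?n..1} t * (1 / t ^ Suc m)))"
      by (rule integrable_mult_right[OF FTC(2)])
    fix t :: real
    show "\<bar>indicat_real {\<epsilon>..1} t * (\<phi> ((1 / t) *\<^sub>R x) / t ^ Suc m)\<bar> \<le> M * (indicat_real {?n..1} t * (1 / t ^ Suc m))"
    proof (cases "t \<in> {\<epsilon>..1}")
      case True
      then have t: "0 < t" using \<epsilon> by auto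
      show ?thesis
      proof (cases "?n \<le> t")
        case True
        then show ?thesis
          using \<open>t \<in> {\<epsilon>..1}\<close> \<phi>(3)[of "(1 / t) *\<^sub>R x"] t
          by (simp add: abs_mult abs_divide divide_right_mono)
      next
        case False
        then have "1 \<le> norm ((1 / t) *\<^sub>R x)" using t by (simp add: field_simps)
        then show ?thesis using False by (simp add: \<phi>(2))
      qed
    next
      case False
      have "0 \<le> indicat_real {?n..1} t * (1 / t ^ Suc m)"
      proof (cases "t \<in> {?n..1}")
        case True
        then have "0 < t" using less_le_trans[OF n0] by simp
        then show ?thesis by simp
      qed simp
      note nn = mult_nonneg_nonneg[OF M0 this]
      have z: "indicat_real {\<epsilon>..1} t = 0" using False by simp
      show ?thesis unfolding z using nn by (simp only: mult_zero_left abs_zero)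
    qed
  qed
  also have "\<dots> = M * (- (1 / (real m * 1 ^ m)) - - (1 / (real m * ?n ^ m)))"
    by (simp only: integral_mult_right_zero FTC(1))
  also have "\<dots> \<le> M * (1 / (m * ?n ^ m))" using M0 by (intro mult_left_mono) auto
  also have "\<dots> = M / m * rker m x"
    using False n0 by (simp add: rker_def powr_minus powr_realpow inverse_eq_divide)
  finally show ?thesis .
qed

text \<open>The power of t is d - 1 = m + 1 with m = d - 2, and d >= 3 makes m >= 1; in dimension 2
  the integral over the scales would produce a logarithm.\<close>

lemma parametrix_le:
  assumes "3 \<le> DIM('a)"
  obtains K where "K > 0" "\<And>\<epsilon> x::'a::euclidean_space. 0 < \<epsilon> \<Longrightarrow> x \<noteq> 0 \<Longrightarrow> \<bar>parametrix \<epsilon> x\<bar> \<le> K * rker (real DIM('a) - 2) x"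
proof -
  obtain M where M: "M > 0" "\<And>x::'a. \<bar>sig x\<bar> \<le> M" using test_bounded[OF test_sig] by metis
  define m where "m = DIM('a) - 2"
  have m: "1 \<le> m" "DIM('a) - 1 = Suc m" using assms by (auto simp: m_def)
  have rm: "real m = real DIM('a) - 2" using assms by (simp add: m_def of_nat_diff)
  show ?thesis
  proof (rule that[of "M / m"])
    fix \<epsilon> :: real and x :: 'a assume "0 < \<epsilon>" "x \<noteq> 0"
    from scale_int_le[OF test_sig sig_zero M(2) m(1) this]
    show "\<bar>parametrix \<epsilon> x\<bar> \<le> M / m * rker (real DIM('a) - 2) x" by (simp only: parametrix_def m(2) rm[symmetric])
  qed (use M m in simp)
qed

lemma partial_sig_zero:
  assumes "1 \<le> norm x" "e \<in> Basis" shows "partial e sig x = 0"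
  by (rule partial_vanishes[OF test_smooth[OF test_sig] sig_zero assms(2,1)])

lemma partial_parametrix_le:
  assumes d: "3 \<le> DIM('a)" and e: "e \<in> Basis"
  obtains K where "K > 0" "\<And>\<epsilon> x::'a::euclidean_space. 0 < \<epsilon> \<Longrightarrow> x \<noteq> 0 \<Longrightarrow> \<bar>partial e (parametrix \<epsilon>) x\<bar> \<le> K * rker (real DIM('a) - 1) x"
proof -
  have t: "test_function (partial e sig)" by (rule test_partial[OF test_sig e])
  obtain M where M: "M > 0" "\<And>x::'a. \<bar>partial e sig x\<bar> \<le> M" using test_bounded[OF t] by metis
  define m where "m = DIM('a) - 1"
  have m: "1 \<le> m" "DIM('a) = Suc m" using d by (auto simp: m_def)
  have rm: "real m = real DIM('a) - 1" using d by (simp add: m_def of_nat_diff)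
  show ?thesis
  proof (rule that[of "M / m"])
    fix \<epsilon> :: real and x :: 'a assume "0 < \<epsilon>" "x \<noteq> 0"
    from scale_int_le[OF t partial_sig_zero[OF _ e] M(2) m(1) this]
    show "\<bar>partial e (parametrix \<epsilon>) x\<bar> \<le> M / m * rker (real DIM('a) - 1) x"
      by (simp only: partial_parametrix[OF \<open>0 < \<epsilon>\<close> e] m(2)[symmetric] rm[symmetric])
  qed (use M m in simp)
qed

text \<open>For x different from 0 the sequence is eventually constant, since scales below |x|
  contribute nothing. Writing the kernel as a limit gives its measurability and its bound from those
  of the regularised kernels.\<close>

definition grad_kernel :: "'a::euclidean_space \<Rightarrow> 'a \<Rightarrow> real" where
  "grad_kernel e x = lim (\<lambda>n. partial e (parametrix (scale_seq n)) x)"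

lemma scale_int_eventually:
  fixes x :: "'a::euclidean_space"
  assumes "\<And>x. 1 \<le> norm x \<Longrightarrow> \<phi> x = 0" "0 < \<epsilon>" "\<epsilon> \<le> norm x"
  shows "scale_int k \<phi> \<epsilon> x = scale_int k \<phi> (norm x) x"
proof -
  have "indicat_real {\<epsilon>..1} t * (\<phi> ((1 / t) *\<^sub>R x) / t ^ k) = indicat_real {norm x..1} t * (\<phi> ((1 / t) *\<^sub>R x) / t ^ k)" for t
  proof (cases "\<epsilon> \<le> t \<and> t < norm x")
    case True
    then have "1 \<le> norm ((1 / t) *\<^sub>R x)" using assms(2) by (simp add: field_simps)
    then show ?thesis by (simp add: assms(1))
  next
    case False
    then show ?thesis using assms(3) by (auto simp: indicator_def)
  qed
  then show ?thesis by (simp only: scale_int_def)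
qed

lemma grad_kernel_lim:
  fixes x :: "'a::euclidean_space"
  assumes e: "e \<in> Basis" and x: "x \<noteq> 0"
  shows "(\<lambda>n. partial e (parametrix (scale_seq n)) x) \<longlonglongrightarrow> grad_kernel e x"
proof -
  have "eventually (\<lambda>n. scale_seq n < norm x) sequentially"
    using order_tendstoD(2)[OF scale_seq_limit, of "norm x"] x by simp
  then have "eventually (\<lambda>n. partial e (parametrix (scale_seq n)) x = scale_int DIM('a) (partial e sig) (norm x) x) sequentially"
  proof eventually_elim
    case (elim n)
    then show ?case
      using scale_int_eventually[OF partial_sig_zero[OF _ e] scale_seq(1), where x=x and k="DIM('a)"]
      by (simp add: partial_parametrix[OF scale_seq(1) e])
  qed
  then have "(\<lambda>n. partial e (parametrix (scale_seq n)) x) \<longlonglongrightarrow> scale_int DIM('a) (partial e sig) (norm x) x"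
    by (rule tendsto_eventually)
  then show ?thesis unfolding grad_kernel_def by (simp add: limI)
qed

lemma grad_kernel_borel:
  fixes e :: "'a::euclidean_space"
  assumes "e \<in> Basis" shows "grad_kernel e \<in> borel_measurable borel"
  unfolding grad_kernel_def[abs_def]
  by (rule borel_measurable_lim_metric) (intro test_borel test_partial test_parametrix scale_seq assms)

lemma grad_kernel_zero:
  assumes "e \<in> Basis" "1 \<le> norm x" shows "grad_kernel e x = 0"
proof -
  have "x \<noteq> 0" using assms(2) by auto
  moreover have "partial e (parametrix (scale_seq n)) x = 0" for n
    using scale_int_zero[OF partial_sig_zero[OF _ assms(1)] scale_seq(1) assms(2)]
    by (simp add: partial_parametrix[OF scale_seq(1) assms(1)])
  ultimately show ?thesis using grad_kernel_lim[OF assms(1), of x] by (simp add: LIMSEQ_const_iff)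
qed

lemma grad_kernel_le:
  assumes d: "3 \<le> DIM('a)" and e: "e \<in> Basis"
  obtains K where "K > 0" "\<And>x::'a::euclidean_space. x \<noteq> 0 \<Longrightarrow> \<bar>grad_kernel e x\<bar> \<le> K * rker (real DIM('a) - 1) x"
proof -
  obtain K where K: "K > 0" "\<And>\<epsilon> x::'a. 0 < \<epsilon> \<Longrightarrow> x \<noteq> 0 \<Longrightarrow> \<bar>partial e (parametrix \<epsilon>) x\<bar> \<le> K * rker (real DIM('a) - 1) x"
    using partial_parametrix_le[OF d e] by metis
  show ?thesis
  proof (rule that[OF K(1)])
    fix x :: 'a assume x: "x \<noteq> 0"
    show "\<bar>grad_kernel e x\<bar> \<le> K * rker (real DIM('a) - 1) x"
      by (rule LIMSEQ_le_const2[OF tendsto_rabs[OF grad_kernel_lim[OF e x]]]) (use K(2) scale_seq(1) x in blast)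
  qed
qed

lemma grad_kernel_L1_limit:
  fixes e :: "'a::euclidean_space"
  assumes d: "3 \<le> DIM('a)" and e: "e \<in> Basis"
  shows "integrable lborel (grad_kernel e)"
    and "(\<lambda>n. \<integral>x. \<bar>partial e (parametrix (scale_seq n)) x - grad_kernel e x\<bar> \<partial>lborel) \<longlonglongrightarrow> 0"
proof -
  obtain K where K: "K > 0" "\<And>\<epsilon> x::'a. 0 < \<epsilon> \<Longrightarrow> x \<noteq> 0 \<Longrightarrow> \<bar>partial e (parametrix \<epsilon>) x\<bar> \<le> K * rker (real DIM('a) - 1) x"
    using partial_parametrix_le[OF d e] by metis
  obtain L where L: "L > 0" "\<And>x::'a. x \<noteq> 0 \<Longrightarrow> \<bar>grad_kernel e x\<bar> \<le> L * rker (real DIM('a) - 1) x"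
    using grad_kernel_le[OF d e] by metis
  have R: "integrable lborel (rker (real DIM('a) - 1) :: 'a \<Rightarrow> real)" using d by (intro integrable_rker) auto
  have t: "test_function (partial e (parametrix (scale_seq n)))" for n
    by (intro test_partial test_parametrix scale_seq e)
  show I: "integrable lborel (grad_kernel e)"
  proof (rule Bochner_Integration.integrable_bound)
    show "integrable lborel (\<lambda>x::'a. L * rker (real DIM('a) - 1) x)" using R by simp
    show "AE x in lborel. norm (grad_kernel e x) \<le> norm (L * rker (real DIM('a) - 1) x)"
      using AE_lborel_singleton[of 0] by eventually_elim (use L in \<open>auto simp: abs_mult rker_nonneg\<close>)
  qed (use grad_kernel_borel[OF e] in simp)
  have "(\<lambda>n. \<integral>x. \<bar>partial e (parametrix (scale_seq n)) x - grad_kernel e x\<bar> \<partial>lborel) \<longlonglongrightarrow> (\<integral>x. 0 \<partial>(lborel :: 'a measure))"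
  proof (rule integral_dominated_convergence[where w="\<lambda>x. (K + L) * rker (real DIM('a) - 1) x"])
    show "AE x in lborel. (\<lambda>n. \<bar>partial e (parametrix (scale_seq n)) x - grad_kernel e x\<bar>) \<longlonglongrightarrow> 0"
      using AE_lborel_singleton[of 0]
      by eventually_elim (use grad_kernel_lim[OF e] in \<open>auto intro!: tendsto_rabs_zero simp: LIM_zero\<close>)
    show "AE x in lborel. norm \<bar>partial e (parametrix (scale_seq n)) x - grad_kernel e x\<bar> \<le> (K + L) * rker (real DIM('a) - 1) x" for n
      using AE_lborel_singleton[of 0]
    proof eventually_elim
      case (elim x)
      show ?case using K(2)[OF scale_seq(1) elim, of n] L(2)[OF elim] by (simp add: distrib_right)
    qed
    show "(\<lambda>x. \<bar>partial e (parametrix (scale_seq n)) x - grad_kernel e x\<bar>) \<in> borel_measurable lborel" for n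
      using test_borel[OF t[of n]] grad_kernel_borel[OF e] by simp
  qed (use R in auto)
  then show "(\<lambda>n. \<integral>x. \<bar>partial e (parametrix (scale_seq n)) x - grad_kernel e x\<bar> \<partial>lborel) \<longlonglongrightarrow> 0" by simp
qed

lemma locint_conv:
  fixes k g :: "'a::euclidean_space \<Rightarrow> real"
  assumes "integrable lborel k" "\<And>x. 1 \<le> norm x \<Longrightarrow> k x = 0" "locint g"
  shows "locint (conv k g)" and "AE x in lborel. integrable lborel (\<lambda>y. k (x - y) * g y)"
proof -
  have kb: "k \<in> borel_measurable borel" using assms(1) by auto
  have ki: "integrable lborel (\<lambda>x. \<bar>k x\<bar> powr 1)" using assms(1) by simp
  have "Lploc 1 g" using assms(3) by (simp add: Lploc_1)
  note L = Lploc_conv[OF kb ki assms(2) this, of 1]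
  show "locint (conv k g)" using L(1) by (simp add: Lploc_1)
  show "AE x in lborel. integrable lborel (\<lambda>y. k (x - y) * g y)" using L(2) by simp
qed

lemma L1loc_lim_kernel:
  fixes k :: "'a::euclidean_space \<Rightarrow> real"
  assumes f: "\<And>n. integrable lborel (f n)" "\<And>n x. 1 \<le> norm x \<Longrightarrow> f n x = 0"
    and k: "integrable lborel k" "\<And>x. 1 \<le> norm x \<Longrightarrow> k x = 0"
    and lim: "(\<lambda>n. \<integral>x. \<bar>f n x - k x\<bar> \<partial>lborel) \<longlonglongrightarrow> 0" and g: "locint g"
  shows "L1loc_lim (\<lambda>n. conv (f n) g) (conv k g)"
  unfolding L1loc_lim_def
proof
  fix R
  let ?g = "cutoff (R + 1) g"
  have Ig: "integrable lborel ?g" by (rule cutoff_integrable[OF g])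
  have Ifk: "integrable lborel (\<lambda>x. f n x - k x)" for n using f k by simp
  show "(\<lambda>n. \<integral>x. \<bar>cutoff R (conv (f n) g) x - cutoff R (conv k g) x\<bar> \<partial>lborel) \<longlonglongrightarrow> 0"
  proof (rule tendsto_sandwich[OF always_eventually always_eventually tendsto_const]; (intro allI)?)
    show "(\<lambda>n. (\<integral>x. \<bar>f n x - k x\<bar> \<partial>lborel) * (\<integral>x. \<bar>?g x\<bar> \<partial>lborel)) \<longlonglongrightarrow> 0"
      using tendsto_mult_right[OF lim, of "\<integral>x. \<bar>?g x\<bar> \<partial>lborel"] by simp
    fix n
    show "0 \<le> (\<integral>x. \<bar>cutoff R (conv (f n) g) x - cutoff R (conv k g) x\<bar> \<partial>lborel)" by simp
    have f2: "\<And>x. 1 \<le> norm x \<Longrightarrow> f n x = 0" using f(2) by blast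
    have a1: "AE x in lborel. integrable lborel (\<lambda>y. f n (x - y) * ?g y)"
      by (rule locint_conv(2)[OF f(1) f2 integrable_locint[OF Ig]])
    have a2: "AE x in lborel. integrable lborel (\<lambda>y. k (x - y) * ?g y)"
      by (rule locint_conv(2)[OF k integrable_locint[OF Ig]])
    note c = conv_L1[OF Ifk Ig, of n]
    have "(\<integral>x. \<bar>cutoff R (conv (f n) g) x - cutoff R (conv k g) x\<bar> \<partial>lborel) \<le> (\<integral>x. \<bar>conv (\<lambda>x. f n x - k x) ?g x\<bar> \<partial>lborel)"
    proof (rule integral_mono_AE)
      have 1: "locint (conv (f n) g)" "locint (conv k g)"
        using locint_conv(1)[OF f(1) f2 g] locint_conv(1)[OF k g] by simp_all
      show "integrable lborel (\<lambda>x. \<bar>cutoff R (conv (f n) g) x - cutoff R (conv k g) x\<bar>)"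
        using cutoff_integrable[OF 1(1), of R] cutoff_integrable[OF 1(2), of R] by simp
      show "integrable lborel (\<lambda>x. \<bar>conv (\<lambda>x. f n x - k x) ?g x\<bar>)" using c(1) by simp
      show "AE x in lborel. \<bar>cutoff R (conv (f n) g) x - cutoff R (conv k g) x\<bar> \<le> \<bar>conv (\<lambda>x. f n x - k x) ?g x\<bar>"
        using a1 a2
      proof eventually_elim
        case (elim x)
        show ?case
        proof (cases "norm x \<le> R")
          case True
          have "conv (\<lambda>x. f n x - k x) ?g x = conv (f n) ?g x - conv k ?g x"
            using elim by (simp add: conv_def left_diff_distrib)
          also have "\<dots> = conv (f n) g x - conv k g x"
            using conv_cutoff(2)[OF f2 True, where h=g] conv_cutoff(2)[OF k(2) True, where h=g] by simp
          finally show ?thesis using True by (simp add: cutoff_def)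
        qed (simp add: cutoff_def)
      qed
    qed
    also have "\<dots> \<le> (\<integral>x. \<bar>f n x - k x\<bar> \<partial>lborel) * (\<integral>x. \<bar>?g x\<bar> \<partial>lborel)" by (rule c(2))
    finally show "(\<integral>x. \<bar>cutoff R (conv (f n) g) x - cutoff R (conv k g) x\<bar> \<partial>lborel)
      \<le> (\<integral>x. \<bar>f n x - k x\<bar> \<partial>lborel) * (\<integral>x. \<bar>?g x\<bar> \<partial>lborel)" .
  qed
qed

section \<open>Completeness of L1_loc and limits of pointwise bounds\<close>

lemma nn_integral_cutoff_diff:
  fixes f g :: "'a::euclidean_space \<Rightarrow> real"
  assumes "locint f" "locint g"
  shows "(\<integral>\<^sup>+x. ennreal \<bar>cutoff R f x - cutoff R g x\<bar> \<partial>lborel) = ennreal (\<integral>x. \<bar>cutoff R f x - cutoff R g x\<bar> \<partial>lborel)"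
  using cutoff_integrable[OF assms(1), of R] cutoff_integrable[OF assms(2), of R]
  by (intro nn_integral_eq_integral) auto

lemma integral_cutoff_mono:
  fixes f g :: "'a::euclidean_space \<Rightarrow> real"
  assumes "locint f" "locint g" "R \<le> S"
  shows "(\<integral>x. \<bar>cutoff R f x - cutoff R g x\<bar> \<partial>lborel) \<le> (\<integral>x. \<bar>cutoff S f x - cutoff S g x\<bar> \<partial>lborel)"
proof (rule integral_mono)
  show "integrable lborel (\<lambda>x. \<bar>cutoff R f x - cutoff R g x\<bar>)" "integrable lborel (\<lambda>x. \<bar>cutoff S f x - cutoff S g x\<bar>)"
    by (intro integrable_abs Bochner_Integration.integrable_diff cutoff_integrable assms)+
  show "\<bar>cutoff R f x - cutoff R g x\<bar> \<le> \<bar>cutoff S f x - cutoff S g x\<bar>" for x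
    using assms(3) by (auto simp: cutoff_def indicator_def)
qed

text \<open>From index r k on, the terms differ by less than 2^-k in L1 on the ball of radius k. The
  increments are then summable almost everywhere on each ball, and Fatou transfers the estimate 2^-k
  to the distance from the pointwise limit. Almost everywhere convergence is part of the conclusion
  because exponents above 1 are recovered from it.\<close>

lemma L1loc_complete:
  fixes h :: "nat \<Rightarrow> 'a::euclidean_space \<Rightarrow> real"
  assumes h: "\<And>n. locint (h n)"
    and cauchy: "\<And>R e. 0 < e \<Longrightarrow> \<exists>N. \<forall>m\<ge>N. \<forall>n\<ge>N. (\<integral>x. \<bar>cutoff R (h m) x - cutoff R (h n) x\<bar> \<partial>lborel) < e"
  obtains H r where "strict_mono r" "locint H" "L1loc_lim (\<lambda>k. h (r k)) H" "AE x in lborel. (\<lambda>k. h (r k) x) \<longlonglongrightarrow> H x"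
proof -
  define P where "P k N \<longleftrightarrow> (\<forall>m\<ge>N. \<forall>n\<ge>N. (\<integral>x. \<bar>cutoff (real k) (h m) x - cutoff (real k) (h n) x\<bar> \<partial>lborel) < (1 / 2) ^ k)" for k N
  have exP: "\<exists>N. P k N" for k unfolding P_def by (rule cauchy) simp
  have "\<exists>r. strict_mono r \<and> (\<forall>k. P k (r k))"
  proof -
    have step: "\<exists>N'. P (Suc k) N' \<and> N < N'" for k N
    proof -
      obtain N1 where "P (Suc k) N1" using exP by blast
      then have "P (Suc k) (max N1 (Suc N))" by (auto simp: P_def)
      then show ?thesis by (intro exI[of _ "max N1 (Suc N)"]) auto
    qed
    obtain r where "\<forall>n. P n (r n)" "\<forall>n. r n < r (Suc n)"
      using dependent_nat_choice[of P "\<lambda>_ x y. x < y"] exP step by metis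
    then show ?thesis by (auto simp: strict_mono_Suc_iff)
  qed
  then obtain r where r: "strict_mono r" "\<And>k. P k (r k)" by blast
  have small: "(\<integral>x. \<bar>cutoff R (h (r k)) x - cutoff R (h (r l)) x\<bar> \<partial>lborel) \<le> (1 / 2) ^ k"
    if "R \<le> real k" "k \<le> l" for R k l
  proof -
    have "r k \<le> r l" using r(1) that(2) by (simp add: strict_mono_less_eq)
    then have "(\<integral>x. \<bar>cutoff (real k) (h (r k)) x - cutoff (real k) (h (r l)) x\<bar> \<partial>lborel) < (1 / 2) ^ k"
      using r(2)[of k] unfolding P_def by blast
    then show ?thesis using integral_cutoff_mono[OF h h that(1), of "r k" "r l"] by linarith
  qed
  have hb[measurable]: "h n \<in> borel_measurable borel" for n using h by (rule locint_borel)
  have cb[measurable]: "cutoff R (h n) \<in> borel_measurable borel" for R n by (intro cutoff_borel hb)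
  have AEc: "AE x in lborel. summable (\<lambda>k. \<bar>cutoff (real R) (h (r k)) x - cutoff (real R) (h (r (Suc k))) x\<bar>)" for R :: nat
  proof -
    \<comment> \<open>The estimate \<open>small\<close> holds only from index R on, so the series is
      summed after a shift by R; its first terms do not affect summability.\<close>
    let ?d = "\<lambda>k x. \<bar>cutoff (real R) (h (r k)) x - cutoff (real R) (h (r (Suc k))) x\<bar>"
    have "(\<integral>\<^sup>+x. (\<Sum>k. ennreal (?d (k + R) x)) \<partial>lborel) = (\<Sum>k. \<integral>\<^sup>+x. ennreal (?d (k + R) x) \<partial>lborel)"
      by (rule nn_integral_suminf) measurable
    also have "\<dots> \<le> (\<Sum>k. ennreal ((1 / 2) ^ (k + R)))"
    proof (intro suminf_le allI summableI)
      fix k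
      show "(\<integral>\<^sup>+x. ennreal (?d (k + R) x) \<partial>lborel) \<le> ennreal ((1 / 2) ^ (k + R))"
        unfolding nn_integral_cutoff_diff[OF h h] by (intro ennreal_leI small) auto
    qed
    also have "\<dots> < \<infinity>"
    proof -
      have "summable (\<lambda>k. (1 / 2 :: real) ^ (k + R))" by (subst summable_iff_shift) (rule summable_geometric, simp)
      then have "(\<Sum>k. ennreal ((1 / 2) ^ (k + R))) \<noteq> top" by (rule ennreal_suminf_neq_top) simp
      then show ?thesis by (simp only: less_top infinity_ennreal_def)
    qed
    finally have "(\<integral>\<^sup>+x. (\<Sum>k. ennreal (?d (k + R) x)) \<partial>lborel) \<noteq> \<infinity>" by simp
    then have "AE x in lborel. (\<Sum>k. ennreal (?d (k + R) x)) \<noteq> \<infinity>"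
      by (intro nn_integral_PInf_AE) measurable
    then show ?thesis
    proof eventually_elim
      case (elim x)
      then have "summable (\<lambda>k. ?d (k + R) x)" by (intro summable_suminf_not_top) auto
      then show ?case by (subst (asm) summable_iff_shift)
    qed
  qed
  have conv: "AE x in lborel. convergent (\<lambda>k. h (r k) x)"
  proof -
    have "AE x in lborel. \<forall>R::nat. summable (\<lambda>k. \<bar>cutoff (real R) (h (r k)) x - cutoff (real R) (h (r (Suc k))) x\<bar>)"
      by (subst AE_all_countable) (rule allI, rule AEc)
    then show ?thesis
    proof eventually_elim
      case (elim x)
      obtain R :: nat where R: "norm x \<le> real R" using real_arch_simple by blast
      have "summable (\<lambda>k. norm (h (r k) x - h (r (Suc k)) x))"
        using elim[rule_format, of R] R by (simp add: cutoff_def)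
      then have "summable (\<lambda>k. h (r k) x - h (r (Suc k)) x)" by (rule summable_norm_cancel)
      then have "summable (\<lambda>k. h (r (Suc k)) x - h (r k) x)" using summable_minus by fastforce
      then have "convergent (\<lambda>n. \<Sum>k<n. h (r (Suc k)) x - h (r k) x)" by (simp add: summable_iff_convergent)
      also have "(\<lambda>n. \<Sum>k<n. h (r (Suc k)) x - h (r k) x) = (\<lambda>n. h (r n) x - h (r 0) x)"
        by (intro ext sum_lessThan_telescope)
      finally have "convergent (\<lambda>n. h (r n) x - h (r 0) x)" .
      then have "convergent (\<lambda>n. (h (r n) x - h (r 0) x) + h (r 0) x)" by (intro convergent_add convergent_const)
      then show ?case by simp
    qed
  qed
  define H where "H x = lim (\<lambda>k. h (r k) x)" for x
  have Hb[measurable]: "H \<in> borel_measurable borel" unfolding H_def[abs_def] by (rule borel_measurable_lim_metric) measurable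
  have AElim: "AE x in lborel. (\<lambda>k. h (r k) x) \<longlonglongrightarrow> H x"
    using conv by eventually_elim (simp add: H_def convergent_LIMSEQ_iff)
  have fatou: "(\<integral>\<^sup>+x. ennreal \<bar>cutoff R (h (r k)) x - cutoff R H x\<bar> \<partial>lborel) \<le> ennreal ((1 / 2) ^ k)"
    if R: "R \<le> real k" for R k
  proof -
    have "(\<integral>\<^sup>+x. ennreal \<bar>cutoff R (h (r k)) x - cutoff R H x\<bar> \<partial>lborel)
        = (\<integral>\<^sup>+x. liminf (\<lambda>l. ennreal \<bar>cutoff R (h (r k)) x - cutoff R (h (r l)) x\<bar>) \<partial>lborel)"
    proof (rule nn_integral_cong_AE)
      show "AE x in lborel. ennreal \<bar>cutoff R (h (r k)) x - cutoff R H x\<bar> = liminf (\<lambda>l. ennreal \<bar>cutoff R (h (r k)) x - cutoff R (h (r l)) x\<bar>)"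
        using AElim
      proof eventually_elim
        case (elim x)
        have "(\<lambda>l. ennreal \<bar>cutoff R (h (r k)) x - cutoff R (h (r l)) x\<bar>) \<longlonglongrightarrow> ennreal \<bar>cutoff R (h (r k)) x - cutoff R H x\<bar>"
          unfolding cutoff_def by (intro tendsto_ennrealI tendsto_intros elim)
        then show ?case by (intro lim_imp_Liminf[symmetric]) auto
      qed
    qed
    also have "\<dots> \<le> liminf (\<lambda>l. \<integral>\<^sup>+x. ennreal \<bar>cutoff R (h (r k)) x - cutoff R (h (r l)) x\<bar> \<partial>lborel)"
      by (rule nn_integral_liminf) measurable
    also have "\<dots> \<le> ennreal ((1 / 2) ^ k)"
    proof (rule Liminf_le)
      show "\<forall>\<^sub>F l in sequentially. (\<integral>\<^sup>+x. ennreal \<bar>cutoff R (h (r k)) x - cutoff R (h (r l)) x\<bar> \<partial>lborel) \<le> ennreal ((1 / 2) ^ k)"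
        using eventually_ge_at_top[of k]
        by eventually_elim (simp only: nn_integral_cutoff_diff[OF h h], intro ennreal_leI small R)
    qed simp
    finally show ?thesis .
  qed
  have HI: "integrable lborel (\<lambda>x. indicat_real (cball 0 R) x * H x)" for R
  proof -
    obtain k :: nat where k: "R \<le> real k" using real_arch_simple by blast
    have m: "(\<lambda>x. cutoff R (h (r k)) x - cutoff R H x) \<in> borel_measurable borel"
      using cutoff_borel[OF Hb] by measurable
    have "integrable lborel (\<lambda>x. cutoff R (h (r k)) x - cutoff R H x)"
      using fatou[OF k] m by (intro integrableI_bounded) (auto intro: le_less_trans)
    then have "integrable lborel (\<lambda>x. cutoff R (h (r k)) x - (cutoff R (h (r k)) x - cutoff R H x))"
      by (rule Bochner_Integration.integrable_diff[OF cutoff_integrable[OF h]])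
    then show ?thesis by (simp add: cutoff_def)
  qed
  have Hl: "locint H" unfolding locint_def using Hb HI by blast
  have "L1loc_lim (\<lambda>k. h (r k)) H"
    unfolding L1loc_lim_def
  proof
    fix R
    obtain K :: nat where K: "R \<le> real K" using real_arch_simple by blast
    show "(\<lambda>k. \<integral>x. \<bar>cutoff R (h (r k)) x - cutoff R H x\<bar> \<partial>lborel) \<longlonglongrightarrow> 0"
    proof (rule tendsto_sandwich[OF always_eventually _ tendsto_const LIMSEQ_realpow_zero[of "1/2"]])
      show "\<forall>\<^sub>F k in sequentially. (\<integral>x. \<bar>cutoff R (h (r k)) x - cutoff R H x\<bar> \<partial>lborel) \<le> (1 / 2) ^ k"
        using eventually_ge_at_top[of K]
      proof eventually_elim
        case (elim k)
        then have "R \<le> real k" using K by linarith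
        from fatou[OF this] show ?case
          unfolding nn_integral_cutoff_diff[OF h Hl] by (simp add: ennreal_le_iff)
      qed
    qed auto
  qed
  from that[OF r(1) Hl this AElim] show ?thesis .
qed

text \<open>On a ball the excess of |h| over A is at most |f n - h|, so its integral lies below a
  null sequence. In this way a bound common to all mollifications reaches the function
  itself.\<close>

lemma L1loc_AE_le:
  fixes h A :: "'a::euclidean_space \<Rightarrow> real"
  assumes f: "\<And>n. locint (f n)" and h: "locint h" and lim: "L1loc_lim f h"
    and A[measurable]: "A \<in> borel_measurable borel" and le: "\<And>n. AE x in lborel. \<bar>f n x\<bar> \<le> A x"
  shows "AE x in lborel. \<bar>h x\<bar> \<le> A x"
proof -
  have [measurable]: "h \<in> borel_measurable borel" using h by (rule locint_borel)
  have R: "AE x in lborel. norm x \<le> real R \<longrightarrow> \<bar>h x\<bar> \<le> A x" for R :: nat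
  proof -
    define e where "e x = indicat_real (cball 0 (real R)) x * max 0 (\<bar>h x\<bar> - A x)" for x
    have eb: "e \<in> borel_measurable borel" unfolding e_def[abs_def] by (rule indicator_mult_borel) measurable
    have e0: "0 \<le> e x" for x by (simp add: e_def)
    have ele: "AE x in lborel. e x \<le> \<bar>cutoff (real R) (f n) x - cutoff (real R) h x\<bar>" for n
      using le[of n] by eventually_elim (auto simp: e_def cutoff_def indicator_def)
    have I: "integrable lborel (\<lambda>x. \<bar>cutoff (real R) (f n) x - cutoff (real R) h x\<bar>)" for n
      using cutoff_integrable[OF f] cutoff_integrable[OF h] by simp
    have eI: "integrable lborel e"
    proof (rule Bochner_Integration.integrable_bound[OF I[of 0]])
      show "AE x in lborel. norm (e x) \<le> norm \<bar>cutoff (real R) (f 0) x - cutoff (real R) h x\<bar>"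
        using ele[of 0] by eventually_elim (use e0 in auto)
    qed (use eb in simp)
    have "(\<integral>x. e x \<partial>lborel) \<le> 0"
    proof (rule LIMSEQ_le_const[OF lim[unfolded L1loc_lim_def, rule_format, of "real R"]], intro exI allI impI)
      fix n
      show "(\<integral>x. e x \<partial>lborel) \<le> (\<integral>x. \<bar>cutoff (real R) (f n) x - cutoff (real R) h x\<bar> \<partial>lborel)"
        by (rule integral_mono_AE[OF eI I ele])
    qed
    then have "(\<integral>x. e x \<partial>lborel) = 0" using e0 by (simp add: antisym)
    then have "AE x in lborel. e x = 0"
      using eI e0 by (subst (asm) integral_nonneg_eq_0_iff_AE) auto
    then show ?thesis by eventually_elim (auto simp: e_def indicator_def split: if_splits)
  qed
  have "AE x in lborel. \<forall>R::nat. norm x \<le> real R \<longrightarrow> \<bar>h x\<bar> \<le> A x"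
    by (subst AE_all_countable) (rule allI, rule R)
  then show ?thesis by eventually_elim (use real_arch_simple in blast)
qed

text \<open>Only the test function has compact support; v will be a mollification of a solution,
  arbitrary at infinity.\<close>

lemma smooth_integration_by_parts:
  fixes \<phi> v :: "'a::euclidean_space \<Rightarrow> real"
  assumes \<phi>: "test_function \<phi>" and v: "smooth v" and e: "e \<in> Basis"
  shows "(\<integral>x. \<phi> x * partial e v x \<partial>lborel) = - (\<integral>x. partial e \<phi> x * v x \<partial>lborel)"
proof -
  obtain R where R: "R > 0" "\<And>x. R \<le> norm x \<Longrightarrow> \<phi> x = 0" using test_functionE[OF \<phi>] by blast
  have R': "partial e \<phi> x = 0" if "R \<le> norm x" for x
    using partial_vanishes[OF test_smooth[OF \<phi>] R(2) e that] .
  have c: "continuous_on UNIV \<phi>" "continuous_on UNIV (partial e \<phi>)" "continuous_on UNIV v" "continuous_on UNIV (partial e v)"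
    using test_continuous[OF \<phi>] test_continuous[OF test_partial[OF \<phi> e]] smooth_continuous[OF v] smooth_continuous[OF smooth_partial[OF v e]] by auto
  have I1: "integrable lborel (\<lambda>x. partial e \<phi> x * v x)"
    by (rule continuous_compact_support_integrable[where R=R]) (use c R' in \<open>auto intro!: continuous_intros\<close>)
  have I2: "integrable lborel (\<lambda>x. \<phi> x * partial e v x)"
    by (rule continuous_compact_support_integrable[where R=R]) (use c R in \<open>auto intro!: continuous_intros\<close>)
  have I3: "integrable lborel (\<lambda>x. \<phi> x * v x)"
    by (rule continuous_compact_support_integrable[where R=R]) (use c R in \<open>auto intro!: continuous_intros\<close>)
  have "(\<integral>x. partial e \<phi> x * v x + \<phi> x * partial e v x \<partial>lborel) = 0"
  proof (rule integral_derivative_zero[OF _ _ I3])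
    show "((\<lambda>s. \<phi> (x + s *\<^sub>R e) * v (x + s *\<^sub>R e)) has_real_derivative partial e \<phi> x * v x + \<phi> x * partial e v x) (at 0)" for x
      using DERIV_mult[OF smooth_directional[OF test_smooth[OF \<phi>] e, of x 0] smooth_directional[OF v e, of x 0]]
      by (simp add: mult_ac)
  qed (use I1 I2 c in \<open>auto intro!: continuous_intros\<close>)
  then show ?thesis using I1 I2 by simp
qed

section \<open>Weak solutions of the Poisson equation\<close>

definition weak_laplace :: "('a::euclidean_space \<Rightarrow> real) \<Rightarrow> ('a \<Rightarrow> real) \<Rightarrow> bool" where
  "weak_laplace u g \<longleftrightarrow> locint u \<and> locint g \<and>
    (\<forall>\<phi>. test_function \<phi> \<longrightarrow> (\<integral>x. u x * laplacian \<phi> x \<partial>lborel) = (\<integral>x. g x * \<phi> x \<partial>lborel))"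

lemma weak_laplace_locint: "weak_laplace u g \<Longrightarrow> locint u" "weak_laplace u g \<Longrightarrow> locint g"
  by (simp_all add: weak_laplace_def)

lemma test_moll_seq: "test_function (moll (scale_seq n))"
  using scale_seq(1)[of n] by (intro test_moll) simp

text \<open>Tested with the reflected parametrix y -> N(x - y), the equation is an identity without
  remainder because \<Delta>N = moll - rho. The \<open>rho\<close> term is smooth and independent of
  n, so all regularity questions move to the convolution of g with a kernel bounded uniformly in
  n.\<close>

lemma mollified_representation:
  fixes u g :: "'a::euclidean_space \<Rightarrow> real"
  assumes w: "weak_laplace u g"
  shows "conv (moll (scale_seq n)) u = (\<lambda>x. conv rho u x + conv (parametrix (scale_seq n)) g x)"
proof
  fix x
  let ?N = "parametrix (scale_seq n) :: 'a \<Rightarrow> real"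
  have t: "test_function ?N" by (rule test_parametrix[OF scale_seq(1)])
  have "(\<integral>y. u y * laplacian (\<lambda>y. ?N (x - y)) y \<partial>lborel) = (\<integral>y. g y * ?N (x - y) \<partial>lborel)"
    using w test_reflect[OF t, of x] unfolding weak_laplace_def by blast
  moreover have "laplacian (\<lambda>y. ?N (x - y)) y = moll (scale_seq n) (x - y) - rho (x - y)" for y
    by (simp add: laplacian_reflect[OF test_smooth[OF t]] laplacian_parametrix[OF scale_seq])
  ultimately have "(\<integral>y. moll (scale_seq n) (x - y) * u y - rho (x - y) * u y \<partial>lborel) = conv ?N g x"
    by (simp add: conv_def algebra_simps)
  then show "conv (moll (scale_seq n)) u x = conv rho u x + conv ?N g x"
    using integrable_conv_test[OF test_moll_seq weak_laplace_locint(1)[OF w], of n x]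
      integrable_conv_test[OF test_rho weak_laplace_locint(1)[OF w], of x]
    by (simp add: conv_def)
qed

lemma partial_sum_fun:
  assumes "smooth \<phi>" "smooth \<psi>"
  shows "partial e (\<lambda>x. \<phi> x + \<psi> x) = (\<lambda>x. partial e \<phi> x + partial e \<psi> x)"
  by (intro ext partial_add smooth_differentiable assms)

lemma mollified_representation_partial:
  fixes u g :: "'a::euclidean_space \<Rightarrow> real"
  assumes w: "weak_laplace u g" and i: "i \<in> Basis"
  shows "partial i (conv (moll (scale_seq n)) u)
    = (\<lambda>x. conv (partial i rho) u x + conv (partial i (parametrix (scale_seq n))) g x)"
proof -
  note l = weak_laplace_locint[OF w] and tN = test_parametrix[OF scale_seq(1)[of n], where 'a='a]
  show ?thesis
    unfolding mollified_representation[OF w]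
    by (simp only: partial_sum_fun[OF smooth_conv[OF test_rho l(1)] smooth_conv[OF tN l(2)]]
        partial_conv[OF test_rho l(1) i] partial_conv[OF tN l(2) i])
qed

lemma mollified_representation_partial2:
  fixes u g :: "'a::euclidean_space \<Rightarrow> real"
  assumes w: "weak_laplace u g" and i: "i \<in> Basis" and j: "j \<in> Basis"
  shows "partial j (partial i (conv (moll (scale_seq n)) u))
    = (\<lambda>x. conv (partial j (partial i rho)) u x + conv (partial j (partial i (parametrix (scale_seq n)))) g x)"
proof -
  note l = weak_laplace_locint[OF w]
  have tN: "test_function (partial i (parametrix (scale_seq n)))" by (intro test_partial test_parametrix scale_seq i)
  have tr: "test_function (partial i rho)" by (intro test_partial test_rho i)
  show ?thesis
    unfolding mollified_representation_partial[OF w i]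
    by (simp only: partial_sum_fun[OF smooth_conv[OF tr l(1)] smooth_conv[OF tN l(2)]]
        partial_conv[OF tr l(1) j] partial_conv[OF tN l(2) j])
qed

lemma conv_kernel_le:
  fixes k m :: "'a::euclidean_space \<Rightarrow> real"
  assumes k: "k \<in> borel_measurable borel" and g: "g \<in> borel_measurable borel" and K: "0 \<le> K"
    and le: "\<And>x. x \<noteq> 0 \<Longrightarrow> \<bar>k x\<bar> \<le> K * m x"
    and I: "integrable lborel (\<lambda>y. m (x - y) * \<bar>g y\<bar>)"
  shows "\<bar>conv k g x\<bar> \<le> K * conv m (\<lambda>y. \<bar>g y\<bar>) x"
proof -
  note [measurable] = k g
  have AEle: "AE y in lborel. \<bar>k (x - y) * g y\<bar> \<le> K * (m (x - y) * \<bar>g y\<bar>)"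
    using AE_lborel_singleton[of x]
  proof eventually_elim
    case (elim y)
    then have "\<bar>k (x - y)\<bar> \<le> K * m (x - y)" by (intro le) simp
    from mult_right_mono[OF this, of "\<bar>g y\<bar>"] show ?case by (simp add: abs_mult mult_ac)
  qed
  have I2: "integrable lborel (\<lambda>y. K * (m (x - y) * \<bar>g y\<bar>))" using I by simp
  have I1: "integrable lborel (\<lambda>y. \<bar>k (x - y) * g y\<bar>)"
  proof (rule Bochner_Integration.integrable_bound[OF I2])
    show "AE y in lborel. norm \<bar>k (x - y) * g y\<bar> \<le> norm (K * (m (x - y) * \<bar>g y\<bar>))"
      using AEle by eventually_elim simp
  qed measurable
  have "\<bar>conv k g x\<bar> \<le> (\<integral>y. \<bar>k (x - y) * g y\<bar> \<partial>lborel)" unfolding conv_def by (rule integral_abs_bound)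
  also have "\<dots> \<le> (\<integral>y. K * (m (x - y) * \<bar>g y\<bar>) \<partial>lborel)" by (rule integral_mono_AE[OF I1 I2 AEle])
  finally show ?thesis by (simp add: conv_def)
qed

lemma Lploc_abs:
  assumes "Lploc p h" shows "Lploc p (\<lambda>x. \<bar>h x\<bar>)"
proof -
  have [measurable]: "h \<in> borel_measurable borel" using assms by (rule Lploc_borel)
  have "(\<lambda>x. \<bar>h x\<bar>) \<in> borel_measurable borel" by measurable
  then show ?thesis using Lploc_integrable[OF assms] by (simp add: Lploc_def)
qed

lemma Lploc_conv_rker:
  fixes g :: "'a::euclidean_space \<Rightarrow> real"
  assumes g: "Lploc s g" and \<alpha>: "0 \<le> \<alpha>" "\<alpha> * t < real DIM('a)"
    and st: "1 \<le> s" "1 \<le> t" "0 < r" "1 / r = 1 / s + 1 / t - 1"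
  shows "Lploc r (conv (rker \<alpha>) (\<lambda>y. \<bar>g y\<bar>))" and "AE x in lborel. integrable lborel (\<lambda>y. rker \<alpha> (x - y) * \<bar>g y\<bar>)"
proof -
  have I: "integrable lborel (\<lambda>x::'a. \<bar>rker \<alpha> x\<bar> powr t)"
    using integrable_rker[of "\<alpha> * t", where 'a='a] \<alpha> st by (simp add: rker_powr)
  note L = Lploc_conv[OF rker_borel I rker_zero Lploc_abs[OF g] st(2,1,3)]
  show "Lploc r (conv (rker \<alpha>) (\<lambda>y. \<bar>g y\<bar>))" "AE x in lborel. integrable lborel (\<lambda>y. rker \<alpha> (x - y) * \<bar>g y\<bar>)"
    using L st(4) by (simp_all add: add.commute)
qed

text \<open>All mollifications of u lie below one function A, since the parametrix is dominated by
  |x|^(2-d) uniformly in the scale. Young's inequality puts A in L^r_loc, and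
  \<open>L1loc_AE_le\<close> passes the bound to u. The condition on t says that |x|^(2-d) is in L^t
  near 0.\<close>

theorem weak_laplace_Lploc:
  fixes u g :: "'a::euclidean_space \<Rightarrow> real"
  assumes d: "3 \<le> DIM('a)" and w: "weak_laplace u g" and g: "Lploc s g"
    and st: "1 \<le> s" "1 \<le> t" "(real DIM('a) - 2) * t < real DIM('a)" "0 < r" "1 / r = 1 / s + 1 / t - 1"
  shows "Lploc r u"
proof -
  note l = weak_laplace_locint[OF w]
  obtain K where K: "K > 0" "\<And>\<epsilon> x::'a. 0 < \<epsilon> \<Longrightarrow> x \<noteq> 0 \<Longrightarrow> \<bar>parametrix \<epsilon> x\<bar> \<le> K * rker (real DIM('a) - 2) x"
    using parametrix_le[OF d] by metis
  define A where "A x = \<bar>conv rho u x\<bar> + K * conv (rker (real DIM('a) - 2)) (\<lambda>y. \<bar>g y\<bar>) x" for x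
  have \<alpha>: "0 \<le> real DIM('a) - 2" using d by simp
  note rk = Lploc_conv_rker[OF g \<alpha> st(3,1,2,4,5)]
  have "Lploc r (conv rho u)"
    by (rule continuous_Lploc[OF smooth_continuous[OF smooth_conv[OF test_rho l(1)]] st(4)])
  then have AL: "Lploc r A"
    unfolding A_def[abs_def] by (intro Lploc_add Lploc_abs Lploc_cmult rk(1) st)
  have "AE x in lborel. \<bar>u x\<bar> \<le> A x"
  proof (rule L1loc_AE_le[OF _ l(1) L1loc_lim_conv_moll[OF l(1)] Lploc_borel[OF AL]])
    fix n
    show "locint (conv (moll (scale_seq n)) u)"
      by (rule continuous_locint[OF smooth_continuous[OF smooth_conv[OF test_moll_seq l(1)]]])
    show "AE x in lborel. \<bar>conv (moll (scale_seq n)) u x\<bar> \<le> A x"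
      using rk(2)
    proof eventually_elim
      case (elim x)
      have "\<bar>conv (parametrix (scale_seq n)) g x\<bar> \<le> K * conv (rker (real DIM('a) - 2)) (\<lambda>y. \<bar>g y\<bar>) x"
      proof (rule conv_kernel_le[OF test_borel[OF test_parametrix[OF scale_seq(1)]] locint_borel[OF l(2)] _ _ elim])
        show "\<bar>parametrix (scale_seq n) y\<bar> \<le> K * rker (real DIM('a) - 2) y" if "y \<noteq> 0" for y :: 'a
          by (rule K(2)[OF scale_seq(1) that])
      qed (use K in simp)
      then show ?case unfolding mollified_representation[OF w] A_def by linarith
    qed
  qed
  then have "AE x in lborel. \<bar>u x\<bar> \<le> \<bar>A x\<bar>" by eventually_elim simp
  from Lploc_dominated[OF AL locint_borel[OF l(1)] this st(4)] show ?thesis .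
qed

text \<open>The limit of \<open>mollified_representation_partial\<close> as the scale tends to 0,
  taken as the definition of the components of the gradient.\<close>

definition grad :: "('a::euclidean_space \<Rightarrow> real) \<Rightarrow> ('a \<Rightarrow> real) \<Rightarrow> 'a \<Rightarrow> 'a \<Rightarrow> real" where
  "grad u g e x = conv (partial e rho) u x + conv (grad_kernel e) g x"

lemma locint_add: "locint f \<Longrightarrow> locint g \<Longrightarrow> locint (\<lambda>x. f x + g x)"
  using Lploc_add[of 1 f g] by (simp add: Lploc_1)

lemma L1loc_lim_add_const: "L1loc_lim f h \<Longrightarrow> L1loc_lim (\<lambda>n x. c x + f n x) (\<lambda>x. c x + h x)"
  unfolding L1loc_lim_def cutoff_def by (simp add: right_diff_distrib[symmetric])

lemma smooth_locint: "smooth v \<Longrightarrow> locint v"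
  by (intro continuous_locint smooth_continuous)

text \<open>The regularised gradient kernels converge in L1, so the differentiated mollifications
  converge in L1_loc and their integration by parts passes to the limit. The exponent in the last
  conclusion is Young's inequality with the kernel |x|^(1-d).\<close>

theorem weak_laplace_gradient:
  fixes u g :: "'a::euclidean_space \<Rightarrow> real"
  assumes d: "3 \<le> DIM('a)" and w: "weak_laplace u g" and e: "e \<in> Basis"
  shows "locint (grad u g e)"
    and "test_function \<phi> \<Longrightarrow> (\<integral>x. u x * partial e \<phi> x \<partial>lborel) = - (\<integral>x. grad u g e x * \<phi> x \<partial>lborel)"
    and "Lploc s g \<Longrightarrow> 1 \<le> s \<Longrightarrow> 1 \<le> t \<Longrightarrow> (real DIM('a) - 1) * t < real DIM('a) \<Longrightarrow> 0 < r \<Longrightarrow> 1 / r = 1 / s + 1 / t - 1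
      \<Longrightarrow> Lploc r (grad u g e)"
proof -
  note l = weak_laplace_locint[OF w]
  have tr: "test_function (partial e rho)" by (rule test_partial[OF test_rho e])
  have tN: "test_function (partial e (parametrix (scale_seq n)))" for n by (intro test_partial test_parametrix scale_seq e)
  note gk = grad_kernel_L1_limit[OF d e]
  have N0: "partial e (parametrix (scale_seq n)) x = 0" if "1 \<le> norm x" for n x
    by (rule partial_vanishes[OF test_smooth[OF test_parametrix[OF scale_seq(1)]] parametrix_zero[OF scale_seq(1)] e that])
  have l2: "locint (conv (grad_kernel e) g)" by (rule locint_conv(1)[OF gk(1) grad_kernel_zero[OF e] l(2)])
  show lg: "locint (grad u g e)"
    unfolding grad_def[abs_def] by (intro locint_add smooth_locint smooth_conv tr l l2)
  have lim: "L1loc_lim (\<lambda>n. partial e (conv (moll (scale_seq n)) u)) (grad u g e)"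
    unfolding mollified_representation_partial[OF w e] grad_def[abs_def]
    by (intro L1loc_lim_add_const L1loc_lim_kernel[OF test_integrable[OF tN] N0 gk(1) grad_kernel_zero[OF e] gk(2) l(2)])
  show "(\<integral>x. u x * partial e \<phi> x \<partial>lborel) = - (\<integral>x. grad u g e x * \<phi> x \<partial>lborel)" if \<phi>: "test_function \<phi>"
  proof -
    have sv: "smooth (conv (moll (scale_seq n)) u)" for n by (rule smooth_conv[OF test_moll_seq l(1)])
    obtain R where R: "R > 0" "\<And>x. R \<le> norm x \<Longrightarrow> \<phi> x = 0" using test_functionE[OF \<phi>] by blast
    obtain R' where R': "R' > 0" "\<And>x. R' \<le> norm x \<Longrightarrow> partial e \<phi> x = 0" using test_functionE[OF test_partial[OF \<phi> e]] by blast
    have "(\<lambda>n. \<integral>x. \<phi> x * partial e (conv (moll (scale_seq n)) u) x \<partial>lborel) \<longlonglongrightarrow> (\<integral>x. \<phi> x * grad u g e x \<partial>lborel)"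
      by (rule L1loc_lim_integral(1)[OF _ lg lim test_continuous[OF \<phi>] R(2)])
        (intro smooth_locint smooth_partial sv e)
    moreover have "(\<lambda>n. - (\<integral>x. partial e \<phi> x * conv (moll (scale_seq n)) u x \<partial>lborel)) \<longlonglongrightarrow> - (\<integral>x. partial e \<phi> x * u x \<partial>lborel)"
      by (intro tendsto_minus L1loc_lim_integral(1)[OF _ l(1) L1loc_lim_conv_moll[OF l(1)] test_continuous[OF test_partial[OF \<phi> e]] R'(2)] smooth_locint sv)
    moreover have "(\<integral>x. \<phi> x * partial e (conv (moll (scale_seq n)) u) x \<partial>lborel) = - (\<integral>x. partial e \<phi> x * conv (moll (scale_seq n)) u x \<partial>lborel)" for n
      by (rule smooth_integration_by_parts[OF \<phi> sv e])
    ultimately have "(\<integral>x. \<phi> x * grad u g e x \<partial>lborel) = - (\<integral>x. partial e \<phi> x * u x \<partial>lborel)"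
      using LIMSEQ_unique by simp
    then show ?thesis by (simp add: mult.commute)
  qed
  show "Lploc r (grad u g e)" if g: "Lploc s g" and st: "1 \<le> s" "1 \<le> t" "(real DIM('a) - 1) * t < real DIM('a)" "0 < r" "1 / r = 1 / s + 1 / t - 1"
  proof -
    obtain K where K: "K > 0" "\<And>x::'a. x \<noteq> 0 \<Longrightarrow> \<bar>grad_kernel e x\<bar> \<le> K * rker (real DIM('a) - 1) x"
      using grad_kernel_le[OF d e] by metis
    have \<alpha>: "0 \<le> real DIM('a) - 1" using d by simp
    note rk = Lploc_conv_rker[OF g \<alpha> st(3,1,2,4,5)]
    have "AE x in lborel. \<bar>conv (grad_kernel e) g x\<bar> \<le> \<bar>K * conv (rker (real DIM('a) - 1)) (\<lambda>y. \<bar>g y\<bar>) x\<bar>"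
      using rk(2)
    proof eventually_elim
      case (elim x)
      have "\<bar>conv (grad_kernel e) g x\<bar> \<le> K * conv (rker (real DIM('a) - 1)) (\<lambda>y. \<bar>g y\<bar>) x"
        by (rule conv_kernel_le[OF grad_kernel_borel[OF e] locint_borel[OF l(2)] less_imp_le[OF K(1)] K(2) elim])
      then show ?case by linarith
    qed
    from Lploc_dominated[OF Lploc_cmult[OF rk(1)] conv_borel[OF grad_kernel_borel[OF e] locint_borel[OF l(2)]] this st(4)]
    have "Lploc r (conv (grad_kernel e) g)" .
    moreover have "Lploc r (conv (partial e rho) u)"
      by (rule continuous_Lploc[OF smooth_continuous[OF smooth_conv[OF tr l(1)]] st(4)])
    ultimately show ?thesis unfolding grad_def[abs_def] using st(4) by (intro Lploc_add)
  qed
qed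

section \<open>Second derivatives of weak solutions\<close>

lemma powr_interpolation:
  fixes z M p p0 :: real
  assumes "0 \<le> z" "0 < M" "1 \<le> p0" "p0 \<le> p"
  shows "z powr p0 \<le> M powr (p0 - 1) * z + M powr (p0 - p) * z powr p"
proof (cases "z = 0")
  case False
  then have z: "0 < z" using assms by simp
  show ?thesis
  proof (cases "z \<le> M")
    case True
    have "z powr p0 = z powr (p0 - 1) * z" using z powr_add[of z "p0 - 1" 1] by simp
    also have "\<dots> \<le> M powr (p0 - 1) * z" using True z assms by (intro mult_right_mono powr_mono2) auto
    finally show ?thesis by (simp add: add_increasing2)
  next
    case False
    have "z powr p0 = z powr (p0 - p) * z powr p" by (simp add: powr_add[symmetric])
    also have "\<dots> \<le> M powr (p0 - p) * z powr p" using False assms by (intro mult_right_mono powr_mono2') auto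
    finally show ?thesis using z by (simp add: add_increasing)
  qed
qed simp

text \<open>Turns smallness of \<integral> |z|^q over a ball into smallness of \<integral> |z|, as
  values below \<eta> contribute at most \<eta> times the volume. It is the counterpart of
  \<open>powr_interpolation\<close>, which gets an intermediate power from L1 and L^p by splitting
  at height M.\<close>

lemma le_eta_powr:
  fixes z \<eta> q :: real
  assumes "0 \<le> z" "0 < \<eta>" "1 \<le> q"
  shows "z \<le> \<eta> + \<eta> powr (1 - q) * z powr q"
proof (cases "z \<le> \<eta>")
  case False
  then have z: "0 < z" using assms by simp
  have "z = z powr (1 - q) * z powr q" using z by (simp add: powr_add[symmetric])
  also have "\<dots> \<le> \<eta> powr (1 - q) * z powr q" using False assms by (intro mult_right_mono powr_mono2') auto
  finally show ?thesis using assms by simp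
qed (simp add: add_increasing2)

lemma partial_diff_fun:
  assumes "smooth \<phi>" "smooth \<psi>"
  shows "partial e (\<lambda>x. \<phi> x - \<psi> x) = (\<lambda>x. partial e \<phi> x - partial e \<psi> x)"
proof
  fix x
  have "((\<lambda>x. \<phi> x - \<psi> x) has_derivative
      (\<lambda>h. frechet_derivative \<phi> (at x) h - frechet_derivative \<psi> (at x) h)) (at x)"
    using assms smooth_differentiable frechet_derivative_works has_derivative_diff by blast
  from partial_eqI[OF this] show "partial e (\<lambda>x. \<phi> x - \<psi> x) x = partial e \<phi> x - partial e \<psi> x"
    by (simp add: partial_def)
qed

lemma test_diff: "test_function \<phi> \<Longrightarrow> test_function \<psi> \<Longrightarrow> test_function (\<lambda>x. \<phi> x - \<psi> x)"
  using test_add[of \<phi> "\<lambda>x. - 1 * \<psi> x"] test_cmult[of \<psi> "- 1"] by simp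

lemma laplacian_diff:
  assumes "smooth \<phi>" "smooth \<psi>"
  shows "laplacian (\<lambda>x. \<phi> x - \<psi> x) x = laplacian \<phi> x - laplacian \<psi> x"
proof -
  have "partial e (partial e (\<lambda>x. \<phi> x - \<psi> x)) x = partial e (partial e \<phi>) x - partial e (partial e \<psi>) x" if "e \<in> Basis" for e
    by (simp only: partial_diff_fun assms smooth_partial that)
  then show ?thesis by (simp add: laplacian_def sum_subtractf)
qed

text \<open>The regularised kernels are kept as a sequence: the natural bound for their limit,
  |x|^(-d), is not integrable at 0. The convolutions converge, by the Calderon--Zygmund inequality,
  although the kernels do not have an integrable majorant of this kind.\<close>

definition hess_kernel :: "'a::euclidean_space \<Rightarrow> 'a \<Rightarrow> nat \<Rightarrow> 'a \<Rightarrow> real" where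
  "hess_kernel i j n = partial j (partial i (parametrix (scale_seq n)))"

lemma test_hess_kernel: "i \<in> Basis \<Longrightarrow> j \<in> Basis \<Longrightarrow> test_function (hess_kernel i j n)"
  unfolding hess_kernel_def by (intro test_partial test_parametrix scale_seq)

lemma hess_kernel_zero:
  assumes "i \<in> Basis" "j \<in> Basis" "1 \<le> norm x"
  shows "hess_kernel i j n x = 0"
  unfolding hess_kernel_def
  by (rule partial_vanishes[OF smooth_partial[OF test_smooth[OF test_parametrix[OF scale_seq(1)]] assms(1)]
        partial_vanishes[OF test_smooth[OF test_parametrix[OF scale_seq(1)]] parametrix_zero[OF scale_seq(1)] assms(1)] assms(2,3)])

text \<open>For G of compact support the convolution of the parametrix with G is a test function
  whose Laplacian is the difference of two mollifications of G, so the inequality for test functions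
  applies. In the difference of two scales the \<open>rho\<close> terms cancel.\<close>

lemma hess_kernel_estimate:
  fixes G :: "'a::euclidean_space \<Rightarrow> real"
  assumes G: "integrable lborel G" "\<And>x. S \<le> norm x \<Longrightarrow> G x = 0" and ij: "i \<in> Basis" "j \<in> Basis"
    and K: "\<And>w :: 'a \<Rightarrow> real. test_function w \<Longrightarrow> (\<integral>x. \<bar>partial j (partial i w) x\<bar> powr p \<partial>lborel) \<le> K * (\<integral>x. \<bar>laplacian w x\<bar> powr p \<partial>lborel)"
  shows "(\<integral>x. \<bar>conv (hess_kernel i j n) G x\<bar> powr p \<partial>lborel)
      \<le> K * (\<integral>x. \<bar>conv (moll (scale_seq n)) G x - conv rho G x\<bar> powr p \<partial>lborel)"
    and "(\<integral>x. \<bar>conv (hess_kernel i j n) G x - conv (hess_kernel i j m) G x\<bar> powr p \<partial>lborel)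
      \<le> K * (\<integral>x. \<bar>conv (moll (scale_seq n)) G x - conv (moll (scale_seq m)) G x\<bar> powr p \<partial>lborel)"
proof -
  define w where "w n = conv (parametrix (scale_seq n)) G" for n
  have l: "locint G" by (rule integrable_locint[OF G(1)])
  have tN: "test_function (parametrix (scale_seq n) :: 'a \<Rightarrow> real)" for n by (rule test_parametrix[OF scale_seq(1)])
  have w: "test_function (w n)" for n unfolding w_def by (rule test_conv[OF tN l G(2)])
  have pw: "partial j (partial i (w n)) = conv (hess_kernel i j n) G" for n
    unfolding w_def hess_kernel_def
    by (simp only: partial_conv[OF tN l ij(1)] partial_conv[OF test_partial[OF tN ij(1)] l ij(2)])
  have lw: "laplacian (w n) x = conv (moll (scale_seq n)) G x - conv rho G x" for n x
    using integrable_conv_test[OF test_moll_seq l, of n x] integrable_conv_test[OF test_rho l, of x]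
    unfolding w_def laplacian_conv[OF tN l]
    by (simp add: conv_def laplacian_parametrix[OF scale_seq] left_diff_distrib)
  show "(\<integral>x. \<bar>conv (hess_kernel i j n) G x\<bar> powr p \<partial>lborel)
      \<le> K * (\<integral>x. \<bar>conv (moll (scale_seq n)) G x - conv rho G x\<bar> powr p \<partial>lborel)"
    using K[OF w[of n]] by (simp only: pw lw)
  have "partial j (partial i (\<lambda>x. w n x - w m x)) x = conv (hess_kernel i j n) G x - conv (hess_kernel i j m) G x" for x
    by (simp only: partial_diff_fun[OF test_smooth[OF w] test_smooth[OF w]] pw
        partial_diff_fun[OF smooth_partial[OF test_smooth[OF w] ij(1)] smooth_partial[OF test_smooth[OF w] ij(1)]])
  moreover have "laplacian (\<lambda>x. w n x - w m x) x = conv (moll (scale_seq n)) G x - conv (moll (scale_seq m)) G x" for x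
    by (simp add: laplacian_diff[OF test_smooth[OF w] test_smooth[OF w]] lw)
  ultimately show "(\<integral>x. \<bar>conv (hess_kernel i j n) G x - conv (hess_kernel i j m) G x\<bar> powr p \<partial>lborel)
      \<le> K * (\<integral>x. \<bar>conv (moll (scale_seq n)) G x - conv (moll (scale_seq m)) G x\<bar> powr p \<partial>lborel)"
    using K[OF test_diff[OF w[of n] w[of m]]] by simp
qed

lemma integral_diff_powr_le:
  fixes a b :: "'a::euclidean_space \<Rightarrow> real"
  assumes "integrable lborel (\<lambda>x. \<bar>a x\<bar> powr p)" "integrable lborel (\<lambda>x. \<bar>b x\<bar> powr p)" "0 \<le> p"
  shows "(\<integral>x. \<bar>a x - b x\<bar> powr p \<partial>lborel) \<le> 2 powr p * ((\<integral>x. \<bar>a x\<bar> powr p \<partial>lborel) + (\<integral>x. \<bar>b x\<bar> powr p \<partial>lborel))"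
proof -
  have "(\<integral>x. \<bar>a x - b x\<bar> powr p \<partial>lborel) \<le> (\<integral>x. 2 powr p * (\<bar>a x\<bar> powr p + \<bar>b x\<bar> powr p) \<partial>lborel)"
  proof (rule integral_mono')
    show "integrable lborel (\<lambda>x. 2 powr p * (\<bar>a x\<bar> powr p + \<bar>b x\<bar> powr p))" using assms by simp
    fix x
    have "\<bar>a x - b x\<bar> powr p \<le> (\<bar>a x\<bar> + \<bar>b x\<bar>) powr p" using assms(3) by (intro powr_mono2) auto
    also have "\<dots> \<le> 2 powr p * (\<bar>a x\<bar> powr p + \<bar>b x\<bar> powr p)" using assms(3) by (intro powr_add_le) auto
    finally show "\<bar>a x - b x\<bar> powr p \<le> 2 powr p * (\<bar>a x\<bar> powr p + \<bar>b x\<bar> powr p)" .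
  qed simp
  then show ?thesis using assms by simp
qed

lemma moll_seq_diff_powr_le:
  fixes G :: "'a::euclidean_space \<Rightarrow> real"
  assumes G: "integrable lborel G" and Gp: "integrable lborel (\<lambda>x. \<bar>G x\<bar> powr p)" and p: "1 \<le> p" and ab: "0 < a" "0 < b"
  shows "(\<integral>x. \<bar>conv (moll a) G x - conv (moll b) G x\<bar> powr p \<partial>lborel) \<le> 2 powr p * (2 * (\<integral>x. \<bar>G x\<bar> powr p \<partial>lborel))"
proof -
  have Gb: "G \<in> borel_measurable borel" using G by auto
  note m = conv_moll_Lp[OF _ Gb Gp p]
  have "(\<integral>x. \<bar>conv (moll a) G x - conv (moll b) G x\<bar> powr p \<partial>lborel)
      \<le> 2 powr p * ((\<integral>x. \<bar>conv (moll a) G x\<bar> powr p \<partial>lborel) + (\<integral>x. \<bar>conv (moll b) G x\<bar> powr p \<partial>lborel))"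
    using p by (intro integral_diff_powr_le m ab) auto
  also have "\<dots> \<le> 2 powr p * ((\<integral>x. \<bar>G x\<bar> powr p \<partial>lborel) + (\<integral>x. \<bar>G x\<bar> powr p \<partial>lborel))"
    by (intro mult_left_mono add_mono m ab) auto
  finally show ?thesis by simp
qed

lemma hess_kernel_powr_bound:
  fixes g :: "'a::euclidean_space \<Rightarrow> real"
  assumes p: "1 < p" and g: "Lploc p g" and ij: "i \<in> Basis" "j \<in> Basis"
  obtains C where "\<And>n. integrable lborel (\<lambda>x. \<bar>cutoff R (conv (hess_kernel i j n) g) x\<bar> powr p)"
    "\<And>n. (\<integral>x. \<bar>cutoff R (conv (hess_kernel i j n) g) x\<bar> powr p \<partial>lborel) \<le> C"
proof -
  obtain K where K: "K > 0" "\<And>w :: 'a \<Rightarrow> real. \<And>i j. test_function w \<Longrightarrow> i \<in> Basis \<Longrightarrow> j \<in> Basis \<Longrightarrow>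
      (\<integral>x. \<bar>partial i (partial j w) x\<bar> powr p \<partial>lborel) \<le> K * (\<integral>x. \<bar>laplacian w x\<bar> powr p \<partial>lborel)"
    by (rule calderon_zygmund[OF p, where 'a='a]) (rule that)
  have lg: "locint g" using Lploc_locint[OF g] p by simp
  define G where "G = cutoff (R + 1) g"
  have IG: "integrable lborel G" unfolding G_def by (rule cutoff_integrable[OF lg])
  have G0: "G x = 0" if "R + 2 \<le> norm x" for x unfolding G_def using that by (intro cutoff_zero) simp
  have Gp: "integrable lborel (\<lambda>x. \<bar>G x\<bar> powr p)" unfolding G_def using p by (intro cutoff_Lp[OF g]) simp
  have tc: "test_function (conv (hess_kernel i j n) G)" for n
    by (rule test_conv[OF test_hess_kernel[OF ij] integrable_locint[OF IG] G0])
  have Ic: "integrable lborel (\<lambda>x. \<bar>conv (hess_kernel i j n) G x\<bar> powr p)" for n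
    using p by (intro test_powr_integrable tc) simp
  have eq: "cutoff R (conv (hess_kernel i j n) g) x = cutoff R (conv (hess_kernel i j n) G) x" for n x
    unfolding G_def using conv_cutoff(2)[OF hess_kernel_zero[OF ij], where x=x and R=R and h=g]
    by (simp add: cutoff_def indicator_def)
  have I: "integrable lborel (\<lambda>x. \<bar>cutoff R (conv (hess_kernel i j n) G) x\<bar> powr p)" for n
    using p by (intro cutoff_Lp continuous_Lploc test_continuous tc) auto
  show ?thesis
  proof (rule that)
    fix n
    show "integrable lborel (\<lambda>x. \<bar>cutoff R (conv (hess_kernel i j n) g) x\<bar> powr p)" unfolding eq by (rule I)
    have "(\<integral>x. \<bar>cutoff R (conv (hess_kernel i j n) g) x\<bar> powr p \<partial>lborel) \<le> (\<integral>x. \<bar>conv (hess_kernel i j n) G x\<bar> powr p \<partial>lborel)"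
      unfolding eq by (intro integral_mono I Ic) (auto simp: cutoff_def indicator_def)
    \<comment> \<open>\<open>rho\<close> is the mollifier at scale 1, so the L^p contraction of
      mollification bounds both terms.\<close>
    also have "\<dots> \<le> K * (\<integral>x. \<bar>conv (moll (scale_seq n)) G x - conv (moll 1) G x\<bar> powr p \<partial>lborel)"
      unfolding moll_1 by (rule hess_kernel_estimate(1)[OF IG G0 ij K(2)[OF _ ij(2,1)]])
    also have "\<dots> \<le> K * (2 powr p * (2 * (\<integral>x. \<bar>G x\<bar> powr p \<partial>lborel)))"
      using K(1) p by (intro mult_left_mono moll_seq_diff_powr_le IG Gp scale_seq) auto
    finally show "(\<integral>x. \<bar>cutoff R (conv (hess_kernel i j n) g) x\<bar> powr p \<partial>lborel) \<le> K * (2 powr p * (2 * (\<integral>x. \<bar>G x\<bar> powr p \<partial>lborel)))" .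
  qed
qed

text \<open>The Calderon--Zygmund estimate with an exponent strictly between \<open>1\<close> and \<open>p\<close> applies to the
  differences, which are small in \<open>L\<^sup>1\<close> and bounded in \<open>L\<^sup>p\<close>; no convergence in \<open>L\<^sup>p\<close> is needed.\<close>

lemma hess_kernel_Cauchy:
  fixes g :: "'a::euclidean_space \<Rightarrow> real"
  assumes p: "1 < p" and g: "Lploc p g" and ij: "i \<in> Basis" "j \<in> Basis" and e: "0 < e"
  shows "\<exists>N. \<forall>m\<ge>N. \<forall>n\<ge>N.
    (\<integral>x. \<bar>cutoff R (conv (hess_kernel i j m) g) x - cutoff R (conv (hess_kernel i j n) g) x\<bar> \<partial>lborel) < e"
proof -
  define p0 where "p0 = (1 + p) / 2"
  have p0: "1 < p0" "p0 < p" using p by (simp_all add: p0_def)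
  obtain K where K: "K > 0" "\<And>w :: 'a \<Rightarrow> real. \<And>i j. test_function w \<Longrightarrow> i \<in> Basis \<Longrightarrow> j \<in> Basis \<Longrightarrow>
      (\<integral>x. \<bar>partial i (partial j w) x\<bar> powr p0 \<partial>lborel) \<le> K * (\<integral>x. \<bar>laplacian w x\<bar> powr p0 \<partial>lborel)"
    by (rule calderon_zygmund[OF p0(1), where 'a='a]) (rule that)
  have lg: "locint g" using Lploc_locint[OF g] p by simp
  define G where "G = cutoff (R + 1) g"
  have IG: "integrable lborel G" unfolding G_def by (rule cutoff_integrable[OF lg])
  have G0: "G x = 0" if "R + 2 \<le> norm x" for x unfolding G_def using that by (intro cutoff_zero) simp
  have Gp: "integrable lborel (\<lambda>x. \<bar>G x\<bar> powr p)" unfolding G_def using p by (intro cutoff_Lp[OF g]) simp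
  have tc: "test_function (conv (hess_kernel i j n) G)" for n
    by (rule test_conv[OF test_hess_kernel[OF ij] integrable_locint[OF IG] G0])
  have tm: "test_function (conv (moll (scale_seq n)) G)" for n
    by (rule test_conv[OF test_moll_seq integrable_locint[OF IG] G0])
  define B where "B = 2 powr p * (2 * (\<integral>x. \<bar>G x\<bar> powr p \<partial>lborel))"
  define a where "a n = (\<integral>x. \<bar>conv (moll (scale_seq n)) G x - G x\<bar> \<partial>lborel)" for n
  have alim: "a \<longlonglongrightarrow> 0" unfolding a_def[abs_def] by (rule conv_moll_L1_limit[OF IG G0])
  define vol where "vol = (\<integral>x. indicat_real (cball (0::'a) R) x \<partial>lborel)"
  have vol0: "0 \<le> vol" by (simp add: vol_def)
  \<comment> \<open>The tolerance e is split in three. \<eta> handles the region where the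
    difference is at most \<eta>; then M makes the share of the L^p bound B small, which works
    because p0 < p; only then c prescribes how close the mollifications must be in L1.\<close>
  define \<eta> where "\<eta> = e / (3 * (vol + 1))"
  have \<eta>: "0 < \<eta>" "\<eta> * vol < e / 3" using e vol0 by (simp_all add: \<eta>_def field_simps)
  define L where "L = \<eta> powr (1 - p0) * K"
  have L: "0 < L" using \<eta> K by (simp add: L_def)
  have "((\<lambda>M. L * (M powr (p0 - p) * B)) \<longlongrightarrow> L * (0 * B)) at_top"
    using p0 by (intro tendsto_intros tendsto_neg_powr filterlim_ident) simp
  then have "\<forall>\<^sub>F M in at_top. L * (M powr (p0 - p) * B) < e / 3"
    using e by (intro order_tendstoD(2)) auto
  then have "\<forall>\<^sub>F M in at_top. L * (M powr (p0 - p) * B) < e / 3 \<and> 0 < M"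
    using eventually_gt_at_top[of "0::real"] by eventually_elim simp
  then obtain M where M: "L * (M powr (p0 - p) * B) < e / 3" "0 < M"
    using eventually_happens'[of "at_top :: real filter"] trivial_limit_at_top_linorder by blast
  define c where "c = e / (6 * (L * M powr (p0 - 1)))"
  have c: "0 < c" "L * M powr (p0 - 1) * (2 * c) = e / 3" using e L M(2) by (simp_all add: c_def field_simps)
  obtain N where N: "\<And>n. n \<ge> N \<Longrightarrow> a n < c"
    using order_tendstoD(2)[OF alim c(1)] by (auto simp: eventually_sequentially)
  have eq: "cutoff R (conv (hess_kernel i j n) g) x = cutoff R (conv (hess_kernel i j n) G) x" for n x
    unfolding G_def using conv_cutoff(2)[OF hess_kernel_zero[OF ij], where x=x and R=R and h=g]
    by (simp add: cutoff_def indicator_def)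
  show ?thesis
  proof (intro exI allI impI)
    fix m n assume mn: "N \<le> m" "N \<le> n"
    define D where "D x = conv (hess_kernel i j m) G x - conv (hess_kernel i j n) G x" for x
    define \<delta> where "\<delta> x = conv (moll (scale_seq m)) G x - conv (moll (scale_seq n)) G x" for x
    have tD: "test_function D" unfolding D_def[abs_def] by (intro test_diff tc)
    have td: "test_function \<delta>" unfolding \<delta>_def[abs_def] by (intro test_diff tm)
    have ID: "integrable lborel (\<lambda>x. \<bar>D x\<bar> powr p0)" using p0 by (intro test_powr_integrable tD) simp
    have Id: "integrable lborel (\<lambda>x. \<bar>\<delta> x\<bar> powr p0)" "integrable lborel (\<lambda>x. \<bar>\<delta> x\<bar> powr p)" "integrable lborel (\<lambda>x. \<bar>\<delta> x\<bar>)"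
      using p0 p test_integrable[OF td] by (auto intro: test_powr_integrable[OF td])
    have "(\<integral>x. \<bar>\<delta> x\<bar> \<partial>lborel) \<le> (\<integral>x. \<bar>conv (moll (scale_seq m)) G x - G x\<bar> + \<bar>conv (moll (scale_seq n)) G x - G x\<bar> \<partial>lborel)"
      using test_integrable[OF tm] IG by (intro integral_mono Id) (auto simp: \<delta>_def)
    also have "\<dots> = a m + a n" using test_integrable[OF tm] IG by (simp add: a_def)
    also have "\<dots> < 2 * c" using N[OF mn(1)] N[OF mn(2)] by simp
    finally have \<delta>1: "(\<integral>x. \<bar>\<delta> x\<bar> \<partial>lborel) < 2 * c" .
    have \<delta>p: "(\<integral>x. \<bar>\<delta> x\<bar> powr p \<partial>lborel) \<le> B"
      unfolding \<delta>_def B_def using p by (intro moll_seq_diff_powr_le IG Gp scale_seq) simp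
    have "(\<integral>x. \<bar>\<delta> x\<bar> powr p0 \<partial>lborel) \<le> (\<integral>x. M powr (p0 - 1) * \<bar>\<delta> x\<bar> + M powr (p0 - p) * \<bar>\<delta> x\<bar> powr p \<partial>lborel)"
      using Id M(2) p0 by (intro integral_mono powr_interpolation) auto
    also have "\<dots> = M powr (p0 - 1) * (\<integral>x. \<bar>\<delta> x\<bar> \<partial>lborel) + M powr (p0 - p) * (\<integral>x. \<bar>\<delta> x\<bar> powr p \<partial>lborel)"
      using Id by simp
    also have "\<dots> \<le> M powr (p0 - 1) * (2 * c) + M powr (p0 - p) * B"
      using \<delta>1 \<delta>p by (intro add_mono mult_left_mono) auto
    finally have \<delta>0: "(\<integral>x. \<bar>\<delta> x\<bar> powr p0 \<partial>lborel) \<le> M powr (p0 - 1) * (2 * c) + M powr (p0 - p) * B" .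
    have "(\<integral>x. \<bar>D x\<bar> powr p0 \<partial>lborel) \<le> K * (\<integral>x. \<bar>\<delta> x\<bar> powr p0 \<partial>lborel)"
      unfolding D_def \<delta>_def by (rule hess_kernel_estimate(2)[OF IG G0 ij K(2)[OF _ ij(2,1)]])
    also have "\<dots> \<le> K * (M powr (p0 - 1) * (2 * c) + M powr (p0 - p) * B)"
      using \<delta>0 K(1) by (intro mult_left_mono) auto
    finally have D0: "(\<integral>x. \<bar>D x\<bar> powr p0 \<partial>lborel) \<le> K * (M powr (p0 - 1) * (2 * c) + M powr (p0 - p) * B)" .
    have Iv: "integrable lborel (\<lambda>x::'a. indicat_real (cball 0 R) x * \<eta>)" by (rule indicator_cball_integrable)
    have "(\<integral>x. \<bar>cutoff R (conv (hess_kernel i j m) g) x - cutoff R (conv (hess_kernel i j n) g) x\<bar> \<partial>lborel)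
        = (\<integral>x. \<bar>cutoff R D x\<bar> \<partial>lborel)"
      unfolding eq by (simp add: cutoff_def D_def right_diff_distrib)
    also have "\<dots> \<le> (\<integral>x. indicat_real (cball 0 R) x * \<eta> + \<eta> powr (1 - p0) * \<bar>D x\<bar> powr p0 \<partial>lborel)"
    proof (rule integral_mono)
      show "integrable lborel (\<lambda>x. \<bar>cutoff R D x\<bar>)"
        by (intro integrable_abs cutoff_integrable smooth_locint test_smooth tD)
      show "integrable lborel (\<lambda>x. indicat_real (cball 0 R) x * \<eta> + \<eta> powr (1 - p0) * \<bar>D x\<bar> powr p0)"
        using Iv ID by simp
      fix x
      have "\<bar>D x\<bar> \<le> \<eta> + \<eta> powr (1 - p0) * \<bar>D x\<bar> powr p0" using \<eta> p0 by (intro le_eta_powr) auto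
      then show "\<bar>cutoff R D x\<bar> \<le> indicat_real (cball 0 R) x * \<eta> + \<eta> powr (1 - p0) * \<bar>D x\<bar> powr p0"
        by (simp add: cutoff_def indicator_def)
    qed
    also have "\<dots> = \<eta> * vol + \<eta> powr (1 - p0) * (\<integral>x. \<bar>D x\<bar> powr p0 \<partial>lborel)"
      using Iv ID by (simp add: vol_def mult.commute)
    also have "\<dots> \<le> \<eta> * vol + \<eta> powr (1 - p0) * (K * (M powr (p0 - 1) * (2 * c) + M powr (p0 - p) * B))"
      using D0 by (intro add_left_mono mult_left_mono) auto
    also have "\<dots> = \<eta> * vol + L * M powr (p0 - 1) * (2 * c) + L * (M powr (p0 - p) * B)"
      by (simp add: L_def algebra_simps)
    also have "\<dots> < e" using \<eta>(2) c(2) M(1) by linarith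
    finally show "(\<integral>x. \<bar>cutoff R (conv (hess_kernel i j m) g) x - cutoff R (conv (hess_kernel i j n) g) x\<bar> \<partial>lborel) < e" .
  qed
qed

text \<open>Fatou on each ball: boundedness in L^p survives the almost everywhere limit, although
  convergence itself is known only in a weaker sense.\<close>

lemma Lploc_AE_limit:
  fixes h :: "nat \<Rightarrow> 'a::euclidean_space \<Rightarrow> real"
  assumes p: "0 < p" and H: "H \<in> borel_measurable borel"
    and I: "\<And>R n. integrable lborel (\<lambda>x. \<bar>cutoff R (h n) x\<bar> powr p)"
    and C: "\<And>R n. (\<integral>x. \<bar>cutoff R (h n) x\<bar> powr p \<partial>lborel) \<le> C R"
    and lim: "AE x in lborel. (\<lambda>n. h n x) \<longlonglongrightarrow> H x"
  shows "Lploc p H"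
  unfolding Lploc_def
proof (intro conjI allI H)
  fix R
  have "(\<integral>\<^sup>+x. ennreal (\<bar>cutoff R H x\<bar> powr p) \<partial>lborel) = (\<integral>\<^sup>+x. liminf (\<lambda>n. ennreal (\<bar>cutoff R (h n) x\<bar> powr p)) \<partial>lborel)"
  proof (rule nn_integral_cong_AE)
    show "AE x in lborel. ennreal (\<bar>cutoff R H x\<bar> powr p) = liminf (\<lambda>n. ennreal (\<bar>cutoff R (h n) x\<bar> powr p))"
      using lim
    proof eventually_elim
      case (elim x)
      have "(\<lambda>n. ennreal (\<bar>cutoff R (h n) x\<bar> powr p)) \<longlonglongrightarrow> ennreal (\<bar>cutoff R H x\<bar> powr p)"
        unfolding cutoff_def using p by (intro tendsto_ennrealI tendsto_powr' tendsto_rabs tendsto_mult tendsto_const elim) auto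
      then show ?case by (intro lim_imp_Liminf[symmetric]) auto
    qed
  qed
  also have "\<dots> \<le> liminf (\<lambda>n. \<integral>\<^sup>+x. ennreal (\<bar>cutoff R (h n) x\<bar> powr p) \<partial>lborel)"
    using I[THEN borel_measurable_integrable] by (intro nn_integral_liminf) (rule measurable_compose[OF _ measurable_ennreal])
  also have "\<dots> \<le> ennreal (C R)"
  proof (rule Liminf_le)
    show "\<forall>\<^sub>F n in sequentially. (\<integral>\<^sup>+x. ennreal (\<bar>cutoff R (h n) x\<bar> powr p) \<partial>lborel) \<le> ennreal (C R)"
      using I C by (intro always_eventually allI) (simp add: nn_integral_eq_integral ennreal_leI)
  qed simp
  finally have fin: "(\<integral>\<^sup>+x. ennreal (\<bar>cutoff R H x\<bar> powr p) \<partial>lborel) < \<infinity>" by (rule le_less_trans) simp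
  have "integrable lborel (\<lambda>x. \<bar>cutoff R H x\<bar> powr p)"
    using fin abs_powr_borel[OF cutoff_borel[OF H]] by (intro integrableI_bounded) auto
  then show "integrable lborel (\<lambda>x. indicat_real (cball 0 R) x * \<bar>H x\<bar> powr p)" by (simp only: cutoff_powr[OF p])
qed

text \<open>H is the smooth term from \<open>rho\<close> plus a limit of convolutions with
  \<open>hess_kernel\<close>. The Cauchy property gives a subsequence that converges in L1_loc,
  which identifies H by testing, and almost everywhere, which gives the exponent p through the
  uniform L^p bounds.\<close>

theorem weak_laplace_hessian:
  fixes u g :: "'a::euclidean_space \<Rightarrow> real"
  assumes w: "weak_laplace u g" and g: "Lploc p g" and p: "1 < p" and ij: "i \<in> Basis" "j \<in> Basis"
  obtains H where "Lploc p H"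
    "\<And>\<phi>. test_function \<phi> \<Longrightarrow> (\<integral>x. u x * partial i (partial j \<phi>) x \<partial>lborel) = (\<integral>x. H x * \<phi> x \<partial>lborel)"
proof -
  note l = weak_laplace_locint[OF w]
  have tr: "test_function (partial j (partial i rho))" by (intro test_partial test_rho ij)
  have lk: "locint (conv (hess_kernel i j n) g)" for n
    by (intro smooth_locint smooth_conv test_hess_kernel ij l)
  obtain H' r where r: "strict_mono r" and H': "locint H'" and lim: "L1loc_lim (\<lambda>k. conv (hess_kernel i j (r k)) g) H'"
    and AE: "AE x in lborel. (\<lambda>k. conv (hess_kernel i j (r k)) g x) \<longlonglongrightarrow> H' x"
    by (rule L1loc_complete[OF lk hess_kernel_Cauchy[OF p g ij]], assumption) (rule that)
  have "\<exists>C. (\<forall>n. integrable lborel (\<lambda>x. \<bar>cutoff R (conv (hess_kernel i j n) g) x\<bar> powr p)) \<and>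
      (\<forall>n. (\<integral>x. \<bar>cutoff R (conv (hess_kernel i j n) g) x\<bar> powr p \<partial>lborel) \<le> C)" for R
    by (rule hess_kernel_powr_bound[OF p g ij, of R]) (rule exI, rule conjI; rule allI)
  then obtain C where C: "\<And>R n. integrable lborel (\<lambda>x. \<bar>cutoff R (conv (hess_kernel i j n) g) x\<bar> powr p)"
      "\<And>R n. (\<integral>x. \<bar>cutoff R (conv (hess_kernel i j n) g) x\<bar> powr p \<partial>lborel) \<le> C R"
    by metis
  have p0: "0 < p" using p by simp
  have LH': "Lploc p H'" by (rule Lploc_AE_limit[OF p0 locint_borel[OF H'] C AE])
  define H where "H x = conv (partial j (partial i rho)) u x + H' x" for x
  have LH: "Lploc p H"
    unfolding H_def[abs_def]
    by (intro Lploc_add LH' continuous_Lploc smooth_continuous smooth_conv tr l p0)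
  have lH: "locint H" using Lploc_locint[OF LH] p by simp
  define v where "v k = conv (moll (scale_seq (r k))) u" for k
  have sv: "smooth (v k)" for k unfolding v_def by (rule smooth_conv[OF test_moll_seq l(1)])
  have limH: "L1loc_lim (\<lambda>k. partial j (partial i (v k))) H"
    unfolding v_def mollified_representation_partial2[OF w ij] H_def[abs_def] hess_kernel_def[symmetric]
    by (rule L1loc_lim_add_const[OF lim])
  have limu: "L1loc_lim v u"
    using L1loc_lim_conv_moll[OF l(1)] LIMSEQ_subseq_LIMSEQ[OF _ r]
    unfolding L1loc_lim_def v_def by (auto simp: o_def)
  show ?thesis
  proof (rule that[OF LH])
    fix \<phi> :: "'a \<Rightarrow> real" assume \<phi>: "test_function \<phi>"
    have \<phi>2: "test_function (partial i (partial j \<phi>))" by (intro test_partial \<phi> ij)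
    obtain R where R: "R > 0" "\<And>x. R \<le> norm x \<Longrightarrow> \<phi> x = 0" using test_functionE[OF \<phi>] by blast
    obtain R' where R': "R' > 0" "\<And>x. R' \<le> norm x \<Longrightarrow> partial i (partial j \<phi>) x = 0" using test_functionE[OF \<phi>2] by blast
    have 1: "(\<lambda>k. \<integral>x. \<phi> x * partial j (partial i (v k)) x \<partial>lborel) \<longlonglongrightarrow> (\<integral>x. \<phi> x * H x \<partial>lborel)"
      by (rule L1loc_lim_integral(1)[OF _ lH limH test_continuous[OF \<phi>] R(2)])
        (intro smooth_locint smooth_partial sv ij)
    have 2: "(\<lambda>k. \<integral>x. partial i (partial j \<phi>) x * v k x \<partial>lborel) \<longlonglongrightarrow> (\<integral>x. partial i (partial j \<phi>) x * u x \<partial>lborel)"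
      by (rule L1loc_lim_integral(1)[OF _ l(1) limu test_continuous[OF \<phi>2] R'(2)]) (intro smooth_locint sv)
    \<comment> \<open>Moving the two derivatives onto \<phi> one after the other reverses their
      order, hence j, i on the mollification but i, j on the test function.\<close>
    have 3: "(\<integral>x. \<phi> x * partial j (partial i (v k)) x \<partial>lborel) = (\<integral>x. partial i (partial j \<phi>) x * v k x \<partial>lborel)" for k
      using smooth_integration_by_parts[OF \<phi> smooth_partial[OF sv ij(1)] ij(2), of k]
        smooth_integration_by_parts[OF test_partial[OF \<phi> ij(2)] sv ij(1), of k] by simp
    have "(\<integral>x. \<phi> x * H x \<partial>lborel) = (\<integral>x. partial i (partial j \<phi>) x * u x \<partial>lborel)"
      using LIMSEQ_unique[OF 1[unfolded 3] 2] .
    then show "(\<integral>x. u x * partial i (partial j \<phi>) x \<partial>lborel) = (\<integral>x. H x * \<phi> x \<partial>lborel)" by (simp add: mult.commute)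
  qed
qed

section \<open>Regularity for the Schroedinger equation\<close>

text \<open>The analysis above runs on Borel functions and \<open>lborel\<close>, where product
  measurability and Fubini are available. This carries its results to functions that are only
  Lebesgue measurable, through almost everywhere equality.\<close>

lemma lebesgue_AE_borel:
  fixes F :: "'a::euclidean_space \<Rightarrow> 'b::euclidean_space"
  assumes G: "G \<in> borel_measurable borel" and ae: "AE x in lborel. F x = G x"
  shows "F \<in> borel_measurable lebesgue"
    and "integrable lebesgue F \<longleftrightarrow> integrable lborel G"
    and "integral\<^sup>L lebesgue F = integral\<^sup>L lborel G"
proof -
  have ae': "AE x in lebesgue. G x = F x" using ae by (auto simp: AE_completion_iff eq_commute)
  have G': "G \<in> borel_measurable lebesgue" using G by (simp add: measurable_completion)
  show F: "F \<in> borel_measurable lebesgue" by (rule borel_measurable_AE[OF G' ae'])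
  have "integrable lebesgue F \<longleftrightarrow> integrable lebesgue G"
    using ae' by (intro integrable_cong_AE F G') (auto simp: eq_commute)
  then show "integrable lebesgue F \<longleftrightarrow> integrable lborel G" using G by (simp add: integrable_completion)
  have "integral\<^sup>L lebesgue F = integral\<^sup>L lebesgue G"
    using ae' by (intro integral_cong_AE F G') (auto simp: eq_commute)
  then show "integral\<^sup>L lebesgue F = integral\<^sup>L lborel G" using G by (simp add: integral_completion)
qed

lemma borel_representative:
  fixes f :: "'a::euclidean_space \<Rightarrow> real"
  assumes "f \<in> borel_measurable lebesgue"
  obtains g where "g \<in> borel_measurable borel" "AE x in lborel. f x = g x"
  using completion_ex_borel_measurable_real[OF assms] by auto

text \<open>Only the norm of f is compared with a Borel function, so vector fields such as V^(1/2)
  times the gradient are covered too. Balls and compact sets test the same property because every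
  compact set lies in a ball.\<close>

lemma Lp_loc_iff_Lploc:
  fixes f :: "'a::euclidean_space \<Rightarrow> 'b::euclidean_space"
  assumes f: "f \<in> borel_measurable lebesgue" and h: "h \<in> borel_measurable borel" and ae: "AE x in lborel. norm (f x) = \<bar>h x\<bar>"
  shows "f \<in> Lp_loc p \<longleftrightarrow> Lploc p h"
proof -
  have I: "(\<lambda>x. norm (f x) powr p) absolutely_integrable_on cball 0 R
      \<longleftrightarrow> integrable lborel (\<lambda>x. indicat_real (cball 0 R) x * \<bar>h x\<bar> powr p)" for R
    unfolding set_integrable_def
  proof (rule lebesgue_AE_borel(2))
    show "(\<lambda>x. indicat_real (cball 0 R) x * \<bar>h x\<bar> powr p) \<in> borel_measurable borel"
      by (intro indicator_mult_borel abs_powr_borel h)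
    show "AE x in lborel. indicat_real (cball 0 R) x *\<^sub>R norm (f x) powr p = indicat_real (cball 0 R) x * \<bar>h x\<bar> powr p"
      using ae by eventually_elim simp
  qed
  show ?thesis
  proof
    assume "f \<in> Lp_loc p"
    then have "(\<lambda>x. norm (f x) powr p) absolutely_integrable_on cball 0 R" for R
      using compact_cball unfolding Lp_loc_def by blast
    then show "Lploc p h" unfolding Lploc_def using h I by blast
  next
    assume L: "Lploc p h"
    have "(\<lambda>x. norm (f x) powr p) absolutely_integrable_on K" if K: "compact K" for K
    proof -
      obtain R where "K \<subseteq> ball 0 R" using bounded_subset_ballD[OF compact_imp_bounded[OF K]] by blast
      then have "K \<subseteq> cball 0 R" using ball_subset_cball by blast
      moreover have "K \<in> sets lebesgue" using K by (simp add: compact_imp_closed)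
      moreover have "(\<lambda>x. norm (f x) powr p) absolutely_integrable_on cball 0 R"
        using Lploc_integrable[OF L] I by blast
      ultimately show ?thesis using set_integrable_subset by blast
    qed
    then show "f \<in> Lp_loc p" unfolding Lp_loc_def using f by blast
  qed
qed

lemma Lp_loc_real_iff:
  fixes f :: "'a::euclidean_space \<Rightarrow> real"
  assumes h: "h \<in> borel_measurable borel" and ae: "AE x in lborel. f x = h x"
  shows "f \<in> Lp_loc p \<longleftrightarrow> Lploc p h"
proof (rule Lp_loc_iff_Lploc[OF lebesgue_AE_borel(1)[OF h ae] h])
  show "AE x in lborel. norm (f x) = \<bar>h x\<bar>" using ae by eventually_elim simp
qed

lemma integrable_locint_test:
  assumes "locint h" "test_function \<phi>"
  shows "integrable lborel (\<lambda>x. h x * \<phi> x)"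
  using integrable_conv_test[OF test_reflect[OF assms(2), of 0] assms(1), of 0] by (simp add: mult.commute)

lemma Lploc_sum:
  assumes "finite A" "\<And>a. a \<in> A \<Longrightarrow> Lploc p (f a)" "0 < p"
  shows "Lploc p (\<lambda>x. \<Sum>a\<in>A. f a x)"
  using assms
proof (induction A rule: finite_induct)
  case empty
  then show ?case using continuous_Lploc[of "\<lambda>x. 0"] by simp
next
  case (insert a A)
  then show ?case by (simp add: Lploc_add)
qed

lemma RH_Lploc:
  fixes V :: "'a::euclidean_space \<Rightarrow> real"
  assumes V: "V \<in> RH q" "AE x in lebesgue. 0 \<le> V x" and W: "W \<in> borel_measurable borel" "AE x in lborel. V x = W x"
  shows "Lploc q W"
  unfolding Lploc_def
proof (intro conjI allI W(1))
  fix R :: real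
  have "(\<lambda>y. V y powr q) absolutely_integrable_on ball 0 (\<bar>R\<bar> + 1)" using V(1) by (simp add: RH_def)
  then have "(\<lambda>y. V y powr q) absolutely_integrable_on cball 0 R"
    by (rule set_integrable_subset) auto
  \<comment> \<open>V >= 0 almost everywhere lets \<open>V x powr q\<close> be read as the power of
    the absolute value of W.\<close>
  moreover have "AE x in lborel. indicat_real (cball 0 R) x *\<^sub>R V x powr q = indicat_real (cball 0 R) x * \<bar>W x\<bar> powr q"
    using V(2)[unfolded AE_completion_iff] W(2) by eventually_elim simp
  ultimately show "integrable lborel (\<lambda>x. indicat_real (cball 0 R) x * \<bar>W x\<bar> powr q)"
    unfolding set_integrable_def
    by (intro lebesgue_AE_borel(2)[OF indicator_mult_borel[OF abs_powr_borel[OF W(1)]], THEN iffD1])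
qed

text \<open>On a ball of radius R the weight is at least (1 + R)^(-\<sigma>), so the decay that it
  imposes at infinity does not affect local integrability.\<close>

lemma weighted_Lploc:
  fixes f :: "'a::euclidean_space \<Rightarrow> real"
  assumes I: "integrable lebesgue (\<lambda>x. \<bar>f x\<bar> powr p / (1 + norm x) powr \<sigma>)" and \<sigma>: "0 < \<sigma>"
    and h: "h \<in> borel_measurable borel" "AE x in lborel. f x = h x"
  shows "Lploc p h"
  unfolding Lploc_def
proof (intro conjI allI h(1))
  fix R :: real
  have hp: "(\<lambda>x. \<bar>h x\<bar> powr p) \<in> borel_measurable borel" by (rule abs_powr_borel[OF h(1)])
  have wb: "(\<lambda>x. \<bar>h x\<bar> powr p / (1 + norm x) powr \<sigma>) \<in> borel_measurable borel" using hp by measurable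
  have ae: "AE x in lborel. \<bar>f x\<bar> powr p / (1 + norm x) powr \<sigma> = \<bar>h x\<bar> powr p / (1 + norm x) powr \<sigma>"
    using h(2) by eventually_elim simp
  have J: "integrable lborel (\<lambda>x. \<bar>h x\<bar> powr p / (1 + norm x) powr \<sigma>)"
    by (rule iffD1[OF lebesgue_AE_borel(2)[OF wb ae] I])
  show "integrable lborel (\<lambda>x. indicat_real (cball 0 R) x * \<bar>h x\<bar> powr p)"
  proof (rule Bochner_Integration.integrable_bound)
    show "integrable lborel (\<lambda>x. (1 + \<bar>R\<bar>) powr \<sigma> * (\<bar>h x\<bar> powr p / (1 + norm x) powr \<sigma>))"
      by (rule integrable_mult_right[OF J])
    show "(\<lambda>x. indicat_real (cball 0 R) x * \<bar>h x\<bar> powr p) \<in> borel_measurable lborel"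
      using indicator_mult_borel[OF hp] by simp
    show "AE x in lborel. norm (indicat_real (cball 0 R) x * \<bar>h x\<bar> powr p)
        \<le> norm ((1 + \<bar>R\<bar>) powr \<sigma> * (\<bar>h x\<bar> powr p / (1 + norm x) powr \<sigma>))"
    proof (rule AE_I2)
      fix x :: 'a
      show "norm (indicat_real (cball 0 R) x * \<bar>h x\<bar> powr p)
        \<le> norm ((1 + \<bar>R\<bar>) powr \<sigma> * (\<bar>h x\<bar> powr p / (1 + norm x) powr \<sigma>))"
      proof (cases "x \<in> cball 0 R")
        case True
        then have "(1 + norm x) powr \<sigma> \<le> (1 + \<bar>R\<bar>) powr \<sigma>" using \<sigma> by (intro powr_mono2) auto
        moreover have pos: "0 < (1 + norm x) powr \<sigma>" using add_pos_nonneg[OF zero_less_one norm_ge_zero[of x]] by simp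
        ultimately have "1 \<le> (1 + \<bar>R\<bar>) powr \<sigma> / (1 + norm x) powr \<sigma>" by simp
        from mult_right_mono[OF this, of "\<bar>h x\<bar> powr p"] show ?thesis using True by (simp add: mult.commute)
      qed simp
    qed
  qed
qed

lemma schroedinger_weak_laplace:
  fixes V u f :: "'a::euclidean_space \<Rightarrow> real"
  assumes sol: "schroedinger_solution V u f"
    and V': "V' \<in> borel_measurable borel" "AE x in lborel. V x = V' x"
    and u': "u' \<in> borel_measurable borel" "AE x in lborel. u x = u' x"
    and f': "f' \<in> borel_measurable borel" "AE x in lborel. f x = f' x"
  shows "locint (\<lambda>x. V' x * u' x)" and "weak_laplace u' (\<lambda>x. V' x * u' x - f' x)"
proof -
  have Vu': "(\<lambda>x. V' x * u' x) \<in> borel_measurable borel" "AE x in lborel. V x * u x = V' x * u' x"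
    subgoal using V' u' by measurable
    subgoal using V'(2) u'(2) by eventually_elim simp
    done
  have l: "locint u'" "locint (\<lambda>x. V' x * u' x)" "locint f'"
    using sol unfolding schroedinger_solution_def Lp_loc_real_iff[OF u'] Lp_loc_real_iff[OF Vu'] Lp_loc_real_iff[OF f'] Lploc_1
    by simp_all
  show "locint (\<lambda>x. V' x * u' x)" by (rule l)
  have lg: "locint (\<lambda>x. V' x * u' x - f' x)"
    using Lploc_add[of 1 "\<lambda>x. V' x * u' x" "\<lambda>x. - 1 * f' x"] Lploc_cmult[of 1 f' "- 1"] l by (simp add: Lploc_1)
  show "weak_laplace u' (\<lambda>x. V' x * u' x - f' x)"
    unfolding weak_laplace_def
  proof (intro conjI allI impI l lg)
    fix \<phi> :: "'a \<Rightarrow> real" assume \<phi>: "test_function \<phi>"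
    have tr: "(LINT x|lebesgue. F x * \<psi> x) = (\<integral>x. G x * \<psi> x \<partial>lborel)"
      if "G \<in> borel_measurable borel" "AE x in lborel. F x = G x" "test_function \<psi>" for F G \<psi> :: "'a \<Rightarrow> real"
    proof (rule lebesgue_AE_borel(3))
      show "(\<lambda>x. G x * \<psi> x) \<in> borel_measurable borel" using that(1) test_borel[OF that(3)] by measurable
      show "AE x in lborel. F x * \<psi> x = G x * \<psi> x" using that(2) by eventually_elim simp
    qed
    have "- (LINT x|lebesgue. u x * laplacian \<phi> x) + (LINT x|lebesgue. V x * u x * \<phi> x) = (LINT x|lebesgue. f x * \<phi> x)"
      using sol \<phi> unfolding schroedinger_solution_def by blast
    then have "(\<integral>x. u' x * laplacian \<phi> x \<partial>lborel) = (\<integral>x. V' x * u' x * \<phi> x \<partial>lborel) - (\<integral>x. f' x * \<phi> x \<partial>lborel)"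
      unfolding tr[OF u' test_laplacian[OF \<phi>]] tr[OF Vu' \<phi>] tr[OF f' \<phi>] by simp
    also have "\<dots> = (\<integral>x. (V' x * u' x - f' x) * \<phi> x \<partial>lborel)"
      using integrable_locint_test[OF l(2) \<phi>] integrable_locint_test[OF l(3) \<phi>] by (simp add: left_diff_distrib)
    finally show "(\<integral>x. u' x * laplacian \<phi> x \<partial>lborel) = (\<integral>x. (V' x * u' x - f' x) * \<phi> x \<partial>lborel)" .
  qed
qed

text \<open>A bootstrap from L1, where Vu lies by the notion of solution. If Vu - f has reciprocal
  exponent a, then u reaches reciprocal exponents above a - 2/d and Vu those above a + 1/q - 2/d,
  less than a since q > d/2. The descent stops at 1/s: it has to stay above 1/q so that u keeps a
  positive reciprocal exponent, and f admits nothing beyond p.\<close>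

lemma potential_term_Lploc:
  fixes V u f :: "'a::euclidean_space \<Rightarrow> real"
  assumes d: "3 \<le> DIM('a)" and q: "real DIM('a) / 2 < q" and V: "Lploc q V" and f: "Lploc p f"
    and l: "locint (\<lambda>x. V x * u x)" and w: "weak_laplace u (\<lambda>x. V x * u x - f x)"
    and s: "1 \<le> s" "s \<le> p" "s < q"
  shows "Lploc s (\<lambda>x. V x * u x)" and "Lploc s (\<lambda>x. V x * u x - f x)"
proof -
  have sub: "Lploc a (\<lambda>x. V x * u x - f x)" if "Lploc a (\<lambda>x. V x * u x)" "1 \<le> a" "a \<le> p" for a
    using Lploc_add[OF that(1) Lploc_cmult[OF Lploc_mono[OF f, of a], of "- 1"]] that by simp
  have q1: "1 < q" using d q by simp
  \<comment> \<open>Half of the available gain 2/d - 1/q; the other half keeps the kernel exponent t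
    strictly below d/(d-2).\<close>
  define \<delta> where "\<delta> = (2 / real DIM('a) - 1 / q) / 2"
  have qd: "1 / q < 2 / real DIM('a)" using d q q1 by (simp add: field_simps)
  have "0 < \<delta>" "2 * \<delta> = 2 / real DIM('a) - 1 / q" using qd by (simp_all add: \<delta>_def)
  then have \<delta>: "0 < \<delta>" "1 / q + \<delta> < 2 / real DIM('a)" by linarith+
  have s': "0 < 1 / s" "1 / s \<le> 1" using s by simp_all
  \<comment> \<open>Each passage from \<open>V u\<close> to \<open>u\<close> and back lowers the reciprocal exponent by up to \<open>\<delta>\<close>.\<close>
  define \<alpha> where "\<alpha> n = max (1 / s) (1 - real n * \<delta>)" for n
  have \<alpha>: "0 < \<alpha> n" "\<alpha> n \<le> 1" "1 / s \<le> \<alpha> n" "\<alpha> (Suc n) \<le> \<alpha> n" "\<alpha> n - \<delta> \<le> \<alpha> (Suc n)" for n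
    using s' \<delta> by (auto simp: \<alpha>_def distrib_right intro: less_max_iff_disj[THEN iffD2] max.coboundedI1 max.coboundedI2)
  have "Lploc (1 / \<alpha> n) (\<lambda>x. V x * u x)" for n
  proof (induction n)
    case 0
    have "\<alpha> 0 = 1" using s by (simp add: \<alpha>_def)
    then show ?case using l by (simp add: Lploc_1)
  next
    case (Suc n)
    have a: "1 \<le> 1 / \<alpha> n" "1 / \<alpha> n \<le> s"
      using \<alpha>(1-3)[of n] s by (simp_all add: field_simps)
    have G: "Lploc (1 / \<alpha> n) (\<lambda>x. V x * u x - f x)" using a s by (intro sub Suc.IH) auto
    \<comment> \<open>r is the exponent of u for which Hoelder with V in L^q returns 1 / \<alpha>
      (Suc n), and t is the kernel exponent that Young's relation then requires. r is positive
      because \<alpha> stays at least 1/s, which exceeds 1/q.\<close>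
    define r where "r = 1 / (\<alpha> (Suc n) - 1 / q)"
    define t where "t = 1 / (1 - 1 / q - (\<alpha> n - \<alpha> (Suc n)))"
    have "1 / q < 1 / s" using s by (simp add: frac_less2)
    then have r: "0 < r" "1 / r = \<alpha> (Suc n) - 1 / q" using \<alpha>(3)[of "Suc n"] by (simp_all add: r_def)
    have td: "2 / real DIM('a) < 1" using d by simp
    have t1: "1 - 2 / real DIM('a) < 1 - 1 / q - (\<alpha> n - \<alpha> (Suc n))" using \<alpha>(5)[of n] \<delta> by linarith
    then have t0: "0 < 1 - 1 / q - (\<alpha> n - \<alpha> (Suc n))" using td by linarith
    have "1 - 1 / q - (\<alpha> n - \<alpha> (Suc n)) \<le> 1" using \<alpha>(4)[of n] zero_less_divide_1_iff[of q] q1 by linarith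
    then have t: "1 \<le> t" "1 / t = 1 - 1 / q - (\<alpha> n - \<alpha> (Suc n))" using t0 by (simp_all add: t_def)
    have "(real DIM('a) - 2) * t < real DIM('a)"
    proof -
      have "(real DIM('a) - 2) / real DIM('a) < 1 / t" using t1 d unfolding t(2) by (simp add: diff_divide_distrib)
      then show ?thesis using d t(1) by (simp add: field_simps)
    qed
    from weak_laplace_Lploc[OF d w G a(1) t(1) this r(1)] have "Lploc r u"
      using r(2) t(2) by simp
    then show ?case
      using q1 r \<alpha>(1)[of "Suc n"] by (intro Lploc_mult[OF V]) auto
  qed
  moreover obtain n :: nat where "1 / \<delta> \<le> real n" using real_arch_simple by blast
  then have "1 - real n * \<delta> \<le> 0" using \<delta> by (simp add: field_simps)
  then have "\<alpha> n = 1 / s" using s' unfolding \<alpha>_def by (intro max.absorb1) linarith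
  ultimately have "Lploc (1 / (1 / s)) (\<lambda>x. V x * u x)" by metis
  then show "Lploc s (\<lambda>x. V x * u x)" by simp
  then show "Lploc s (\<lambda>x. V x * u x - f x)" using s by (intro sub)
qed

text \<open>\<mu> is the reciprocal exponent left for the gradient after V^(1/2), which is in
  L^(2q), has taken 1/(2q). Since Vu - f has every exponent s >= 1 with s < q and s <= p, and the
  gradient gains less than 1/d over it, \<mu> has to exceed both 0 and 1/q - 1/d; this is the
  hypothesis on p.\<close>

lemma gradient_term_Lploc:
  fixes V u f :: "'a::euclidean_space \<Rightarrow> real"
  assumes d: "3 \<le> DIM('a)" and q: "real DIM('a) / 2 < q" and V: "Lploc q V" and f: "Lploc p f"
    and l: "locint (\<lambda>x. V x * u x)" and w: "weak_laplace u (\<lambda>x. V x * u x - f x)"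
    and p: "1 \<le> p" "max (1 / q - 1 / real DIM('a)) 0 + 1 / (2 * q) < 1 / p" and e: "e \<in> Basis"
  shows "Lploc p (\<lambda>x. sqrt (V x) * grad u (\<lambda>x. V x * u x - f x) e x)"
proof -
  have q1: "1 < q" using d q by simp
  define \<mu> where "\<mu> = 1 / p - 1 / (2 * q)"
  have \<mu>: "0 < \<mu>" "1 / q - 1 / real DIM('a) < \<mu>" using p(2) by (auto simp: \<mu>_def max_def split: if_splits)
  have qd: "1 / (2 * q) < 1 / real DIM('a)" using d q q1 by (simp add: field_simps)
  \<comment> \<open>If p < q, then s = p works because 1/(2q) < 1/d. Otherwise 1/s is taken slightly
    above 1/q, so that s < q <= p.\<close>
  obtain s where s: "1 \<le> s" "s \<le> p" "s < q" "\<mu> \<le> 1 / s" "1 / s < \<mu> + 1 / real DIM('a)"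
  proof (cases "p < q")
    case True
    then show ?thesis using p(1) qd q1 by (intro that[of p]) (auto simp: \<mu>_def)
  next
    case False
    have "1 / q < min 1 (\<mu> + 1 / real DIM('a))" using q1 \<mu>(2) by simp
    then obtain z where z: "1 / q < z" "z < min 1 (\<mu> + 1 / real DIM('a))" using dense by blast
    have z0: "0 < z" using z(1) q1 by (meson order_less_trans zero_less_divide_1_iff zero_less_one)
    have zq: "1 / z < q" using z(1) z0 q1 by (simp add: field_simps)
    have "1 / p \<le> 1 / q" using False q1 by (intro divide_left_mono) auto
    moreover have "0 < 1 / (2 * q)" using q1 by simp
    ultimately have "\<mu> \<le> z" using z(1) unfolding \<mu>_def by linarith
    moreover have "1 \<le> 1 / z" "1 / (1 / z) = z" using z z0 by simp_all
    moreover have "1 / z \<le> p" using zq False by linarith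
    ultimately show ?thesis using z(2) zq by (intro that[of "1 / z"]) auto
  qed
  note g = potential_term_Lploc(2)[OF d q V f l w s(1-3)]
  define t where "t = 1 / (1 + \<mu> - 1 / s)"
  have dd: "1 / real DIM('a) < 1" using d by simp
  have t0: "1 - 1 / real DIM('a) < 1 + \<mu> - 1 / s" using s(5) by simp
  then have t1: "0 < 1 + \<mu> - 1 / s" using dd by linarith
  then have t: "1 \<le> t" "1 / t = 1 + \<mu> - 1 / s" using s(4) by (simp_all add: t_def)
  have td: "(real DIM('a) - 1) * t < real DIM('a)"
  proof -
    have "(real DIM('a) - 1) / real DIM('a) < 1 / t" using t0 d unfolding t(2) by (simp add: diff_divide_distrib)
    then show ?thesis using d t(1) by (simp add: field_simps)
  qed
  have "Lploc (1 / \<mu>) (grad u (\<lambda>x. V x * u x - f x) e)"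
    using \<mu>(1) t(2) by (intro weak_laplace_gradient(3)[OF d w e g s(1) t(1) td]) auto
  moreover have "Lploc (2 * q) (\<lambda>x. sqrt (V x))"
  proof -
    have [measurable]: "V \<in> borel_measurable borel" using V by (rule Lploc_borel)
    \<comment> \<open>The real root is odd, so the identity holds for negative v as well; a Borel
      representative of V may take negative values on a null set.\<close>
    have "\<bar>sqrt v\<bar> powr (2 * q) = \<bar>v\<bar> powr q" for v
    proof -
      have "\<bar>sqrt v\<bar> = \<bar>v\<bar> powr (1 / 2)"
        by (cases "0 \<le> v") (simp_all add: powr_half_sqrt real_sqrt_minus)
      then show ?thesis by (simp only: powr_powr) simp
    qed
    moreover have "(\<lambda>x. sqrt (V x)) \<in> borel_measurable borel" by measurable
    ultimately show ?thesis using Lploc_integrable[OF V] by (simp add: Lploc_def)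
  qed
  ultimately show ?thesis
    using \<mu>(1) q1 p(1) by (intro Lploc_mult[of "2 * q" _ "1 / \<mu>"]) (auto simp: \<mu>_def)
qed

theorem corollary2:
  fixes V u f :: "'a::euclidean_space \<Rightarrow> real" and q p \<sigma> p\<^sub>1 :: real
  assumes "DIM('a) \<ge> 3"
    and "q > real DIM('a) / 2"
    and "V \<in> RH q"
    and "AE x in lebesgue. 0 \<le> V x"
    and "\<not> (AE x in lebesgue. V x = 0)"
    and "schroedinger_solution V u f"
    and "p \<ge> 1" and "\<sigma> > 0"
    and "integrable lebesgue (\<lambda>x. \<bar>f x\<bar> powr p / (1 + norm x) powr \<sigma>)"
    and "1 / p\<^sub>1 = max (1 / q - 1 / real DIM('a)) 0 + 1 / (2 * q)"
  shows "(1 < p \<and> p < q \<longrightarrow>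
            (\<exists>H. weak_hessian u H \<and> (\<forall>e\<in>Basis. \<forall>e'\<in>Basis. H e e' \<in> Lp_loc p))) \<and>
         (1 \<le> p \<and> p < q \<longrightarrow> (\<lambda>x. V x * u x) \<in> Lp_loc p) \<and>
         (1 \<le> p \<and> p < p\<^sub>1 \<longrightarrow>
            (\<exists>G. weak_gradient u G \<and> (\<lambda>x. sqrt (V x) *\<^sub>R G x) \<in> Lp_loc p))"
proof -
  note d = assms(1) and q = assms(2) and sol = assms(6)
  have q1: "1 < q" using d q by simp
  have mu: "u \<in> Lp_loc 1" and mf: "f \<in> Lp_loc 1" using sol by (simp_all add: schroedinger_solution_def)
  \<comment> \<open>The statement involves V, u and f only up to null sets, so Borel representatives
    can replace them.\<close>
  obtain V' where V': "V' \<in> borel_measurable borel" "AE x in lborel. V x = V' x"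
    using borel_representative[of V] assms(3) by (auto simp: RH_def)
  obtain u' where u': "u' \<in> borel_measurable borel" "AE x in lborel. u x = u' x"
    using borel_representative[of u] mu by (auto simp: Lp_loc_def)
  obtain f' where f': "f' \<in> borel_measurable borel" "AE x in lborel. f x = f' x"
    using borel_representative[of f] mf by (auto simp: Lp_loc_def)
  define g where "g = (\<lambda>x. V' x * u' x - f' x)"
  have LV: "Lploc q V'" by (rule RH_Lploc[OF assms(3,4) V'])
  have Lf: "Lploc p f'" by (rule weighted_Lploc[OF assms(9,8) f'])
  note l = schroedinger_weak_laplace(1)[OF sol V' u' f'] and w = schroedinger_weak_laplace(2)[OF sol V' u' f']
  have w': "weak_laplace u' g" using w by (simp add: g_def)
  have Vu': "(\<lambda>x. V' x * u' x) \<in> borel_measurable borel" "AE x in lborel. V x * u x = V' x * u' x"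
    subgoal using l by (rule locint_borel)
    subgoal using V'(2) u'(2) by eventually_elim simp
    done
  have tr: "(LINT x|lebesgue. u x * \<psi> x) = (\<integral>x. u' x * \<psi> x \<partial>lborel)" if "test_function \<psi>" for \<psi> :: "'a \<Rightarrow> real"
  proof (rule lebesgue_AE_borel(3))
    show "(\<lambda>x. u' x * \<psi> x) \<in> borel_measurable borel" using u'(1) test_borel[OF that] by measurable
    show "AE x in lborel. u x * \<psi> x = u' x * \<psi> x" using u'(2) by eventually_elim simp
  qed
  have trb: "(LINT x|lebesgue. F x) = (\<integral>x. F x \<partial>lborel)" if "F \<in> borel_measurable borel" for F :: "'a \<Rightarrow> real"
    using that by (intro lebesgue_AE_borel(3)) auto
  have 1: "\<exists>H. weak_hessian u H \<and> (\<forall>e\<in>Basis. \<forall>e'\<in>Basis. H e e' \<in> Lp_loc p)" if p: "1 < p" "p < q"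
  proof -
    have Lg: "Lploc p g" unfolding g_def using p by (intro potential_term_Lploc(2)[OF d q LV Lf l w]) auto
    define Q where "Q e e' H \<longleftrightarrow> Lploc p H \<and> (\<forall>\<phi>. test_function \<phi> \<longrightarrow>
      (\<integral>x. u' x * partial e (partial e' \<phi>) x \<partial>lborel) = (\<integral>x. H x * \<phi> x \<partial>lborel))" for e e' and H :: "'a \<Rightarrow> real"
    have ex: "\<exists>H. Q e e' H" if "e \<in> Basis" "e' \<in> Basis" for e e' :: 'a
      by (rule weak_laplace_hessian[OF w' Lg p(1) that]) (auto simp: Q_def)
    \<comment> \<open>The entries exist separately for each pair of directions; a choice assembles
      them into one Hessian.\<close>
    define H where "H e e' = (SOME H. Q e e' H)" for e e'
    have H: "Q e e' (H e e')" if "e \<in> Basis" "e' \<in> Basis" for e e'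
      unfolding H_def by (rule someI_ex[OF ex[OF that]])
    have HL: "H e e' \<in> Lp_loc s" if "e \<in> Basis" "e' \<in> Basis" "0 < s" "s \<le> p" for e e' s
    proof -
      have L: "Lploc p (H e e')" using H[OF that(1,2)] by (simp add: Q_def)
      show ?thesis using Lp_loc_real_iff[OF Lploc_borel[OF L], of "H e e'" s] Lploc_mono[OF L that(3,4)] by simp
    qed
    have HE: "(LINT x|lebesgue. u x * partial e (partial e' \<phi>) x) = (LINT x|lebesgue. H e e' x * \<phi> x)"
      if ee: "e \<in> Basis" "e' \<in> Basis" and \<phi>: "test_function \<phi>" for e e' \<phi>
    proof -
      have L: "H e e' \<in> borel_measurable borel" using H[OF ee] by (auto simp: Q_def Lploc_borel)
      have b: "(\<lambda>x. H e e' x * \<phi> x) \<in> borel_measurable borel" using L test_borel[OF \<phi>] by measurable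
      show ?thesis
        unfolding tr[OF test_partial[OF test_partial[OF \<phi> ee(2)] ee(1)]] trb[OF b]
        using H[OF ee] \<phi> by (simp add: Q_def)
    qed
    have "weak_hessian u H"
      unfolding weak_hessian_def using mu p by (intro conjI ballI allI impI HL HE) auto
    moreover have "\<forall>e\<in>Basis. \<forall>e'\<in>Basis. H e e' \<in> Lp_loc p" using p by (intro ballI HL) auto
    ultimately show ?thesis by blast
  qed
  have 2: "(\<lambda>x. V x * u x) \<in> Lp_loc p" if "p < q"
    unfolding Lp_loc_real_iff[OF Vu'] using that assms(7) by (intro potential_term_Lploc(1)[OF d q LV Lf l w]) auto
  have 3: "\<exists>G. weak_gradient u G \<and> (\<lambda>x. sqrt (V x) *\<^sub>R G x) \<in> Lp_loc p" if pp: "p < p\<^sub>1"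
  proof -
    have p0: "0 < p" using assms(7) by simp
    have "1 / p\<^sub>1 < 1 / p" using pp p0 by (simp add: frac_less2)
    then have pm: "max (1 / q - 1 / real DIM('a)) 0 + 1 / (2 * q) < 1 / p" using assms(10) by simp
    define D where "D = grad u' g"
    have lD: "locint (D e)" if "e \<in> Basis" for e
      unfolding D_def by (rule weak_laplace_gradient(1)[OF d w' that])
    have Db: "D e \<in> borel_measurable borel" if "e \<in> Basis" for e by (rule locint_borel[OF lD[OF that]])
    have VD: "Lploc p (\<lambda>x. sqrt (V' x) * D e x)" if "e \<in> Basis" for e
      unfolding D_def g_def by (rule gradient_term_Lploc[OF d q LV Lf l w assms(7) pm that])
    \<comment> \<open>The components become one vector field. Its norm is at most the sum of their
      absolute values, so the componentwise bounds give those for G.\<close>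
    define G where "G x = (\<Sum>e\<in>Basis. D e x *\<^sub>R e)" for x
    have Gb[measurable]: "G \<in> borel_measurable borel"
      unfolding G_def[abs_def] by (intro borel_measurable_sum borel_measurable_scaleR Db borel_measurable_const)
    have Gn: "norm (G x) \<le> (\<Sum>e\<in>Basis. \<bar>D e x\<bar>)" for x
      unfolding G_def by (rule order_trans[OF norm_sum]) simp
    have Ge: "G x \<bullet> e = D e x" if "e \<in> Basis" for x e
      using that by (simp add: G_def inner_sum_left inner_Basis if_distrib[where f="\<lambda>c. _ * c"] cong: if_cong)
    have nG: "(\<lambda>x. norm (G x)) \<in> borel_measurable borel" by measurable
    have Gl: "G \<in> borel_measurable lebesgue" using Gb by (simp add: measurable_completion)
    have "Lploc 1 (\<lambda>x. norm (G x))"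
    proof (rule Lploc_dominated[OF _ nG])
      show "Lploc 1 (\<lambda>x. \<Sum>e\<in>Basis. \<bar>D e x\<bar>)"
        by (intro Lploc_sum Lploc_abs) (use lD in \<open>auto simp: Lploc_1\<close>)
      show "AE x in lborel. \<bar>norm (G x)\<bar> \<le> \<bar>\<Sum>e\<in>Basis. \<bar>D e x\<bar>\<bar>"
        using Gn by (intro AE_I2) (auto intro: order_trans[OF _ abs_ge_self])
    qed simp
    then have G1: "G \<in> Lp_loc 1" using Lp_loc_iff_Lploc[OF Gl nG] by simp
    have "(LINT x|lebesgue. u x * partial e \<phi> x) = - (LINT x|lebesgue. (G x \<bullet> e) * \<phi> x)"
      if \<phi>: "test_function \<phi>" and e: "e \<in> Basis" for \<phi> e
    proof -
      have b: "(\<lambda>x. D e x * \<phi> x) \<in> borel_measurable borel" using Db[OF e] test_borel[OF \<phi>] by measurable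
      show ?thesis
        unfolding tr[OF test_partial[OF \<phi> e]] Ge[OF e] trb[OF b] unfolding D_def
        by (rule weak_laplace_gradient(2)[OF d w' e \<phi>])
    qed
    then have "weak_gradient u G" unfolding weak_gradient_def using mu G1 by blast
    moreover have "(\<lambda>x. sqrt (V x) *\<^sub>R G x) \<in> Lp_loc p"
    proof -
      define h where "h x = \<bar>sqrt (V' x)\<bar> * norm (G x)" for x
      have hb: "h \<in> borel_measurable borel" unfolding h_def[abs_def] using V'(1) by measurable
      have sG: "(\<lambda>x. sqrt (V' x) *\<^sub>R G x) \<in> borel_measurable borel" using V'(1) by measurable
      have ml: "(\<lambda>x. sqrt (V x) *\<^sub>R G x) \<in> borel_measurable lebesgue"
      proof (rule lebesgue_AE_borel(1)[OF sG])
        show "AE x in lborel. sqrt (V x) *\<^sub>R G x = sqrt (V' x) *\<^sub>R G x" using V'(2) by eventually_elim simp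
      qed
      have "AE x in lborel. norm (sqrt (V x) *\<^sub>R G x) = \<bar>h x\<bar>" using V'(2) by eventually_elim (simp add: h_def)
      from Lp_loc_iff_Lploc[OF ml hb this] have "(\<lambda>x. sqrt (V x) *\<^sub>R G x) \<in> Lp_loc p \<longleftrightarrow> Lploc p h" .
      moreover have "Lploc p h"
      proof (rule Lploc_dominated[OF _ hb _ p0])
        show "Lploc p (\<lambda>x. \<Sum>e\<in>Basis. \<bar>sqrt (V' x) * D e x\<bar>)" by (intro Lploc_sum Lploc_abs VD p0) auto
        show "AE x in lborel. \<bar>h x\<bar> \<le> \<bar>\<Sum>e\<in>Basis. \<bar>sqrt (V' x) * D e x\<bar>\<bar>"
        proof (rule AE_I2)
          fix x
          have "\<bar>h x\<bar> \<le> \<bar>sqrt (V' x)\<bar> * (\<Sum>e\<in>Basis. \<bar>D e x\<bar>)"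
            unfolding h_def using Gn[of x] by (simp add: abs_mult mult_left_mono)
          also have "\<dots> = (\<Sum>e\<in>Basis. \<bar>sqrt (V' x) * D e x\<bar>)" by (simp add: sum_distrib_left abs_mult)
          finally show "\<bar>h x\<bar> \<le> \<bar>\<Sum>e\<in>Basis. \<bar>sqrt (V' x) * D e x\<bar>\<bar>" by linarith
        qed
      qed
      ultimately show ?thesis by blast
    qed
    ultimately show ?thesis by blast
  qed
  show ?thesis using 1 2 3 by blast
qed

end
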